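(* For every $m\ge1$ and every $q$ with $m\le q\le 2m$, $$b_{0q}(m)=\frac{2^{\frac{m^2+m+2}{2}}}{\pi^m(m+2)\prod_{j=1}^{m-1}j!}\int_{Y_{2m-q}}\Big|\prod_{j=1}^m\lambda_j\Big|\,\Delta(\lambda)\,e^{-\sum_{j=1}^m\lambda_j}\,F_q(\lambda)\,d\lambda,$$ where $F_q(\lambda)=e^{(m+2)\lambda_m}$ if $q>m$ and $F_m(\lambda)=1$.
   Context: $\mathrm{Sym}(m,\mathbb C)$ is the space of complex symmetric $m\times m$ matrices, equipped with the Hilbert–Schmidt inner product $\langle H,H'\rangle=\mathrm{Tr}\,HH'^*$ and the associated Lebesgue measure $dH$; $dx$ is Lebesgue measure on $\mathbb C$. For $0\le k\le m$ let $\mathbf S_{m,k}=\{(H,x)\in\mathrm{Sym}(m,\mathbb C)\times\mathbb C:\ 2HH^*-|x|^2I\text{ has exactly }k\text{ negative eigenvalues}\}$, and define $$b_{0q}(m)=\pi^{-\binom{m+2}{2}}\int_{\mathbf S_{m,q-m}}\big|\det(2HH^*-|x|^2I)\big|\,e^{-\mathrm{Tr}\,HH^*-|x|^2}\,dH\,dx .$$ (This is the universal leading coefficient in the asymptotic expansion of the expected density of critical points of Morse index $q$ of random sections of high powers of a positive line bundle.) $Y_p=\{\lambda\in\mathbb R^m:\lambda_1>\dots>\lambda_p>0>\lambda_{p+1}>\dots>\lambda_m\}$, and $\Delta(\lambda)=\prod_{i<j}(\lambda_i-\lambda_j)$ is the Vandermonde determinant. *)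

theory Defs
  imports "HOL-Analysis.Analysis" "Jordan_Normal_Form.Schur_Decomposition"
begin

definition sym_idx :: "nat \<Rightarrow> (nat \<times> nat) set" where
  "sym_idx m = {(i, j). i \<le> j \<and> j < m}"

definition sym_mat :: "nat \<Rightarrow> (nat \<times> nat \<Rightarrow> complex) \<Rightarrow> complex mat" where
  "sym_mat m h = Matrix.mat m m (\<lambda>(i, j). if i \<le> j then h (i, j) else h (j, i))"

text \<open>Lebesgue measure on Sym(m,C) associated with the Hilbert-Schmidt inner product
  Tr(H H'^*).  In the coordinates h(i,i), h(i,j) (i<j) an orthonormal basis is
  E_ii, (E_ij+E_ji)/sqrt 2 (over R: also times i), so dH = 2^(m(m-1)/2) times the
  coordinate Lebesgue measure.\<close>
definition sym_lebesgue :: "nat \<Rightarrow> (nat \<times> nat \<Rightarrow> complex) measure" where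
  "sym_lebesgue m = density (PiM (sym_idx m) (\<lambda>_. (lborel :: complex measure)))
      (\<lambda>_. ennreal (2 ^ (m * (m - 1) div 2)))"

definition num_neg_eigenvalues :: "complex mat \<Rightarrow> nat" where
  "num_neg_eigenvalues A =
     (\<Sum>a\<in>{a. poly (char_poly A) a = 0 \<and> Im a = 0 \<and> Re a < 0}. Polynomial.order a (char_poly A))"

definition crit_mat :: "nat \<Rightarrow> (nat \<times> nat \<Rightarrow> complex) \<Rightarrow> complex \<Rightarrow> complex mat" where
  "crit_mat m h x = 2 \<cdot>\<^sub>m (sym_mat m h * mat_adjoint (sym_mat m h))
                     - complex_of_real ((cmod x)\<^sup>2) \<cdot>\<^sub>m 1\<^sub>m m"

definition S_set :: "nat \<Rightarrow> nat \<Rightarrow> ((nat \<times> nat \<Rightarrow> complex) \<times> complex) set" where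
  "S_set m k = {(h, x). h \<in> space (PiM (sym_idx m) (\<lambda>_. (lborel :: complex measure)))
                  \<and> num_neg_eigenvalues (crit_mat m h x) = k}"

definition tr_HHstar :: "nat \<Rightarrow> (nat \<times> nat \<Rightarrow> complex) \<Rightarrow> real" where
  "tr_HHstar m h = Re (\<Sum>i<m. (sym_mat m h * mat_adjoint (sym_mat m h)) $$ (i, i))"

definition b0q :: "nat \<Rightarrow> nat \<Rightarrow> ennreal" where
  "b0q m q = ennreal (pi powr (- real ((m + 2) choose 2))) *
     (\<integral>\<^sup>+ z. indicator (S_set m (q - m)) z *
        ennreal (norm (det (crit_mat m (fst z) (snd z))) *
                 exp (- tr_HHstar m (fst z) - (cmod (snd z))\<^sup>2))
      \<partial>(sym_lebesgue m \<Otimes>\<^sub>M (lborel :: complex measure)))"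

text \<open>Y_p, with lambda_1, ..., lambda_m stored as l 0, ..., l (m-1).\<close>
definition Y_set :: "nat \<Rightarrow> nat \<Rightarrow> (nat \<Rightarrow> real) set" where
  "Y_set m p = {l \<in> space (PiM {..<m} (\<lambda>_. (lborel :: real measure))).
      (\<forall>i. Suc i < m \<longrightarrow> l (Suc i) < l i) \<and>
      (\<forall>i<m. (i < p \<longrightarrow> 0 < l i) \<and> (p \<le> i \<longrightarrow> l i < 0))}"

definition vandermonde :: "nat \<Rightarrow> (nat \<Rightarrow> real) \<Rightarrow> real" where
  "vandermonde m l = (\<Prod>(i, j)\<in>{(i, j). i < j \<and> j < m}. l i - l j)"

definition F_fun :: "nat \<Rightarrow> nat \<Rightarrow> (nat \<Rightarrow> real) \<Rightarrow> real" where
  "F_fun m q l = (if q > m then exp (real (m + 2) * l (m - 1)) else 1)"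

end

theory Submission
  imports Defs "HOL-Real_Asymp.Real_Asymp"
begin

text \<open>
  The integrand depends on \<open>H\<close> only through the squared singular values \<open>s\<^sub>1 > \<dots> > s\<^sub>m > 0\<close>, and for
  such functions Lebesgue measure on Sym(m,C) becomes a constant multiple of \<open>\<Delta>(s) ds\<close>. This is
  proved by induction on the size. By Takagi's factorization \<open>H\<close> has a coneigenvector: the conjugate of
  \<open>(y, 1)\<close> is mapped to \<open>\<kappa> (y, 1)\<close>, with \<open>|\<kappa>|\<^sup>2\<close> the smallest squared singular value. With the upper left
  block fixed, \<open>(y, \<kappa>)\<close> replaces the last column of \<open>H\<close>, and the Jacobian is a principal minor of
  \<open>|\<kappa>|\<^sup>2 - H H\<^sup>*\<close>. A unitary congruence splits off \<open>\<kappa>\<close>; what remains of the Jacobian is the product of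
  the differences \<open>s\<^sub>i - |\<kappa>|\<^sup>2\<close>, that is, the new factors of the Vandermonde determinant, while the
  integral over \<open>y\<close> gives a constant.

  Putting \<open>t = |x|\<^sup>2\<close> and \<open>\<lambda>\<^sub>j = s\<^sub>j - t/2\<close> turns the eigenvalues \<open>2 s\<^sub>j - t\<close> into \<open>2 \<lambda>\<^sub>j\<close>, leaves \<open>\<Delta>\<close>
  unchanged and decouples \<open>t\<close>, except for the constraint \<open>t > - 2 \<lambda>\<^sub>m\<close>. Integrating
  \<open>exp (- (m+2) t / 2)\<close> over the admissible \<open>t\<close> produces \<open>F\<^sub>q\<close>.
\<close>

subsection \<open>Lebesgue integrals over products\<close>

text \<open>Only coordinate spaces are integrated over; no measure on the unitary group enters,
  because the direction of the coneigenvector is recorded in the affine coordinates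
  \<open>y\<close>. Fixing its last entry to be 1 uses up its phase, which therefore moves into
  \<kappa>: this makes \<kappa> complex, lets (y, \<kappa>) match the n + 1 complex entries of the
  last column, and costs a factor pi. A matrix generically has one such representation for each
  singular value; choosing the smallest makes it unique almost everywhere and puts the new value
  last in the decreasing order. The defining relation \<kappa> y - K conj(y) is only real linear, so
  Jacobians appear as |a|^2 - |b|^2. The remaining constant pi^n / n! is the integral over y of (1 +
  |y|^2)^(-n-1), whose exponent is the Jacobian of the congruence on symmetric matrices of size n.
  The substitution requires the upper left block to have distinct positive singular values. That
  almost every block has them is read off from the induction hypothesis itself.\<close>

interpretation lborel_product: product_sigma_finite "\<lambda>_::'i. lborel :: 'a::euclidean_space measure"
  by (simp add: product_sigma_finite_def sigma_finite_lborel)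

text \<open>Tonelli's theorem, one coordinate at a time. The constants \<open>c i\<close> multiply
  the transformed integral instead of dividing the other one, which avoids division in
  \<open>ennreal\<close>.\<close>

lemma nn_integral_PiM_componentwise:
  fixes f :: "'i \<Rightarrow> 'a::euclidean_space \<Rightarrow> 'a" and c :: "'i \<Rightarrow> ennreal"
  assumes "finite I"
    and "\<And>i. i \<in> I \<Longrightarrow> f i \<in> borel_measurable borel"
    and "\<And>i g. i \<in> I \<Longrightarrow> g \<in> borel_measurable borel \<Longrightarrow>
           (\<integral>\<^sup>+x. g (f i x) \<partial>lborel) * c i = (\<integral>\<^sup>+x. g x \<partial>lborel)"
    and "g \<in> borel_measurable (PiM I (\<lambda>_. lborel :: 'a measure))"
  shows "(\<integral>\<^sup>+x. g (\<lambda>i\<in>I. f i (x i)) \<partial>PiM I (\<lambda>_. lborel)) * (\<Prod>i\<in>I. c i)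
         = (\<integral>\<^sup>+x. g x \<partial>PiM I (\<lambda>_. lborel))"
  using assms
proof (induction I arbitrary: g rule: finite_induct)
  case empty
  then show ?case by (simp add: PiM_empty nn_integral_count_space_finite)
next
  case (insert i I)
  let ?M = "\<lambda>_::'i. lborel :: 'a measure"
  note [measurable] = insert.prems(3)
  have f[measurable]: "\<And>j. j \<in> insert i I \<Longrightarrow> f j \<in> borel_measurable borel"
    by (rule insert.prems(1))
  have fi[measurable]: "f i \<in> borel_measurable borel" by (rule f) simp
  have fm[measurable]: "(\<lambda>x. \<lambda>j\<in>J. f j (x j)) \<in> measurable (PiM J ?M) (PiM J ?M)" if "J \<subseteq> insert i I" for J
  proof (rule measurable_restrict)
    fix j assume j: "j \<in> J"
    have "f j \<in> borel_measurable borel" using that j by (intro f) auto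
    moreover have "(\<lambda>x. x j) \<in> measurable (PiM J ?M) lborel"
      using j by (rule measurable_component_singleton)
    ultimately show "(\<lambda>x. f j (x j)) \<in> measurable (PiM J ?M) lborel" by simp
  qed
  have fm1: "(\<lambda>x. g (\<lambda>j\<in>insert i I. f j (x j))) \<in> borel_measurable (PiM (insert i I) ?M)"
    using measurable_compose[OF fm[OF order_refl] insert.prems(3)] .
  have G[measurable]: "(\<lambda>x. \<integral>\<^sup>+y. g (x(i := y)) \<partial>lborel) \<in> borel_measurable (PiM I ?M)"
    by measurable
  have "(\<integral>\<^sup>+x. g (\<lambda>j\<in>insert i I. f j (x j)) \<partial>PiM (insert i I) ?M)
      = (\<integral>\<^sup>+x. \<integral>\<^sup>+y. g ((\<lambda>j\<in>I. f j (x j))(i := f i y)) \<partial>lborel \<partial>PiM I ?M)"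
  proof (subst lborel_product.product_nn_integral_insert[OF insert.hyps(1,2) fm1],
      intro nn_integral_cong arg_cong[where f=g] ext)
    fix x y j
    show "(\<lambda>j\<in>insert i I. f j ((x(i := y)) j)) j = ((\<lambda>j\<in>I. f j (x j))(i := f i y)) j"
      using insert.hyps by auto
  qed
  also have "\<dots> * c i = (\<integral>\<^sup>+x. (\<integral>\<^sup>+y. g ((\<lambda>j\<in>I. f j (x j))(i := f i y)) \<partial>lborel) * c i \<partial>PiM I ?M)"
  proof (rule nn_integral_multc[symmetric])
    have *: "(\<lambda>x. \<lambda>j\<in>I. f j (x j)) \<in> measurable (PiM I ?M) (PiM I ?M)"
      by (rule fm) auto
    have "(\<lambda>(x,y). g ((\<lambda>j\<in>I. f j (x j))(i := f i y))) \<in> borel_measurable (PiM I ?M \<Otimes>\<^sub>M lborel)"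
      using * by measurable
    then show "(\<lambda>x. \<integral>\<^sup>+y. g ((\<lambda>j\<in>I. f j (x j))(i := f i y)) \<partial>lborel) \<in> borel_measurable (PiM I ?M)"
      by measurable
  qed
  also have "\<dots> = (\<integral>\<^sup>+x. (\<integral>\<^sup>+y. g ((\<lambda>j\<in>I. f j (x j))(i := y)) \<partial>lborel) \<partial>PiM I ?M)"
  proof (rule nn_integral_cong)
    fix x assume x: "x \<in> space (PiM I ?M)"
    have "(\<lambda>j\<in>I. f j (x j)) \<in> space (PiM I ?M)"
      using x by (auto simp: space_PiM)
    then have "(\<lambda>y. g ((\<lambda>j\<in>I. f j (x j))(i := y))) \<in> borel_measurable borel"
      using measurable_comp[OF measurable_component_update insert.prems(3), OF _ insert.hyps(2)]
      by (simp add: comp_def)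
    then show "(\<integral>\<^sup>+y. g ((\<lambda>j\<in>I. f j (x j))(i := f i y)) \<partial>lborel) * c i
        = (\<integral>\<^sup>+y. g ((\<lambda>j\<in>I. f j (x j))(i := y)) \<partial>lborel)"
      by (intro insert.prems(2)) auto
  qed
  also have "\<dots> * (\<Prod>i\<in>I. c i) = (\<integral>\<^sup>+x. (\<integral>\<^sup>+y. g (x(i := y)) \<partial>lborel) \<partial>PiM I ?M)"
    by (rule insert.IH[OF _ _ G]) (use insert.prems(1,2) in auto)
  also have "\<dots> = (\<integral>\<^sup>+x. g x \<partial>PiM (insert i I) ?M)"
    by (simp add: lborel_product.product_nn_integral_insert insert.hyps insert.prems)
  finally show ?case
    by (simp only: prod.insert[OF insert.hyps(1,2)] mult.assoc)
qed

lemma nn_integral_lborel_translate: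
  fixes g :: "'a::euclidean_space \<Rightarrow> ennreal"
  assumes [measurable]: "g \<in> borel_measurable borel"
  shows "(\<integral>\<^sup>+x. g (x + a) \<partial>lborel) = (\<integral>\<^sup>+x. g x \<partial>lborel)"
proof -
  have "(\<integral>\<^sup>+x. g x \<partial>lborel) = (\<integral>\<^sup>+x. g x \<partial>distr lborel borel ((+) a))"
    by (simp add: lborel_distr_plus)
  also have "\<dots> = (\<integral>\<^sup>+x. g (x + a) \<partial>lborel)"
    by (subst nn_integral_distr) (auto simp: add.commute)
  finally show ?thesis by simp
qed

lemma nn_integral_PiM_translate:
  fixes a :: "'i \<Rightarrow> 'a::euclidean_space"
  assumes "finite I" "g \<in> borel_measurable (PiM I (\<lambda>_. lborel :: 'a measure))"
  shows "(\<integral>\<^sup>+x. g (\<lambda>i\<in>I. x i + a i) \<partial>PiM I (\<lambda>_. lborel)) = (\<integral>\<^sup>+x. g x \<partial>PiM I (\<lambda>_. lborel))"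
  using nn_integral_PiM_componentwise[of I "\<lambda>i x. x + a i" "\<lambda>_. 1" g] assms
  by (simp add: nn_integral_lborel_translate)


text \<open>Serves to rename the index pairs \<open>(i, n)\<close> of a last column as plain indices
  \<open>i\<close>. The two measures agree on boxes, and this determines a product measure.\<close>

lemma nn_integral_PiM_reindex:
  fixes f :: "'i \<Rightarrow> 'j" and h :: "'j \<Rightarrow> 'i" and g :: "('j \<Rightarrow> 'a::euclidean_space) \<Rightarrow> ennreal"
  assumes fin: "finite I" and hf: "\<And>i. i \<in> I \<Longrightarrow> h (f i) = i"
    and g: "g \<in> borel_measurable (PiM (f ` I) (\<lambda>_. lborel :: 'a measure))"
  shows "(\<integral>\<^sup>+x. g x \<partial>PiM (f ` I) (\<lambda>_. lborel)) = (\<integral>\<^sup>+x. g (\<lambda>j\<in>f ` I. x (h j)) \<partial>PiM I (\<lambda>_. lborel))"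
proof -
  let ?M = "\<lambda>_. lborel :: 'a measure"
  let ?t = "\<lambda>x. \<lambda>j\<in>f ` I. x (h j)"
  have inj: "inj_on f I" using hf by (metis inj_on_inverseI)
  have t: "?t \<in> measurable (PiM I ?M) (PiM (f ` I) ?M)"
    by (rule measurable_restrict) (auto simp: hf intro!: measurable_component_singleton)
  have "distr (PiM I ?M) (PiM (f ` I) ?M) ?t = PiM (f ` I) ?M"
  proof (rule lborel_product.PiM_eqI)
    fix A :: "'j \<Rightarrow> 'a set" assume A: "\<And>i. i \<in> f ` I \<Longrightarrow> A i \<in> sets lborel"
    have "?t -` Pi\<^sub>E (f ` I) A \<inter> space (PiM I ?M) = Pi\<^sub>E I (\<lambda>i. A (f i))"
      by (auto simp: space_PiM PiE_iff hf extensional_def)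
    then have "emeasure (distr (PiM I ?M) (PiM (f ` I) ?M) ?t) (Pi\<^sub>E (f ` I) A)
      = emeasure (PiM I ?M) (Pi\<^sub>E I (\<lambda>i. A (f i)))"
      using A fin by (subst emeasure_distr[OF t]) (auto intro!: sets_PiM_I_finite)
    also have "\<dots> = (\<Prod>i\<in>I. emeasure lborel (A (f i)))"
      using A fin by (subst lborel_product.emeasure_PiM) auto
    finally show "emeasure (distr (PiM I ?M) (PiM (f ` I) ?M) ?t) (Pi\<^sub>E (f ` I) A)
      = (\<Prod>i\<in>f ` I. emeasure lborel (A i))"
      by (simp add: prod.reindex[OF inj])
  qed (use fin in auto)
  then have "(\<integral>\<^sup>+x. g x \<partial>PiM (f ` I) ?M) = (\<integral>\<^sup>+x. g x \<partial>distr (PiM I ?M) (PiM (f ` I) ?M) ?t)"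
    by simp
  also have "\<dots> = (\<integral>\<^sup>+x. g (?t x) \<partial>PiM I ?M)"
    using g by (subst nn_integral_distr[OF t]) auto
  finally show ?thesis .
qed

text \<open>The disc of squared radius a has area pi * a, so the squared modulus carries area to pi
  times length on the half line. The sets \<open>{..a}\<close> generate the Borel sets and have
  finite measure, so agreement on them suffices.\<close>

lemma nn_integral_complex_norm_squared:
  assumes [measurable]: "g \<in> borel_measurable borel"
  shows "(\<integral>\<^sup>+z. g ((cmod z)\<^sup>2) \<partial>lborel)
       = ennreal pi * (\<integral>\<^sup>+x. g x * indicator {0..} x \<partial>lborel)"
proof -
  let ?D = "distr (lborel :: complex measure) borel (\<lambda>z. (cmod z)\<^sup>2)"
  let ?E = "density lborel (\<lambda>x::real. ennreal pi * indicator {0..} x)"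
  have m: "(\<lambda>z::complex. (cmod z)\<^sup>2) \<in> borel_measurable lborel" by simp
  have D: "emeasure ?D {..a} = ennreal (pi * max 0 a)" for a
  proof (cases "a < 0")
    case True
    then have "(\<lambda>z::complex. (cmod z)\<^sup>2) -` {..a} = {}"
      by (auto, smt (verit) zero_le_power2)
    then show ?thesis using True by (subst emeasure_distr[OF m]) auto
  next
    case False
    then have "(\<lambda>z::complex. (cmod z)\<^sup>2) -` {..a} = cball 0 (sqrt a)"
      by (auto simp: real_le_rsqrt) (metis norm_ge_zero real_sqrt_le_iff real_sqrt_abs abs_of_nonneg real_le_lsqrt sqrt_le_D)
    then show ?thesis using False
      by (subst emeasure_distr[OF m]) (auto simp: emeasure_cball eval_unit_ball_vol)
  qed
  have E: "emeasure ?E {..a} = ennreal (pi * max 0 a)" for a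
  proof -
    have "emeasure ?E {..a} = (\<integral>\<^sup>+x. ennreal pi * indicator {0..a} x \<partial>lborel)"
      by (subst emeasure_density) (auto intro!: nn_integral_cong split: split_indicator)
    also have "\<dots> = ennreal (pi * max 0 a)"
      by (subst nn_integral_cmult) (auto simp: ennreal_mult' max_def)
    finally show ?thesis .
  qed
  have "?D = ?E"
  proof (rule measure_eqI_generator_eq[where E="range atMost" and \<Omega>=UNIV and A="\<lambda>n. {..real n}"])
    show "Int_stable (range (atMost :: real \<Rightarrow> _))"
      by (auto simp: Int_stable_def)
    show "sets ?D = sigma_sets UNIV (range atMost)" "sets ?E = sigma_sets UNIV (range atMost)"
      by (simp_all add: borel_eq_atMost)
    show "(\<Union>n. {..real n}) = UNIV" using real_arch_simple by auto
    show "\<And>X. X \<in> range atMost \<Longrightarrow> emeasure ?D X = emeasure ?E X" using D E by auto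
    show "\<And>i. emeasure ?D {..real i} \<noteq> \<infinity>" using D by auto
  qed auto
  then have "(\<integral>\<^sup>+x. g x \<partial>?D) = (\<integral>\<^sup>+x. g x \<partial>?E)" by simp
  then have "(\<integral>\<^sup>+z. g ((cmod z)\<^sup>2) \<partial>lborel) = (\<integral>\<^sup>+x. ennreal pi * indicator {0..} x * g x \<partial>lborel)"
    by (simp add: nn_integral_distr nn_integral_density)
  also have "\<dots> = ennreal pi * (\<integral>\<^sup>+x. g x * indicator {0..} x \<partial>lborel)"
    by (subst nn_integral_cmult[symmetric]) (auto simp: ac_simps)
  finally show ?thesis .
qed

lemma nn_integral_complex_gaussian:
  assumes w: "w > 0"
  shows "(\<integral>\<^sup>+z. ennreal (exp (- (w * (cmod z)\<^sup>2))) \<partial>lborel) = ennreal (pi / w)"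
proof -
  have "(\<integral>\<^sup>+x. ennreal (exp (- (w * x))) * indicator {0..} x \<partial>lborel) = ennreal (0 - (- exp (- (w * 0)) / w))"
  proof (rule nn_integral_FTC_atLeast)
    show "((\<lambda>x. - exp (- (w * x)) / w) \<longlongrightarrow> 0) at_top"
      using w by real_asymp
  qed (use w in \<open>auto intro!: derivative_eq_intros\<close>)
  then show ?thesis
    using nn_integral_complex_norm_squared[of "\<lambda>x. ennreal (exp (- (w * x)))"] w
    by (simp flip: ennreal_mult')
qed

lemma nn_integral_complex_inverse_power:
  assumes A: "A > 0"
  shows "(\<integral>\<^sup>+z. ennreal (1 / (A + (cmod z)\<^sup>2) ^ Suc (Suc k)) \<partial>lborel)
    = ennreal (pi / (real (Suc k) * A ^ Suc k))"
proof -
  have "(\<integral>\<^sup>+x. ennreal (1 / (A + x) ^ Suc (Suc k)) * indicator {0..} x \<partial>lborel)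
      = ennreal (0 - (- 1 / (real (Suc k) * (A + 0) ^ Suc k)))"
  proof (rule nn_integral_FTC_atLeast)
    fix x :: real assume x: "0 \<le> x"
    then have nz: "A + x \<noteq> 0" using A by simp
    show "((\<lambda>x. - 1 / (real (Suc k) * (A + x) ^ Suc k)) has_real_derivative 1 / (A + x) ^ Suc (Suc k)) (at x)"
    proof -
      define a P S where "a = A + x" and "P = (A + x) ^ k" and "S = real (Suc k)"
      have nz': "a \<noteq> 0" "P \<noteq> 0" "S \<noteq> 0" using nz by (auto simp: a_def P_def S_def)
      have "((\<lambda>x. (A + x) ^ Suc k) has_real_derivative S * P) (at x)"
        using DERIV_power_Suc[of "\<lambda>x. A + x" 1 x UNIV k]
        by (simp add: S_def P_def DERIV_cmult_Id DERIV_add[OF DERIV_const DERIV_ident, simplified] del: power_Suc)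
      from DERIV_cmult[OF DERIV_inverse_fun[OF this power_not_zero[OF nz]], of "- 1 / S"]
      have "((\<lambda>x. (- 1 / S) * inverse ((A + x) ^ Suc k)) has_real_derivative
          (- 1 / S) * (- (S * P * inverse (((A + x) ^ Suc k) ^ Suc (Suc 0))))) (at x)" .
      moreover have "(- 1 / S) * (- (S * P * inverse (((A + x) ^ Suc k) ^ Suc (Suc 0)))) = 1 / (A + x) ^ Suc (Suc k)"
      proof -
        have "(- 1 / S) * (- (S * P * inverse ((a * P) ^ Suc (Suc 0)))) = 1 / (a * (a * P))"
          using nz' by (simp add: field_simps)
        then show ?thesis by (simp add: a_def P_def)
      qed
      moreover have "(\<lambda>x. (- 1 / S) * inverse ((A + x) ^ Suc k)) = (\<lambda>x. - 1 / (real (Suc k) * (A + x) ^ Suc k))"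
        unfolding S_def by (rule ext) (simp only: divide_inverse inverse_mult_distrib mult.assoc)
      ultimately show ?thesis by simp
    qed
  next
    have "filterlim (\<lambda>x. real (Suc k) * (A + x) ^ Suc k) at_top at_top"
      by (intro filterlim_tendsto_pos_mult_at_top[OF tendsto_const] filterlim_pow_at_top
          filterlim_tendsto_add_at_top[OF tendsto_const] filterlim_ident) auto
    then show "((\<lambda>x. - 1 / (real (Suc k) * (A + x) ^ Suc k)) \<longlongrightarrow> 0) at_top"
      by (intro real_tendsto_divide_at_top[OF tendsto_const])
  qed (use A in auto)
  then show ?thesis
    using nn_integral_complex_norm_squared[of "\<lambda>x. ennreal (1 / (A + x) ^ Suc (Suc k))"] A
    by (simp flip: ennreal_mult')
qed

text \<open>Each integration over one plane lowers the exponent by one while the squared modulus of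
  the chosen coordinate joins \<open>A\<close>; this is why both \<open>A\<close> and
  \<open>k\<close> vary in the induction. The case \<open>A = 1\<close>, \<open>k = 0\<close>
  supplies the constant pi^n / n! of the induction on the matrix size.\<close>

lemma nn_integral_PiM_inverse_power:
  assumes "finite I" "A > 0"
  shows "(\<integral>\<^sup>+y. ennreal (1 / (A + (\<Sum>i\<in>I. (cmod (y i))\<^sup>2)) ^ (card I + Suc k)) \<partial>PiM I (\<lambda>_. lborel :: complex measure))
    = ennreal (pi ^ card I * fact k / (fact (card I + k) * A ^ Suc k))"
  using assms
proof (induction I arbitrary: A k rule: finite_induct)
  case empty
  then show ?case by (simp add: PiM_empty nn_integral_count_space_finite)
next
  case (insert i I)
  let ?M = "\<lambda>_. lborel :: complex measure"
  have A: "A + (cmod z)\<^sup>2 > 0" for z :: complex using insert.prems by (simp add: add_pos_nonneg)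
  have "(\<integral>\<^sup>+y. ennreal (1 / (A + (\<Sum>i\<in>insert i I. (cmod (y i))\<^sup>2)) ^ (card (insert i I) + Suc k)) \<partial>PiM (insert i I) ?M)
     = (\<integral>\<^sup>+z. \<integral>\<^sup>+y. ennreal (1 / (A + (\<Sum>j\<in>insert i I. (cmod ((y(i := z)) j))\<^sup>2)) ^ (card (insert i I) + Suc k)) \<partial>PiM I ?M \<partial>lborel)"
    by (rule lborel_product.product_nn_integral_insert_rev[OF insert.hyps(1,2)]) measurable
  also have "\<dots> = (\<integral>\<^sup>+z. \<integral>\<^sup>+y. ennreal (1 / ((A + (cmod z)\<^sup>2) + (\<Sum>j\<in>I. (cmod (y j))\<^sup>2)) ^ (card I + Suc (Suc k))) \<partial>PiM I ?M \<partial>lborel)"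
  proof (intro nn_integral_cong arg_cong[where f=ennreal] arg_cong2[where f="(/)"] refl arg_cong2[where f="(^)"])
    fix z :: complex and y :: "'a \<Rightarrow> complex"
    have "(\<Sum>j\<in>I. (cmod ((y(i := z)) j))\<^sup>2) = (\<Sum>j\<in>I. (cmod (y j))\<^sup>2)"
      using insert.hyps by (intro sum.cong) auto
    then show "A + (\<Sum>j\<in>insert i I. (cmod ((y(i := z)) j))\<^sup>2) = (A + (cmod z)\<^sup>2) + (\<Sum>j\<in>I. (cmod (y j))\<^sup>2)"
      using insert.hyps by simp
  qed (use insert.hyps in simp)
  also have "\<dots> = (\<integral>\<^sup>+z. ennreal (pi ^ card I * fact (Suc k) / (fact (card I + Suc k) * (A + (cmod z)\<^sup>2) ^ Suc (Suc k))) \<partial>lborel)"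
    by (intro nn_integral_cong insert.IH A)
  also have "\<dots> = (\<integral>\<^sup>+z. ennreal (pi ^ card I * fact (Suc k) / fact (card I + Suc k)) * ennreal (1 / (A + (cmod z)\<^sup>2) ^ Suc (Suc k)) \<partial>lborel)"
    by (intro nn_integral_cong, subst ennreal_mult'[symmetric]) (auto simp del: power_Suc fact_Suc)
  also have "\<dots> = ennreal (pi ^ card I * fact (Suc k) / fact (card I + Suc k)) * ennreal (pi / (real (Suc k) * A ^ Suc k))"
    by (subst nn_integral_cmult, measurable, subst nn_integral_complex_inverse_power[OF insert.prems], rule refl)
  also have "\<dots> = ennreal (pi ^ card (insert i I) * fact k / (fact (card (insert i I) + k) * A ^ Suc k))"
    using insert.hyps by (subst ennreal_mult'[symmetric]) (auto simp: field_simps simp del: of_nat_Suc intro!: arg_cong[where f=ennreal])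
  finally show ?case .
qed

text \<open>An isometry preserves a Gaussian weight, and averaging over translations carries this
  invariance over to Lebesgue measure, so that no determinant of \<open>T\<close> is needed.\<close>
lemma nn_integral_PiM_isometry:
  fixes T T' :: "('i \<Rightarrow> complex) \<Rightarrow> ('i \<Rightarrow> complex)" and w :: "'i \<Rightarrow> real" and I :: "'i set"
  defines "P \<equiv> PiM I (\<lambda>_. lborel :: complex measure)"
  assumes fin: "finite I" and T[measurable]: "T \<in> measurable P P"
    and T'_space: "\<And>x. x \<in> space P \<Longrightarrow> T' x \<in> space P"
    and inv: "\<And>x. x \<in> space P \<Longrightarrow> T (T' x) = x"
    and add: "\<And>x y. x \<in> space P \<Longrightarrow> y \<in> space P \<Longrightarrow> T (\<lambda>i\<in>I. x i + y i) = (\<lambda>i\<in>I. T x i + T y i)"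
    and w: "\<And>i. i \<in> I \<Longrightarrow> w i > 0"
    and iso: "\<And>x. x \<in> space P \<Longrightarrow> (\<Sum>i\<in>I. w i * (cmod (T x i))\<^sup>2) = (\<Sum>i\<in>I. w i * (cmod (x i))\<^sup>2)"
    and g[measurable]: "g \<in> borel_measurable P"
  shows "(\<integral>\<^sup>+x. g (T x) \<partial>P) = (\<integral>\<^sup>+x. g x \<partial>P)"
proof -
  interpret P: finite_product_sigma_finite "\<lambda>_. lborel :: complex measure" I by standard fact
  interpret PP: pair_sigma_finite P P unfolding P_def by standard
  define e where "e x = ennreal (exp (- (\<Sum>i\<in>I. w i * (cmod (x i))\<^sup>2)))" for x :: "'i \<Rightarrow> complex"
  have e[measurable]: "e \<in> borel_measurable P" unfolding e_def P_def by measurable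
  have "(\<integral>\<^sup>+x. e x \<partial>P) = (\<integral>\<^sup>+x. (\<Prod>i\<in>I. ennreal (exp (- (w i * (cmod (x i))\<^sup>2)))) \<partial>P)"
    using fin by (auto intro!: nn_integral_cong simp: e_def prod_ennreal exp_sum sum_negf[symmetric])
  also have "\<dots> = (\<Prod>i\<in>I. ennreal (pi / w i))"
    unfolding P_def using fin w
    by (subst lborel_product.product_nn_integral_prod) (auto simp: nn_integral_complex_gaussian)
  also have "\<dots> = ennreal (\<Prod>i\<in>I. pi / w i)"
    using w by (intro prod_ennreal) (auto intro!: less_imp_le)
  finally have E: "(\<integral>\<^sup>+x. e x \<partial>P) = ennreal (\<Prod>i\<in>I. pi / w i)" .
  have Epos: "(\<Prod>i\<in>I. pi / w i) > 0" using w by (intro prod_pos) auto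
  have plus[measurable]: "(\<lambda>z. \<lambda>i\<in>I. a z i + b z i) \<in> measurable N P"
    if "a \<in> measurable N P" "b \<in> measurable N P" for a b and N :: "'z measure"
    unfolding P_def
  proof (rule measurable_restrict)
    fix i assume i: "i \<in> I"
    show "(\<lambda>z. a z i + b z i) \<in> measurable N lborel"
      using measurable_compose[OF that(1)[unfolded P_def] measurable_component_singleton[OF i]]
        measurable_compose[OF that(2)[unfolded P_def] measurable_component_singleton[OF i]] by simp
  qed
  have spT: "T x \<in> space P" if "x \<in> space P" for x using T that by (rule measurable_space)
  \<comment> \<open>The double integral of \<open>e (T y) * g (x + T y)\<close> is evaluated in two
    orders. Integrating over x first frees \<open>g\<close> from T by translation. In the other
    order a translation in y moves x into the Gaussian \<open>e\<close>, whose integral splits off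
    again and cancels, being positive and finite.\<close>
  have "(\<integral>\<^sup>+x. g x \<partial>P) * (\<integral>\<^sup>+x. e x \<partial>P) = (\<integral>\<^sup>+y. e (T y) * (\<integral>\<^sup>+x. g x \<partial>P) \<partial>P)"
  proof (subst nn_integral_multc)
    have "(\<integral>\<^sup>+y. e (T y) \<partial>P) = (\<integral>\<^sup>+y. e y \<partial>P)"
      by (intro nn_integral_cong) (simp add: e_def iso)
    then show "(\<integral>\<^sup>+x. g x \<partial>P) * (\<integral>\<^sup>+x. e x \<partial>P) = (\<integral>\<^sup>+y. e (T y) \<partial>P) * (\<integral>\<^sup>+x. g x \<partial>P)"
      by (simp add: mult.commute)
  qed measurable
  also have "\<dots> = (\<integral>\<^sup>+y. (\<integral>\<^sup>+x. e (T y) * g (\<lambda>i\<in>I. x i + T y i) \<partial>P) \<partial>P)"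
  proof (rule nn_integral_cong)
    fix y assume y: "y \<in> space P"
    have "(\<lambda>x. g (\<lambda>i\<in>I. x i + T y i)) \<in> borel_measurable P"
      using y spT by measurable
    then show "e (T y) * (\<integral>\<^sup>+x. g x \<partial>P) = (\<integral>\<^sup>+x. e (T y) * g (\<lambda>i\<in>I. x i + T y i) \<partial>P)"
      using nn_integral_PiM_translate[OF fin g[unfolded P_def], of "T y"]
      by (subst nn_integral_cmult) (auto simp: P_def)
  qed
  also have "\<dots> = (\<integral>\<^sup>+x. (\<integral>\<^sup>+y. e (T y) * g (\<lambda>i\<in>I. x i + T y i) \<partial>P) \<partial>P)"
    by (rule PP.Fubini') measurable
  also have "\<dots> = (\<integral>\<^sup>+x. (\<integral>\<^sup>+y. e (\<lambda>i\<in>I. x i - T y i) * g (T y) \<partial>P) \<partial>P)"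
  proof (rule nn_integral_cong)
    fix x assume x: "x \<in> space P"
    \<comment> \<open>Since \<open>T a = - x\<close> and T is additive, replacing y by y + a turns x
      + T y into T y, and T y into T y - x.\<close>
    define a where "a = T' (\<lambda>i\<in>I. - x i)"
    have "(\<lambda>i\<in>I. - x i) \<in> space P" by (auto simp: P_def space_PiM)
    then have a: "a \<in> space P" "T a = (\<lambda>i\<in>I. - x i)" using T'_space inv by (auto simp: a_def)
    have m: "(\<lambda>y. e (T y) * g (\<lambda>i\<in>I. x i + T y i)) \<in> borel_measurable P"
      using x by measurable
    have "(\<integral>\<^sup>+y. e (T y) * g (\<lambda>i\<in>I. x i + T y i) \<partial>P)
       = (\<integral>\<^sup>+y. e (T (\<lambda>i\<in>I. y i + a i)) * g (\<lambda>i\<in>I. x i + T (\<lambda>i\<in>I. y i + a i) i) \<partial>P)"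
      using nn_integral_PiM_translate[OF fin m[unfolded P_def], of a] by (simp add: P_def)
    also have "\<dots> = (\<integral>\<^sup>+y. e (\<lambda>i\<in>I. x i - T y i) * g (T y) \<partial>P)"
    proof (rule nn_integral_cong)
      fix y assume y: "y \<in> space P"
      have 1: "T (\<lambda>i\<in>I. y i + a i) = (\<lambda>i\<in>I. T y i - x i)"
        using add[OF y a(1)] a(2) by auto
      have 2: "(\<lambda>i\<in>I. x i + (\<lambda>i\<in>I. T y i - x i) i) = T y"
        using spT[OF y] by (auto simp: P_def space_PiM PiE_iff extensional_def)
      have 3: "e (\<lambda>i\<in>I. T y i - x i) = e (\<lambda>i\<in>I. x i - T y i)"
        by (auto simp: e_def norm_minus_commute intro!: sum.cong)
      show "e (T (\<lambda>i\<in>I. y i + a i)) * g (\<lambda>i\<in>I. x i + T (\<lambda>i\<in>I. y i + a i) i) = e (\<lambda>i\<in>I. x i - T y i) * g (T y)"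
        by (simp only: 1 2 3)
    qed
    finally show "(\<integral>\<^sup>+y. e (T y) * g (\<lambda>i\<in>I. x i + T y i) \<partial>P) = (\<integral>\<^sup>+y. e (\<lambda>i\<in>I. x i - T y i) * g (T y) \<partial>P)" .
  qed
  also have "\<dots> = (\<integral>\<^sup>+y. (\<integral>\<^sup>+x. e (\<lambda>i\<in>I. x i + (\<lambda>i\<in>I. - T y i) i) * g (T y) \<partial>P) \<partial>P)"
  proof (subst PP.Fubini')
    have "(\<lambda>z. \<lambda>i\<in>I. - T (fst z) i) \<in> measurable (P \<Otimes>\<^sub>M P) P"
      unfolding P_def
    proof (rule measurable_restrict)
      fix i assume i: "i \<in> I"
      have "(\<lambda>z. T (fst z)) \<in> measurable (P \<Otimes>\<^sub>M P) P" by measurable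
      from measurable_compose[OF this[unfolded P_def] measurable_component_singleton[OF i]]
      show "(\<lambda>z. - T (fst z) i) \<in> measurable (PiM I (\<lambda>_. lborel :: complex measure) \<Otimes>\<^sub>M PiM I (\<lambda>_. lborel :: complex measure)) lborel" by simp
    qed
    from plus[OF measurable_snd this]
    have "(\<lambda>z. \<lambda>i\<in>I. snd z i + (\<lambda>i\<in>I. - T (fst z) i) i) \<in> measurable (P \<Otimes>\<^sub>M P) P" .
    then have [measurable]: "(\<lambda>z. \<lambda>i\<in>I. snd z i - T (fst z) i) \<in> measurable (P \<Otimes>\<^sub>M P) P"
      by (simp cong: restrict_cong)
    show "(\<lambda>(y, x). e (\<lambda>i\<in>I. x i - T y i) * g (T y)) \<in> borel_measurable (P \<Otimes>\<^sub>M P)"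
      unfolding case_prod_beta by measurable
  qed (simp cong: restrict_cong)
  also have "\<dots> = (\<integral>\<^sup>+y. (\<integral>\<^sup>+x. e x \<partial>P) * g (T y) \<partial>P)"
  proof (rule nn_integral_cong)
    fix y assume y: "y \<in> space P"
    have "(\<lambda>x. e (\<lambda>i\<in>I. x i + (\<lambda>i\<in>I. - T y i) i)) \<in> borel_measurable P"
    proof (rule measurable_compose[OF plus e])
      show "(\<lambda>x. \<lambda>i\<in>I. - T y i) \<in> measurable P P"
        by (rule measurable_const) (auto simp: P_def space_PiM)
    qed simp
    then show "(\<integral>\<^sup>+x. e (\<lambda>i\<in>I. x i + (\<lambda>i\<in>I. - T y i) i) * g (T y) \<partial>P) = (\<integral>\<^sup>+x. e x \<partial>P) * g (T y)"
      using nn_integral_PiM_translate[OF fin e[unfolded P_def], of "\<lambda>i\<in>I. - T y i"]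
      by (subst nn_integral_multc) (auto simp: P_def)
  qed
  also have "\<dots> = (\<integral>\<^sup>+y. g (T y) \<partial>P) * (\<integral>\<^sup>+x. e x \<partial>P)"
    by (subst nn_integral_cmult) (auto simp: mult.commute)
  finally show ?thesis
  proof -
    assume eq: "(\<integral>\<^sup>+x. g x \<partial>P) * (\<integral>\<^sup>+x. e x \<partial>P) = (\<integral>\<^sup>+y. g (T y) \<partial>P) * (\<integral>\<^sup>+x. e x \<partial>P)"
    have "(\<integral>\<^sup>+x. e x \<partial>P) * ennreal (inverse (\<Prod>i\<in>I. pi / w i)) = 1"
      using Epos by (simp add: E flip: ennreal_mult)
    then show ?thesis using eq by (metis mult.assoc mult.right_neutral)
  qed
qed

section \<open>Changes of variables in the complex plane\<close>

lemma borel_measurable_cnj [measurable]: "cnj \<in> borel_measurable borel"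
  by (intro borel_measurable_continuous_onI continuous_intros)

text \<open>Determinants of derivatives and the area formula live in \<open>real^2\<close>; this
  real linear bijection transfers them to the complex plane.\<close>

definition complex_of_cart :: "real^2 \<Rightarrow> complex" where
  "complex_of_cart v = Complex (vec_nth v 1) (vec_nth v 2)"

definition cart_of_complex :: "complex \<Rightarrow> real^2" where
  "cart_of_complex z = (\<chi> i. if i = 1 then Re z else Im z)"

lemma cart_of_complex_nth [simp]:
  "vec_nth (cart_of_complex z) 1 = Re z" "vec_nth (cart_of_complex z) 2 = Im z"
  by (simp_all add: cart_of_complex_def)

lemma complex_of_cart_inverse [simp]:
  "complex_of_cart (cart_of_complex z) = z" "cart_of_complex (complex_of_cart v) = v"
  by (simp_all add: complex_of_cart_def complex_eq_iff Finite_Cartesian_Product.vec_eq_iff forall_2)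

lemma bounded_linear_complex_of_cart: "bounded_linear complex_of_cart"
  by (rule linear_conv_bounded_linear[THEN iffD1], rule linearI)
     (auto simp: complex_of_cart_def complex_eq_iff)

lemma bounded_linear_cart_of_complex: "bounded_linear cart_of_complex"
  by (rule linear_conv_bounded_linear[THEN iffD1], rule linearI)
     (auto simp: Finite_Cartesian_Product.vec_eq_iff forall_2)

lemma measurable_complex_of_cart [measurable]: "complex_of_cart \<in> borel_measurable borel"
  by (intro borel_measurable_continuous_onI linear_continuous_on bounded_linear_complex_of_cart)

lemma measurable_cart_of_complex [measurable]: "cart_of_complex \<in> borel_measurable borel"
  by (intro borel_measurable_continuous_onI linear_continuous_on bounded_linear_cart_of_complex)

lemma lborel_complex_eq_distr: "distr lborel borel complex_of_cart = lborel"
proof (rule lborel_eqI[symmetric])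
  fix l u :: complex assume lu: "\<And>b. b \<in> Basis \<Longrightarrow> l \<bullet> b \<le> u \<bullet> b"
  have le: "Re l \<le> Re u" "Im l \<le> Im u" using lu[of 1] lu[of \<i>] by (auto simp: Basis_complex_def)
  have "complex_of_cart -` box l u = box (cart_of_complex l) (cart_of_complex u)"
    by (auto simp: in_box_complex_iff complex_of_cart_def mem_box_cart forall_2)
  then have "emeasure (distr lborel borel complex_of_cart) (box l u)
      = emeasure lborel (box (cart_of_complex l) (cart_of_complex u))"
    by (subst emeasure_distr) auto
  also have "\<dots> = (\<Prod>b\<in>Basis. (cart_of_complex u - cart_of_complex l) \<bullet> b)"
    using le by (intro emeasure_lborel_box) (auto simp: Basis_vec_def inner_axis UNIV_2)
  also have "\<dots> = ennreal ((Re u - Re l) * (Im u - Im l))"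
    by (simp add: Basis_vec_def inner_axis UNIV_2 axis_eq_axis mult.commute)
  finally show "emeasure (distr lborel borel complex_of_cart) (box l u) = (\<Prod>b\<in>Basis. (u - l) \<bullet> b)"
    by (simp add: Basis_complex_def)
qed simp

text \<open>The area formula for injective differentiable maps, extended to images of infinite
  measure: if the integral of the Jacobian were finite, the image would have finite measure, so both
  sides are infinite together.\<close>

lemma emeasure_image_cart:
  fixes f :: "real^'n::{finite,wellorder} \<Rightarrow> real^'n::_"
  assumes S: "S \<in> sets borel"
    and der: "\<And>x. x \<in> S \<Longrightarrow> (f has_derivative f' x) (at x within S)"
    and inj: "inj_on f S"
    and m[measurable]: "(\<lambda>x. Determinants.det (matrix (f' x))) \<in> borel_measurable borel"
  shows "f ` S \<in> sets lebesgue"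
    and "emeasure lebesgue (f ` S) = (\<integral>\<^sup>+x. ennreal \<bar>Determinants.det (matrix (f' x))\<bar> * indicator S x \<partial>lborel)"
proof -
  let ?d = "\<lambda>x. \<bar>Determinants.det (matrix (f' x))\<bar>"
  note [measurable] = S
  have SL: "S \<in> sets lebesgue" using S by simp
  show im: "f ` S \<in> sets lebesgue"
    using der SL by (intro differentiable_image_in_sets_lebesgue) (auto simp: differentiable_on_def differentiable_def)
  have restr: "(\<lambda>x. indicator S x *\<^sub>R ?d x) = (\<lambda>x. if x \<in> S then ?d x else 0)"
    by (auto simp: fun_eq_iff indicator_def)
  have hi: "(\<integral>\<^sup>+x. ennreal (?d x) * indicator S x \<partial>lborel) = ennreal r" if "(?d has_integral r) S" for r
  proof -
    have "((\<lambda>x. indicator S x *\<^sub>R ?d x) has_integral r) UNIV"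
      unfolding restr using that by (simp only: has_integral_restrict_UNIV)
    then have "(\<integral>\<^sup>+x. ennreal (indicator S x *\<^sub>R ?d x) \<partial>lborel) = ennreal r"
      by (intro nn_integral_has_integral_lborel) auto
    then show ?thesis
      by (simp add: mult.commute ennreal_mult' ennreal_indicator[symmetric] del: ennreal_indicator)
  qed
  show "emeasure lebesgue (f ` S) = (\<integral>\<^sup>+x. ennreal (?d x) * indicator S x \<partial>lborel)"
  proof (cases "f ` S \<in> lmeasurable")
    case True
    then have "(?d has_integral measure lebesgue (f ` S)) S"
      using has_measure_differentiable_image[OF SL der inj] by blast
    from hi[OF this] show ?thesis
      by (simp add: emeasure_eq_measure2[OF True])
  next
    case False
    then have inf: "emeasure lebesgue (f ` S) = \<infinity>"
      using fmeasurableI[OF im] by (metis infinity_ennreal_def less_top)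
    have "(\<integral>\<^sup>+x. ennreal (?d x) * indicator S x \<partial>lborel) = \<infinity>"
    proof (rule ccontr)
      assume "(\<integral>\<^sup>+x. ennreal (?d x) * indicator S x \<partial>lborel) \<noteq> \<infinity>"
      then have fin: "(\<integral>\<^sup>+x. ennreal (indicator S x *\<^sub>R ?d x) \<partial>lborel) < \<infinity>"
        by (simp add: mult.commute ennreal_mult' ennreal_indicator[symmetric] less_top del: ennreal_indicator)
      have "integrable lborel (\<lambda>x. indicator S x *\<^sub>R ?d x)"
        using fin by (intro integrableI_nonneg) auto
      then have "(\<lambda>x. indicator S x *\<^sub>R ?d x) integrable_on UNIV"
        by (rule integrable_on_lborel)
      then have "?d integrable_on S"
        unfolding restr by (simp only: integrable_restrict_UNIV)
      with False show False
        using measurable_differentiable_image_eq[OF SL der inj] by blast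
    qed
    with inf show ?thesis by simp
  qed
qed

text \<open>Every real linear map of the plane has the form
  \<open>A * \<zeta> + B * cnj \<zeta>\<close>, with determinant |A|^2 - |B|^2. Keeping the two
  Wirtinger coefficients spares the applications a split into real and imaginary parts. The image
  need only have a null complement.\<close>

lemma nn_integral_complex_change_of_variables:
  fixes g :: "complex \<Rightarrow> complex" and A B :: "complex \<Rightarrow> complex"
  assumes S[measurable]: "S \<in> sets borel" and g[measurable]: "g \<in> borel_measurable borel"
    and A[measurable]: "A \<in> borel_measurable borel" and B[measurable]: "B \<in> borel_measurable borel"
    and der: "\<And>z. z \<in> S \<Longrightarrow> (g has_derivative (\<lambda>\<zeta>. A z * \<zeta> + B z * cnj \<zeta>)) (at z)"
    and inj: "inj_on g S"
    and N: "N \<in> null_sets lborel" "- N \<subseteq> g ` S"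
    and f[measurable]: "f \<in> borel_measurable borel"
  shows "(\<integral>\<^sup>+z. f z \<partial>lborel)
    = (\<integral>\<^sup>+z. f (g z) * ennreal \<bar>(cmod (A z))\<^sup>2 - (cmod (B z))\<^sup>2\<bar> * indicator S z \<partial>lborel)"
proof -
  let ?J = "\<lambda>z. ennreal \<bar>(cmod (A z))\<^sup>2 - (cmod (B z))\<^sup>2\<bar>"
  let ?c = complex_of_cart and ?r = cart_of_complex
  define G where "G = ?r \<circ> g \<circ> ?c"
  define G' where "G' v = ?r \<circ> (\<lambda>\<zeta>. A (?c v) * \<zeta> + B (?c v) * cnj \<zeta>) \<circ> ?c" for v
  have det: "Determinants.det (matrix (G' v)) = (cmod (A (?c v)))\<^sup>2 - (cmod (B (?c v)))\<^sup>2" for v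
  proof -
    have ax: "?c (axis 1 1) = 1" "?c (axis 2 1) = \<i>"
      by (simp_all add: complex_of_cart_def complex_eq_iff axis_def)
    show ?thesis
      unfolding cmod_power2 by (simp add: det_2 matrix_def G'_def ax algebra_simps power2_eq_square)
  qed
  \<comment> \<open>The claim is an equality of measures, so it suffices to test Borel sets E, where
    the area formula applies to the part of S that g maps into E.\<close>
  have "distr (density lborel (\<lambda>z. ?J z * indicator S z)) borel g = lborel"
  proof (rule measure_eqI)
    fix E assume "E \<in> sets (distr (density lborel (\<lambda>z. ?J z * indicator S z)) borel g)"
    then have E[measurable]: "E \<in> sets borel" by simp
    let ?S = "?c -` (S \<inter> g -` E)"
    have gE: "g -` E \<in> sets borel" using measurable_sets_borel[OF g E] by simp
    have S': "?S \<in> sets borel"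
      using measurable_sets_borel[OF measurable_complex_of_cart, of "S \<inter> g -` E"] gE by simp
    have 1: "(G has_derivative G' v) (at v within ?S)" if "v \<in> ?S" for v
      unfolding G_def G'_def using that
      by (intro diff_chain_within diff_chain_at has_derivative_at_withinI[OF diff_chain_at]
          bounded_linear_imp_has_derivative bounded_linear_complex_of_cart bounded_linear_cart_of_complex der) auto
    have 2: "inj_on G ?S"
    proof (rule inj_onI)
      fix u v assume uv: "u \<in> ?S" "v \<in> ?S" "G u = G v"
      then have "g (?c u) = g (?c v)" unfolding G_def comp_def by (metis complex_of_cart_inverse(1))
      then have "?c u = ?c v" using inj uv by (auto dest: inj_onD)
      then show "u = v" by (metis complex_of_cart_inverse(2))
    qed
    have 3: "(\<lambda>x. Determinants.det (matrix (G' x))) \<in> borel_measurable borel"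
      unfolding det by measurable
    have "emeasure (distr (density lborel (\<lambda>z. ?J z * indicator S z)) borel g) E
        = (\<integral>\<^sup>+z. ?J z * indicator S z * indicator (g -` E) z \<partial>lborel)"
      using gE by (subst emeasure_distr) (auto simp: emeasure_density)
    also have "\<dots> = (\<integral>\<^sup>+z. ?J z * indicator (S \<inter> g -` E) z \<partial>distr lborel borel ?c)"
      by (auto simp: lborel_complex_eq_distr intro!: nn_integral_cong split: split_indicator)
    also have "\<dots> = (\<integral>\<^sup>+v. ?J (?c v) * indicator ?S v \<partial>lborel)"
      using gE by (subst nn_integral_distr) (auto intro!: nn_integral_cong split: split_indicator)
    also have "\<dots> = emeasure lebesgue (G ` ?S)"
      by (subst emeasure_image_cart(2)[OF S' 1 2 3]) (auto simp: det)
    also have "G ` ?S = ?r ` (E \<inter> g ` S)"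
    proof -
      have "G ` ?S = ?r ` g ` ?c ` ?S" by (simp add: G_def image_comp comp_assoc)
      also have "?c ` ?S = S \<inter> g -` E"
        by (metis complex_of_cart_inverse(1) surjI surj_image_vimage_eq)
      also have "g ` (S \<inter> g -` E) = E \<inter> g ` S" by auto
      finally show ?thesis .
    qed
    \<comment> \<open>What g misses of E lies in N and is discarded. The image is known only to be
      Lebesgue measurable, hence the completed measure.\<close>
    also have "emeasure lebesgue (?r ` (E \<inter> g ` S)) = emeasure lebesgue (?r ` E)"
    proof -
      have rX: "?r ` X = ?c -` X" for X
        by (auto simp: image_iff) (metis complex_of_cart_inverse(2))
      have "N \<in> null_sets (distr lborel borel ?c)" using N by (simp add: lborel_complex_eq_distr)
      then have "?c -` N \<in> null_sets lborel"
        by (subst (asm) null_sets_distr_iff) auto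
      then have "?c -` N \<in> null_sets lebesgue" by (rule null_sets_completionI)
      moreover have "?c -` E - ?c -` (E \<inter> g ` S) \<subseteq> ?c -` N" using N by auto
      ultimately have "?c -` E - ?c -` (E \<inter> g ` S) \<in> null_sets lebesgue"
        by (metis null_sets_completion_subset)
      then have "emeasure lebesgue (?c -` E) = emeasure lebesgue (?c -` (E \<inter> g ` S) \<union> (?c -` E - ?c -` (E \<inter> g ` S)))"
        by (intro arg_cong[where f="emeasure lebesgue"]) auto
      also have "\<dots> = emeasure lebesgue (?c -` (E \<inter> g ` S))"
      proof (rule emeasure_Un_null_set)
        have "?c -` (E \<inter> g ` S) = G ` ?S" using \<open>G ` ?S = _\<close> by (simp add: rX)
        then show "?c -` (E \<inter> g ` S) \<in> sets lebesgue"
          using emeasure_image_cart(1)[OF S' 1 2 3] by simp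
      qed fact
      finally show ?thesis by (simp add: rX)
    qed
    also have "\<dots> = emeasure (distr lborel borel ?c) E"
    proof -
      have "?r ` E = ?c -` E" by (auto simp: image_iff) (metis complex_of_cart_inverse(2))
      moreover have "?c -` E \<in> sets borel" using measurable_sets_borel[OF measurable_complex_of_cart E] by simp
      ultimately show ?thesis by (simp add: emeasure_distr)
    qed
    finally show "emeasure (distr (density lborel (\<lambda>z. ?J z * indicator S z)) borel g) E = emeasure lborel E"
      by (simp add: lborel_complex_eq_distr)
  qed simp
  then have "(\<integral>\<^sup>+z. f z \<partial>lborel) = (\<integral>\<^sup>+z. f z \<partial>distr (density lborel (\<lambda>z. ?J z * indicator S z)) borel g)"
    by simp
  also have "\<dots> = (\<integral>\<^sup>+z. ?J z * indicator S z * f (g z) \<partial>lborel)"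
    by (simp add: nn_integral_distr nn_integral_density)
  also have "\<dots> = (\<integral>\<^sup>+z. f (g z) * ?J z * indicator S z \<partial>lborel)"
    by (simp add: ac_simps)
  finally show ?thesis .
qed

lemma nn_integral_complex_real_linear:
  assumes d: "(cmod a)\<^sup>2 \<noteq> (cmod b)\<^sup>2" and f: "f \<in> borel_measurable borel"
  shows "(\<integral>\<^sup>+z. f (a * z + b * cnj z) \<partial>lborel) * ennreal \<bar>(cmod a)\<^sup>2 - (cmod b)\<^sup>2\<bar> = (\<integral>\<^sup>+z. f z \<partial>lborel)"
proof -
  define g where "g z = a * z + b * cnj z" for z
  \<comment> \<open>The inverse is explicit: for w = a z + b conj(z), combining w with its conjugate
    eliminates conj(z), and \<open>cnj a * w - b * cnj w\<close> equals
    \<open>D * z\<close>.\<close>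
  define D where "D = cnj a * a - b * cnj b"
  have "D = complex_of_real ((cmod a)\<^sup>2 - (cmod b)\<^sup>2)"
    unfolding D_def of_real_diff complex_norm_square by (simp only: mult.commute[of a])
  then have D: "D \<noteq> 0" using d by (simp only: of_real_eq_0_iff)
  have cD: "cnj D = D" by (simp add: D_def mult.commute)
  have 1: "g ((cnj a * w - b * cnj w) / D) = w" for w
  proof -
    have "g ((cnj a * w - b * cnj w) / D) = (a * (cnj a * w - b * cnj w) + b * (a * cnj w - cnj b * w)) / D"
      by (simp add: g_def add_divide_distrib cD)
    also have "a * (cnj a * w - b * cnj w) + b * (a * cnj w - cnj b * w) = D * w"
      by (simp add: D_def algebra_simps)
    finally show ?thesis using D by simp
  qed
  have 2: "(cnj a * g z - b * cnj (g z)) / D = z" for z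
  proof -
    have "cnj a * g z - b * cnj (g z) = D * z" by (simp add: g_def D_def algebra_simps)
    then show ?thesis using D by simp
  qed
  have "(\<integral>\<^sup>+z. f z \<partial>lborel) = (\<integral>\<^sup>+z. f (g z) * ennreal \<bar>(cmod a)\<^sup>2 - (cmod b)\<^sup>2\<bar> * indicator UNIV z \<partial>lborel)"
  proof (rule nn_integral_complex_change_of_variables[where N="{}"])
    show "inj_on g UNIV" by (rule injI) (metis 2)
    show "- {} \<subseteq> range g"
    proof
      fix w show "w \<in> range g" using 1[of w] by (metis rangeI)
    qed
    show "(g has_derivative (\<lambda>\<zeta>. a * \<zeta> + b * cnj \<zeta>)) (at z)" for z
      unfolding g_def[abs_def] by (intro bounded_linear_imp_has_derivative bounded_linear_add
        bounded_linear_mult_right bounded_linear_const_mult bounded_linear_cnj)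
    show "g \<in> borel_measurable borel" unfolding g_def[abs_def] by measurable
  qed (use f in auto)
  also have "\<dots> = (\<integral>\<^sup>+z. f (g z) * ennreal \<bar>(cmod a)\<^sup>2 - (cmod b)\<^sup>2\<bar> \<partial>lborel)" by simp
  also have "\<dots> = (\<integral>\<^sup>+z. f (g z) \<partial>lborel) * ennreal \<bar>(cmod a)\<^sup>2 - (cmod b)\<^sup>2\<bar>"
  proof (rule nn_integral_multc)
    show "(\<lambda>z. f (g z)) \<in> borel_measurable lborel" using f unfolding g_def by measurable
  qed
  finally show ?thesis unfolding g_def by simp
qed

subsection \<open>Unitary matrices and the Takagi factorization\<close>

lemma index_mult_mat_sum:
  assumes "A \<in> carrier_mat p n" "B \<in> carrier_mat n r" "i < p" "j < r"
  shows "(A * B) $$ (i, j) = (\<Sum>k<n. A $$ (i, k) * B $$ (k, j))"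
  using assms by (auto simp: scalar_prod_def atLeast0LessThan)

lemma mat_adjoint_carrier [simp]:
  "A \<in> carrier_mat n k \<Longrightarrow> mat_adjoint A \<in> carrier_mat k n"
  by (auto simp: mat_adjoint_def mat_of_rows_def)

lemma mat_adjoint_dim [simp]:
  "dim_row (mat_adjoint A) = dim_col A" "dim_col (mat_adjoint A) = dim_row A"
  by (auto simp: mat_adjoint_def mat_of_rows_def)

lemma mat_adjoint_index:
  fixes A :: "complex mat"
  assumes "A \<in> carrier_mat n k" "i < k" "j < n"
  shows "mat_adjoint A $$ (i, j) = cnj (A $$ (j, i))"
  using assms by (auto simp: mat_adjoint_def mat_of_rows_def)

lemma mat_adjoint_mult:
  fixes A :: "complex mat"
  assumes A: "A \<in> carrier_mat n k" and B: "B \<in> carrier_mat k r"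
  shows "mat_adjoint (A * B) = mat_adjoint B * mat_adjoint A"
proof (rule eq_matI)
  fix i j assume "i < dim_row (mat_adjoint B * mat_adjoint A)" "j < dim_col (mat_adjoint B * mat_adjoint A)"
  then have ij: "i < r" "j < n" using A B mat_adjoint_carrier[OF A] mat_adjoint_carrier[OF B] by auto
  show "mat_adjoint (A * B) $$ (i, j) = (mat_adjoint B * mat_adjoint A) $$ (i, j)"
    using ij A B
    by (subst mat_adjoint_index[of _ n r])
       (auto simp: index_mult_mat_sum[of _ n k _ r] index_mult_mat_sum[of _ r k _ n] mat_adjoint_index[of _ n k]
         mat_adjoint_index[of _ k r] simp del: index_mult_mat intro!: sum.cong)
qed (use A B mat_adjoint_carrier[OF A] mat_adjoint_carrier[OF B] mat_adjoint_carrier[of "A*B" n r] in auto)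

lemma mat_adjoint_eq_map_transpose:
  fixes A :: "complex mat"
  assumes A: "A \<in> carrier_mat n k"
  shows "mat_adjoint A = map_mat cnj (transpose_mat A)"
  using A mat_adjoint_carrier[OF A]
  by (intro eq_matI) (auto simp: mat_adjoint_index[of _ n k])

lemma det_mat_adjoint:
  fixes A :: "complex mat"
  assumes A: "A \<in> carrier_mat n n"
  shows "det (mat_adjoint A) = cnj (det A)"
proof -
  interpret cnj: comm_ring_hom cnj by standard auto
  show ?thesis
    using A by (simp add: mat_adjoint_eq_map_transpose det_transpose)
qed

definition unitary_mat :: "nat \<Rightarrow> complex mat \<Rightarrow> bool" where
  "unitary_mat n U \<longleftrightarrow> U \<in> carrier_mat n n \<and> U * mat_adjoint U = 1\<^sub>m n"

definition symmetric_mat :: "nat \<Rightarrow> complex mat \<Rightarrow> bool" where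
  "symmetric_mat n A \<longleftrightarrow> A \<in> carrier_mat n n \<and> transpose_mat A = A"

lemma unitary_matD:
  assumes "unitary_mat n U"
  shows "U \<in> carrier_mat n n" "U * mat_adjoint U = 1\<^sub>m n" "mat_adjoint U * U = 1\<^sub>m n"
  using assms mat_mult_left_right_inverse[of U n "mat_adjoint U"]
  by (auto simp: unitary_mat_def)

lemma unitary_matI_left:
  assumes U: "U \<in> carrier_mat n n" and "mat_adjoint U * U = 1\<^sub>m n"
  shows "unitary_mat n U"
  using assms mat_mult_left_right_inverse[OF mat_adjoint_carrier[OF U] U]
  by (auto simp: unitary_mat_def)

lemma unitary_mat_columns:
  assumes "unitary_mat n U" "i < n" "j < n"
  shows "(\<Sum>k<n. cnj (U $$ (k, i)) * U $$ (k, j)) = (if i = j then 1 else 0)"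
proof -
  note U = unitary_matD[OF assms(1)]
  have "(mat_adjoint U * U) $$ (i, j) = (\<Sum>k<n. cnj (U $$ (k, i)) * U $$ (k, j))"
    using U(1) assms by (subst index_mult_mat_sum[of _ n n]) (auto simp: mat_adjoint_index[of _ n n])
  then show ?thesis using U(3) assms by simp
qed

lemma unitary_mat_rows:
  assumes "unitary_mat n U" "i < n" "j < n"
  shows "(\<Sum>k<n. U $$ (i, k) * cnj (U $$ (j, k))) = (if i = j then 1 else 0)"
proof -
  note U = unitary_matD[OF assms(1)]
  have "(U * mat_adjoint U) $$ (i, j) = (\<Sum>k<n. U $$ (i, k) * cnj (U $$ (j, k)))"
    using U(1) assms by (subst index_mult_mat_sum[of _ n n]) (auto simp: mat_adjoint_index[of _ n n])
  then show ?thesis using U(2) assms by simp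
qed

lemma unitary_matI_columns:
  assumes U: "U \<in> carrier_mat n n"
    and c: "\<And>i j. i < n \<Longrightarrow> j < n \<Longrightarrow> (\<Sum>k<n. cnj (U $$ (k, i)) * U $$ (k, j)) = (if i = j then 1 else 0)"
  shows "unitary_mat n U"
proof (rule unitary_matI_left[OF U], rule eq_matI)
  fix i j assume "i < dim_row (1\<^sub>m n :: complex mat)" "j < dim_col (1\<^sub>m n :: complex mat)"
  then show "(mat_adjoint U * U) $$ (i, j) = 1\<^sub>m n $$ (i, j)"
    using U c[of i j] by (subst index_mult_mat_sum[of _ n n]) (auto simp: mat_adjoint_index[of _ n n])
qed (use U mat_adjoint_carrier[OF U] in auto)

lemma unitary_mat_mult:
  assumes "unitary_mat n U" "unitary_mat n V"
  shows "unitary_mat n (U * V)"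
proof -
  note U = unitary_matD[OF assms(1)] and V = unitary_matD[OF assms(2)]
  have "mat_adjoint (U * V) * (U * V) = mat_adjoint V * (mat_adjoint U * U) * V"
    using U(1) V(1) by (simp add: mat_adjoint_mult[of _ n n _ n] assoc_mult_mat[of _ n n _ n _ n] mult_carrier_mat[of _ n n _ n])
  also have "\<dots> = 1\<^sub>m n"
    using U V by (simp add: right_mult_one_mat[of _ n n])
  finally show ?thesis using U V by (intro unitary_matI_left) auto
qed

lemma unitary_mat_one: "unitary_mat n (1\<^sub>m n)"
proof -
  have "map_mat cnj (1\<^sub>m n) = 1\<^sub>m n" by (rule eq_matI) auto
  then show ?thesis by (simp add: unitary_mat_def mat_adjoint_eq_map_transpose[of _ n n])
qed

lemma cmod_det_unitary:
  assumes "unitary_mat n U"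
  shows "cmod (det U) = 1"
proof -
  note U = unitary_matD[OF assms]
  have "det U * cnj (det U) = 1"
    using det_mult[OF U(1) mat_adjoint_carrier[OF U(1)]] U by (simp add: det_mat_adjoint)
  then have "complex_of_real ((cmod (det U))\<^sup>2) = 1"
    by (simp only: complex_norm_square)
  then have "(cmod (det U))\<^sup>2 = 1" by (simp only: of_real_eq_1_iff)
  then show ?thesis by (simp add: power2_eq_1_iff) (smt (verit) norm_ge_zero)
qed

lemma unitary_mat_preserves_norm:
  assumes U: "unitary_mat n U"
  shows "(\<Sum>i<n. (cmod (\<Sum>k<n. U $$ (i, k) * v k))\<^sup>2) = (\<Sum>k<n. (cmod (v k))\<^sup>2)"
proof -
  have "complex_of_real (\<Sum>i<n. (cmod (\<Sum>k<n. U $$ (i, k) * v k))\<^sup>2)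
    = (\<Sum>i<n. (\<Sum>k<n. U $$ (i, k) * v k) * cnj (\<Sum>l<n. U $$ (i, l) * v l))"
    by (simp only: of_real_sum complex_norm_square)
  also have "\<dots> = (\<Sum>i<n. \<Sum>k<n. \<Sum>l<n. (v k * cnj (v l)) * (cnj (U $$ (i, l)) * U $$ (i, k)))"
    by (simp add: sum_product ac_simps)
  also have "\<dots> = (\<Sum>k<n. \<Sum>l<n. (v k * cnj (v l)) * (\<Sum>i<n. cnj (U $$ (i, l)) * U $$ (i, k)))"
  proof -
    let ?f = "\<lambda>i k l. (v k * cnj (v l)) * (cnj (U $$ (i, l)) * U $$ (i, k))"
    have "(\<Sum>i<n. \<Sum>k<n. \<Sum>l<n. ?f i k l) = (\<Sum>k<n. \<Sum>i<n. \<Sum>l<n. ?f i k l)" by (rule sum.swap)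
    also have "\<dots> = (\<Sum>k<n. \<Sum>l<n. \<Sum>i<n. ?f i k l)" by (rule sum.cong[OF refl]) (rule sum.swap)
    finally show ?thesis by (simp only: sum_distrib_left)
  qed
  also have "\<dots> = (\<Sum>k<n. \<Sum>l<n. (v k * cnj (v l)) * (if l = k then 1 else 0))"
    by (intro sum.cong refl) (simp add: unitary_mat_columns[OF U])
  also have "\<dots> = (\<Sum>k<n. v k * cnj (v k))"
    by (intro sum.cong refl) (simp add: if_distrib cong: if_cong)
  also have "\<dots> = complex_of_real (\<Sum>k<n. (cmod (v k))\<^sup>2)"
    by (simp only: of_real_sum complex_norm_square)
  finally show ?thesis by (simp only: of_real_eq_iff)
qed

text \<open>A Householder reflection, multiplied by a phase.\<close>
lemma exists_unitary_with_column:
  fixes z :: "nat \<Rightarrow> complex"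
  assumes p: "p < n" and z: "(\<Sum>i<n. (cmod (z i))\<^sup>2) = 1"
  shows "\<exists>V. unitary_mat n V \<and> (\<forall>i<n. V $$ (i, p) = z i)"
proof -
  \<comment> \<open>This phase makes \<open>c * z p\<close> real and nonpositive, so
    \<open>w p\<close> is 1 + |z p| and the reflection never degenerates.\<close>
  obtain c where c: "cmod c = 1" "c * z p = - complex_of_real (cmod (z p))"
  proof (cases "z p = 0")
    case True then show ?thesis using that[of 1] by simp
  next
    case False
    show ?thesis
    proof (rule that[of "- cnj (z p) / cmod (z p)"])
      show "cmod (- cnj (z p) / complex_of_real (cmod (z p))) = 1" using False by (simp add: norm_divide)
      have "- cnj (z p) / complex_of_real (cmod (z p)) * z p = - (complex_of_real ((cmod (z p))\<^sup>2)) / cmod (z p)"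
        by (simp only: complex_norm_square) (simp add: mult.commute)
      then show "- cnj (z p) / complex_of_real (cmod (z p)) * z p = - complex_of_real (cmod (z p))"
        using False by (simp add: power2_eq_square)
    qed
  qed
  have cc: "cnj c * c = 1" using c(1) complex_norm_square[of c] by (simp add: mult.commute)
  define w where "w i = (if i = p then 1 else 0) - c * z i" for i
  define a where "a = 1 / complex_of_real (1 + cmod (z p))"
  have pos: "1 + cmod (z p) > 0" by (simp add: add_pos_nonneg)
  have pos': "complex_of_real (1 + cmod (z p)) \<noteq> 0" using pos by (simp only: of_real_eq_0_iff)
  have wp: "w p = complex_of_real (1 + cmod (z p))" using c by (simp add: w_def)
  have zz: "(\<Sum>i<n. cnj (z i) * z i) = 1"
  proof -
    have "(\<Sum>i<n. cnj (z i) * z i) = complex_of_real (\<Sum>i<n. (cmod (z i))\<^sup>2)"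
      by (simp only: of_real_sum complex_norm_square mult.commute)
    then show ?thesis using z by simp
  qed
  have ww: "(\<Sum>k<n. cnj (w k) * w k) = 2 * complex_of_real (1 + cmod (z p))"
  proof -
    have "cnj (w k) * w k = (if k = p then 1 - c * z k - cnj c * cnj (z k) else 0) + cnj (z k) * z k" for k
    proof -
      have "cnj (d - c * u) * (d - c * u) = d * d - d * (c * u) - d * (cnj c * cnj u) + (cnj c * c) * (cnj u * u)"
        if "cnj d = d" for d u using that by (simp add: algebra_simps)
      from this[of 1 "z k"] this[of 0 "z k"] show ?thesis
        by (cases "k = p") (simp_all add: w_def cc)
    qed
    then have "(\<Sum>k<n. cnj (w k) * w k)
      = (\<Sum>k<n. if k = p then 1 - c * z k - cnj c * cnj (z k) else 0) + (\<Sum>k<n. cnj (z k) * z k)"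
      by (simp only: sum.distrib)
    also have "\<dots> = (1 - c * z p - cnj (c * z p)) + 1"
      unfolding zz using p by simp
    also have "\<dots> = 2 * complex_of_real (1 + cmod (z p))" unfolding c by simp
    finally show ?thesis .
  qed
  \<comment> \<open>Because \<open>a\<close> is 2 divided by the squared norm of \<open>w\<close>,
    the bracket is the reflection along \<open>w\<close>. It maps the p-th unit vector to
    \<open>c\<close> times \<open>z\<close>, and the factor \<open>cnj c\<close> removes the
    phase.\<close>
  define V where "V = mat n n (\<lambda>(i, j). cnj c * ((if i = j then 1 else 0) - a * w i * cnj (w j)))"
  have V: "V \<in> carrier_mat n n" by (simp add: V_def)
  have ca: "cnj a = a" by (simp add: a_def)
  have aw: "a * (\<Sum>k<n. cnj (w k) * w k) = 2"
  proof -
    have "1 / X * (2 * X) = 2" if "X \<noteq> 0" for X :: complex using that by simp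
    from this[OF pos'] show ?thesis by (simp only: ww a_def)
  qed
  have "unitary_mat n V"
  proof (rule unitary_matI_columns[OF V])
    fix i j assume ij: "i < n" "j < n"
    have "(\<Sum>k<n. cnj (V $$ (k, i)) * V $$ (k, j))
      = (\<Sum>k<n. (if k = i then (if k = j then 1 else 0) else 0) - (if k = i then a * w k * cnj (w j) else 0)
            - (if k = j then a * w i * cnj (w k) else 0) + a * w i * cnj (w j) * (a * (cnj (w k) * w k)))"
    proof (intro sum.cong refl)
      fix k assume k: "k \<in> {..<n}"
      have "cnj (V $$ (k, i)) * V $$ (k, j) = (cnj c * c) * (((if k = i then 1 else 0) - a * cnj (w k) * w i) *
          ((if k = j then 1 else 0) - a * w k * cnj (w j)))"
        using ij k ca by (simp add: V_def)
      moreover have "(d1 - a * cnj (w k) * w i) * (d2 - a * w k * cnj (w j))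
          = d1 * d2 - d1 * (a * w k * cnj (w j)) - d2 * (a * w i * cnj (w k)) + a * w i * cnj (w j) * (a * (cnj (w k) * w k))" for d1 d2
        by (simp add: algebra_simps)
      ultimately have "cnj (V $$ (k, i)) * V $$ (k, j) = (if k = i then 1 else 0) * (if k = j then 1 else 0)
          - (if k = i then 1 else 0) * (a * w k * cnj (w j)) - (if k = j then 1 else 0) * (a * w i * cnj (w k))
          + a * w i * cnj (w j) * (a * (cnj (w k) * w k))"
        by (simp only: cc mult_1_left)
      then show "cnj (V $$ (k, i)) * V $$ (k, j) = (if k = i then (if k = j then 1 else 0) else 0) - (if k = i then a * w k * cnj (w j) else 0)
            - (if k = j then a * w i * cnj (w k) else 0) + a * w i * cnj (w j) * (a * (cnj (w k) * w k))"
        by (cases "k = i"; cases "k = j") simp_all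
    qed
    also have "\<dots> = (if i = j then 1 else 0) - a * w i * cnj (w j) - a * w i * cnj (w j)
        + a * w i * cnj (w j) * (a * (\<Sum>k<n. cnj (w k) * w k))"
      using ij by (simp add: sum.distrib sum_subtractf sum_distrib_left)
    also have "\<dots> = (if i = j then 1 else 0)" unfolding aw by simp
    finally show "(\<Sum>k<n. cnj (V $$ (k, i)) * V $$ (k, j)) = (if i = j then 1 else 0)" .
  qed
  moreover have "V $$ (i, p) = z i" if "i < n" for i
  proof -
    have "a * cnj (w p) = 1" using pos' by (simp add: wp a_def)
    then have "V $$ (i, p) = cnj c * ((if i = p then 1 else 0) - w i)"
      using that p by (simp add: V_def mult.assoc mult.left_commute[of _ "w i"])
    also have "\<dots> = cnj c * c * z i" by (simp add: w_def)
    finally show ?thesis using cc by simp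
  qed
  ultimately show ?thesis by blast
qed

section \<open>Bordered matrices and congruence\<close>

definition border :: "nat \<Rightarrow> complex mat \<Rightarrow> (nat \<Rightarrow> complex) \<Rightarrow> complex \<Rightarrow> complex mat" where
  "border n K v c = mat (Suc n) (Suc n) (\<lambda>(i, j). if i < n then (if j < n then K $$ (i, j) else v i)
     else (if j < n then v j else c))"

lemma border_carrier [simp]: "border n K v c \<in> carrier_mat (Suc n) (Suc n)"
  by (simp add: border_def)

lemma border_dim [simp]: "dim_row (border n K v c) = Suc n" "dim_col (border n K v c) = Suc n"
  by (simp_all add: border_def)

lemma border_index:
  "i < n \<Longrightarrow> j < n \<Longrightarrow> border n K v c $$ (i, j) = K $$ (i, j)"
  "i < n \<Longrightarrow> border n K v c $$ (i, n) = v i"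
  "j < n \<Longrightarrow> border n K v c $$ (n, j) = v j"
  "border n K v c $$ (n, n) = c"
  by (simp_all add: border_def)

lemma eq_mat_SucI:
  assumes "A \<in> carrier_mat (Suc n) (Suc n)" "B \<in> carrier_mat (Suc n) (Suc n)"
    and "\<And>i j. i < n \<Longrightarrow> j < n \<Longrightarrow> A $$ (i, j) = B $$ (i, j)"
    and "\<And>i. i < n \<Longrightarrow> A $$ (i, n) = B $$ (i, n)" "\<And>j. j < n \<Longrightarrow> A $$ (n, j) = B $$ (n, j)"
    and "A $$ (n, n) = B $$ (n, n)"
  shows "A = B"
proof (rule eq_matI)
  fix i j assume "i < dim_row B" "j < dim_col B"
  then have "i < n \<or> i = n" "j < n \<or> j = n" using assms(2) by auto
  then show "A $$ (i, j) = B $$ (i, j)" using assms(3-6) by blast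
qed (use assms(1,2) in auto)

lemma index_congruence_sum:
  assumes "A \<in> carrier_mat p n" "B \<in> carrier_mat n n" "i < p" "j < p"
  shows "(A * B * transpose_mat A) $$ (i, j) = (\<Sum>k<n. (\<Sum>l<n. A $$ (i, l) * B $$ (l, k)) * A $$ (j, k))"
proof -
  have "(A * B * transpose_mat A) $$ (i, j) = (\<Sum>k<n. (A * B) $$ (i, k) * transpose_mat A $$ (k, j))"
    using assms by (intro index_mult_mat_sum[of _ p]) auto
  then show ?thesis using assms by (auto simp: index_mult_mat_sum[of _ p n _ n] simp del: index_mult_mat intro!: sum.cong)
qed

lemma index_adj_congruence_sum:
  fixes A :: "complex mat"
  assumes "A \<in> carrier_mat p n" "B \<in> carrier_mat n n" "i < p" "j < p"
  shows "(A * B * mat_adjoint A) $$ (i, j) = (\<Sum>k<n. (\<Sum>l<n. A $$ (i, l) * B $$ (l, k)) * cnj (A $$ (j, k)))"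
proof -
  have "(A * B * mat_adjoint A) $$ (i, j) = (\<Sum>k<n. (A * B) $$ (i, k) * mat_adjoint A $$ (k, j))"
    using assms by (intro index_mult_mat_sum[of _ p]) auto
  then show ?thesis using assms
    by (auto simp: index_mult_mat_sum[of _ p n _ n] mat_adjoint_index[of _ p n] simp del: index_mult_mat intro!: sum.cong)
qed

lemma unitary_border: 
  assumes U: "unitary_mat n U"
  shows "unitary_mat (Suc n) (border n U (\<lambda>_. 0) 1)"
proof (rule unitary_matI_columns)
  fix i j assume "i < Suc n" "j < Suc n"
  then have "i < n \<or> i = n" "j < n \<or> j = n" by auto
  then show "(\<Sum>k<Suc n. cnj (border n U (\<lambda>_. 0) 1 $$ (k, i)) * border n U (\<lambda>_. 0) 1 $$ (k, j)) = (if i = j then 1 else 0)"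
    by (elim disjE) (simp_all add: border_index unitary_mat_columns[OF U])
qed simp

text \<open>The embedded unitary acts on the block by congruence, on the column linearly and on the
  corner trivially. The block can therefore be diagonalized without losing the bordered
  shape.\<close>

lemma border_congruence:
  assumes U: "U \<in> carrier_mat n n" and K: "K \<in> carrier_mat n n"
  shows "border n U (\<lambda>_. 0) 1 * border n K v c * transpose_mat (border n U (\<lambda>_. 0) 1)
    = border n (U * K * transpose_mat U) (\<lambda>i. \<Sum>k<n. U $$ (i, k) * v k) c"
proof -
  let ?E = "border n U (\<lambda>_. 0) 1" and ?H = "border n K v c"
  have e: "(?E * ?H * transpose_mat ?E) $$ (i, j)
      = (\<Sum>k<Suc n. (\<Sum>l<Suc n. ?E $$ (i, l) * ?H $$ (l, k)) * ?E $$ (j, k))" if "i < Suc n" "j < Suc n" for i j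
    using that by (intro index_congruence_sum) auto
  have UK: "(U * K * transpose_mat U) $$ (i, j) = (\<Sum>k<n. (\<Sum>l<n. U $$ (i, l) * K $$ (l, k)) * U $$ (j, k))"
    if "i < n" "j < n" for i j using that U K by (intro index_congruence_sum) auto
  show ?thesis
  proof (rule eq_mat_SucI)
    show "?E * ?H * transpose_mat ?E \<in> carrier_mat (Suc n) (Suc n)"
      by (intro mult_carrier_mat[of _ "Suc n" "Suc n"]) auto
  next
    fix i j assume ij: "i < n" "j < n"
    then show "(?E * ?H * transpose_mat ?E) $$ (i, j) = border n (U * K * transpose_mat U) (\<lambda>i. \<Sum>k<n. U $$ (i, k) * v k) c $$ (i, j)"
      by (simp add: e UK border_index del: index_mult_mat assoc_mult_mat)
  next
    fix i assume i: "i < n"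
    then show "(?E * ?H * transpose_mat ?E) $$ (i, n) = border n (U * K * transpose_mat U) (\<lambda>i. \<Sum>k<n. U $$ (i, k) * v k) c $$ (i, n)"
      by (simp add: e border_index del: index_mult_mat assoc_mult_mat)
    show "(?E * ?H * transpose_mat ?E) $$ (n, i) = border n (U * K * transpose_mat U) (\<lambda>i. \<Sum>k<n. U $$ (i, k) * v k) c $$ (n, i)"
      using i by (simp add: e border_index mult.commute[of "v _"] del: index_mult_mat assoc_mult_mat)
  next
    show "(?E * ?H * transpose_mat ?E) $$ (n, n) = border n (U * K * transpose_mat U) (\<lambda>i. \<Sum>k<n. U $$ (i, k) * v k) c $$ (n, n)"
      by (simp add: e border_index del: index_mult_mat assoc_mult_mat)
  qed simp
qed

lemma symmetric_congruence:
  assumes "symmetric_mat n A" "U \<in> carrier_mat n n"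
  shows "symmetric_mat n (U * A * transpose_mat U)"
proof -
  have A: "A \<in> carrier_mat n n" "transpose_mat A = A" using assms by (auto simp: symmetric_mat_def)
  have "transpose_mat (U * A * transpose_mat U) = transpose_mat (transpose_mat U) * (transpose_mat A * transpose_mat U)"
    using A(1) assms(2) by (simp add: transpose_mult[of _ n n _ n])
  then show ?thesis using A assms(2) by (simp add: symmetric_mat_def assoc_mult_mat[of _ n n _ n _ n] mult_carrier_mat[of _ n n _ n])
qed

lemma symmetric_mat_index: "symmetric_mat n A \<Longrightarrow> i < n \<Longrightarrow> j < n \<Longrightarrow> A $$ (i, j) = A $$ (j, i)"
proof -
  assume A: "symmetric_mat n A" and ij: "i < n" "j < n"
  have "A $$ (i, j) = transpose_mat A $$ (i, j)" using A by (simp add: symmetric_mat_def)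
  also have "\<dots> = A $$ (j, i)" using A ij by (intro index_transpose_mat(1)) (auto simp: symmetric_mat_def)
  finally show ?thesis .
qed

lemma symmetric_border: "symmetric_mat n K \<Longrightarrow> symmetric_mat (Suc n) (border n K v c)"
proof -
  assume K: "symmetric_mat n K"
  have "transpose_mat (border n K v c) = border n K v c"
  proof (rule eq_mat_SucI)
    fix i j assume "i < n" "j < n"
    then show "transpose_mat (border n K v c) $$ (i, j) = border n K v c $$ (i, j)"
      using symmetric_mat_index[OF K, of j i] by (simp add: border_index)
  qed (auto simp: border_index)
  then show ?thesis by (simp add: symmetric_mat_def)
qed

text \<open>The inner factors, the transpose of U and its adjoint, cancel. Congruence of A thus
  becomes unitary conjugation of A times its adjoint, which is why squared singular values are
  congruence invariants.\<close>

lemma congruence_mult_adjoint: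
  assumes U: "unitary_mat n U" and A: "A \<in> carrier_mat n n"
  shows "(U * A * transpose_mat U) * mat_adjoint (U * A * transpose_mat U) = U * (A * mat_adjoint A) * mat_adjoint U"
proof -
  note U' = unitary_matD[OF U]
  have UT: "transpose_mat U * mat_adjoint (transpose_mat U) = 1\<^sub>m n"
  proof (rule eq_matI)
    fix i j assume "i < dim_row (1\<^sub>m n :: complex mat)" "j < dim_col (1\<^sub>m n :: complex mat)"
    then show "(transpose_mat U * mat_adjoint (transpose_mat U)) $$ (i, j) = 1\<^sub>m n $$ (i, j)"
      using U'(1) unitary_mat_columns[OF U, of j i]
      by (subst index_mult_mat_sum[of _ n n _ n]) (auto simp: mat_adjoint_index[of _ n n] mult.commute)
  qed (use U'(1) mat_adjoint_carrier[of "transpose_mat U" n n] in auto)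
  have "(U * A * transpose_mat U) * mat_adjoint (U * A * transpose_mat U)
    = U * A * (transpose_mat U * mat_adjoint (transpose_mat U)) * (mat_adjoint A * mat_adjoint U)"
    using U'(1) A by (simp add: mat_adjoint_mult[of _ n n _ n] assoc_mult_mat[of _ n n _ n _ n] mult_carrier_mat[of _ n n _ n])
  also have "\<dots> = U * (A * mat_adjoint A) * mat_adjoint U"
    unfolding UT using U'(1) A by (simp add: assoc_mult_mat[of _ n n _ n _ n] mult_carrier_mat[of _ n n _ n] right_mult_one_mat[of _ n n])
  finally show ?thesis .
qed

lemma congruence_inverse:
  assumes U: "unitary_mat n U" and A: "A \<in> carrier_mat n n"
  shows "U * (mat_adjoint U * A * transpose_mat (mat_adjoint U)) * transpose_mat U = A"
proof -
  note U' = unitary_matD[OF U]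
  have "transpose_mat (mat_adjoint U) * transpose_mat U = transpose_mat (U * mat_adjoint U)"
    using U'(1) by (simp add: transpose_mult[of _ n n _ n])
  then have UT: "transpose_mat (mat_adjoint U) * transpose_mat U = 1\<^sub>m n" using U' by simp
  have "U * (mat_adjoint U * A * transpose_mat (mat_adjoint U)) * transpose_mat U
    = (U * mat_adjoint U) * A * (transpose_mat (mat_adjoint U) * transpose_mat U)"
    using U'(1) A by (simp add: assoc_mult_mat[of _ n n _ n _ n] mult_carrier_mat[of _ n n _ n])
  then show ?thesis using U' UT A by simp
qed

text \<open>Let u be an eigenvector of A times its adjoint with eigenvalue s, and p = A conj(u). By
  symmetry of A, A conj(p) = s u. With \<sigma> the square root of s, the vector p + \<sigma> u is a
  coneigenvector unless it vanishes; in that case p = - \<sigma> u, and multiplying u by the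
  imaginary unit flips the sign, because the map is antilinear.\<close>

lemma exists_coneigenvector:
  assumes A: "symmetric_mat n A" and n: "n > 0"
  shows "\<exists>z \<sigma>. \<sigma> \<ge> 0 \<and> (\<Sum>i<n. (cmod (z i))\<^sup>2) = 1 \<and>
    (\<forall>i<n. (\<Sum>k<n. A $$ (i, k) * cnj (z k)) = complex_of_real \<sigma> * z i)"
proof -
  have Ac: "A \<in> carrier_mat n n" using A by (simp add: symmetric_mat_def)
  note sym = symmetric_mat_index[OF A]
  let ?B = "A * mat_adjoint A"
  have B: "?B \<in> carrier_mat n n" using Ac by (intro mult_carrier_mat) auto
  have "degree (char_poly ?B) = n" using degree_monic_char_poly[OF B] by simp
  then have "\<not> constant (poly (char_poly ?B))" using n by (simp add: constant_degree)
  then obtain s where "poly (char_poly ?B) s = 0" using fundamental_theorem_of_algebra by blast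
  then have "eigenvalue ?B s" using eigenvalue_root_char_poly[OF B] by simp
  then obtain uv where uv: "uv \<in> carrier_vec n" "uv \<noteq> 0\<^sub>v n" "?B *\<^sub>v uv = s \<cdot>\<^sub>v uv"
    using B by (auto simp: eigenvalue_def eigenvector_def)
  define u where "u i = uv $ i" for i
  define p where "p i = (\<Sum>k<n. A $$ (i, k) * cnj (u k))" for i
  have Ap: "(\<Sum>k<n. A $$ (i, k) * cnj (p k)) = s * u i" if i: "i < n" for i
  proof -
    have "(?B *\<^sub>v uv) $ i = (\<Sum>l<n. ?B $$ (i, l) * u l)"
      using i B uv(1) by (simp add: scalar_prod_def atLeast0LessThan u_def del: index_mult_mat)
    also have "\<dots> = (\<Sum>l<n. \<Sum>k<n. A $$ (i, k) * (cnj (A $$ (k, l)) * u l))"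
      using i Ac by (intro sum.cong refl)
        (auto simp: index_mult_mat_sum[of _ n n _ n] mat_adjoint_index[of _ n n] sum_distrib_right sym mult.assoc
           simp del: index_mult_mat intro!: sum.cong)
    also have "\<dots> = (\<Sum>k<n. A $$ (i, k) * cnj (p k))"
      by (subst sum.swap) (simp add: p_def sum_distrib_left)
    finally show ?thesis using uv i by (simp add: u_def)
  qed
  obtain i0 where i0: "i0 < n" "u i0 \<noteq> 0"
    using uv(1,2) by (metis carrier_vecD eq_vecI index_zero_vec(1) index_zero_vec(2) u_def)
  have upos: "(\<Sum>i<n. (cmod (u i))\<^sup>2) > 0"
    using i0 by (intro sum_pos2[of _ i0]) auto
  \<comment> \<open>Pairing the eigenvalue equation with u gives s |u|^2 = |p|^2, so s is real and
    nonnegative.\<close>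
  have "s * complex_of_real (\<Sum>i<n. (cmod (u i))\<^sup>2) = (\<Sum>i<n. cnj (u i) * (s * u i))"
    by (simp only: of_real_sum complex_norm_square sum_distrib_left) (simp add: ac_simps)
  also have "\<dots> = (\<Sum>i<n. \<Sum>k<n. cnj (u i) * (A $$ (i, k) * cnj (p k)))"
    by (simp add: Ap sum_distrib_left[symmetric])
  also have "\<dots> = (\<Sum>k<n. \<Sum>i<n. cnj (u i) * (A $$ (i, k) * cnj (p k)))" by (rule sum.swap)
  also have "\<dots> = (\<Sum>k<n. p k * cnj (p k))"
  proof (rule sum.cong[OF refl])
    fix k assume k: "k \<in> {..<n}"
    show "(\<Sum>i<n. cnj (u i) * (A $$ (i, k) * cnj (p k))) = p k * cnj (p k)"
      unfolding p_def[of k] sum_distrib_right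
      using k by (intro sum.cong refl) (simp add: sym[of k] ac_simps p_def)
  qed
  also have "\<dots> = complex_of_real (\<Sum>k<n. (cmod (p k))\<^sup>2)"
    by (simp only: of_real_sum complex_norm_square)
  finally have s_eq: "s * complex_of_real (\<Sum>i<n. (cmod (u i))\<^sup>2) = complex_of_real (\<Sum>k<n. (cmod (p k))\<^sup>2)" .
  define r where "r = (\<Sum>k<n. (cmod (p k))\<^sup>2) / (\<Sum>i<n. (cmod (u i))\<^sup>2)"
  have r: "r \<ge> 0" unfolding r_def using upos by (auto intro!: divide_nonneg_pos sum_nonneg)
  have sr: "s = complex_of_real r"
  proof -
    have "complex_of_real (\<Sum>i<n. (cmod (u i))\<^sup>2) \<noteq> 0" using upos by (simp only: of_real_eq_0_iff)
    then show ?thesis using s_eq unfolding r_def of_real_divide by (metis nonzero_eq_divide_eq)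
  qed
  define \<sigma> where "\<sigma> = sqrt r"
  have \<sigma>: "\<sigma> \<ge> 0" "complex_of_real \<sigma> * complex_of_real \<sigma> = s"
    using r by (auto simp: \<sigma>_def sr of_real_mult[symmetric] simp del: of_real_mult)
  have "\<exists>z'. (\<exists>i<n. z' i \<noteq> 0) \<and> (\<forall>i<n. (\<Sum>k<n. A $$ (i, k) * cnj (z' k)) = complex_of_real \<sigma> * z' i)"
  proof (cases "\<exists>i<n. p i + complex_of_real \<sigma> * u i \<noteq> 0")
    case True
    have "(\<Sum>k<n. A $$ (i, k) * cnj (p k + complex_of_real \<sigma> * u k)) = complex_of_real \<sigma> * (p i + complex_of_real \<sigma> * u i)"
      if "i < n" for i
    proof -
      have "(\<Sum>k<n. A $$ (i, k) * cnj (p k + complex_of_real \<sigma> * u k))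
        = (\<Sum>k<n. A $$ (i, k) * cnj (p k)) + complex_of_real \<sigma> * (\<Sum>k<n. A $$ (i, k) * cnj (u k))"
        by (simp add: algebra_simps sum.distrib sum_distrib_left)
      also have "\<dots> = complex_of_real \<sigma> * complex_of_real \<sigma> * u i + complex_of_real \<sigma> * p i"
        using that by (simp only: Ap \<sigma>(2) p_def[symmetric])
      finally show ?thesis by (simp add: algebra_simps)
    qed
    with True show ?thesis by (intro exI[of _ "\<lambda>k. p k + complex_of_real \<sigma> * u k"]) blast
  next
    case False
    have "(\<Sum>k<n. A $$ (i, k) * cnj (\<i> * u k)) = complex_of_real \<sigma> * (\<i> * u i)" if "i < n" for i
    proof -
      have "(\<Sum>k<n. A $$ (i, k) * cnj (\<i> * u k)) = - \<i> * p i"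
        by (simp add: p_def sum_distrib_left sum_negf ac_simps)
      moreover have "p i = - (complex_of_real \<sigma> * u i)" using False that by (simp add: eq_neg_iff_add_eq_0)
      ultimately show ?thesis by simp
    qed
    moreover have "\<i> * u i0 \<noteq> 0" using i0 by simp
    ultimately show ?thesis using i0(1) by (intro exI[of _ "\<lambda>k. \<i> * u k"]) blast
  qed
  then obtain z' i1 where z': "i1 < n" "z' i1 \<noteq> 0"
    "\<And>i. i < n \<Longrightarrow> (\<Sum>k<n. A $$ (i, k) * cnj (z' k)) = complex_of_real \<sigma> * z' i" by blast
  define N where "N = sqrt (\<Sum>i<n. (cmod (z' i))\<^sup>2)"
  have "(\<Sum>i<n. (cmod (z' i))\<^sup>2) > 0" using z' by (intro sum_pos2[of _ i1]) auto
  then have N: "N > 0" "N\<^sup>2 = (\<Sum>i<n. (cmod (z' i))\<^sup>2)" by (auto simp: N_def)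
  show ?thesis
  proof (intro exI[of _ "\<lambda>i. z' i / complex_of_real N"] exI[of _ \<sigma>] conjI allI impI)
    have "(\<Sum>i<n. (cmod (z' i / complex_of_real N))\<^sup>2) = (\<Sum>i<n. (cmod (z' i))\<^sup>2) / N\<^sup>2"
      using N(1) by (simp add: norm_divide power_divide sum_divide_distrib)
    then show "(\<Sum>i<n. (cmod (z' i / complex_of_real N))\<^sup>2) = 1" using N by (metis divide_self less_irrefl power_not_zero)
  next
    fix i assume "i < n"
    from z'(3)[OF this] show "(\<Sum>k<n. A $$ (i, k) * cnj (z' k / complex_of_real N)) = complex_of_real \<sigma> * (z' i / complex_of_real N)"
      by (simp add: sum_divide_distrib[symmetric])
  qed (rule \<sigma>)
qed

text \<open>A unit coneigenvector is completed to a unitary V with that last column. Congruence by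
  the adjoint of V then clears the last column outside the corner, hence by symmetry the last row,
  and the remaining block is smaller.\<close>

theorem takagi_factorization:
  assumes "symmetric_mat n A"
  shows "\<exists>U \<sigma>. unitary_mat n U \<and> (\<forall>i<n. \<sigma> i \<ge> 0) \<and>
    A = U * mat_diag n (\<lambda>i. complex_of_real (\<sigma> i)) * transpose_mat U"
  using assms
proof (induction n arbitrary: A)
  case 0
  then show ?case
    by (intro exI[of _ "1\<^sub>m 0"] exI[of _ "\<lambda>_. 0"] conjI unitary_mat_one) (auto simp: symmetric_mat_def intro!: eq_matI)
next
  case (Suc n)
  have Ac: "A \<in> carrier_mat (Suc n) (Suc n)" using Suc.prems by (simp add: symmetric_mat_def)
  obtain z s where s: "s \<ge> 0" and z: "(\<Sum>i<Suc n. (cmod (z i))\<^sup>2) = 1"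
    and Az: "\<And>i. i < Suc n \<Longrightarrow> (\<Sum>k<Suc n. A $$ (i, k) * cnj (z k)) = complex_of_real s * z i"
    using exists_coneigenvector[OF Suc.prems] by blast
  obtain V where V: "unitary_mat (Suc n) V" and Vz: "\<And>i. i < Suc n \<Longrightarrow> V $$ (i, n) = z i"
    using exists_unitary_with_column[OF _ z, of n] by blast
  note Vc = unitary_matD(1)[OF V]
  define B where "B = mat_adjoint V * A * transpose_mat (mat_adjoint V)"
  have Bs: "symmetric_mat (Suc n) B"
    unfolding B_def using Suc.prems Vc by (intro symmetric_congruence) auto
  have Bc: "B \<in> carrier_mat (Suc n) (Suc n)" using Bs by (simp add: symmetric_mat_def)
  have Bn: "B $$ (i, n) = (if i = n then complex_of_real s else 0)" if i: "i < Suc n" for i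
  proof -
    have "B $$ (i, n) = (\<Sum>k<Suc n. (\<Sum>l<Suc n. mat_adjoint V $$ (i, l) * A $$ (l, k)) * mat_adjoint V $$ (n, k))"
      unfolding B_def using i Vc Ac by (intro index_congruence_sum) auto
    also have "\<dots> = (\<Sum>k<Suc n. \<Sum>l<Suc n. cnj (V $$ (l, i)) * (A $$ (l, k) * cnj (z k)))"
      unfolding sum_distrib_right
      using i Vc Vz by (intro sum.cong refl) (auto simp: mat_adjoint_index[of _ "Suc n" "Suc n"])
    also have "\<dots> = (\<Sum>l<Suc n. cnj (V $$ (l, i)) * (\<Sum>k<Suc n. A $$ (l, k) * cnj (z k)))"
      unfolding sum_distrib_left by (rule sum.swap)
    also have "\<dots> = (\<Sum>l<Suc n. complex_of_real s * (cnj (V $$ (l, i)) * V $$ (l, n)))"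
      by (intro sum.cong refl) (simp only: Az Vz lessThan_iff mult.left_commute)
    also have "\<dots> = complex_of_real s * (if i = n then 1 else 0)"
      unfolding sum_distrib_left[symmetric] using i by (subst unitary_mat_columns[OF V]) auto
    finally show ?thesis by simp
  qed
  define B' where "B' = mat n n (\<lambda>(i, j). B $$ (i, j))"
  have B's: "symmetric_mat n B'"
    unfolding symmetric_mat_def using symmetric_mat_index[OF Bs]
    by (auto simp: B'_def intro!: eq_matI)
  obtain U' \<sigma>' where U': "unitary_mat n U'" and \<sigma>': "\<And>i. i < n \<Longrightarrow> \<sigma>' i \<ge> 0"
    and B'U: "B' = U' * mat_diag n (\<lambda>i. complex_of_real (\<sigma>' i)) * transpose_mat U'"
    using Suc.IH[OF B's] by blast
  define \<sigma> where "\<sigma> = \<sigma>'(n := s)"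
  let ?E = "border n U' (\<lambda>_. 0) 1"
  let ?D = "mat_diag (Suc n) (\<lambda>i. complex_of_real (\<sigma> i))"
  have E: "unitary_mat (Suc n) ?E" by (rule unitary_border[OF U'])
  have D: "?D = border n (mat_diag n (\<lambda>i. complex_of_real (\<sigma>' i))) (\<lambda>_. 0) (complex_of_real s)"
    by (rule eq_mat_SucI[of _ n]) (auto simp: border_index mat_diag_def \<sigma>_def)
  have "B = border n B' (\<lambda>_. 0) (complex_of_real s)"
  proof (rule eq_mat_SucI[of _ n])
    fix j assume "j < n"
    then show "B $$ (n, j) = border n B' (\<lambda>_. 0) (complex_of_real s) $$ (n, j)"
      using symmetric_mat_index[OF Bs, of n j] Bn[of j] by (simp add: border_index)
  qed (auto simp: Bc border_index Bn B'_def)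
  also have "\<dots> = ?E * ?D * transpose_mat ?E"
    unfolding D using unitary_matD(1)[OF U'] by (subst border_congruence) (auto simp: B'U)
  finally have B_eq: "B = ?E * ?D * transpose_mat ?E" .
  have "A = V * B * transpose_mat V"
    unfolding B_def using congruence_inverse[OF V Ac] by simp
  also have "\<dots> = (V * ?E) * ?D * transpose_mat (V * ?E)"
    unfolding B_eq using Vc
    by (simp add: transpose_mult[of _ "Suc n" "Suc n" _ "Suc n"] assoc_mult_mat[of _ "Suc n" "Suc n" _ "Suc n" _ "Suc n"]
        mult_carrier_mat[of _ "Suc n" "Suc n" _ "Suc n"])
  finally have "A = (V * ?E) * ?D * transpose_mat (V * ?E)" .
  moreover have "unitary_mat (Suc n) (V * ?E)" by (rule unitary_mat_mult[OF V E])
  moreover have "\<forall>i<Suc n. \<sigma> i \<ge> 0" using \<sigma>' s by (auto simp: \<sigma>_def less_Suc_eq)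
  ultimately show ?case by blast
qed

section \<open>Squared singular values as roots of a polynomial\<close>

lemma prod_list_map_upt: "prod_list (map f [0..<n]) = (\<Prod>i<n. f i :: 'a::comm_monoid_mult)"
  by (induction n) (auto simp: mult.commute)

lemma char_poly_mat_diag: "char_poly (mat_diag n f) = (\<Prod>i<n. [:- f i, 1:])"
proof -
  have "char_poly (mat_diag n f) = (\<Prod>a\<leftarrow>diag_mat (mat_diag n f). [:- a, 1:])"
    by (rule char_poly_upper_triangular[of _ n]) (auto simp: mat_diag_def upper_triangular_def)
  also have "diag_mat (mat_diag n f) = map f [0..<n]"
    by (auto simp: diag_mat_def mat_diag_def)
  also have "(\<Prod>a\<leftarrow>map f [0..<n]. [:- a, 1:]) = (\<Prod>i<n. [:- f i, 1:])"
    using prod_list_map_upt[of "\<lambda>i. [:- f i, 1:]" n] by (simp add: comp_def)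
  finally show ?thesis .
qed

text \<open>The roots are the squared singular values with multiplicity. Working with the polynomial
  avoids choosing an order for them and makes invariance under congruence an equation.\<close>

definition sing_poly :: "complex mat \<Rightarrow> complex poly" where
  "sing_poly A = char_poly (A * mat_adjoint A)"

lemma char_poly_unitary_conj:
  assumes U: "unitary_mat n U" and X: "X \<in> carrier_mat n n"
  shows "char_poly (U * X * mat_adjoint U) = char_poly X"
proof (rule char_poly_similar)
  note U' = unitary_matD[OF U]
  have "similar_mat_wit (U * X * mat_adjoint U) X U (mat_adjoint U)"
    unfolding similar_mat_wit_def Let_def using U' X
    by (auto intro!: mult_carrier_mat[of _ n n _ n] simp del: assoc_mult_mat)
  then show "similar_mat (U * X * mat_adjoint U) X" unfolding similar_mat_def by blast
qed

lemma sing_poly_congruence: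
  assumes U: "unitary_mat n U" and A: "A \<in> carrier_mat n n"
  shows "sing_poly (U * A * transpose_mat U) = sing_poly A"
  unfolding sing_poly_def congruence_mult_adjoint[OF assms]
  using A by (intro char_poly_unitary_conj[OF U] mult_carrier_mat[of _ n n]) auto

lemma mat_diag_mult_adjoint:
  "mat_diag n (\<lambda>i. complex_of_real (s i)) * mat_adjoint (mat_diag n (\<lambda>i. complex_of_real (s i)))
    = mat_diag n (\<lambda>i. complex_of_real ((s i)\<^sup>2))"
proof -
  have "mat_adjoint (mat_diag n (\<lambda>i. complex_of_real (s i))) = mat_diag n (\<lambda>i. complex_of_real (s i))"
    by (rule eq_matI) (auto simp: mat_adjoint_index[of _ n n] mat_diag_def)
  then show ?thesis by (simp add: power2_eq_square)
qed

lemma sing_poly_mat_diag: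
  "sing_poly (mat_diag n (\<lambda>i. complex_of_real (s i))) = (\<Prod>i<n. [:- complex_of_real ((s i)\<^sup>2), 1:])"
  unfolding sing_poly_def mat_diag_mult_adjoint by (rule char_poly_mat_diag)

lemma sing_poly_takagi:
  assumes "unitary_mat n U"
  shows "sing_poly (U * mat_diag n (\<lambda>i. complex_of_real (\<sigma> i)) * transpose_mat U)
    = (\<Prod>i<n. [:- complex_of_real ((\<sigma> i)\<^sup>2), 1:])"
  using assms by (simp only: sing_poly_congruence[OF _ mat_diag_dim] sing_poly_mat_diag)

lemma poly_prod_linear: "poly (\<Prod>i<n. [:- a i, 1:]) x = (\<Prod>i<n. x - a i :: 'a::comm_ring_1)"
  by (simp add: poly_prod)

text \<open>The vector is the column of the Takagi unitary belonging to a diagonal entry with square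
  x.\<close>

lemma exists_singular_vector:
  assumes A: "symmetric_mat n A" and x: "x \<ge> 0" and root: "poly (sing_poly A) (complex_of_real x) = 0"
  shows "\<exists>z. (\<exists>i<n. z i \<noteq> 0) \<and>
    (\<forall>i<n. (\<Sum>k<n. A $$ (i, k) * cnj (z k)) = complex_of_real (sqrt x) * z i)"
proof -
  obtain U \<sigma> where U: "unitary_mat n U" and \<sigma>: "\<And>i. i < n \<Longrightarrow> \<sigma> i \<ge> 0"
    and A_eq: "A = U * mat_diag n (\<lambda>i. complex_of_real (\<sigma> i)) * transpose_mat U"
    using takagi_factorization[OF A] by blast
  note Uc = unitary_matD(1)[OF U]
  have "(\<Prod>i<n. complex_of_real x - complex_of_real ((\<sigma> i)\<^sup>2)) = 0"
    using root unfolding A_eq sing_poly_takagi[OF U] poly_prod_linear .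
  then obtain j where j: "j < n" "complex_of_real x = complex_of_real ((\<sigma> j)\<^sup>2)" by auto
  then have sx: "sqrt x = \<sigma> j" using \<sigma>[OF j(1)] by (simp only: of_real_eq_iff) simp
  define z where "z i = U $$ (i, j)" for i
  have "(\<Sum>k<n. A $$ (i, k) * cnj (z k)) = complex_of_real (\<sigma> j) * z i" if i: "i < n" for i
  proof -
    have Aik: "A $$ (i, k) = (\<Sum>l<n. U $$ (i, l) * complex_of_real (\<sigma> l) * U $$ (k, l))" if "k < n" for k
    proof -
      have "A $$ (i, k) = (\<Sum>l<n. (\<Sum>p<n. U $$ (i, p) * mat_diag n (\<lambda>i. complex_of_real (\<sigma> i)) $$ (p, l)) * U $$ (k, l))"
        unfolding A_eq using i that Uc by (intro index_congruence_sum) auto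
      also have "\<dots> = (\<Sum>l<n. U $$ (i, l) * complex_of_real (\<sigma> l) * U $$ (k, l))"
        by (intro sum.cong refl arg_cong2[where f="(*)"]) (auto simp: mat_diag_def if_distrib cong: if_cong)
      finally show ?thesis .
    qed
    have "(\<Sum>k<n. A $$ (i, k) * cnj (z k)) = (\<Sum>k<n. \<Sum>l<n. U $$ (i, l) * complex_of_real (\<sigma> l) * (cnj (U $$ (k, j)) * U $$ (k, l)))"
      by (intro sum.cong refl) (simp add: Aik z_def sum_distrib_right mult.assoc mult.commute[of "cnj _"])
    also have "\<dots> = (\<Sum>l<n. U $$ (i, l) * complex_of_real (\<sigma> l) * (\<Sum>k<n. cnj (U $$ (k, j)) * U $$ (k, l)))"
      unfolding sum_distrib_left by (rule sum.swap)
    also have "\<dots> = (\<Sum>l<n. U $$ (i, l) * complex_of_real (\<sigma> l) * (if j = l then 1 else 0))"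
      using j by (intro sum.cong refl) (simp add: unitary_mat_columns[OF U])
    also have "\<dots> = complex_of_real (\<sigma> j) * z i" using j by (simp add: z_def if_distrib cong: if_cong)
    finally show ?thesis .
  qed
  moreover have "\<exists>i<n. z i \<noteq> 0"
  proof (rule ccontr)
    assume "\<not> (\<exists>i<n. z i \<noteq> 0)"
    then have "(\<Sum>k<n. cnj (U $$ (k, j)) * U $$ (k, j)) = 0" by (simp add: z_def)
    then show False using unitary_mat_columns[OF U j(1) j(1)] by simp
  qed
  ultimately show ?thesis unfolding sx by blast
qed

text \<open>Applying the antilinear map that sends z to A conj(z) twice multiplies z by
  |\<kappa>|^2, and by symmetry its square is A times its adjoint. Here \<kappa> may carry a
  phase.\<close>

lemma singular_vector_root:
  assumes A: "symmetric_mat n A" and z: "i0 < n" "z i0 \<noteq> 0"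
    and Az: "\<And>i. i < n \<Longrightarrow> (\<Sum>k<n. A $$ (i, k) * cnj (z k)) = \<kappa> * z i"
  shows "poly (sing_poly A) (complex_of_real ((cmod \<kappa>)\<^sup>2)) = 0"
proof -
  have Ac: "A \<in> carrier_mat n n" using A by (simp add: symmetric_mat_def)
  let ?B = "A * mat_adjoint A"
  have B: "?B \<in> carrier_mat n n" using Ac by (intro mult_carrier_mat) auto
  have "?B *\<^sub>v vec n z = complex_of_real ((cmod \<kappa>)\<^sup>2) \<cdot>\<^sub>v vec n z"
  proof (rule eq_vecI)
    fix i assume "i < dim_vec (complex_of_real ((cmod \<kappa>)\<^sup>2) \<cdot>\<^sub>v vec n z)"
    then have i: "i < n" by simp
    have "(?B *\<^sub>v vec n z) $ i = (\<Sum>l<n. ?B $$ (i, l) * z l)"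
    proof -
      have "(?B *\<^sub>v vec n z) $ i = row ?B i \<bullet> vec n z" using i B by (intro index_mult_mat_vec) auto
      also have "\<dots> = (\<Sum>l<n. row ?B i $ l * vec n z $ l)" by (simp add: scalar_prod_def atLeast0LessThan)
      also have "\<dots> = (\<Sum>l<n. ?B $$ (i, l) * z l)"
        using i B by (intro sum.cong refl arg_cong2[where f="(*)"] index_row(1)) auto
      finally show ?thesis .
    qed
    also have "\<dots> = (\<Sum>l<n. \<Sum>k<n. A $$ (i, k) * cnj (A $$ (k, l) * cnj (z l)))"
      using i Ac by (intro sum.cong refl)
        (auto simp: index_mult_mat_sum[of _ n n _ n] mat_adjoint_index[of _ n n] sum_distrib_right
          symmetric_mat_index[OF A] mult.assoc simp del: index_mult_mat intro!: sum.cong)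
    also have "\<dots> = (\<Sum>k<n. A $$ (i, k) * cnj (\<Sum>l<n. A $$ (k, l) * cnj (z l)))"
      by (subst sum.swap) (simp add: sum_distrib_left)
    also have "\<dots> = (\<Sum>k<n. cnj \<kappa> * (A $$ (i, k) * cnj (z k)))"
      by (intro sum.cong refl) (subst Az, auto simp: ac_simps)
    also have "\<dots> = complex_of_real ((cmod \<kappa>)\<^sup>2) * z i"
      unfolding sum_distrib_left[symmetric] Az[OF i] complex_norm_square by simp
    finally show "(?B *\<^sub>v vec n z) $ i = (complex_of_real ((cmod \<kappa>)\<^sup>2) \<cdot>\<^sub>v vec n z) $ i" using i by simp
  qed (use B in auto)
  moreover have "vec n z \<noteq> 0\<^sub>v n" using z by (metis index_vec index_zero_vec(1))
  ultimately have "eigenvalue ?B (complex_of_real ((cmod \<kappa>)\<^sup>2))"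
    unfolding eigenvalue_def eigenvector_def using B by (intro exI[of _ "vec n z"]) auto
  then show ?thesis using eigenvalue_root_char_poly[OF B] by (simp add: sing_poly_def)
qed

lemma unitary_mat_conj_action:
  assumes U: "unitary_mat n U" and k: "k < n"
  shows "(\<Sum>j<n. U $$ (j, k) * cnj (\<Sum>l<n. U $$ (j, l) * y l)) = cnj (y k)"
proof -
  have "(\<Sum>j<n. U $$ (j, k) * cnj (\<Sum>l<n. U $$ (j, l) * y l))
    = (\<Sum>j<n. \<Sum>l<n. cnj (y l) * (cnj (U $$ (j, l)) * U $$ (j, k)))"
    by (simp add: sum_distrib_left ac_simps)
  also have "\<dots> = (\<Sum>l<n. cnj (y l) * (\<Sum>j<n. cnj (U $$ (j, l)) * U $$ (j, k)))"
    unfolding sum_distrib_left by (rule sum.swap)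
  also have "\<dots> = (\<Sum>l<n. cnj (y l) * (if l = k then 1 else 0))"
    using k by (intro sum.cong refl) (simp add: unitary_mat_columns[OF U])
  also have "\<dots> = cnj (y k)" using k by (simp add: if_distrib cong: if_cong)
  finally show ?thesis .
qed

lemma unitary_mat_inner:
  assumes U: "unitary_mat n U"
  shows "(\<Sum>i<n. (\<Sum>k<n. U $$ (i, k) * v k) * cnj (\<Sum>l<n. U $$ (i, l) * y l)) = (\<Sum>k<n. v k * cnj (y k))"
proof -
  have "(\<Sum>i<n. (\<Sum>k<n. U $$ (i, k) * v k) * cnj (\<Sum>l<n. U $$ (i, l) * y l))
    = (\<Sum>i<n. \<Sum>k<n. v k * (U $$ (i, k) * cnj (\<Sum>l<n. U $$ (i, l) * y l)))"
    unfolding sum_distrib_right by (intro sum.cong refl) (simp only: ac_simps)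
  also have "\<dots> = (\<Sum>k<n. v k * (\<Sum>i<n. U $$ (i, k) * cnj (\<Sum>l<n. U $$ (i, l) * y l)))"
    unfolding sum_distrib_left by (rule sum.swap)
  also have "\<dots> = (\<Sum>k<n. v k * cnj (y k))"
    by (intro sum.cong refl) (simp only: unitary_mat_conj_action[OF U] lessThan_iff)
  finally show ?thesis .
qed

subsection \<open>Matrices with a prescribed coneigenvector\<close>

text \<open>The last column forced by the first n rows of the coneigenvector equation for (y,
  1).\<close>

definition con_image :: "nat \<Rightarrow> complex mat \<Rightarrow> complex \<Rightarrow> (nat \<Rightarrow> complex) \<Rightarrow> nat \<Rightarrow> complex" where
  "con_image n K \<kappa> y i = \<kappa> * y i - (\<Sum>j<n. K $$ (i, j) * cnj (y j))"

text \<open>The symmetric matrix with upper left block \<open>K\<close> that maps the conjugate of \<open>(y, 1)\<close> to \<open>\<kappa> (y, 1)\<close>.\<close>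
definition con_mat :: "nat \<Rightarrow> complex mat \<Rightarrow> complex \<Rightarrow> (nat \<Rightarrow> complex) \<Rightarrow> complex mat" where
  "con_mat n K \<kappa> y = border n K (con_image n K \<kappa> y) (\<kappa> - (\<Sum>i<n. con_image n K \<kappa> y i * cnj (y i)))"

text \<open>At x = |\<kappa>|^2, the modulus of this leading minor times 1 + |y|^2 is the Jacobian
  of the passage from (y, \<kappa>) to the last column; it enters through
  \<open>con_weight\<close>.\<close>

definition corner_minor :: "nat \<Rightarrow> complex mat \<Rightarrow> real \<Rightarrow> complex" where
  "corner_minor n H x = det (mat n n (\<lambda>(i, j). (if i = j then complex_of_real x else 0) - (H * mat_adjoint H) $$ (i, j)))"

text \<open>The embedded unitary carries (y, 1) to (U y, 1), so the conditions that define the two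
  matrices correspond. This equivariance later permits a diagonal block.\<close>

lemma con_mat_congruence:
  assumes U: "unitary_mat n U" and K: "K \<in> carrier_mat n n"
  shows "con_mat n (U * K * transpose_mat U) \<kappa> (\<lambda>i. \<Sum>k<n. U $$ (i, k) * y k)
    = border n U (\<lambda>_. 0) 1 * con_mat n K \<kappa> y * transpose_mat (border n U (\<lambda>_. 0) 1)"
proof -
  note Uc = unitary_matD(1)[OF U]
  have v: "con_image n (U * K * transpose_mat U) \<kappa> (\<lambda>i. \<Sum>k<n. U $$ (i, k) * y k) i
      = (\<Sum>k<n. U $$ (i, k) * con_image n K \<kappa> y k)" if i: "i < n" for i
  proof -
    have "(\<Sum>j<n. (U * K * transpose_mat U) $$ (i, j) * cnj (\<Sum>k<n. U $$ (j, k) * y k))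
      = (\<Sum>j<n. \<Sum>k<n. (\<Sum>l<n. U $$ (i, l) * K $$ (l, k)) * (U $$ (j, k) * cnj (\<Sum>k<n. U $$ (j, k) * y k)))"
      using i Uc K by (intro sum.cong refl)
        (simp only: index_congruence_sum[of _ n n] lessThan_iff sum_distrib_right mult.assoc)
    also have "\<dots> = (\<Sum>k<n. (\<Sum>l<n. U $$ (i, l) * K $$ (l, k)) * (\<Sum>j<n. U $$ (j, k) * cnj (\<Sum>k<n. U $$ (j, k) * y k)))"
      unfolding sum_distrib_left by (rule sum.swap)
    also have "\<dots> = (\<Sum>k<n. (\<Sum>l<n. U $$ (i, l) * K $$ (l, k)) * cnj (y k))"
      by (intro sum.cong refl) (simp only: unitary_mat_conj_action[OF U] lessThan_iff)
    also have "\<dots> = (\<Sum>l<n. U $$ (i, l) * (\<Sum>k<n. K $$ (l, k) * cnj (y k)))"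
      unfolding sum_distrib_left sum_distrib_right by (subst sum.swap) (simp only: mult.assoc)
    finally show ?thesis
      by (simp add: con_image_def right_diff_distrib sum_subtractf sum_distrib_left mult.left_commute)
  qed
  have "(\<Sum>i<n. con_image n (U * K * transpose_mat U) \<kappa> (\<lambda>i. \<Sum>k<n. U $$ (i, k) * y k) i * cnj (\<Sum>k<n. U $$ (i, k) * y k))
    = (\<Sum>i<n. con_image n K \<kappa> y i * cnj (y i))"
    unfolding unitary_mat_inner[OF U, of "con_image n K \<kappa> y" y, symmetric]
    by (intro sum.cong refl arg_cong2[where f="(*)"]) (simp only: v lessThan_iff)
  then show ?thesis
    unfolding con_mat_def border_congruence[OF Uc K]
    by (intro eq_mat_SucI[of _ n]) (simp_all add: border_index v del: index_mult_mat assoc_mult_mat)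
qed

text \<open>The embedded unitary acts on the leading block by conjugation with U, so the determinant
  changes only by the unimodular factors \<open>det U\<close> and its conjugate.\<close>

lemma corner_minor_congruence:
  assumes U: "unitary_mat n U" and H: "H \<in> carrier_mat (Suc n) (Suc n)"
  shows "cmod (corner_minor n (border n U (\<lambda>_. 0) 1 * H * transpose_mat (border n U (\<lambda>_. 0) 1)) x)
    = cmod (corner_minor n H x)"
proof -
  note Uc = unitary_matD(1)[OF U]
  let ?E = "border n U (\<lambda>_. 0) 1"
  define X where "X = H * mat_adjoint H"
  have X: "X \<in> carrier_mat (Suc n) (Suc n)" unfolding X_def using H by (intro mult_carrier_mat[of _ _ "Suc n"]) auto
  define Y where "Y = mat n n (\<lambda>(i, j). (if i = j then complex_of_real x else 0) - X $$ (i, j))"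
  have Y: "Y \<in> carrier_mat n n" by (simp add: Y_def)
  have "mat n n (\<lambda>(i, j). (if i = j then complex_of_real x else 0) - (?E * X * mat_adjoint ?E) $$ (i, j))
    = U * Y * mat_adjoint U"
  proof (rule eq_matI)
    fix i j assume "i < dim_row (U * Y * mat_adjoint U)" "j < dim_col (U * Y * mat_adjoint U)"
    then have ij: "i < n" "j < n" using Uc by auto
    have "(?E * X * mat_adjoint ?E) $$ (i, j) = (\<Sum>k<Suc n. (\<Sum>l<Suc n. ?E $$ (i, l) * X $$ (l, k)) * cnj (?E $$ (j, k)))"
      using ij X by (intro index_adj_congruence_sum[of _ "Suc n"]) auto
    also have "\<dots> = (\<Sum>k<n. (\<Sum>l<n. U $$ (i, l) * X $$ (l, k)) * cnj (U $$ (j, k)))"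
      using ij by (simp add: border_index)
    finally have 1: "(?E * X * mat_adjoint ?E) $$ (i, j) = \<dots>" .
    have "(U * Y * mat_adjoint U) $$ (i, j) = (\<Sum>k<n. (\<Sum>l<n. U $$ (i, l) * Y $$ (l, k)) * cnj (U $$ (j, k)))"
      using ij Uc Y by (intro index_adj_congruence_sum) auto
    also have "\<dots> = (\<Sum>k<n. U $$ (i, k) * complex_of_real x * cnj (U $$ (j, k)) - (\<Sum>l<n. U $$ (i, l) * X $$ (l, k)) * cnj (U $$ (j, k)))"
    proof (intro sum.cong refl)
      fix k assume k: "k \<in> {..<n}"
      have "(\<Sum>l<n. U $$ (i, l) * Y $$ (l, k)) = (\<Sum>l<n. (if l = k then U $$ (i, l) * complex_of_real x else 0) - U $$ (i, l) * X $$ (l, k))"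
        using k by (intro sum.cong refl) (auto simp: Y_def algebra_simps)
      also have "\<dots> = U $$ (i, k) * complex_of_real x - (\<Sum>l<n. U $$ (i, l) * X $$ (l, k))"
        using k by (simp add: sum_subtractf)
      finally show "(\<Sum>l<n. U $$ (i, l) * Y $$ (l, k)) * cnj (U $$ (j, k))
          = U $$ (i, k) * complex_of_real x * cnj (U $$ (j, k)) - (\<Sum>l<n. U $$ (i, l) * X $$ (l, k)) * cnj (U $$ (j, k))"
        by (simp only: left_diff_distrib)
    qed
    also have "\<dots> = complex_of_real x * (\<Sum>k<n. U $$ (i, k) * cnj (U $$ (j, k))) - (\<Sum>k<n. (\<Sum>l<n. U $$ (i, l) * X $$ (l, k)) * cnj (U $$ (j, k)))"
      by (simp add: sum_subtractf sum_distrib_left ac_simps)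
    finally show "mat n n (\<lambda>(i, j). (if i = j then complex_of_real x else 0) - (?E * X * mat_adjoint ?E) $$ (i, j)) $$ (i, j)
        = (U * Y * mat_adjoint U) $$ (i, j)"
      using ij by (simp add: 1 unitary_mat_rows[OF U] del: index_mult_mat assoc_mult_mat)
  qed (use Uc in auto)
  then have "corner_minor n (?E * H * transpose_mat ?E) x = det (U * Y * mat_adjoint U)"
    unfolding corner_minor_def congruence_mult_adjoint[OF unitary_border[OF U] H] X_def by simp
  also have "\<dots> = det U * det Y * cnj (det U)"
    using Uc Y by (simp add: det_mult[of _ n] mult_carrier_mat[of _ n n] det_mat_adjoint del: assoc_mult_mat)
  finally show ?thesis
    using cmod_det_unitary[OF U] by (simp add: norm_mult corner_minor_def Y_def X_def)
qed

text \<open>The matrix with blocks D, u, v, 1 is reduced in two ways. Clearing v with the corner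
  leaves D minus the rank one matrix; clearing u with D leaves the Schur complement in the
  corner.\<close>

lemma det_diag_minus_rank_one:
  fixes d :: "nat \<Rightarrow> 'a::field"
  assumes d: "\<And>i. i < n \<Longrightarrow> d i \<noteq> 0"
  shows "det (mat n n (\<lambda>(i, j). (if i = j then d i else 0) - u i * v j))
    = (\<Prod>i<n. d i) * (1 - (\<Sum>i<n. u i * v i / d i))"
proof -
  define X where "X = mat n n (\<lambda>(i, j). (if i = j then d i else 0) - u i * v j)"
  define c where "c = 1 - (\<Sum>i<n. u i * v i / d i)"
  let ?D = "mat_diag n d" and ?u = "mat n 1 (\<lambda>(i, j). u i)" and ?v = "mat 1 n (\<lambda>(i, j). v j)"
  let ?M = "four_block_mat ?D ?u ?v (1\<^sub>m 1)"
  let ?N = "four_block_mat (1\<^sub>m n) (0\<^sub>m n 1) (- ?v) (1\<^sub>m 1)"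
  let ?L = "four_block_mat (1\<^sub>m n) (mat n 1 (\<lambda>(i, j). - u i / d i)) (0\<^sub>m 1 n) (1\<^sub>m 1)"
  have M: "?M \<in> carrier_mat (n + 1) (n + 1)" and N: "?N \<in> carrier_mat (n + 1) (n + 1)" and L: "?L \<in> carrier_mat (n + 1) (n + 1)"
    by (intro four_block_carrier_mat; simp)+
  have "?M * ?N = four_block_mat X ?u (0\<^sub>m 1 n) (1\<^sub>m 1)"
  proof (subst mult_four_block_mat[of _ n n _ 1 _ 1])
    have 1: "?D * 1\<^sub>m n + ?u * - ?v = X"
      by (rule eq_matI) (auto simp: X_def mat_diag_def scalar_prod_def right_mult_one_mat[of _ n n])
    have 2: "?D * 0\<^sub>m n 1 + ?u * 1\<^sub>m 1 = ?u"
      by (simp add: right_mult_zero_mat[of _ n n] right_mult_one_mat[of _ n 1] left_add_zero_mat[of _ n 1])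
    have 3: "?v * 1\<^sub>m n + 1\<^sub>m 1 * - ?v = 0\<^sub>m 1 n"
      by (rule eq_matI) (auto simp: right_mult_one_mat[of _ 1 n] left_mult_one_mat[of _ 1 n])
    have 4: "?v * 0\<^sub>m n 1 + 1\<^sub>m 1 * 1\<^sub>m 1 = (1\<^sub>m 1 :: 'a mat)"
      by (simp add: right_mult_zero_mat[of _ 1 n])
    show "four_block_mat (?D * 1\<^sub>m n + ?u * - ?v) (?D * 0\<^sub>m n 1 + ?u * 1\<^sub>m 1) (?v * 1\<^sub>m n + 1\<^sub>m 1 * - ?v)
       (?v * 0\<^sub>m n 1 + 1\<^sub>m 1 * 1\<^sub>m 1) = four_block_mat X ?u (0\<^sub>m 1 n) (1\<^sub>m 1)"
      unfolding 1 2 3 4 ..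
  qed auto
  then have "det ?M * det ?N = det X"
    using det_mult[OF M N] det_four_block_mat_lower_left_zero[of X n ?u 1 "0\<^sub>m 1 n" "1\<^sub>m 1"] by (simp add: X_def)
  moreover have "det ?N = 1"
    by (subst det_four_block_mat_upper_right_zero[of _ n _ 1]) auto
  ultimately have 1: "det ?M = det X" by simp
  have "?M * ?L = four_block_mat ?D (0\<^sub>m n 1) ?v (mat 1 1 (\<lambda>_. c))"
  proof (subst mult_four_block_mat[of _ n n _ 1 _ 1])
    have 1: "?D * 1\<^sub>m n + ?u * 0\<^sub>m 1 n = ?D"
      by (simp add: right_mult_one_mat[of _ n n] right_mult_zero_mat[of _ n 1])
    have 2: "?D * mat n 1 (\<lambda>(i, j). - u i / d i) + ?u * 1\<^sub>m 1 = 0\<^sub>m n 1"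
      using d by (intro eq_matI) (auto simp: mat_diag_mult_left[of _ n 1] right_mult_one_mat[of _ n 1])
    have 3: "?v * 1\<^sub>m n + 1\<^sub>m 1 * 0\<^sub>m 1 n = ?v"
      by (simp add: right_mult_one_mat[of _ 1 n])
    have 4: "?v * mat n 1 (\<lambda>(i, j). - u i / d i) + 1\<^sub>m 1 * 1\<^sub>m 1 = mat 1 1 (\<lambda>_. c)"
      by (rule eq_matI) (auto simp: c_def scalar_prod_def atLeast0LessThan sum_negf ac_simps)
    show "four_block_mat (?D * 1\<^sub>m n + ?u * 0\<^sub>m 1 n) (?D * mat n 1 (\<lambda>(i, j). - u i / d i) + ?u * 1\<^sub>m 1)
      (?v * 1\<^sub>m n + 1\<^sub>m 1 * 0\<^sub>m 1 n) (?v * mat n 1 (\<lambda>(i, j). - u i / d i) + 1\<^sub>m 1 * 1\<^sub>m 1)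
      = four_block_mat ?D (0\<^sub>m n 1) ?v (mat 1 1 (\<lambda>_. c))"
      unfolding 1 2 3 4 ..
  qed auto
  moreover have "det ?L = 1"
    by (subst det_four_block_mat_lower_left_zero[of _ n _ 1]) auto
  moreover have "det ?D = (\<Prod>i<n. d i)"
    by (subst det_upper_triangular[of _ n])
       (auto simp: mat_diag_def upper_triangular_def diag_mat_def prod_list_map_upt[symmetric] intro!: arg_cong[where f=prod_list])
  moreover have "det (mat 1 1 (\<lambda>_. c)) = c" by (simp add: det_single)
  ultimately have "det ?M = (\<Prod>i<n. d i) * c"
    using det_mult[OF M L] det_four_block_mat_upper_right_zero[of ?D n "0\<^sub>m n 1" 1 ?v "mat 1 1 (\<lambda>_. c)"] by simp
  with 1 show ?thesis by (simp add: X_def c_def)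
qed

text \<open>Let W be unitary with last column (y, 1) / sqrt N and leading block Q. Undoing the
  congruence by W splits the matrix into a block H and the entry \<kappa>, and reading off the upper
  left block expresses K affinely through H: it is Q H times the transpose of Q, plus \<kappa> / N
  times y y^T. Choosing Q as a unitary V times a diagonal matrix with first entry 1 / sqrt N makes
  |det Q|^2 = 1 / N evident. At x = |\<kappa>|^2 the corner drops out of x minus the product with
  the adjoint, so the leading minor is |det Q|^2 times the characteristic polynomial for H. This is
  where the differences of squared singular values come from.\<close>

lemma con_mat_reduction:
  fixes \<kappa> :: complex and y :: "nat \<Rightarrow> complex" and n :: nat
  defines "N \<equiv> 1 + (\<Sum>i<n. (cmod (y i))\<^sup>2)"
  shows "\<exists>V W. unitary_mat n V \<and> unitary_mat (Suc n) W \<and>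
    (\<forall>H. symmetric_mat n H \<longrightarrow>
      (let Q = V * mat_diag n (\<lambda>i. if i = 0 then complex_of_real (1 / sqrt N) else 1);
           K = mat n n (\<lambda>(i, j). (Q * H * transpose_mat Q) $$ (i, j) + \<kappa> / complex_of_real N * y i * y j)
       in con_mat n K \<kappa> y = W * border n H (\<lambda>_. 0) \<kappa> * transpose_mat W \<and>
          N * cmod (corner_minor n (con_mat n K \<kappa> y) ((cmod \<kappa>)\<^sup>2)) = cmod (poly (sing_poly H) (complex_of_real ((cmod \<kappa>)\<^sup>2)))))"
proof -
  define r where "r = sqrt (\<Sum>i<n. (cmod (y i))\<^sup>2)"
  have r2: "r\<^sup>2 = (\<Sum>i<n. (cmod (y i))\<^sup>2)" unfolding r_def by (intro real_sqrt_pow2 sum_nonneg) auto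
  have Npos: "N > 0" unfolding N_def by (intro add_pos_nonneg sum_nonneg) auto
  define d where "d = 1 / sqrt N"
  have d: "d\<^sup>2 = 1 / N" "d > 0" using Npos by (auto simp: d_def power_divide)
  have dN: "d\<^sup>2 * (1 + r\<^sup>2) = 1" using Npos by (simp add: d r2 N_def[symmetric])
  define s where "s = complex_of_real (\<Sum>i<n. (cmod (y i))\<^sup>2)"
  have s_sum: "s = (\<Sum>i<n. y i * cnj (y i))" unfolding s_def by (simp only: of_real_sum complex_norm_square)
  define \<tau> where "\<tau> = \<kappa> / complex_of_real N"
  have N_s: "complex_of_real N = 1 + s" by (simp add: N_def s_def)
  have Nnz: "complex_of_real N \<noteq> 0" using Npos by (simp only: of_real_eq_0_iff)
  have \<tau>\<kappa>: "\<kappa> = \<tau> * (1 + s)" using Nnz by (simp add: \<tau>_def N_s[symmetric])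
  have \<tau>d: "complex_of_real d * \<kappa> * complex_of_real d = \<tau>"
  proof -
    have "complex_of_real d * complex_of_real d = complex_of_real (1 / N)"
      unfolding d(1)[symmetric] by (simp add: power2_eq_square)
    then show ?thesis unfolding \<tau>_def by (simp add: mult.assoc mult.left_commute[of _ \<kappa>] mult.commute[of _ \<kappa>])
  qed
  have \<tau>d': "complex_of_real d * (\<kappa> * complex_of_real d) = \<tau>"
    using \<tau>d by (simp only: mult.assoc)
  \<comment> \<open>The first column of V is the direction of y. For y = 0, which includes n = 0,
    any unitary serves because the relation then holds with r = 0.\<close>
  obtain V where V: "unitary_mat n V" and Vy: "\<And>i. i < n \<Longrightarrow> y i = complex_of_real r * V $$ (i, 0)"
  proof (cases "r = 0")
    case True
    then have "(\<Sum>i<n. (cmod (y i))\<^sup>2) = 0" using r2 by simp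
    then have "\<forall>i<n. y i = 0" by (subst (asm) sum_nonneg_eq_0_iff) auto
    then show ?thesis using that[OF unitary_mat_one] True by simp
  next
    case False
    then have n: "0 < n" using r2 by (intro gr0I) simp
    have "(\<Sum>i<n. (cmod (y i / complex_of_real r))\<^sup>2) = 1"
      using False by (simp add: norm_divide power_divide sum_divide_distrib[symmetric] r2[symmetric])
    from exists_unitary_with_column[OF n this] show ?thesis using that False by fastforce
  qed
  note Vc = unitary_matD(1)[OF V]
  let ?\<delta> = "\<lambda>i::nat. if i = 0 then complex_of_real d else 1"
  \<comment> \<open>Shrinking the column in the direction of y to length d leaves exactly the
    squared norm d^2 r^2 that the last row of W supplies, since d^2 (1 + r^2) = 1.\<close>
  define Q where "Q = V * mat_diag n ?\<delta>"
  have Qc: "Q \<in> carrier_mat n n" unfolding Q_def using Vc by (intro mult_carrier_mat[of _ n n]) auto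
  have Qij: "Q $$ (i, j) = V $$ (i, j) * ?\<delta> j" if "i < n" "j < n" for i j
    unfolding Q_def using that Vc by (subst mat_diag_mult_right[of _ n n]) auto
  define g where "g j = (\<Sum>p<n. cnj (y p) * Q $$ (p, j))" for j
  have g: "g j = (if j = 0 then complex_of_real (r * d) else 0)" if j: "j < n" for j
  proof -
    have "g j = (\<Sum>p<n. complex_of_real r * ?\<delta> j * (cnj (V $$ (p, 0)) * V $$ (p, j)))"
      unfolding g_def using j by (intro sum.cong refl) (simp add: Vy Qij)
    also have "\<dots> = complex_of_real r * ?\<delta> j * (if 0 = j then 1 else 0)"
      unfolding sum_distrib_left[symmetric] using j by (subst unitary_mat_columns[OF V]) auto
    finally show ?thesis by simp
  qed
  have QQ: "(\<Sum>i<n. cnj (Q $$ (i, j)) * Q $$ (i, k)) + cnj (g j) * g k = (if j = k then 1 else 0)"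
    if jk: "j < n" "k < n" for j k
  proof -
    have "(\<Sum>i<n. cnj (Q $$ (i, j)) * Q $$ (i, k)) = (\<Sum>i<n. ?\<delta> j * ?\<delta> k * (cnj (V $$ (i, j)) * V $$ (i, k)))"
      using jk by (intro sum.cong refl) (simp add: Qij)
    also have "\<dots> = ?\<delta> j * ?\<delta> k * (if j = k then 1 else 0)"
      unfolding sum_distrib_left[symmetric] using jk by (subst unitary_mat_columns[OF V]) auto
    finally have 1: "(\<Sum>i<n. cnj (Q $$ (i, j)) * Q $$ (i, k)) = ?\<delta> j * ?\<delta> k * (if j = k then 1 else 0)" .
    have "complex_of_real d * complex_of_real d + complex_of_real (r * d) * complex_of_real (r * d) = complex_of_real (d\<^sup>2 * (1 + r\<^sup>2))"
      by (simp add: power2_eq_square algebra_simps)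
    then have "complex_of_real d * complex_of_real d + complex_of_real (r * d) * complex_of_real (r * d) = 1"
      unfolding dN by simp
    then show ?thesis unfolding 1 g[OF jk(1)] g[OF jk(2)] by auto
  qed
  \<comment> \<open>The last column is the normalized vector (y, 1); the entries - g j of the last
    row make the other columns orthogonal to it.\<close>
  define W where "W = mat (Suc n) (Suc n) (\<lambda>(i, j). if j < n then (if i < n then Q $$ (i, j) else - g j)
      else (if i < n then y i * complex_of_real d else complex_of_real d))"
  have Wc: "W \<in> carrier_mat (Suc n) (Suc n)" by (simp add: W_def)
  have Wi: "i < n \<Longrightarrow> j < n \<Longrightarrow> W $$ (i, j) = Q $$ (i, j)" "j < n \<Longrightarrow> W $$ (n, j) = - g j"
    "i < n \<Longrightarrow> W $$ (i, n) = y i * complex_of_real d" "W $$ (n, n) = complex_of_real d" for i j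
    by (simp_all add: W_def)
  have cg: "(\<Sum>i<n. cnj (Q $$ (i, j)) * y i) = cnj (g j)" for j
    by (simp add: g_def mult.commute)
  have W: "unitary_mat (Suc n) W"
  proof (rule unitary_matI_columns[OF Wc])
    fix j k assume "j < Suc n" "k < Suc n"
    then consider "j < n" "k < n" | "j < n" "k = n" | "j = n" "k < n" | "j = n" "k = n" by linarith
    then show "(\<Sum>i<Suc n. cnj (W $$ (i, j)) * W $$ (i, k)) = (if j = k then 1 else 0)"
    proof cases
      case 1 then show ?thesis using QQ[of j k] by (simp add: Wi)
    next
      case 2
      have "(\<Sum>i<n. cnj (Q $$ (i, j)) * (y i * complex_of_real d)) = (\<Sum>i<n. cnj (Q $$ (i, j)) * y i) * complex_of_real d"
        by (simp add: sum_distrib_right mult.assoc)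
      then show ?thesis using 2 by (simp add: Wi cg)
    next
      case 3
      have "(\<Sum>i<n. cnj (y i) * complex_of_real d * Q $$ (i, k)) = g k * complex_of_real d"
        by (simp add: g_def sum_distrib_right sum_distrib_left ac_simps)
      then show ?thesis using 3 by (simp add: Wi)
    next
      case 4
      have "(\<Sum>i<n. cnj (y i) * complex_of_real d * (y i * complex_of_real d)) = s * complex_of_real (d\<^sup>2)"
        by (simp add: s_sum sum_distrib_right sum_distrib_left power2_eq_square ac_simps)
      moreover have "s * complex_of_real (d\<^sup>2) + complex_of_real (d\<^sup>2) = complex_of_real (d\<^sup>2 * (1 + r\<^sup>2))"
        by (simp add: s_def r2 algebra_simps)
      ultimately show ?thesis using 4 by (simp add: Wi dN) (simp add: power2_eq_square)
    qed
  qed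
  have main: "con_mat n K \<kappa> y = W * border n H (\<lambda>_. 0) \<kappa> * transpose_mat W \<and>
      N * cmod (corner_minor n (con_mat n K \<kappa> y) ((cmod \<kappa>)\<^sup>2)) = cmod (poly (sing_poly H) (complex_of_real ((cmod \<kappa>)\<^sup>2)))"
    if H: "symmetric_mat n H" and K_def: "K = mat n n (\<lambda>(i, j). (Q * H * transpose_mat Q) $$ (i, j) + \<tau> * y i * y j)" for H K
  proof
    have Hc: "H \<in> carrier_mat n n" using H by (simp add: symmetric_mat_def)
    define M where "M = Q * H * transpose_mat Q"
    have Ms: "symmetric_mat n M" unfolding M_def by (rule symmetric_congruence[OF H Qc])
    have Mij: "M $$ (i, j) = (\<Sum>k<n. (\<Sum>l<n. Q $$ (i, l) * H $$ (l, k)) * Q $$ (j, k))" if "i < n" "j < n" for i j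
      unfolding M_def using that Qc Hc by (intro index_congruence_sum) auto
    have Kij: "K $$ (i, j) = M $$ (i, j) + \<tau> * y i * y j" if "i < n" "j < n" for i j
      using that by (simp add: K_def M_def del: index_mult_mat assoc_mult_mat)
    define \<mu> where "\<mu> i = (\<Sum>j<n. M $$ (i, j) * cnj (y j))" for i
    have gM: "(\<Sum>k<n. (\<Sum>l<n. Q $$ (i, l) * H $$ (l, k)) * g k) = \<mu> i" if i: "i < n" for i
    proof -
      define a where "a k = (\<Sum>l<n. Q $$ (i, l) * H $$ (l, k))" for k
      have "(\<Sum>k<n. a k * g k) = (\<Sum>k<n. \<Sum>p<n. a k * (cnj (y p) * Q $$ (p, k)))"
        unfolding g_def sum_distrib_left ..
      also have "\<dots> = (\<Sum>p<n. \<Sum>k<n. a k * (cnj (y p) * Q $$ (p, k)))" by (rule sum.swap)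
      also have "\<dots> = (\<Sum>p<n. (\<Sum>k<n. a k * Q $$ (p, k)) * cnj (y p))"
        unfolding sum_distrib_right by (intro sum.cong refl) (simp only: ac_simps)
      also have "\<dots> = \<mu> i"
        unfolding \<mu>_def a_def by (intro sum.cong refl arg_cong2[where f="(*)"]) (simp only: Mij[OF i] lessThan_iff)
      finally show ?thesis by (simp only: a_def)
    qed
    have ci: "con_image n K \<kappa> y i = \<tau> * y i - \<mu> i" if i: "i < n" for i
    proof -
      have "(\<Sum>j<n. K $$ (i, j) * cnj (y j)) = (\<Sum>j<n. M $$ (i, j) * cnj (y j) + \<tau> * y i * (y j * cnj (y j)))"
        using i by (intro sum.cong refl) (simp add: Kij algebra_simps)
      also have "\<dots> = \<mu> i + \<tau> * y i * s" by (simp add: sum.distrib \<mu>_def s_sum sum_distrib_left)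
      finally show ?thesis unfolding con_image_def \<tau>\<kappa> by (simp add: algebra_simps)
    qed
    have cc: "\<kappa> - (\<Sum>i<n. con_image n K \<kappa> y i * cnj (y i)) = \<tau> + (\<Sum>i<n. \<mu> i * cnj (y i))"
    proof -
      have "(\<Sum>i<n. con_image n K \<kappa> y i * cnj (y i)) = (\<Sum>i<n. \<tau> * (y i * cnj (y i)) - \<mu> i * cnj (y i))"
        by (intro sum.cong refl) (simp add: ci algebra_simps)
      also have "\<dots> = \<tau> * s - (\<Sum>i<n. \<mu> i * cnj (y i))" by (simp add: sum_subtractf s_sum sum_distrib_left)
      finally show ?thesis unfolding \<tau>\<kappa> by (simp add: algebra_simps)
    qed
    let ?B = "border n H (\<lambda>_. 0) \<kappa>"
    have Bs: "symmetric_mat (Suc n) ?B" by (rule symmetric_border[OF H])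
    have WB: "(W * ?B * transpose_mat W) $$ (i, j) = (\<Sum>k<n. (\<Sum>l<n. W $$ (i, l) * H $$ (l, k)) * W $$ (j, k)) + W $$ (i, n) * \<kappa> * W $$ (j, n)"
      if "i < Suc n" "j < Suc n" for i j
    proof -
      have "(W * ?B * transpose_mat W) $$ (i, j) = (\<Sum>k<Suc n. (\<Sum>l<Suc n. W $$ (i, l) * ?B $$ (l, k)) * W $$ (j, k))"
        using that Wc by (intro index_congruence_sum) auto
      then show ?thesis by (simp add: border_index)
    qed
    have in_eq: "(W * ?B * transpose_mat W) $$ (i, n) = con_mat n K \<kappa> y $$ (i, n)" if i: "i < n" for i
    proof -
      note gM[OF i]
      then have "(W * ?B * transpose_mat W) $$ (i, n) = - \<mu> i + y i * (complex_of_real d * \<kappa> * complex_of_real d)"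
        using i by (subst WB) (simp_all add: Wi sum_negf mult.assoc)
      then show ?thesis using i by (simp add: con_mat_def border_index ci \<tau>d \<tau>d' mult.commute[of "y i"])
    qed
    have "con_mat n K \<kappa> y = W * ?B * transpose_mat W"
    proof (rule eq_mat_SucI[of _ n])
      show "W * ?B * transpose_mat W \<in> carrier_mat (Suc n) (Suc n)" using symmetric_congruence[OF Bs Wc] by (simp add: symmetric_mat_def)
    next
      fix i j assume ij: "i < n" "j < n"
      have "W $$ (i, n) * \<kappa> * W $$ (j, n) = (complex_of_real d * \<kappa> * complex_of_real d) * y i * y j"
        using ij by (simp add: Wi ac_simps)
      then show "con_mat n K \<kappa> y $$ (i, j) = (W * ?B * transpose_mat W) $$ (i, j)"
        using ij by (subst WB) (simp_all add: con_mat_def border_index Kij Mij Wi(1) \<tau>d)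
    next
      fix i assume i: "i < n"
      show 1: "con_mat n K \<kappa> y $$ (i, n) = (W * ?B * transpose_mat W) $$ (i, n)" using in_eq[OF i] by simp
      show "con_mat n K \<kappa> y $$ (n, i) = (W * ?B * transpose_mat W) $$ (n, i)"
        using i 1 symmetric_mat_index[OF symmetric_congruence[OF Bs Wc], of n i] by (simp add: con_mat_def border_index)
    next
      have "(\<Sum>k<n. (\<Sum>l<n. W $$ (n, l) * H $$ (l, k)) * W $$ (n, k)) = (\<Sum>k<n. (\<Sum>l<n. g l * H $$ (l, k)) * g k)"
        by (simp add: Wi sum_negf)
      also have "\<dots> = (\<Sum>k<n. \<Sum>p<n. cnj (y p) * ((\<Sum>l<n. Q $$ (p, l) * H $$ (l, k)) * g k))"
      proof (intro sum.cong refl)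
        fix k
        have "(\<Sum>l<n. g l * H $$ (l, k)) = (\<Sum>l<n. \<Sum>p<n. cnj (y p) * (Q $$ (p, l) * H $$ (l, k)))"
          unfolding g_def sum_distrib_right mult.assoc ..
        also have "\<dots> = (\<Sum>p<n. cnj (y p) * (\<Sum>l<n. Q $$ (p, l) * H $$ (l, k)))"
          unfolding sum_distrib_left by (rule sum.swap)
        finally show "(\<Sum>l<n. g l * H $$ (l, k)) * g k = (\<Sum>p<n. cnj (y p) * ((\<Sum>l<n. Q $$ (p, l) * H $$ (l, k)) * g k))"
          by (simp only: sum_distrib_right[of _ _ "g k"] mult.assoc)
      qed
      also have "\<dots> = (\<Sum>p<n. cnj (y p) * (\<Sum>k<n. (\<Sum>l<n. Q $$ (p, l) * H $$ (l, k)) * g k))"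
        unfolding sum_distrib_left by (rule sum.swap)
      also have "\<dots> = (\<Sum>p<n. cnj (y p) * \<mu> p)"
        by (intro sum.cong refl arg_cong2[where f="(*)"]) (simp only: gM lessThan_iff)
      finally have "(W * ?B * transpose_mat W) $$ (n, n) = (\<Sum>p<n. cnj (y p) * \<mu> p) + \<tau>"
        by (subst WB) (simp_all add: Wi(4) \<tau>d)
      then show "con_mat n K \<kappa> y $$ (n, n) = (W * ?B * transpose_mat W) $$ (n, n)"
        by (simp add: con_mat_def border_index cc mult.commute[of "cnj (y _)" "\<mu> _"])
    qed (simp add: con_mat_def)
    then show CW: "con_mat n K \<kappa> y = W * ?B * transpose_mat W" .
    define x where "x = (cmod \<kappa>)\<^sup>2"
    define X where "X = H * mat_adjoint H"
    have Xc: "X \<in> carrier_mat n n" unfolding X_def using Hc by (intro mult_carrier_mat[of _ n n]) auto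
    have BB: "?B * mat_adjoint ?B = border n X (\<lambda>_. 0) (complex_of_real x)"
    proof (rule eq_mat_SucI[of _ n])
      have e: "(?B * mat_adjoint ?B) $$ (i, j) = (\<Sum>k<Suc n. ?B $$ (i, k) * cnj (?B $$ (j, k)))" if "i < Suc n" "j < Suc n" for i j
        using that by (subst index_mult_mat_sum[of _ "Suc n" "Suc n" _ "Suc n"]) (auto simp: mat_adjoint_index[of _ "Suc n" "Suc n"])
      have Xij: "X $$ (i, j) = (\<Sum>k<n. H $$ (i, k) * cnj (H $$ (j, k)))" if "i < n" "j < n" for i j
        unfolding X_def using that Hc by (subst index_mult_mat_sum[of _ n n _ n]) (auto simp: mat_adjoint_index[of _ n n])
      show "?B * mat_adjoint ?B \<in> carrier_mat (Suc n) (Suc n)" by (intro mult_carrier_mat[of _ _ "Suc n"]) auto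
      show "(?B * mat_adjoint ?B) $$ (i, j) = border n X (\<lambda>_. 0) (complex_of_real x) $$ (i, j)" if "i < n" "j < n" for i j
        using that by (simp add: e Xij border_index del: index_mult_mat)
      show "(?B * mat_adjoint ?B) $$ (i, n) = border n X (\<lambda>_. 0) (complex_of_real x) $$ (i, n)" if "i < n" for i
        using that by (simp add: e border_index del: index_mult_mat)
      show "(?B * mat_adjoint ?B) $$ (n, j) = border n X (\<lambda>_. 0) (complex_of_real x) $$ (n, j)" if "j < n" for j
        using that by (simp add: e border_index del: index_mult_mat)
      have "complex_of_real x = \<kappa> * cnj \<kappa>" unfolding x_def by (rule complex_norm_square)
      then show "(?B * mat_adjoint ?B) $$ (n, n) = border n X (\<lambda>_. 0) (complex_of_real x) $$ (n, n)"
        by (simp add: e border_index del: index_mult_mat)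
    qed simp
    define Y where "Y = mat n n (\<lambda>(i, j). (if i = j then complex_of_real x else 0) - X $$ (i, j))"
    have Yc: "Y \<in> carrier_mat n n" by (simp add: Y_def)
    \<comment> \<open>The last column of W contributes x on both sides of the subtraction, because
      the corner has squared modulus x and the rows of W are orthonormal. Only Q survives.\<close>
    have "mat n n (\<lambda>(i, j). (if i = j then complex_of_real x else 0) - (con_mat n K \<kappa> y * mat_adjoint (con_mat n K \<kappa> y)) $$ (i, j)) = Q * Y * mat_adjoint Q"
    proof (rule eq_matI)
      fix i j assume "i < dim_row (Q * Y * mat_adjoint Q)" "j < dim_col (Q * Y * mat_adjoint Q)"
      then have ij: "i < n" "j < n" using Qc by auto
      have "(con_mat n K \<kappa> y * mat_adjoint (con_mat n K \<kappa> y)) $$ (i, j) = (W * border n X (\<lambda>_. 0) (complex_of_real x) * mat_adjoint W) $$ (i, j)"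
        unfolding CW BB[symmetric] by (subst congruence_mult_adjoint[OF W]) auto
      also have "\<dots> = (\<Sum>k<Suc n. (\<Sum>l<Suc n. W $$ (i, l) * border n X (\<lambda>_. 0) (complex_of_real x) $$ (l, k)) * cnj (W $$ (j, k)))"
        using ij Wc by (intro index_adj_congruence_sum[of _ "Suc n"]) auto
      also have "\<dots> = (\<Sum>k<n. (\<Sum>l<n. Q $$ (i, l) * X $$ (l, k)) * cnj (Q $$ (j, k))) + complex_of_real x * (W $$ (i, n) * cnj (W $$ (j, n)))"
        using ij by (simp add: border_index Wi)
      finally have 1: "(con_mat n K \<kappa> y * mat_adjoint (con_mat n K \<kappa> y)) $$ (i, j) = \<dots>" .
      have "(\<Sum>k<Suc n. W $$ (i, k) * cnj (W $$ (j, k))) = (if i = j then 1 else 0)"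
        using ij by (intro unitary_mat_rows[OF W]) auto
      then have "(\<Sum>k<n. Q $$ (i, k) * cnj (Q $$ (j, k))) + W $$ (i, n) * cnj (W $$ (j, n)) = (if i = j then 1 else 0)"
        using ij by (simp add: Wi(1))
      then have 2: "complex_of_real x * (\<Sum>k<n. Q $$ (i, k) * cnj (Q $$ (j, k))) = (if i = j then complex_of_real x else 0) - complex_of_real x * (W $$ (i, n) * cnj (W $$ (j, n)))"
        by (simp add: eq_diff_eq distrib_left[symmetric])
      have "(Q * Y * mat_adjoint Q) $$ (i, j) = (\<Sum>k<n. (\<Sum>l<n. Q $$ (i, l) * Y $$ (l, k)) * cnj (Q $$ (j, k)))"
        using ij Qc Yc by (intro index_adj_congruence_sum) auto
      also have "\<dots> = (\<Sum>k<n. complex_of_real x * (Q $$ (i, k) * cnj (Q $$ (j, k))) - (\<Sum>l<n. Q $$ (i, l) * X $$ (l, k)) * cnj (Q $$ (j, k)))"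
      proof (intro sum.cong refl)
        fix k assume k: "k \<in> {..<n}"
        have "(\<Sum>l<n. Q $$ (i, l) * Y $$ (l, k)) = (\<Sum>l<n. (if l = k then Q $$ (i, l) * complex_of_real x else 0) - Q $$ (i, l) * X $$ (l, k))"
          using k by (intro sum.cong refl) (auto simp: Y_def algebra_simps)
        also have "\<dots> = Q $$ (i, k) * complex_of_real x - (\<Sum>l<n. Q $$ (i, l) * X $$ (l, k))"
          using k by (simp add: sum_subtractf)
        finally show "(\<Sum>l<n. Q $$ (i, l) * Y $$ (l, k)) * cnj (Q $$ (j, k))
            = complex_of_real x * (Q $$ (i, k) * cnj (Q $$ (j, k))) - (\<Sum>l<n. Q $$ (i, l) * X $$ (l, k)) * cnj (Q $$ (j, k))"
          by (simp add: left_diff_distrib)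
      qed
      also have "\<dots> = complex_of_real x * (\<Sum>k<n. Q $$ (i, k) * cnj (Q $$ (j, k))) - (\<Sum>k<n. (\<Sum>l<n. Q $$ (i, l) * X $$ (l, k)) * cnj (Q $$ (j, k)))"
        by (simp add: sum_subtractf sum_distrib_left)
      finally have 3: "(Q * Y * mat_adjoint Q) $$ (i, j) = \<dots>" .
      show "mat n n (\<lambda>(i, j). (if i = j then complex_of_real x else 0) - (con_mat n K \<kappa> y * mat_adjoint (con_mat n K \<kappa> y)) $$ (i, j)) $$ (i, j) = (Q * Y * mat_adjoint Q) $$ (i, j)"
        unfolding 3 2 using ij by (simp add: 1 del: index_mult_mat assoc_mult_mat)
    qed (use Qc in auto)
    then have "corner_minor n (con_mat n K \<kappa> y) x = det (Q * Y * mat_adjoint Q)"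
      unfolding corner_minor_def by simp
    also have "\<dots> = det Q * det Y * cnj (det Q)"
      using Qc Yc by (simp add: det_mult[of _ n] mult_carrier_mat[of _ n n] det_mat_adjoint del: assoc_mult_mat)
    finally have "cmod (corner_minor n (con_mat n K \<kappa> y) x) = (cmod (det Q))\<^sup>2 * cmod (det Y)"
      by (simp add: norm_mult power2_eq_square)
    moreover have "cmod (det Q) = d"
    proof -
      have "det (mat_diag n ?\<delta>) = (\<Prod>i<n. ?\<delta> i)"
        by (subst det_upper_triangular[of _ n])
           (auto simp: mat_diag_def upper_triangular_def diag_mat_def prod_list_map_upt[symmetric] intro!: arg_cong[where f=prod_list])
      also have "\<dots> = complex_of_real d"
      \<comment> \<open>For n = 0 the product is empty, and d = 1 as well because N = 1.\<close>
      proof (cases n)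
        case 0
        then show ?thesis by (simp add: d_def N_def)
      next
        case (Suc k)
        then show ?thesis by (simp only: prod.lessThan_Suc_shift) simp
      qed
      finally show ?thesis
        using Vc cmod_det_unitary[OF V] d(2) unfolding Q_def by (subst det_mult[of _ n]) (auto simp: norm_mult)
    qed
    moreover have "det Y = poly (sing_poly H) (complex_of_real x)"
    proof -
      have "Y = - char_matrix X (complex_of_real x)"
        using Xc by (intro eq_matI) (auto simp: Y_def char_matrix_def)
      then show ?thesis using char_poly_matrix[OF Xc] by (simp add: sing_poly_def X_def)
    qed
    ultimately show "N * cmod (corner_minor n (con_mat n K \<kappa> y) ((cmod \<kappa>)\<^sup>2)) = cmod (poly (sing_poly H) (complex_of_real ((cmod \<kappa>)\<^sup>2)))"
      using Npos by (simp add: x_def d(1))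
  qed
  show ?thesis
    using V W main unfolding Q_def d_def \<tau>_def Let_def by blast
qed

subsection \<open>Measurability of singular values\<close>

text \<open>Measurability is entrywise, with the size fixed on the whole space, since matrices of
  every size share one type.\<close>

definition mat_measurable :: "'z measure \<Rightarrow> nat \<Rightarrow> ('z \<Rightarrow> complex mat) \<Rightarrow> bool" where
  "mat_measurable N n X \<longleftrightarrow> (\<forall>z\<in>space N. X z \<in> carrier_mat n n) \<and>
     (\<forall>i<n. \<forall>j<n. (\<lambda>z. X z $$ (i, j)) \<in> borel_measurable N)"

lemma mat_measurableD:
  assumes "mat_measurable N n X"
  shows "z \<in> space N \<Longrightarrow> X z \<in> carrier_mat n n"
    and "i < n \<Longrightarrow> j < n \<Longrightarrow> (\<lambda>z. X z $$ (i, j)) \<in> borel_measurable N"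
  using assms by (auto simp: mat_measurable_def)

lemma mat_measurable_compose:
  assumes f: "f \<in> measurable N' N" and X: "mat_measurable N n X"
  shows "mat_measurable N' n (\<lambda>z. X (f z))"
  unfolding mat_measurable_def
  using measurable_space[OF f] mat_measurableD[OF X] measurable_compose[OF f mat_measurableD(2)[OF X]] by blast

lemma mat_measurable_mult:
  assumes X: "mat_measurable N n X" and Y: "mat_measurable N n Y"
  shows "mat_measurable N n (\<lambda>z. X z * Y z)"
  unfolding mat_measurable_def
proof (intro conjI ballI allI impI)
  fix z assume "z \<in> space N"
  then show "X z * Y z \<in> carrier_mat n n" using mat_measurableD(1)[OF X] mat_measurableD(1)[OF Y]
    by (intro mult_carrier_mat[of _ n n]) auto
next
  fix i j assume ij: "i < n" "j < n"
  have "(\<lambda>z. \<Sum>k<n. X z $$ (i, k) * Y z $$ (k, j)) \<in> borel_measurable N"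
    using ij by (intro borel_measurable_sum borel_measurable_times mat_measurableD(2)[OF X] mat_measurableD(2)[OF Y]) auto
  then show "(\<lambda>z. (X z * Y z) $$ (i, j)) \<in> borel_measurable N"
    using ij index_mult_mat_sum[OF mat_measurableD(1)[OF X] mat_measurableD(1)[OF Y]]
    by (subst measurable_cong) auto
qed

lemma mat_measurable_adjoint:
  assumes X: "mat_measurable N n X"
  shows "mat_measurable N n (\<lambda>z. mat_adjoint (X z))"
  unfolding mat_measurable_def
proof (intro conjI ballI allI impI)
  fix z assume "z \<in> space N"
  then show "mat_adjoint (X z) \<in> carrier_mat n n" using mat_measurableD(1)[OF X] by auto
next
  fix i j assume ij: "i < n" "j < n"
  have "(\<lambda>z. cnj (X z $$ (j, i))) \<in> borel_measurable N"
    using measurable_compose[OF mat_measurableD(2)[OF X ij(2,1)] borel_measurable_cnj] .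
  then show "(\<lambda>z. mat_adjoint (X z) $$ (i, j)) \<in> borel_measurable N"
    using ij mat_adjoint_index[OF mat_measurableD(1)[OF X]] by (subst measurable_cong) auto
qed

lemma permutes_bound: "p permutes {0..<n} \<Longrightarrow> i < n \<Longrightarrow> p i < (n::nat)"
  using permutes_in_image[of p "{0..<n}" i] by simp

lemma borel_measurable_det:
  assumes X: "mat_measurable N n X"
  shows "(\<lambda>z. det (X z)) \<in> borel_measurable N"
proof -
  have "(\<lambda>z. \<Sum>p\<in>{p. p permutes {0..<n}}. signof p * (\<Prod>i=0..<n. X z $$ (i, p i))) \<in> borel_measurable N"
    by (intro borel_measurable_sum borel_measurable_times borel_measurable_const borel_measurable_prod mat_measurableD(2)[OF X])
       (auto simp: permutes_bound)
  then show ?thesis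
    by (subst measurable_cong) (use mat_measurableD(1)[OF X] in \<open>auto simp: det_def'\<close>)
qed

definition poly_measurable :: "'z measure \<Rightarrow> ('z \<Rightarrow> complex poly) \<Rightarrow> bool" where
  "poly_measurable N P \<longleftrightarrow> (\<forall>k. (\<lambda>z. poly.coeff (P z) k) \<in> borel_measurable N)"

lemma poly_measurable_mult:
  "poly_measurable N P \<Longrightarrow> poly_measurable N Q \<Longrightarrow> poly_measurable N (\<lambda>z. P z * Q z)"
  unfolding poly_measurable_def coeff_mult by (intro allI borel_measurable_sum borel_measurable_times) auto

lemma poly_measurable_const: "poly_measurable N (\<lambda>z. p)"
  by (simp add: poly_measurable_def)

lemma poly_measurable_sum:
  "(\<And>i. i \<in> I \<Longrightarrow> poly_measurable N (P i)) \<Longrightarrow> poly_measurable N (\<lambda>z. \<Sum>i\<in>I. P i z)"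
  unfolding poly_measurable_def coeff_sum by (intro allI borel_measurable_sum) auto

lemma poly_measurable_prod:
  assumes "\<And>i. i \<in> I \<Longrightarrow> poly_measurable N (P i)"
  shows "poly_measurable N (\<lambda>z. \<Prod>i\<in>I. P i z)"
  using assms
  by (induction I rule: infinite_finite_induct) (auto simp: poly_measurable_const intro!: poly_measurable_mult)

text \<open>Leibniz's expansion writes each coefficient as a polynomial in the entries.\<close>

lemma poly_measurable_char_poly:
  assumes X: "mat_measurable N n X"
  shows "poly_measurable N (\<lambda>z. char_poly (X z))"
proof -
  define P where "P i j z = (if i = j then [:- X z $$ (i, j), 1:] else [:- X z $$ (i, j):])" for i j z
  have P: "poly_measurable N (P i j)" if "i < n" "j < n" for i j
    unfolding poly_measurable_def
  proof
    fix k
    have "(\<lambda>z. poly.coeff (P i j z) k) = (\<lambda>z. if k = 0 then - X z $$ (i, j) else if k = 1 \<and> i = j then 1 else 0)"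
      by (auto simp: P_def coeff_pCons fun_eq_iff split: nat.splits)
    then show "(\<lambda>z. poly.coeff (P i j z) k) \<in> borel_measurable N"
      using mat_measurableD(2)[OF X that] by simp
  qed
  have cp: "char_poly (X z) = (\<Sum>p\<in>{p. p permutes {0..<n}}. signof p * (\<Prod>i=0..<n. P i (p i) z))" if z: "z \<in> space N" for z
  proof -
    note c = mat_measurableD(1)[OF X z]
    have "char_poly (X z) = (\<Sum>p\<in>{p. p permutes {0..<n}}. signof p * (\<Prod>i=0..<n. char_poly_matrix (X z) $$ (i, p i)))"
      unfolding char_poly_def using c by (subst det_def'[of _ n]) auto
    also have "\<dots> = (\<Sum>p\<in>{p. p permutes {0..<n}}. signof p * (\<Prod>i=0..<n. P i (p i) z))"
      using c by (intro sum.cong refl arg_cong2[where f="(*)"] prod.cong)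
        (auto simp: char_poly_matrix_def P_def permutes_bound)
    finally show ?thesis .
  qed
  have *: "poly_measurable N (\<lambda>z. \<Sum>p\<in>{p. p permutes {0..<n}}. signof p * (\<Prod>i=0..<n. P i (p i) z))"
    by (intro poly_measurable_sum poly_measurable_mult poly_measurable_const poly_measurable_prod P) (auto simp: permutes_bound)
  show ?thesis
    unfolding poly_measurable_def
  proof
    fix k
    show "(\<lambda>z. poly.coeff (char_poly (X z)) k) \<in> borel_measurable N"
      using *[unfolded poly_measurable_def, rule_format, of k]
      by (subst measurable_cong) (use cp in auto)
  qed
qed

lemma degree_prod_linear: "degree (\<Prod>j<m. [:- a j, 1:] :: complex poly) = m"
  by (subst degree_prod_sum_eq) auto

text \<open>The roots can be selected measurably: the smallest one is measurable because its superlevel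
  sets are described by lower bounds at rational points, and the coefficients of the quotient by the
  corresponding linear factor are again measurable.\<close>
lemma measurable_nonneg_roots:
  fixes m :: nat
  assumes "poly_measurable N P"
    and "\<And>z. z \<in> space N \<Longrightarrow> \<exists>s. (\<forall>j<m. 0 \<le> s j) \<and> P z = (\<Prod>j<m. [:- complex_of_real (s j), 1:])"
  shows "\<exists>r. (\<forall>j<m. r j \<in> borel_measurable N) \<and>
    (\<forall>z\<in>space N. (\<forall>j<m. 0 \<le> r j z) \<and> P z = (\<Prod>j<m. [:- complex_of_real (r j z), 1:]))"
  using assms
proof (induction m arbitrary: P)
  case 0
  then show ?case by auto
next
  case (Suc m)
  note Pm = Suc.prems(1)
  have "\<exists>s. (\<forall>j<Suc m. 0 \<le> s j) \<and> P z = (\<Prod>j<Suc m. [:- complex_of_real (s j), 1:])" if "z \<in> space N" for z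
    using Suc.prems(2)[OF that] .
  then obtain s where s: "\<And>z j. z \<in> space N \<Longrightarrow> j < Suc m \<Longrightarrow> 0 \<le> s z j"
    and Ps: "\<And>z. z \<in> space N \<Longrightarrow> P z = (\<Prod>j<Suc m. [:- complex_of_real (s z j), 1:])" by metis
  define \<rho> where "\<rho> z = Min (s z ` {..<Suc m})" for z
  have \<rho>_in: "\<rho> z \<in> s z ` {..<Suc m}" for z unfolding \<rho>_def by (intro Min_in) auto
  have \<rho>_le: "\<rho> z \<le> s z j" if "j < Suc m" for z j unfolding \<rho>_def using that by (intro Min_le) auto
  have root_iff: "poly (P z) (complex_of_real t) = 0 \<longleftrightarrow> (\<exists>j<Suc m. t = s z j)" if "z \<in> space N" for z t
    unfolding Ps[OF that] poly_prod_linear by (subst prod_zero_iff) (auto simp del: prod.lessThan_Suc)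
  have gt_iff: "a < \<rho> z \<longleftrightarrow> (\<forall>t\<in>{0..a}. poly (P z) (complex_of_real t) \<noteq> 0)" if z: "z \<in> space N" and a: "0 \<le> a" for z a
  proof
    assume "a < \<rho> z"
    then show "\<forall>t\<in>{0..a}. poly (P z) (complex_of_real t) \<noteq> 0"
      unfolding root_iff[OF z] using \<rho>_le[of _ z] by fastforce
  next
    assume *: "\<forall>t\<in>{0..a}. poly (P z) (complex_of_real t) \<noteq> 0"
    obtain j where j: "j < Suc m" "\<rho> z = s z j" using \<rho>_in[of z] by auto
    then have "\<rho> z \<ge> 0" "poly (P z) (complex_of_real (\<rho> z)) = 0" using s[OF z] root_iff[OF z] by auto
    then show "a < \<rho> z" using * by (metis atLeastAtMost_iff not_le)
  qed
  have poly_sum: "poly (P z) x = (\<Sum>k\<le>Suc m. poly.coeff (P z) k * x ^ k)" if "z \<in> space N" for z x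
    using degree_prod_linear[where m="Suc m" and a="\<lambda>j. complex_of_real (s z j)"] Ps[OF that] by (simp add: poly_altdef)
  have pm: "(\<lambda>z. poly (P z) x) \<in> borel_measurable N" for x
  proof (subst measurable_cong[OF poly_sum])
    show "(\<lambda>z. \<Sum>k\<le>Suc m. poly.coeff (P z) k * x ^ k) \<in> borel_measurable N"
      using Pm unfolding poly_measurable_def by (intro borel_measurable_sum borel_measurable_times) auto
  qed auto
  \<comment> \<open>Compactness turns nonvanishing on the closed interval into a lower bound 1 / (n
    + 1) for the modulus. By continuity and density this bound need only hold at rational points of
    the open interval, which is a countable condition.\<close>
  have cont_iff: "(\<forall>t\<in>{0..a}. poly (P z) (complex_of_real t) \<noteq> 0) \<longleftrightarrow>
      (\<exists>n::nat. \<forall>t\<in>\<rat>. t \<in> {0<..<a} \<longrightarrow> inverse (real (Suc n)) \<le> cmod (poly (P z) (complex_of_real t)))" if a: "0 < a" for z a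
  proof
    let ?f = "\<lambda>t. cmod (poly (P z) (complex_of_real t))"
    have cf: "continuous_on A ?f" for A by (intro continuous_intros)
    assume nz: "\<forall>t\<in>{0..a}. poly (P z) (complex_of_real t) \<noteq> 0"
    obtain t0 where t0: "t0 \<in> {0..a}" "\<And>t. t \<in> {0..a} \<Longrightarrow> ?f t0 \<le> ?f t"
      using continuous_attains_inf[OF _ _ cf, of "{0..a}"] a by auto
    then have "?f t0 > 0" using nz by auto
    then obtain n where "inverse (real (Suc n)) < ?f t0" using reals_Archimedean by blast
    then show "\<exists>n::nat. \<forall>t\<in>\<rat>. t \<in> {0<..<a} \<longrightarrow> inverse (real (Suc n)) \<le> ?f t"
      using t0(2) by (intro exI[of _ n]) (fastforce intro: order.trans[OF less_imp_le])
  next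
    let ?f = "\<lambda>t. cmod (poly (P z) (complex_of_real t))"
    assume "\<exists>n::nat. \<forall>t\<in>\<rat>. t \<in> {0<..<a} \<longrightarrow> inverse (real (Suc n)) \<le> ?f t"
    then obtain n where n: "\<And>t. t \<in> \<rat> \<Longrightarrow> t \<in> {0<..<a} \<Longrightarrow> inverse (real (Suc n)) \<le> ?f t" by blast
    have closed: "closed {t. inverse (real (Suc n)) \<le> ?f t}"
      by (intro closed_Collect_le continuous_intros)
    have "{0<..<a} \<subseteq> closure ({0<..<a} \<inter> \<rat>)"
      using Rats_closure_real open_Int_closure_subset[of "{0<..<a}" "\<rat>"] by (metis Int_UNIV_right open_greaterThanLessThan)
    also have "\<dots> \<subseteq> {t. inverse (real (Suc n)) \<le> ?f t}"
      using n closed by (intro closure_minimal) auto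
    finally have "closure {0<..<a} \<subseteq> {t. inverse (real (Suc n)) \<le> ?f t}"
      using closed by (intro closure_minimal)
    then have "{0..a} \<subseteq> {t. inverse (real (Suc n)) \<le> ?f t}" using a by (simp add: closure_greaterThanLessThan)
    then show "\<forall>t\<in>{0..a}. poly (P z) (complex_of_real t) \<noteq> 0" by fastforce
  qed
  have \<rho>_nonneg: "0 \<le> \<rho> z" if "z \<in> space N" for z using \<rho>_in[of z] s[OF that] by auto
  have \<rho>m: "\<rho> \<in> borel_measurable N"
  proof (rule borel_measurableI_greater)
    fix a :: real
    consider "a < 0" | "a = 0" | "a > 0" by linarith
    then show "{z \<in> space N. a < \<rho> z} \<in> sets N"
    proof cases
      case 1
      then have "{z \<in> space N. a < \<rho> z} = space N" using \<rho>_nonneg by fastforce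
      then show ?thesis by simp
    next
      case 2
      have "{z \<in> space N. a < \<rho> z} = {z \<in> space N. poly (P z) 0 \<noteq> 0}" using gt_iff[of _ a] 2 by auto
      also have "\<dots> \<in> sets N" using pm[of 0] by measurable
      finally show ?thesis .
    next
      case 3
      have "{z \<in> space N. a < \<rho> z} = {z \<in> space N. \<exists>n::nat. \<forall>t\<in>\<rat>. t \<in> {0<..<a} \<longrightarrow> inverse (real (Suc n)) \<le> cmod (poly (P z) (complex_of_real t))}"
        using 3 gt_iff[of _ a] cont_iff[OF 3] by auto
      also have "\<dots> \<in> sets N"
      proof -
        have [measurable]: "(\<lambda>z. poly (P z) (complex_of_real t)) \<in> borel_measurable N" for t by (rule pm)
        have "{z \<in> space N. \<forall>t\<in>\<rat>. t \<in> {0<..<a} \<longrightarrow> inverse (real (Suc n)) \<le> cmod (poly (P z) (complex_of_real t))} \<in> sets N" for n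
        proof (rule sets.sets_Collect_countable_All')
          fix t :: real
          show "{z \<in> space N. t \<in> {0<..<a} \<longrightarrow> inverse (real (Suc n)) \<le> cmod (poly (P z) (complex_of_real t))} \<in> sets N"
            by measurable
        qed (rule countable_rat)
        then show ?thesis by (rule sets.sets_Collect_countable_Ex)
      qed
      finally show ?thesis .
    qed
  qed
  define Q where "Q z = synthetic_div (P z) (complex_of_real (\<rho> z))" for z
  have PQ: "P z = [:- complex_of_real (\<rho> z), 1:] * Q z" if z: "z \<in> space N" for z
  proof -
    have "poly (P z) (complex_of_real (\<rho> z)) = 0" using \<rho>_in[of z] root_iff[OF z] by auto
    then show ?thesis using synthetic_div_correct'[of "complex_of_real (\<rho> z)" "P z"] by (simp add: Q_def)
  qed
  have Qs: "\<exists>s'. (\<forall>j<m. 0 \<le> s' j) \<and> Q z = (\<Prod>j<m. [:- complex_of_real (s' j), 1:])" if z: "z \<in> space N" for z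
  proof -
    obtain i where i: "i < Suc m" "\<rho> z = s z i" using \<rho>_in[of z] by auto
    \<comment> \<open>The index of the minimal root trades places with the last index, so that its
      factor can be cancelled.\<close>
    define s' where "s' j = s z (Transposition.transpose i m j)" for j
    have "(\<Prod>j<Suc m. [:- complex_of_real (s z j), 1:]) = (\<Prod>j<Suc m. [:- complex_of_real (s' j), 1:])"
      unfolding s'_def using i
      by (intro prod.reindex_bij_betw[symmetric, of "Transposition.transpose i m"] permutes_imp_bij permutes_swap_id) auto
    also have "\<dots> = (\<Prod>j<m. [:- complex_of_real (s' j), 1:]) * [:- complex_of_real (\<rho> z), 1:]"
      using i by (simp add: s'_def)
    finally have "[:- complex_of_real (\<rho> z), 1:] * Q z = [:- complex_of_real (\<rho> z), 1:] * (\<Prod>j<m. [:- complex_of_real (s' j), 1:])"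
      using PQ[OF z] Ps[OF z] by (simp add: mult.commute)
    then have "Q z = (\<Prod>j<m. [:- complex_of_real (s' j), 1:])"
      by (subst (asm) mult_cancel_left) auto
    moreover have "0 \<le> s' j" if "j < m" for j
      unfolding s'_def using that i by (intro s[OF z]) (auto simp: Transposition.transpose_def)
    ultimately show ?thesis by blast
  qed
  have Qd: "poly.coeff (Q z) k = 0" if "z \<in> space N" "m < k" for z k
    using Qs[OF that(1)] degree_prod_linear[where m=m] that(2) by (metis coeff_eq_0)
  \<comment> \<open>Comparing coefficients in P = (X - \<rho>) Q determines those of Q from the top
    down; above degree m they are zero, and there the recursion starts.\<close>
  have Qrec: "poly.coeff (Q z) k = poly.coeff (P z) (Suc k) + complex_of_real (\<rho> z) * poly.coeff (Q z) (Suc k)" if "z \<in> space N" for z k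
    using PQ[OF that] by (simp add: coeff_pCons)
  have "poly_measurable N Q"
    unfolding poly_measurable_def
  proof
    fix k
    have "(\<lambda>z. poly.coeff (Q z) k) \<in> borel_measurable N" if "m + 1 - k = d" for d k
      using that
    proof (induction d arbitrary: k)
      case 0
      then have "m < k" by simp
      then show ?case using Qd by (subst measurable_cong[of _ _ "\<lambda>_. 0"]) auto
    next
      case (Suc d)
      have "(\<lambda>z. poly.coeff (P z) (Suc k) + complex_of_real (\<rho> z) * poly.coeff (Q z) (Suc k)) \<in> borel_measurable N"
        using Pm Suc.IH[of "Suc k"] Suc.prems \<rho>m unfolding poly_measurable_def
        by (intro borel_measurable_add borel_measurable_times borel_measurable_of_real) auto
      then show ?case by (subst measurable_cong[OF Qrec]) auto
    qed
    then show "(\<lambda>z. poly.coeff (Q z) k) \<in> borel_measurable N" by blast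
  qed
  from Suc.IH[OF this Qs] obtain r where r: "\<And>j. j < m \<Longrightarrow> r j \<in> borel_measurable N"
    "\<And>z. z \<in> space N \<Longrightarrow> (\<forall>j<m. 0 \<le> r j z) \<and> Q z = (\<Prod>j<m. [:- complex_of_real (r j z), 1:])" by blast
  show ?case
  proof (intro exI[of _ "r(m := \<rho>)"] conjI ballI allI impI)
    fix j assume "j < Suc m"
    then show "(r(m := \<rho>)) j \<in> borel_measurable N" using r(1) \<rho>m by (auto simp: less_Suc_eq)
  next
    fix z j assume "z \<in> space N" "j < Suc m"
    then show "0 \<le> (r(m := \<rho>)) j z" using r(2)[of z] \<rho>_nonneg by (auto simp: less_Suc_eq)
  next
    fix z assume z: "z \<in> space N"
    show "P z = (\<Prod>j<Suc m. [:- complex_of_real ((r(m := \<rho>)) j z), 1:])"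
      using PQ[OF z] r(2)[OF z] by (simp add: mult.commute)
  qed
qed

lemma measurable_singular_values:
  assumes X: "mat_measurable N n X" and sym: "\<And>z. z \<in> space N \<Longrightarrow> symmetric_mat n (X z)"
  shows "\<exists>r. (\<forall>j<n. r j \<in> borel_measurable N) \<and>
    (\<forall>z\<in>space N. (\<forall>j<n. 0 \<le> r j z) \<and> sing_poly (X z) = (\<Prod>j<n. [:- complex_of_real (r j z), 1:]))"
proof (rule measurable_nonneg_roots)
  show "poly_measurable N (\<lambda>z. sing_poly (X z))"
    unfolding sing_poly_def by (intro poly_measurable_char_poly[of _ n] mat_measurable_mult mat_measurable_adjoint X)
next
  fix z assume "z \<in> space N"
  from takagi_factorization[OF sym[OF this]] obtain U \<sigma> where
    "unitary_mat n U" "X z = U * mat_diag n (\<lambda>i. complex_of_real (\<sigma> i)) * transpose_mat U" by blast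
  then show "\<exists>s. (\<forall>j<n. 0 \<le> s j) \<and> sing_poly (X z) = (\<Prod>j<n. [:- complex_of_real (s j), 1:])"
    by (intro exI[of _ "\<lambda>j. (\<sigma> j)\<^sup>2"]) (simp add: sing_poly_takagi)
qed

lemma prod_linear_eq_iff_mset:
  "(\<Prod>j<n. [:- a j, 1:] :: complex poly) = (\<Prod>j<n. [:- b j, 1:]) \<longleftrightarrow>
     image_mset a (mset_set {..<n}) = image_mset b (mset_set {..<n})"
proof
  have "proots (\<Prod>j<n. [:- a j, 1:] :: complex poly) = image_mset a (mset_set {..<n})" for a
    by (subst proots_prod) (auto simp: sum_unfold_sum_mset)
  then show "(\<Prod>j<n. [:- a j, 1:]) = (\<Prod>j<n. [:- b j, 1:]) \<Longrightarrow> image_mset a (mset_set {..<n}) = image_mset b (mset_set {..<n})"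
    by metis
next
  assume eq: "image_mset a (mset_set {..<n}) = image_mset b (mset_set {..<n})"
  have "(\<Prod>j<n. [:- a j, 1:] :: complex poly) = prod_mset (image_mset (\<lambda>x. [:- x, 1:]) (image_mset a (mset_set {..<n})))" for a
    by (simp add: prod_unfold_prod_mset image_mset.compositionality comp_def)
  then show "(\<Prod>j<n. [:- a j, 1:] :: complex poly) = (\<Prod>j<n. [:- b j, 1:])" using eq by metis
qed

lemma image_mset_of_real_eqD:
  assumes "image_mset (\<lambda>j. complex_of_real (a j)) M = image_mset (\<lambda>j. complex_of_real (b j)) M'"
  shows "image_mset a M = image_mset b M'"
  using arg_cong[OF assms, of "image_mset Re"] by (simp add: image_mset.compositionality comp_def)

abbreviation cleb :: "'i set \<Rightarrow> ('i \<Rightarrow> complex) measure" where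
  "cleb I \<equiv> PiM I (\<lambda>_. lborel)"

subsection \<open>Lebesgue measure on symmetric matrices\<close>

definition sym_coords :: "nat \<Rightarrow> complex mat \<Rightarrow> nat \<times> nat \<Rightarrow> complex" where
  "sym_coords n A = (\<lambda>p\<in>sym_idx n. A $$ p)"

text \<open>Functions of matrices are tested only on symmetric ones, through the coordinates in
  which the measure is a product.\<close>

definition sym_measurable :: "nat \<Rightarrow> (complex mat \<Rightarrow> ennreal) \<Rightarrow> bool" where
  "sym_measurable n \<Phi> \<longleftrightarrow> (\<lambda>h. \<Phi> (sym_mat n h)) \<in> borel_measurable (cleb (sym_idx n))"

definition unitarily_invariant :: "nat \<Rightarrow> (complex mat \<Rightarrow> 'b) \<Rightarrow> bool" where
  "unitarily_invariant n \<Phi> \<longleftrightarrow> (\<forall>U A. unitary_mat n U \<longrightarrow> symmetric_mat n A \<longrightarrow> \<Phi> (U * A * transpose_mat U) = \<Phi> A)"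

lemma finite_sym_idx [simp]: "finite (sym_idx n)"
  by (rule finite_subset[of _ "{..<n} \<times> {..<n}"]) (auto simp: sym_idx_def)

lemma sym_mat_carrier [simp]: "sym_mat n h \<in> carrier_mat n n"
  by (simp add: sym_mat_def)

lemma sym_mat_index: "i < n \<Longrightarrow> j < n \<Longrightarrow> sym_mat n h $$ (i, j) = (if i \<le> j then h (i, j) else h (j, i))"
  by (simp add: sym_mat_def)

lemma symmetric_sym_mat [simp]: "symmetric_mat n (sym_mat n h)"
  unfolding symmetric_mat_def by (auto simp: sym_mat_def intro!: eq_matI)

lemma sym_mat_coords: "symmetric_mat n A \<Longrightarrow> sym_mat n (sym_coords n A) = A"
proof (rule eq_matI)
  fix i j assume A: "symmetric_mat n A" and "i < dim_row A" "j < dim_col A"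
  then have "i < n" "j < n" by (auto simp: symmetric_mat_def)
  then show "sym_mat n (sym_coords n A) $$ (i, j) = A $$ (i, j)"
    using symmetric_mat_index[OF A, of i j] by (auto simp: sym_mat_index sym_coords_def sym_idx_def)
qed (auto simp: symmetric_mat_def sym_mat_def)

lemma sym_coords_mat: "h \<in> space (cleb (sym_idx n)) \<Longrightarrow> sym_coords n (sym_mat n h) = h"
  by (auto simp: sym_coords_def space_PiM PiE_iff extensional_def sym_idx_def sym_mat_def fun_eq_iff restrict_def)

lemma sym_coords_space [simp]: "sym_coords n A \<in> space (cleb (sym_idx n))"
  by (simp add: sym_coords_def space_PiM)

lemma mat_measurable_sym_mat: "mat_measurable (cleb (sym_idx n)) n (sym_mat n)"
  unfolding mat_measurable_def
proof (intro conjI ballI allI impI)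
  fix i j assume ij: "i < n" "j < n"
  then have "(if i \<le> j then (i, j) else (j, i)) \<in> sym_idx n" by (auto simp: sym_idx_def)
  from measurable_component_singleton[OF this, of "\<lambda>_. lborel :: complex measure"]
  show "(\<lambda>h. sym_mat n h $$ (i, j)) \<in> borel_measurable (cleb (sym_idx n))"
    using ij by (cases "i \<le> j") (simp_all add: sym_mat_index)
qed simp

lemma measurable_sym_coords:
  assumes "mat_measurable N n X"
  shows "(\<lambda>z. sym_coords n (X z)) \<in> measurable N (cleb (sym_idx n))"
  unfolding sym_coords_def
  by (rule measurable_restrict) (use mat_measurableD(2)[OF assms] in \<open>auto simp: sym_idx_def\<close>)

text \<open>A symmetric matrix is recovered from its coordinates, so the composition factors through
  the coordinate space.\<close>

lemma sym_measurable_compose: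
  assumes \<Phi>: "sym_measurable n \<Phi>" and X: "mat_measurable N n X"
    and sym: "\<And>z. z \<in> space N \<Longrightarrow> symmetric_mat n (X z)"
  shows "(\<lambda>z. \<Phi> (X z)) \<in> borel_measurable N"
  using measurable_compose[OF measurable_sym_coords[OF X] \<Phi>[unfolded sym_measurable_def]]
  by (subst measurable_cong) (use sym_mat_coords[OF sym] in auto)

lemma mat_measurable_border:
  assumes K: "mat_measurable N n K" and v: "\<And>i. i < n \<Longrightarrow> (\<lambda>z. v z i) \<in> borel_measurable N"
    and c: "c \<in> borel_measurable N"
  shows "mat_measurable N (Suc n) (\<lambda>z. border n (K z) (v z) (c z))"
  unfolding mat_measurable_def
proof (intro conjI ballI allI impI)
  fix i j assume "i < Suc n" "j < Suc n"
  then consider "i < n" "j < n" | "i < n" "j = n" | "i = n" "j < n" | "i = n" "j = n" by linarith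
  then show "(\<lambda>z. border n (K z) (v z) (c z) $$ (i, j)) \<in> borel_measurable N"
    using mat_measurableD(2)[OF K] v c by cases (simp_all add: border_index)
qed simp

lemma measurable_con_image:
  assumes K: "mat_measurable N n K" and \<kappa>: "\<kappa> \<in> borel_measurable N" and y: "\<And>i. i < n \<Longrightarrow> (\<lambda>z. y z i) \<in> borel_measurable N"
    and i: "i < n"
  shows "(\<lambda>z. con_image n (K z) (\<kappa> z) (y z) i) \<in> borel_measurable N"
  unfolding con_image_def using i
  by (intro borel_measurable_diff borel_measurable_times borel_measurable_sum \<kappa> y mat_measurableD(2)[OF K]
      measurable_compose[OF y borel_measurable_cnj]) auto

lemma mat_measurable_con_mat:
  assumes K: "mat_measurable N n K" and \<kappa>: "\<kappa> \<in> borel_measurable N" and y: "\<And>i. i < n \<Longrightarrow> (\<lambda>z. y z i) \<in> borel_measurable N"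
  shows "mat_measurable N (Suc n) (\<lambda>z. con_mat n (K z) (\<kappa> z) (y z))"
  unfolding con_mat_def
  by (intro mat_measurable_border K measurable_con_image \<kappa> y borel_measurable_diff borel_measurable_sum borel_measurable_times
      measurable_compose[OF y borel_measurable_cnj]) auto

lemma borel_measurable_corner_minor:
  assumes H: "mat_measurable N (Suc n) H" and x: "x \<in> borel_measurable N"
  shows "(\<lambda>z. corner_minor n (H z) (x z)) \<in> borel_measurable N"
  unfolding corner_minor_def
proof (rule borel_measurable_det[of _ n])
  have HH: "mat_measurable N (Suc n) (\<lambda>z. H z * mat_adjoint (H z))"
    by (intro mat_measurable_mult mat_measurable_adjoint H)
  have [measurable]: "(\<lambda>z. (H z * mat_adjoint (H z)) $$ (i, j)) \<in> borel_measurable N" if "i < n" "j < n" for i j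
    using mat_measurableD(2)[OF HH, of i j] that by simp
  note [measurable] = x
  show "mat_measurable N n (\<lambda>z. mat n n (\<lambda>(i, j). (if i = j then complex_of_real (x z) else 0) - (H z * mat_adjoint (H z)) $$ (i, j)))"
    unfolding mat_measurable_def by (auto simp del: index_mult_mat)
qed

section \<open>Congruences acting on the coordinate measure\<close>

lemma sum_square_sym_idx:
  fixes A :: "nat \<Rightarrow> nat \<Rightarrow> real"
  assumes "\<And>i j. A i j = A j i"
  shows "(\<Sum>(i, j)\<in>sym_idx n. (if i = j then 1 else 2) * A i j) = (\<Sum>i<n. \<Sum>j<n. A i j)"
proof (induction n)
  case 0
  then show ?case by (simp add: sym_idx_def)
next
  case (Suc n)
  have split: "sym_idx (Suc n) = sym_idx n \<union> (\<lambda>i. (i, n)) ` {..<Suc n}"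
    by (auto simp: sym_idx_def image_iff less_Suc_eq)
  have disj: "sym_idx n \<inter> (\<lambda>i. (i, n)) ` {..<Suc n} = {}" by (auto simp: sym_idx_def)
  have "(\<Sum>(i, j)\<in>sym_idx (Suc n). (if i = j then 1 else 2) * A i j)
    = (\<Sum>i<n. \<Sum>j<n. A i j) + (\<Sum>i<Suc n. (if i = n then 1 else 2) * A i n)"
    unfolding split by (subst sum.union_disjoint) (auto simp: disj Suc sum.reindex inj_on_def)
  also have "(\<Sum>i<Suc n. (if i = n then 1 else 2) * A i n) = (\<Sum>i<n. A i n) + (\<Sum>i<n. A n i) + A n n"
  proof -
    have "(\<Sum>i<n. (if i = n then 1 else 2) * A i n) = (\<Sum>i<n. A i n + A n i)"
      using assms by (intro sum.cong) auto
    then show ?thesis by (simp add: sum.distrib)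
  qed
  finally show ?case by (simp add: sum.distrib)
qed

lemma frobenius_congruence:
  assumes V: "unitary_mat n V" and A: "A \<in> carrier_mat n n"
  shows "(\<Sum>i<n. \<Sum>j<n. (cmod ((V * A * transpose_mat V) $$ (i, j)))\<^sup>2) = (\<Sum>i<n. \<Sum>j<n. (cmod (A $$ (i, j)))\<^sup>2)"
proof -
  note Vc = unitary_matD(1)[OF V]
  have "(\<Sum>i<n. \<Sum>j<n. (cmod ((V * A * transpose_mat V) $$ (i, j)))\<^sup>2)
    = (\<Sum>i<n. \<Sum>j<n. (cmod (\<Sum>k<n. V $$ (j, k) * (\<Sum>l<n. V $$ (i, l) * A $$ (l, k))))\<^sup>2)"
    using Vc A by (intro sum.cong refl) (simp only: index_congruence_sum[of _ n n] lessThan_iff mult.commute)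
  also have "\<dots> = (\<Sum>i<n. \<Sum>k<n. (cmod (\<Sum>l<n. V $$ (i, l) * A $$ (l, k)))\<^sup>2)"
    by (intro sum.cong refl unitary_mat_preserves_norm[OF V])
  also have "\<dots> = (\<Sum>k<n. \<Sum>i<n. (cmod (\<Sum>l<n. V $$ (i, l) * A $$ (l, k)))\<^sup>2)" by (rule sum.swap)
  also have "\<dots> = (\<Sum>k<n. \<Sum>l<n. (cmod (A $$ (l, k)))\<^sup>2)"
    by (intro sum.cong refl unitary_mat_preserves_norm[OF V])
  also have "\<dots> = (\<Sum>i<n. \<Sum>j<n. (cmod (A $$ (i, j)))\<^sup>2)" by (rule sum.swap)
  finally show ?thesis .
qed

lemma sum_sym_idx_frobenius:
  "(\<Sum>p\<in>sym_idx n. (if fst p = snd p then 1 else 2) * (cmod (h p))\<^sup>2) = (\<Sum>i<n. \<Sum>j<n. (cmod (sym_mat n h $$ (i, j)))\<^sup>2)"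
proof -
  let ?A = "\<lambda>i j. (cmod (if i \<le> j then h (i, j) else h (j, i)))\<^sup>2"
  have "(\<Sum>p\<in>sym_idx n. (if fst p = snd p then 1 else 2) * (cmod (h p))\<^sup>2) = (\<Sum>(i, j)\<in>sym_idx n. (if i = j then 1 else 2) * ?A i j)"
    by (intro sum.cong) (auto simp: sym_idx_def)
  also have "\<dots> = (\<Sum>i<n. \<Sum>j<n. ?A i j)" by (rule sum_square_sym_idx) auto
  also have "\<dots> = (\<Sum>i<n. \<Sum>j<n. (cmod (sym_mat n h $$ (i, j)))\<^sup>2)"
    by (intro sum.cong refl) (simp add: sym_mat_index)
  finally show ?thesis .
qed

text \<open>Congruence preserves the Frobenius norm. In the coordinates this norm weighs
  off-diagonal entries twice, and it is for these weights that the isometry lemma carries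
  \<open>w\<close>.\<close>

lemma nn_integral_sym_congruence:
  assumes V: "unitary_mat n V" and F: "sym_measurable n F"
  shows "(\<integral>\<^sup>+h. F (V * sym_mat n h * transpose_mat V) \<partial>cleb (sym_idx n)) = (\<integral>\<^sup>+h. F (sym_mat n h) \<partial>cleb (sym_idx n))"
proof -
  let ?T = "\<lambda>W h. sym_coords n (W * sym_mat n h * transpose_mat W)"
  note Vc = unitary_matD(1)[OF V]
  have sym: "symmetric_mat n (W * sym_mat n h * transpose_mat W)" if "W \<in> carrier_mat n n" for W h
    using that by (intro symmetric_congruence) auto
  have mT: "mat_measurable (cleb (sym_idx n)) n (\<lambda>h. W * sym_mat n h * transpose_mat W)" if "W \<in> carrier_mat n n" for W
    using that by (intro mat_measurable_mult mat_measurable_sym_mat) (auto simp: mat_measurable_def)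
  have "(\<integral>\<^sup>+h. F (sym_mat n (?T V h)) \<partial>cleb (sym_idx n)) = (\<integral>\<^sup>+h. F (sym_mat n h) \<partial>cleb (sym_idx n))"
  proof (rule nn_integral_PiM_isometry[where T'="?T (mat_adjoint V)" and w="\<lambda>p. if fst p = snd p then 1 else 2"])
    show "?T V \<in> measurable (cleb (sym_idx n)) (cleb (sym_idx n))"
      by (intro measurable_sym_coords mT Vc)
    show "?T V (?T (mat_adjoint V) x) = x" if "x \<in> space (cleb (sym_idx n))" for x
      using that Vc by (simp add: sym_mat_coords[OF sym] congruence_inverse[OF V] sym_coords_mat del: assoc_mult_mat)
    show "?T V (\<lambda>i\<in>sym_idx n. x i + y i) = (\<lambda>i\<in>sym_idx n. ?T V x i + ?T V y i)"
      if "x \<in> space (cleb (sym_idx n))" "y \<in> space (cleb (sym_idx n))" for x y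
    proof -
      have a: "sym_mat n (\<lambda>i\<in>sym_idx n. x i + y i) = sym_mat n x + sym_mat n y"
        by (rule eq_matI) (auto simp: sym_mat_def sym_idx_def)
      have "V * (sym_mat n x + sym_mat n y) * transpose_mat V = V * sym_mat n x * transpose_mat V + V * sym_mat n y * transpose_mat V"
        using Vc by (simp add: mult_add_distrib_mat[of _ n n _ n] add_mult_distrib_mat[of _ n n _ _ n] mult_carrier_mat[of _ n n _ n] del: assoc_mult_mat)
      then show ?thesis unfolding a using Vc
        by (auto simp: sym_coords_def sym_idx_def fun_eq_iff restrict_def index_mult_mat(2,3) simp del: index_mult_mat(1) assoc_mult_mat
            intro!: index_add_mat(1))
    qed
    show "(\<Sum>i\<in>sym_idx n. (if fst i = snd i then 1 else 2) * (cmod (?T V x i))\<^sup>2) = (\<Sum>i\<in>sym_idx n. (if fst i = snd i then 1 else 2) * (cmod (x i))\<^sup>2)"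
      for x
      unfolding sum_sym_idx_frobenius sym_mat_coords[OF sym[OF Vc]] by (rule frobenius_congruence[OF V]) simp
    show "(\<lambda>h. F (sym_mat n h)) \<in> borel_measurable (cleb (sym_idx n))" using F by (simp add: sym_measurable_def)
  qed auto
  then show ?thesis by (simp add: sym_mat_coords[OF sym[OF Vc]] del: assoc_mult_mat)
qed

text \<open>Each index lies in n - 1 off-diagonal pairs and counts twice in its diagonal pair, which
  gives the exponent \<open>Suc n\<close>.\<close>

lemma prod_sym_idx: "(\<Prod>p\<in>sym_idx n. g (fst p) * g (snd p)) = (\<Prod>i<n. g i ^ Suc n :: 'a::comm_monoid_mult)"
proof (induction n)
  case 0
  then show ?case by (simp add: sym_idx_def)
next
  case (Suc n)
  have split: "sym_idx (Suc n) = sym_idx n \<union> (\<lambda>i. (i, n)) ` {..<Suc n}"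
    by (auto simp: sym_idx_def image_iff less_Suc_eq)
  have disj: "sym_idx n \<inter> (\<lambda>i. (i, n)) ` {..<Suc n} = {}" by (auto simp: sym_idx_def)
  have "(\<Prod>p\<in>sym_idx (Suc n). g (fst p) * g (snd p)) = (\<Prod>i<n. g i ^ Suc n) * (\<Prod>i<Suc n. g i * g n)"
    unfolding split by (subst prod.union_disjoint) (auto simp: disj Suc prod.reindex inj_on_def)
  then show ?case by (simp add: prod.distrib ac_simps power_Suc2)
qed

text \<open>The coordinate (i, j) is scaled by d i * d j. Scaling a plane has the square of the
  factor as its Jacobian, hence the outer square.\<close>

lemma nn_integral_sym_diag:
  assumes d: "\<And>i. i < n \<Longrightarrow> d i > (0::real)" and F: "sym_measurable n F"
  shows "(\<integral>\<^sup>+h. F (mat_diag n (\<lambda>i. complex_of_real (d i)) * sym_mat n h * transpose_mat (mat_diag n (\<lambda>i. complex_of_real (d i)))) \<partial>cleb (sym_idx n))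
      * ennreal (((\<Prod>i<n. d i) ^ Suc n)\<^sup>2) = (\<integral>\<^sup>+h. F (sym_mat n h) \<partial>cleb (sym_idx n))"
proof -
  let ?D = "mat_diag n (\<lambda>i. complex_of_real (d i))"
  have eq: "?D * sym_mat n h * transpose_mat ?D = sym_mat n (\<lambda>p\<in>sym_idx n. complex_of_real (d (fst p) * d (snd p)) * h p)" for h
  proof (rule eq_matI)
    have Dt: "transpose_mat ?D = ?D" by (rule eq_matI) (auto simp: mat_diag_def)
    fix i j assume "i < dim_row (sym_mat n (\<lambda>p\<in>sym_idx n. complex_of_real (d (fst p) * d (snd p)) * h p))"
      "j < dim_col (sym_mat n (\<lambda>p\<in>sym_idx n. complex_of_real (d (fst p) * d (snd p)) * h p))"
    then have ij: "i < n" "j < n" by (auto simp: sym_mat_def)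
    have "?D * sym_mat n h \<in> carrier_mat n n" by (intro mult_carrier_mat[of _ n n]) auto
    then have "(?D * sym_mat n h * transpose_mat ?D) $$ (i, j) = complex_of_real (d i) * sym_mat n h $$ (i, j) * complex_of_real (d j)"
      unfolding Dt using ij by (subst mat_diag_mult_right[of _ n n]) (auto simp: mat_diag_mult_left[of _ n n])
    then show "(?D * sym_mat n h * transpose_mat ?D) $$ (i, j) = sym_mat n (\<lambda>p\<in>sym_idx n. complex_of_real (d (fst p) * d (snd p)) * h p) $$ (i, j)"
      using ij by (auto simp: sym_mat_index sym_idx_def simp del: index_mult_mat)
  qed (auto simp: sym_mat_def mat_diag_def)
  have "(\<integral>\<^sup>+h. F (sym_mat n (\<lambda>p\<in>sym_idx n. complex_of_real (d (fst p) * d (snd p)) * h p)) \<partial>cleb (sym_idx n)) * (\<Prod>p\<in>sym_idx n. ennreal ((d (fst p) * d (snd p))\<^sup>2))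
    = (\<integral>\<^sup>+h. F (sym_mat n h) \<partial>cleb (sym_idx n))"
  proof (rule nn_integral_PiM_componentwise)
    fix p and g :: "complex \<Rightarrow> ennreal" assume p: "p \<in> sym_idx n" and g: "g \<in> borel_measurable borel"
    define r where "r = d (fst p) * d (snd p)"
    have "r > 0" using p d by (auto simp: sym_idx_def r_def)
    then have "(\<integral>\<^sup>+x. g (complex_of_real r * x) \<partial>lborel) * ennreal (r\<^sup>2) = (\<integral>\<^sup>+x. g x \<partial>lborel)"
      using nn_integral_complex_real_linear[of "complex_of_real r" 0 g] g by simp
    then show "(\<integral>\<^sup>+x. g (complex_of_real (d (fst p) * d (snd p)) * x) \<partial>lborel) * ennreal ((d (fst p) * d (snd p))\<^sup>2) = (\<integral>\<^sup>+x. g x \<partial>lborel)"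
      by (simp only: r_def)
  qed (use F in \<open>auto simp: sym_measurable_def\<close>)
  moreover have "(\<Prod>p\<in>sym_idx n. ennreal ((d (fst p) * d (snd p))\<^sup>2)) = ennreal (((\<Prod>i<n. d i) ^ Suc n)\<^sup>2)"
  proof -
    have "(\<Prod>p\<in>sym_idx n. (d (fst p) * d (snd p))\<^sup>2) = (\<Prod>i<n. d i ^ Suc n)\<^sup>2"
      unfolding prod_sym_idx[symmetric] prod_power_distrib ..
    also have "(\<Prod>i<n. d i ^ Suc n) = (\<Prod>i<n. d i) ^ Suc n" by (rule prod_power_distrib[symmetric])
    finally show ?thesis by (subst prod_ennreal) auto
  qed
  ultimately show ?thesis unfolding eq by simp
qed

text \<open>The Jacobian of the affine substitution in \<open>con_mat_reduction\<close>: the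
  translation and the unitary V cost nothing, and the single diagonal entry 1 / sqrt N contributes
  its power 2 (n + 1), that is 1 / N^(n+1).\<close>

lemma nn_integral_sym_reduction:
  fixes \<tau> :: complex and y :: "nat \<Rightarrow> complex" and n :: nat
  defines "N \<equiv> 1 + (\<Sum>i<n. (cmod (y i))\<^sup>2)"
  defines "Q \<equiv> \<lambda>V. V * mat_diag n (\<lambda>i. if i = 0 then complex_of_real (1 / sqrt N) else 1)"
  assumes V: "unitary_mat n V" and F: "sym_measurable n F"
  shows "(\<integral>\<^sup>+h. F (sym_mat n h) \<partial>cleb (sym_idx n)) = ennreal (1 / N ^ Suc n) *
    (\<integral>\<^sup>+h. F (mat n n (\<lambda>(i, j). (Q V * sym_mat n h * transpose_mat (Q V)) $$ (i, j) + \<tau> * y i * y j)) \<partial>cleb (sym_idx n))"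
proof -
  note Vc = unitary_matD(1)[OF V]
  have Npos: "N > 0" unfolding N_def by (intro add_pos_nonneg sum_nonneg) auto
  define G where "G A = F (mat n n (\<lambda>(i, j). A $$ (i, j) + \<tau> * y i * y j))" for A
  have add_sym: "symmetric_mat n (mat n n (\<lambda>(i, j). A $$ (i, j) + \<tau> * y i * y j))" if "symmetric_mat n A" for A
    unfolding symmetric_mat_def using symmetric_mat_index[OF that] by (auto intro!: eq_matI)
  have G: "sym_measurable n G"
    unfolding sym_measurable_def G_def
  proof (rule sym_measurable_compose[OF F])
    show "mat_measurable (cleb (sym_idx n)) n (\<lambda>h. mat n n (\<lambda>(i, j). sym_mat n h $$ (i, j) + \<tau> * y i * y j))"
      unfolding mat_measurable_def using mat_measurableD(2)[OF mat_measurable_sym_mat] by auto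
  qed (simp add: add_sym)
  define d where "d i = (if i = 0 then 1 / sqrt N else 1)" for i :: nat
  let ?D = "mat_diag n (\<lambda>i. complex_of_real (d i))"
  have D: "?D = mat_diag n (\<lambda>i. if i = 0 then complex_of_real (1 / sqrt N) else 1)"
    by (rule arg_cong[where f="mat_diag n"]) (auto simp: d_def)
  define G' where "G' A = G (V * A * transpose_mat V)" for A
  have G': "sym_measurable n G'"
    unfolding sym_measurable_def G'_def
    using Vc by (intro sym_measurable_compose[OF G] mat_measurable_mult mat_measurable_sym_mat symmetric_congruence)
      (auto simp: mat_measurable_def)
  have "(\<integral>\<^sup>+h. F (sym_mat n h) \<partial>cleb (sym_idx n))
      = (\<integral>\<^sup>+h. F (sym_mat n (\<lambda>p\<in>sym_idx n. h p + \<tau> * y (fst p) * y (snd p))) \<partial>cleb (sym_idx n))"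
    using F by (subst nn_integral_PiM_translate) (auto simp: sym_measurable_def)
  also have "\<dots> = (\<integral>\<^sup>+h. G (sym_mat n h) \<partial>cleb (sym_idx n))"
    unfolding G_def by (intro nn_integral_cong arg_cong[where f=F] eq_matI) (auto simp: sym_mat_def sym_idx_def)
  also have "\<dots> = (\<integral>\<^sup>+h. G' (sym_mat n h) \<partial>cleb (sym_idx n))"
    unfolding G'_def by (rule nn_integral_sym_congruence[OF V G, symmetric])
  also have "\<dots> = (\<integral>\<^sup>+h. G' (?D * sym_mat n h * transpose_mat ?D) \<partial>cleb (sym_idx n)) * ennreal (((\<Prod>i<n. d i) ^ Suc n)\<^sup>2)"
    using Npos by (intro nn_integral_sym_diag[OF _ G', symmetric]) (auto simp: d_def)
  also have "((\<Prod>i<n. d i) ^ Suc n)\<^sup>2 = 1 / N ^ Suc n"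
  proof -
    have "(\<Prod>i<n. d i) = 1 / sqrt N"
    proof (cases n)
      case 0 then show ?thesis by (simp add: N_def)
    next
      case (Suc k)
      have "(\<Prod>i<Suc k. d i) = d 0 * (\<Prod>i<k. d (Suc i))" by (rule prod.lessThan_Suc_shift)
      then show ?thesis using Suc by (simp add: d_def)
    qed
    then have "((\<Prod>i<n. d i)\<^sup>2) = 1 / N" using Npos by (simp add: power_divide)
    then show ?thesis by (metis power_commutes power_mult power_one_over mult.commute)
  qed
  also have "(\<lambda>h. G' (?D * sym_mat n h * transpose_mat ?D)) = (\<lambda>h. F (mat n n (\<lambda>(i, j). (Q V * sym_mat n h * transpose_mat (Q V)) $$ (i, j) + \<tau> * y i * y j)))"
  proof
    fix h
    have "V * (?D * sym_mat n h * transpose_mat ?D) * transpose_mat V = (V * ?D) * sym_mat n h * transpose_mat (V * ?D)"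
      using Vc by (simp add: transpose_mult[of _ n n _ n] assoc_mult_mat[of _ n n _ n _ n] mult_carrier_mat[of _ n n _ n])
    then show "G' (?D * sym_mat n h * transpose_mat ?D) = F (mat n n (\<lambda>(i, j). (Q V * sym_mat n h * transpose_mat (Q V)) $$ (i, j) + \<tau> * y i * y j))"
      unfolding G'_def G_def Q_def D by simp
  qed
  finally show ?thesis by (simp add: mult.commute)
qed

lemma sym_idx_Suc: "sym_idx (Suc n) = insert (n, n) (sym_idx n \<union> (\<lambda>i. (i, n)) ` {..<n})"
  by (auto simp: sym_idx_def less_Suc_eq)

lemma nn_integral_sym_Suc:
  assumes \<Phi>: "sym_measurable (Suc n) \<Phi>"
  shows "(\<integral>\<^sup>+h. \<Phi> (sym_mat (Suc n) h) \<partial>cleb (sym_idx (Suc n)))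
    = (\<integral>\<^sup>+k. \<integral>\<^sup>+v. \<integral>\<^sup>+c. \<Phi> (border n (sym_mat n k) v c) \<partial>lborel \<partial>cleb {..<n} \<partial>cleb (sym_idx n))"
proof -
  let ?I = "sym_idx n" and ?J = "(\<lambda>i. (i, n)) ` {..<n}"
  let ?f = "\<lambda>h. \<Phi> (sym_mat (Suc n) h)"
  have fin: "finite (?I \<union> ?J)" "(n, n) \<notin> ?I \<union> ?J" "?I \<inter> ?J = {}" "finite ?I" "finite ?J"
    using finite_sym_idx[of n] by (auto simp: sym_idx_def)
  have f: "?f \<in> borel_measurable (cleb (insert (n, n) (?I \<union> ?J)))" using \<Phi> by (simp add: sym_measurable_def sym_idx_Suc)
  let ?g = "\<lambda>x. \<integral>\<^sup>+c. ?f (x((n, n) := c)) \<partial>lborel"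
  have g: "?g \<in> borel_measurable (cleb (?I \<union> ?J))"
    using f by measurable
  have "(\<integral>\<^sup>+h. ?f h \<partial>cleb (sym_idx (Suc n))) = (\<integral>\<^sup>+x. ?g x \<partial>cleb (?I \<union> ?J))"
    unfolding sym_idx_Suc by (rule lborel_product.product_nn_integral_insert[OF fin(1,2) f])
  also have "\<dots> = (\<integral>\<^sup>+k. \<integral>\<^sup>+u. ?g (merge ?I ?J (k, u)) \<partial>cleb ?J \<partial>cleb ?I)"
    by (rule lborel_product.product_nn_integral_fold[OF fin(3,4,5) g])
  also have "\<dots> = (\<integral>\<^sup>+k. \<integral>\<^sup>+v. ?g (merge ?I ?J (k, \<lambda>j\<in>?J. v (fst j))) \<partial>cleb {..<n} \<partial>cleb ?I)"
  proof (rule nn_integral_cong)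
    fix k assume k: "k \<in> space (cleb ?I)"
    have "(\<lambda>u. merge ?I ?J (k, u)) \<in> measurable (cleb ?J) (cleb (?I \<union> ?J))"
      using k by measurable
    then have "(\<lambda>u. ?g (merge ?I ?J (k, u))) \<in> borel_measurable (cleb ?J)"
      using g by (rule measurable_compose)
    then show "(\<integral>\<^sup>+u. ?g (merge ?I ?J (k, u)) \<partial>cleb ?J) = (\<integral>\<^sup>+v. ?g (merge ?I ?J (k, \<lambda>j\<in>?J. v (fst j))) \<partial>cleb {..<n})"
      by (intro nn_integral_PiM_reindex) auto
  qed
  also have "\<dots> = (\<integral>\<^sup>+k. \<integral>\<^sup>+v. \<integral>\<^sup>+c. \<Phi> (border n (sym_mat n k) v c) \<partial>lborel \<partial>cleb {..<n} \<partial>cleb ?I)"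
  proof (intro nn_integral_cong arg_cong[where f=\<Phi>] eq_mat_SucI[of _ n])
    fix k :: "nat \<times> nat \<Rightarrow> complex" and v :: "nat \<Rightarrow> complex" and c :: complex and i j assume ij: "i < n" "j < n"
    then show "sym_mat (Suc n) ((merge ?I ?J (k, \<lambda>j\<in>?J. v (fst j)))((n, n) := c)) $$ (i, j) = border n (sym_mat n k) v c $$ (i, j)"
      by (auto simp: sym_mat_index border_index merge_def sym_idx_def)
  qed (auto simp: sym_mat_index border_index merge_def sym_idx_def)
  finally show ?thesis .
qed

subsection \<open>Slices with a fixed principal minor\<close>

text \<open>Expresses that x is at most every squared singular value. Phrased through roots, it is
  visibly invariant under congruence and needs no ordering of them.\<close>

definition below_spectrum :: "complex mat \<Rightarrow> real \<Rightarrow> bool" where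
  "below_spectrum H x \<longleftrightarrow> (\<forall>t. 0 \<le> t \<and> t < x \<longrightarrow> poly (sing_poly H) (complex_of_real t) \<noteq> 0)"

lemma below_spectrum_iff:
  fixes n :: nat
  assumes "sing_poly H = (\<Prod>j<n. [:- complex_of_real (r j), 1:])" "\<And>j. j < n \<Longrightarrow> 0 \<le> r j"
  shows "below_spectrum H x \<longleftrightarrow> (\<forall>j<n. x \<le> r j)"
proof -
  have "poly (sing_poly H) (complex_of_real t) = 0 \<longleftrightarrow> (\<exists>j<n. t = r j)" for t
    unfolding assms(1) poly_prod_linear by (subst prod_zero_iff) auto
  then show ?thesis unfolding below_spectrum_def using assms(2) by (metis not_le)
qed

lemma measurable_below_spectrum:
  assumes H: "mat_measurable N n H" and sym: "\<And>z. z \<in> space N \<Longrightarrow> symmetric_mat n (H z)"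
    and x[measurable]: "x \<in> borel_measurable N"
  shows "{z \<in> space N. below_spectrum (H z) (x z)} \<in> sets N"
proof -
  obtain r where r: "\<And>j. j < n \<Longrightarrow> r j \<in> borel_measurable N"
    and r': "\<And>z. z \<in> space N \<Longrightarrow> (\<forall>j<n. 0 \<le> r j z) \<and> sing_poly (H z) = (\<Prod>j<n. [:- complex_of_real (r j z), 1:])"
    using measurable_singular_values[OF H sym] by blast
  have "{z \<in> space N. below_spectrum (H z) (x z)} = {z \<in> space N. \<forall>j\<in>{..<n}. x z \<le> r j z}"
    using below_spectrum_iff[where n=n] r' by auto
  also have "\<dots> \<in> sets N"
    using r by (intro sets.sets_Collect_finite_All borel_measurable_le x) auto
  finally show ?thesis .
qed

lemma below_spectrum_congruence:
  assumes "unitary_mat n U" "A \<in> carrier_mat n n"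
  shows "below_spectrum (U * A * transpose_mat U) x \<longleftrightarrow> below_spectrum A x"
  unfolding below_spectrum_def sing_poly_congruence[OF assms] ..

section \<open>Null sets and the parametrization over a diagonal block\<close>

lemma null_sets_Re_line:
  assumes "u \<noteq> 0"
  shows "{c. Re (c / u) = C} \<in> null_sets lborel"
proof -
  have "{c. Re (c / u) = C} = {c. cnj (1 / u) \<bullet> c = C}"
    by (auto simp: inner_complex_def complex_eq_iff divide_complex_def algebra_simps)
  moreover have "negligible {c. cnj (1 / u) \<bullet> c = C}"
    using assms by (intro negligible_hyperplane) auto
  ultimately have "{c. Re (c / u) = C} \<in> null_sets lebesgue" by (simp add: negligible_iff_null_sets)
  moreover have "{c. Re (c / u) = C} \<in> sets lborel" by measurable
  ultimately show ?thesis by (simp add: null_sets_completion_iff)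
qed

lemma AE_PiM_nonzero: "finite I \<Longrightarrow> AE v in cleb I. \<forall>k\<in>I. v k \<noteq> 0"
proof (intro AE_finite_allI)
  fix k assume I: "finite I" and k: "k \<in> I"
  let ?A = "\<lambda>i. if i = k then {0} else (UNIV :: complex set)"
  have "{v \<in> space (cleb I). \<not> v k \<noteq> 0} = Pi\<^sub>E I ?A" using k by (auto simp: space_PiM PiE_iff extensional_def dest!: bspec[of _ _ k])
  moreover have "emeasure (cleb I) (Pi\<^sub>E I ?A) = (\<Prod>i\<in>I. emeasure lborel (?A i))"
    using I by (intro lborel_product.emeasure_PiM) auto
  moreover have "(\<Prod>i\<in>I. emeasure lborel (?A i)) = 0" using I k by (intro prod_zero) auto
  moreover have "Pi\<^sub>E I ?A \<in> sets (cleb I)" using I by (intro sets_PiM_I_finite) auto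
  ultimately show "AE v in cleb I. v k \<noteq> 0" by (intro AE_I[of _ _ "Pi\<^sub>E I ?A"]) auto
qed

text \<open>\<open>D\<close> stands for the upper left block after diagonalization. Distinct
  positive \<sigma> k are the generic case; distinctness keeps the poles of \<open>a\<close> and
  \<open>b\<close> apart.\<close>

locale diagonal_slice =
  fixes n :: nat and \<sigma> :: "nat \<Rightarrow> real"
  assumes \<sigma>_pos: "k < n \<Longrightarrow> \<sigma> k > 0" and \<sigma>_inj: "inj_on \<sigma> {..<n}"
begin

abbreviation D :: "complex mat" where "D \<equiv> mat_diag n (\<lambda>i. complex_of_real (\<sigma> i))"

text \<open>Eliminating y from the coneigenvector equations gives the corner entry \<kappa> a - b,
  where \<open>a\<close> and \<open>b\<close> depend on \<kappa> only through x = |\<kappa>|^2; on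
  each circle the corner entry is thus affine in \<kappa>. The same \<open>a\<close> is the rank one
  factor in the leading minor.\<close>

definition a :: "(nat \<Rightarrow> complex) \<Rightarrow> real \<Rightarrow> real" where
  "a v x = 1 - (\<Sum>k<n. (cmod (v k))\<^sup>2 / (x - (\<sigma> k)\<^sup>2))"

definition b :: "(nat \<Rightarrow> complex) \<Rightarrow> real \<Rightarrow> complex" where
  "b v x = (\<Sum>k<n. complex_of_real (\<sigma> k) * (v k)\<^sup>2 / complex_of_real (x - (\<sigma> k)\<^sup>2))"

definition h :: "(nat \<Rightarrow> complex) \<Rightarrow> complex \<Rightarrow> complex" where
  "h v \<kappa> = \<kappa> * complex_of_real (a v ((cmod \<kappa>)\<^sup>2)) - b v ((cmod \<kappa>)\<^sup>2)"

text \<open>For fixed \<open>v\<close>, the bordered matrix with corner entry \<open>h v \<kappa>\<close> maps the conjugate of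
  \<open>(yy v \<kappa>, 1)\<close> to \<open>\<kappa> (yy v \<kappa>, 1)\<close>; thus \<open>h v\<close> is the change of variables from \<open>\<kappa>\<close> to the
  corner entry.\<close>
definition yy :: "(nat \<Rightarrow> complex) \<Rightarrow> complex \<Rightarrow> nat \<Rightarrow> complex" where
  "yy v \<kappa> k = (cnj \<kappa> * v k + complex_of_real (\<sigma> k) * cnj (v k)) / complex_of_real ((cmod \<kappa>)\<^sup>2 - (\<sigma> k)\<^sup>2)"

definition regular :: "real \<Rightarrow> bool" where "regular x \<longleftrightarrow> (\<forall>k<n. x \<noteq> (\<sigma> k)\<^sup>2)"

lemma D_symmetric: "symmetric_mat n D"
  unfolding symmetric_mat_def by (auto simp: mat_diag_def intro!: eq_matI)

lemma D_sum: "i < n \<Longrightarrow> (\<Sum>j<n. D $$ (i, j) * f j) = complex_of_real (\<sigma> i) * f i"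
  by (simp add: mat_diag_def if_distrib if_distribR cong: if_cong)

lemma h_eq: "h v \<kappa> = \<kappa> - (\<Sum>k<n. v k * cnj (yy v \<kappa> k))"
proof -
  have "v k * cnj (yy v \<kappa> k) = \<kappa> * complex_of_real ((cmod (v k))\<^sup>2 / ((cmod \<kappa>)\<^sup>2 - (\<sigma> k)\<^sup>2))
     + complex_of_real (\<sigma> k) * (v k)\<^sup>2 / complex_of_real ((cmod \<kappa>)\<^sup>2 - (\<sigma> k)\<^sup>2)" for k
  proof -
    have "complex_of_real ((cmod (v k))\<^sup>2 / d) = v k * cnj (v k) / complex_of_real d" for d
      by (simp only: of_real_divide complex_norm_square)
    then show ?thesis
      by (simp only: yy_def complex_cnj_divide complex_cnj_add complex_cnj_mult complex_cnj_cnj complex_cnj_complex_of_real)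
         (simp add: add_divide_distrib power2_eq_square distrib_left mult.commute mult.left_commute)
  qed
  then have "(\<Sum>k<n. v k * cnj (yy v \<kappa> k)) = \<kappa> * complex_of_real (\<Sum>k<n. (cmod (v k))\<^sup>2 / ((cmod \<kappa>)\<^sup>2 - (\<sigma> k)\<^sup>2)) + b v ((cmod \<kappa>)\<^sup>2)"
    by (simp only: b_def sum.distrib of_real_sum sum_distrib_left)
  then show ?thesis by (simp add: h_def a_def algebra_simps)
qed

text \<open>The real linear equation for y has determinant |\<kappa>|^2 - (\<sigma> k)^2.
  Multiplying it by \<open>cnj \<kappa>\<close> and adding \<sigma> k times its conjugate isolates
  y.\<close>

lemma yy_solves:
  assumes "k < n" "regular ((cmod \<kappa>)\<^sup>2)"
  shows "\<kappa> * yy v \<kappa> k - complex_of_real (\<sigma> k) * cnj (yy v \<kappa> k) = v k"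
proof -
  let ?d = "complex_of_real ((cmod \<kappa>)\<^sup>2 - (\<sigma> k)\<^sup>2)"
  have d: "?d \<noteq> 0" using assms unfolding of_real_eq_0_iff by (auto simp: regular_def)
  have dd: "?d = \<kappa> * cnj \<kappa> - complex_of_real (\<sigma> k) * complex_of_real (\<sigma> k)"
    unfolding of_real_diff complex_norm_square by (simp add: power2_eq_square)
  have "\<kappa> * yy v \<kappa> k - complex_of_real (\<sigma> k) * cnj (yy v \<kappa> k)
    = (\<kappa> * (cnj \<kappa> * v k + complex_of_real (\<sigma> k) * cnj (v k)) - complex_of_real (\<sigma> k) * (\<kappa> * cnj (v k) + complex_of_real (\<sigma> k) * v k)) / ?d"
    by (simp only: yy_def complex_cnj_divide complex_cnj_add complex_cnj_mult complex_cnj_cnj complex_cnj_complex_of_real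
        times_divide_eq_right diff_divide_distrib)
  also have "\<kappa> * (cnj \<kappa> * v k + complex_of_real (\<sigma> k) * cnj (v k)) - complex_of_real (\<sigma> k) * (\<kappa> * cnj (v k) + complex_of_real (\<sigma> k) * v k) = ?d * v k"
    unfolding dd by (simp add: algebra_simps)
  finally show ?thesis using d by simp
qed

lemma yy_unique:
  assumes "k < n" "regular ((cmod \<kappa>)\<^sup>2)" and eq: "\<kappa> * y - complex_of_real (\<sigma> k) * cnj y = v k"
  shows "yy v \<kappa> k = y"
proof -
  let ?d = "complex_of_real ((cmod \<kappa>)\<^sup>2 - (\<sigma> k)\<^sup>2)"
  have d: "?d \<noteq> 0" using assms unfolding of_real_eq_0_iff by (auto simp: regular_def)
  have dd: "?d = \<kappa> * cnj \<kappa> - complex_of_real (\<sigma> k) * complex_of_real (\<sigma> k)"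
    unfolding of_real_diff complex_norm_square by (simp add: power2_eq_square)
  have "cnj \<kappa> * v k + complex_of_real (\<sigma> k) * cnj (v k) = ?d * y"
    unfolding dd eq[symmetric] by (simp add: algebra_simps)
  then show ?thesis unfolding yy_def using d by simp
qed

lemma con_image_D: "i < n \<Longrightarrow> con_image n D \<kappa> y i = \<kappa> * y i - complex_of_real (\<sigma> i) * cnj (y i)"
  unfolding con_image_def by (simp only: D_sum)

lemma border_eq_con_mat:
  assumes "regular ((cmod \<kappa>)\<^sup>2)"
  shows "border n D v (h v \<kappa>) = con_mat n D \<kappa> (yy v \<kappa>)"
proof -
  have ci: "con_image n D \<kappa> (yy v \<kappa>) i = v i" if "i < n" for i
    using that assms by (simp add: con_image_D yy_solves)
  show ?thesis
    unfolding con_mat_def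
    by (rule eq_mat_SucI[of _ n]) (simp_all add: border_index ci h_eq)
qed

lemma con_mat_root:
  assumes K: "symmetric_mat m K"
  shows "poly (sing_poly (con_mat m K \<kappa> y)) (complex_of_real ((cmod \<kappa>)\<^sup>2)) = 0"
proof (rule singular_vector_root[of "Suc m" _ m "\<lambda>i. if i < m then y i else 1"])
  show "symmetric_mat (Suc m) (con_mat m K \<kappa> y)" unfolding con_mat_def by (rule symmetric_border[OF K])
  fix i assume "i < Suc m"
  then consider "i < m" | "i = m" by linarith
  then show "(\<Sum>k<Suc m. con_mat m K \<kappa> y $$ (i, k) * cnj (if k < m then y k else 1)) = \<kappa> * (if i < m then y i else 1)"
  proof cases
    case 1
    then show ?thesis by (simp add: con_mat_def border_index) (simp add: con_image_def)
  next
    case 2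
    then show ?thesis by (simp add: con_mat_def border_index)
  qed
qed auto

text \<open>Several \<kappa> can produce the same corner entry, generically one for each singular
  value. The spectral condition keeps the smallest modulus, and a nonzero \<open>a\<close> then
  determines the phase; together they make \<open>h v\<close> injective.\<close>

definition slice :: "(nat \<Rightarrow> complex) \<Rightarrow> complex set" where
  "slice v = {\<kappa>. regular ((cmod \<kappa>)\<^sup>2) \<and> a v ((cmod \<kappa>)\<^sup>2) \<noteq> 0 \<and> below_spectrum (border n D v (h v \<kappa>)) ((cmod \<kappa>)\<^sup>2)}"

text \<open>Both squared moduli are roots of the polynomial of one and the same matrix, and each is
  at most every root, so they agree. For equal modulus \<open>h v\<close> is affine in \<kappa> with
  slope \<open>a\<close>, which is nonzero.\<close>

lemma inj_on_h: "inj_on (h v) (slice v)"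
proof (rule inj_onI)
  fix \<kappa> \<kappa>' assume k: "\<kappa> \<in> slice v" "\<kappa>' \<in> slice v" and eq: "h v \<kappa> = h v \<kappa>'"
  have root: "poly (sing_poly (border n D v (h v \<mu>))) (complex_of_real ((cmod \<mu>)\<^sup>2)) = 0" if "\<mu> \<in> slice v" for \<mu>
    using that con_mat_root[OF D_symmetric] by (simp add: slice_def border_eq_con_mat)
  have "\<not> (cmod \<kappa>)\<^sup>2 < (cmod \<kappa>')\<^sup>2" "\<not> (cmod \<kappa>')\<^sup>2 < (cmod \<kappa>)\<^sup>2"
  proof -
    have 1: "below_spectrum (border n D v (h v \<kappa>)) ((cmod \<kappa>')\<^sup>2)" using k(2) unfolding slice_def eq by blast
    have 2: "below_spectrum (border n D v (h v \<kappa>)) ((cmod \<kappa>)\<^sup>2)" using k(1) unfolding slice_def by blast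
    show "\<not> (cmod \<kappa>)\<^sup>2 < (cmod \<kappa>')\<^sup>2"
      using 1 root[OF k(1)] unfolding below_spectrum_def by (metis zero_le_power2)
    show "\<not> (cmod \<kappa>')\<^sup>2 < (cmod \<kappa>)\<^sup>2"
      using 2 root[OF k(2)] unfolding below_spectrum_def eq by (metis zero_le_power2)
  qed
  then have x: "(cmod \<kappa>)\<^sup>2 = (cmod \<kappa>')\<^sup>2" by linarith
  have "\<kappa> * complex_of_real (a v ((cmod \<kappa>)\<^sup>2)) = \<kappa>' * complex_of_real (a v ((cmod \<kappa>)\<^sup>2))"
    using eq unfolding h_def x by simp
  moreover have "complex_of_real (a v ((cmod \<kappa>)\<^sup>2)) \<noteq> 0"
    using k(1) unfolding slice_def of_real_eq_0_iff by blast
  ultimately show "\<kappa> = \<kappa>'" by (metis mult_right_cancel)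
qed

text \<open>Clearing denominators turns \<open>a\<close> into the polynomial P. It is nonzero: at
  the square of \<sigma> 0 all terms but one vanish, and the survivor is nonzero since v 0 is
  nonzero and the \<sigma> j are distinct. For n = 0 it is 1.\<close>

lemma finite_zeros_a:
  assumes v: "\<And>k. k < n \<Longrightarrow> v k \<noteq> 0"
  shows "finite {x. regular x \<and> a v x = 0}"
proof -
  define P where "P = (\<Prod>k<n. [:- (\<sigma> k)\<^sup>2, 1:]) - (\<Sum>k<n. Polynomial.smult ((cmod (v k))\<^sup>2) (\<Prod>j\<in>{..<n} - {k}. [:- (\<sigma> j)\<^sup>2, 1:]))"
  have Pa: "poly P x = (\<Prod>k<n. x - (\<sigma> k)\<^sup>2) * a v x" if "regular x" for x
  proof -
    have "poly P x = (\<Prod>k<n. x - (\<sigma> k)\<^sup>2) - (\<Sum>k<n. (cmod (v k))\<^sup>2 * (\<Prod>j\<in>{..<n} - {k}. x - (\<sigma> j)\<^sup>2))"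
      by (simp add: P_def poly_prod poly_sum)
    also have "(\<Sum>k<n. (cmod (v k))\<^sup>2 * (\<Prod>j\<in>{..<n} - {k}. x - (\<sigma> j)\<^sup>2))
       = (\<Sum>k<n. (\<Prod>k<n. x - (\<sigma> k)\<^sup>2) * ((cmod (v k))\<^sup>2 / (x - (\<sigma> k)\<^sup>2)))"
    proof (rule sum.cong[OF refl])
      fix k assume k: "k \<in> {..<n}"
      then have "x - (\<sigma> k)\<^sup>2 \<noteq> 0" using that by (auto simp: regular_def)
      moreover have "(\<Prod>k<n. x - (\<sigma> k)\<^sup>2) = (x - (\<sigma> k)\<^sup>2) * (\<Prod>j\<in>{..<n} - {k}. x - (\<sigma> j)\<^sup>2)"
        using k by (intro prod.remove) auto
      ultimately show "(cmod (v k))\<^sup>2 * (\<Prod>j\<in>{..<n} - {k}. x - (\<sigma> j)\<^sup>2) = (\<Prod>k<n. x - (\<sigma> k)\<^sup>2) * ((cmod (v k))\<^sup>2 / (x - (\<sigma> k)\<^sup>2))"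
        by simp
    qed
    finally show ?thesis by (simp add: a_def right_diff_distrib sum_distrib_left)
  qed
  have "P \<noteq> 0"
  proof (cases n)
    case 0 then show ?thesis by (simp add: P_def)
  next
    case (Suc n')
    then have n: "0 < n" by simp
    have "poly P ((\<sigma> 0)\<^sup>2) = - ((cmod (v 0))\<^sup>2 * (\<Prod>j\<in>{..<n} - {0}. (\<sigma> 0)\<^sup>2 - (\<sigma> j)\<^sup>2))"
    proof -
      have "(\<Prod>k<n. (\<sigma> 0)\<^sup>2 - (\<sigma> k)\<^sup>2) = 0" using n by (intro prod_zero) auto
      moreover have "(\<Sum>k<n. (cmod (v k))\<^sup>2 * (\<Prod>j\<in>{..<n} - {k}. (\<sigma> 0)\<^sup>2 - (\<sigma> j)\<^sup>2))
        = (\<Sum>k\<in>{0}. (cmod (v k))\<^sup>2 * (\<Prod>j\<in>{..<n} - {k}. (\<sigma> 0)\<^sup>2 - (\<sigma> j)\<^sup>2))"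
      proof (rule sum.mono_neutral_right)
        show "\<forall>k\<in>{..<n} - {0}. (cmod (v k))\<^sup>2 * (\<Prod>j\<in>{..<n} - {k}. (\<sigma> 0)\<^sup>2 - (\<sigma> j)\<^sup>2) = 0"
        proof
          fix k assume "k \<in> {..<n} - {0}"
          then have "(\<Prod>j\<in>{..<n} - {k}. (\<sigma> 0)\<^sup>2 - (\<sigma> j)\<^sup>2) = 0" using n by (intro prod_zero bexI[of _ 0]) auto
          then show "(cmod (v k))\<^sup>2 * (\<Prod>j\<in>{..<n} - {k}. (\<sigma> 0)\<^sup>2 - (\<sigma> j)\<^sup>2) = 0" by simp
        qed
      qed (use n in auto)
      ultimately show ?thesis by (simp add: P_def poly_prod poly_sum)
    qed
    moreover have "(\<sigma> 0)\<^sup>2 - (\<sigma> j)\<^sup>2 \<noteq> 0" if "j \<in> {..<n} - {0}" for j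
    proof -
      have "\<sigma> 0 \<noteq> \<sigma> j" using that n inj_onD[OF \<sigma>_inj, of 0 j] by auto
      then show ?thesis using \<sigma>_pos[of 0] \<sigma>_pos[of j] that n by (auto simp: power2_eq_iff)
    qed
    ultimately have "poly P ((\<sigma> 0)\<^sup>2) \<noteq> 0" using v[OF n] by auto
    then show ?thesis by auto
  qed
  then have "finite {x. poly P x = 0}" by (rule poly_roots_finite)
  then show ?thesis by (rule finite_subset[rotated]) (auto simp: Pa)
qed

text \<open>Corner entries whose matrix has the singular value \<sigma> k must be discarded, since
  there \<open>yy\<close> has a pole. Row k of the singular vector equation says that v k conj(z n)
  is \<sigma> k (z k - conj(z k)), hence purely imaginary. So z n is fixed up to a real scale r, the
  other rows fix z j for j different from k, and Im (z k) is fixed as well. Only the real part p of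
  z k is free after scaling, and the last row then places c on a real line. The scale is nonzero,
  because z n = 0 would force every entry to vanish.\<close>

lemma exceptional_line:
  assumes v: "\<And>k. k < n \<Longrightarrow> v k \<noteq> 0" and k: "k < n"
  shows "\<exists>C. \<forall>c. poly (sing_poly (border n D v c)) (complex_of_real ((\<sigma> k)\<^sup>2)) = 0 \<longrightarrow> Re (c / (v k)\<^sup>2) = C"
proof -
  \<comment> \<open>The values of z n, of z j, and of the constant part of the last row for the
    vector scaled so that v k conj(z n) is the imaginary unit. None of them depends on c.\<close>
  define \<zeta>0 where "\<zeta>0 = cnj (\<i> / v k)"
  define Z where "Z j = (complex_of_real (\<sigma> k) * (v j * cnj \<zeta>0) + complex_of_real (\<sigma> j) * cnj (v j * cnj \<zeta>0)) / complex_of_real ((\<sigma> k)\<^sup>2 - (\<sigma> j)\<^sup>2)" for j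
  define R where "R = complex_of_real (\<sigma> k) * \<zeta>0 - (\<Sum>j\<in>{..<n} - {k}. v j * cnj (Z j)) + \<i> * v k / complex_of_real (2 * \<sigma> k)"
  have sk: "\<sigma> k > 0" using \<sigma>_pos[OF k] .
  have vk: "v k \<noteq> 0" using v[OF k] .
  have sne: "(\<sigma> k)\<^sup>2 - (\<sigma> j)\<^sup>2 \<noteq> 0" if "j < n" "j \<noteq> k" for j
  proof -
    have "\<sigma> k \<noteq> \<sigma> j" using that k inj_onD[OF \<sigma>_inj, of k j] by auto
    then show ?thesis using sk \<sigma>_pos[of j] that by (auto simp: power2_eq_iff)
  qed
  show ?thesis
  proof (intro exI[of _ "Re (- \<i> / v k * R)"] allI impI)
    fix c assume root: "poly (sing_poly (border n D v c)) (complex_of_real ((\<sigma> k)\<^sup>2)) = 0"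
    let ?H = "border n D v c"
    obtain z i0 where i0: "i0 < Suc n" "z i0 \<noteq> 0"
      and Hz: "\<And>i. i < Suc n \<Longrightarrow> (\<Sum>l<Suc n. ?H $$ (i, l) * cnj (z l)) = complex_of_real (sqrt ((\<sigma> k)\<^sup>2)) * z i"
      using exists_singular_vector[OF symmetric_border[OF D_symmetric] _ root] by auto
    have Hrow: "complex_of_real (\<sigma> i) * cnj (z i) + v i * cnj (z n) = complex_of_real (\<sigma> k) * z i" if i: "i < n" for i
    proof -
      have "(\<Sum>l<Suc n. ?H $$ (i, l) * cnj (z l)) = (\<Sum>l<n. D $$ (i, l) * cnj (z l)) + v i * cnj (z n)"
        using i by (simp add: border_index)
      then show ?thesis using Hz[of i] i sk by (simp add: D_sum)
    qed
    have Hlast: "(\<Sum>l<n. v l * cnj (z l)) + c * cnj (z n) = complex_of_real (\<sigma> k) * z n"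
      using Hz[of n] sk by (simp add: border_index)
    have solve: "w = (complex_of_real (\<sigma> k) * e + complex_of_real (\<sigma> j) * cnj e) / complex_of_real ((\<sigma> k)\<^sup>2 - (\<sigma> j)\<^sup>2)"
      if j: "j < n" "j \<noteq> k" and eq: "complex_of_real (\<sigma> j) * cnj w + e = complex_of_real (\<sigma> k) * w" for j w e
    proof -
      have e: "e = complex_of_real (\<sigma> k) * w - complex_of_real (\<sigma> j) * cnj w" using eq by (simp add: algebra_simps)
      have "complex_of_real (\<sigma> k) * e + complex_of_real (\<sigma> j) * cnj e = complex_of_real ((\<sigma> k)\<^sup>2 - (\<sigma> j)\<^sup>2) * w"
        unfolding e by (simp add: algebra_simps power2_eq_square)
      moreover have "complex_of_real ((\<sigma> k)\<^sup>2 - (\<sigma> j)\<^sup>2) \<noteq> 0" using sne[OF j] unfolding of_real_eq_0_iff .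
      ultimately show ?thesis by (metis nonzero_mult_div_cancel_left)
    qed
    have zn: "z n \<noteq> 0"
    proof
      assume 0: "z n = 0"
      have zj: "z j = 0" if "j < n" "j \<noteq> k" for j
        using solve[OF that, of "z j" 0] Hrow[OF that(1)] 0 by simp
      have "(\<Sum>l<n. v l * cnj (z l)) = v k * cnj (z k)"
        using k zj by (subst sum.remove[of _ k]) auto
      then have "z k = 0" using Hlast 0 vk by simp
      then show False using i0 zj 0 by (metis less_Suc_eq)
    qed
    \<comment> \<open>Chosen so that v k conj(z n) is r times the imaginary unit; dividing by r
      normalizes the singular vector.\<close>
    define r where "r = 2 * \<sigma> k * Im (z k)"
    have vr: "v k * cnj (z n) = \<i> * complex_of_real r"
    proof -
      have "v k * cnj (z n) = complex_of_real (\<sigma> k) * (z k - cnj (z k))" using Hrow[OF k] by (simp add: algebra_simps)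
      also have "\<dots> = \<i> * complex_of_real r" by (simp add: r_def complex_eq_iff)
      finally show ?thesis .
    qed
    then have r: "r \<noteq> 0" using zn vk by auto
    have r': "complex_of_real r \<noteq> 0" using r by simp
    have zeta: "z n / complex_of_real r = \<zeta>0"
    proof -
      have "cnj (z n) = \<i> * complex_of_real r / v k" using vr vk by (simp add: field_simps)
      then have "z n = cnj (\<i> / v k) * complex_of_real r"
        by (metis (no_types, lifting) complex_cnj_cnj complex_cnj_complex_of_real complex_cnj_mult times_divide_eq_left)
      then show ?thesis using r' by (simp add: \<zeta>0_def)
    qed
    have zZ: "z j / complex_of_real r = Z j" if j: "j < n" "j \<noteq> k" for j
      unfolding Z_def
    proof (rule solve[OF j])
      have "(complex_of_real (\<sigma> j) * cnj (z j) + v j * cnj (z n)) / complex_of_real r = complex_of_real (\<sigma> k) * z j / complex_of_real r"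
        using Hrow[OF j(1)] by simp
      then show "complex_of_real (\<sigma> j) * cnj (z j / complex_of_real r) + v j * cnj \<zeta>0 = complex_of_real (\<sigma> k) * (z j / complex_of_real r)"
        unfolding zeta[symmetric] by (simp add: add_divide_distrib)
    qed
    define p where "p = Re (z k) / r"
    have zk: "z k / complex_of_real r = complex_of_real p + \<i> / complex_of_real (2 * \<sigma> k)"
      using r sk by (simp add: complex_eq_iff p_def r_def Re_divide_of_real Im_divide_of_real)
    have "((\<Sum>l<n. v l * cnj (z l)) + c * cnj (z n)) / complex_of_real r = complex_of_real (\<sigma> k) * z n / complex_of_real r"
      using Hlast by simp
    then have e1: "(\<Sum>l<n. v l * cnj (z l / complex_of_real r)) + c * cnj \<zeta>0 = complex_of_real (\<sigma> k) * \<zeta>0"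
      unfolding zeta[symmetric] by (simp add: add_divide_distrib sum_divide_distrib)
    have e2: "(\<Sum>l<n. v l * cnj (z l / complex_of_real r))
      = v k * cnj (complex_of_real p + \<i> / complex_of_real (2 * \<sigma> k)) + (\<Sum>j\<in>{..<n} - {k}. v j * cnj (Z j))"
    proof -
      have "(\<Sum>l<n. v l * cnj (z l / complex_of_real r)) = v k * cnj (z k / complex_of_real r) + (\<Sum>j\<in>{..<n} - {k}. v j * cnj (z j / complex_of_real r))"
        using k by (intro sum.remove) auto
      also have "(\<Sum>j\<in>{..<n} - {k}. v j * cnj (z j / complex_of_real r)) = (\<Sum>j\<in>{..<n} - {k}. v j * cnj (Z j))"
        by (intro sum.cong refl) (simp add: zZ[symmetric])
      finally show ?thesis unfolding zk .
    qed
    have "c * cnj \<zeta>0 = complex_of_real (\<sigma> k) * \<zeta>0 - (\<Sum>l<n. v l * cnj (z l / complex_of_real r))"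
      using e1 by (metis add_diff_cancel_left')
    also have "\<dots> = complex_of_real (\<sigma> k) * \<zeta>0 - (\<Sum>j\<in>{..<n} - {k}. v j * cnj (Z j))
        - v k * cnj (complex_of_real p + \<i> / complex_of_real (2 * \<sigma> k))" unfolding e2 by (simp add: algebra_simps)
    also have "\<dots> = R - v k * complex_of_real p" by (simp add: R_def algebra_simps)
    finally have "c * cnj \<zeta>0 = R - v k * complex_of_real p" .
    then have "c * \<i> / v k = R - v k * complex_of_real p" by (simp add: \<zeta>0_def)
    then have "c / (v k)\<^sup>2 = - \<i> / v k * (R - v k * complex_of_real p)"
    proof -
      assume *: "c * \<i> / v k = R - v k * complex_of_real p"
      have "- \<i> / v k * (c * \<i> / v k) = c / (v k)\<^sup>2" using vk by (simp add: field_simps power2_eq_square)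
      then show ?thesis unfolding * by simp
    qed
    also have "\<dots> = - \<i> / v k * R + \<i> * complex_of_real p" using vk by (simp add: field_simps)
    finally show "Re (c / (v k)\<^sup>2) = Re (- \<i> / v k * R)" by simp
  qed
qed

text \<open>For generic c the preimage comes from a singular vector z for the least squared singular
  value x. Its last entry is nonzero: otherwise \<sigma> i |z i| = sqrt x |z i| for all i < n, and x
  would be some (\<sigma> i)^2. Rescaling the last entry to 1 then exhibits c as a value of
  \<open>h v\<close>.\<close>

lemma slice_image:
  assumes v: "\<And>k. k < n \<Longrightarrow> v k \<noteq> 0"
  shows "\<exists>N\<in>null_sets lborel. - N \<subseteq> h v ` slice v"
proof -
  have "\<forall>k. \<exists>C. k < n \<longrightarrow> (\<forall>c. poly (sing_poly (border n D v c)) (complex_of_real ((\<sigma> k)\<^sup>2)) = 0 \<longrightarrow> Re (c / (v k)\<^sup>2) = C)"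
    using exceptional_line[of v, OF v] by blast
  from choice[OF this] obtain C where
    C: "\<And>k c. k < n \<Longrightarrow> poly (sing_poly (border n D v c)) (complex_of_real ((\<sigma> k)\<^sup>2)) = 0 \<Longrightarrow> Re (c / (v k)\<^sup>2) = C k"
    by blast
  \<comment> \<open>Two kinds of exceptional corner entries: the lines on which x could hit a pole,
    and the finitely many values to which \<open>h v\<close> collapses where \<open>a\<close> is
    zero.\<close>
  define N where "N = (\<Union>k\<in>{..<n}. {c. Re (c / (v k)\<^sup>2) = C k}) \<union> (\<lambda>x. - b v x) ` {x. regular x \<and> a v x = 0}"
  have "N \<in> null_sets lborel"
    unfolding N_def
  proof (intro null_sets.Un null_sets_UN' countable_finite)
    show "(\<lambda>x. - b v x) ` {x. regular x \<and> a v x = 0} \<in> null_sets lborel"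
      by (intro finite_imp_null_set_lborel finite_imageI finite_zeros_a v)
  qed (use v in \<open>auto intro!: null_sets_Re_line\<close>)
  moreover have "c \<in> h v ` slice v" if c: "c \<notin> N" for c
  proof -
    let ?H = "border n D v c"
    have Hs: "symmetric_mat (Suc n) ?H" by (rule symmetric_border[OF D_symmetric])
    obtain U s where U: "unitary_mat (Suc n) U" and "?H = U * mat_diag (Suc n) (\<lambda>i. complex_of_real (s i)) * transpose_mat U"
      using takagi_factorization[OF Hs] by blast
    then have sp: "sing_poly ?H = (\<Prod>i<Suc n. [:- complex_of_real ((s i)\<^sup>2), 1:])" by (simp only: sing_poly_takagi)
    define x where "x = Min ((\<lambda>i. (s i)\<^sup>2) ` {..<Suc n})"
    have "x \<in> (\<lambda>i. (s i)\<^sup>2) ` {..<Suc n}" unfolding x_def by (intro Min_in) auto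
    then obtain i1 where i1: "i1 < Suc n" "x = (s i1)\<^sup>2" by auto
    have x_le: "x \<le> (s i)\<^sup>2" if "i < Suc n" for i unfolding x_def using that by (intro Min_le) auto
    have bs: "below_spectrum ?H x" using below_spectrum_iff[OF sp] x_le by auto
    have x0: "x \<ge> 0" using i1 by simp
    have root: "poly (sing_poly ?H) (complex_of_real x) = 0"
      unfolding sp poly_prod_linear using i1 by (intro prod_zero bexI[of _ i1]) auto
    have reg: "regular x"
      unfolding regular_def
    proof (intro allI impI notI)
      fix k assume k: "k < n" and xk: "x = (\<sigma> k)\<^sup>2"
      have "Re (c / (v k)\<^sup>2) = C k" by (rule C[OF k root[unfolded xk]])
      then show False using c k unfolding N_def by blast
    qed
    obtain z i0 where i0: "i0 < Suc n" "z i0 \<noteq> 0"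
      and Hz: "\<And>i. i < Suc n \<Longrightarrow> (\<Sum>l<Suc n. ?H $$ (i, l) * cnj (z l)) = complex_of_real (sqrt x) * z i"
      using exists_singular_vector[OF Hs x0 root] by blast
    have Hrow: "complex_of_real (\<sigma> i) * cnj (z i) + v i * cnj (z n) = complex_of_real (sqrt x) * z i" if i: "i < n" for i
    proof -
      have "(\<Sum>l<Suc n. ?H $$ (i, l) * cnj (z l)) = (\<Sum>l<n. D $$ (i, l) * cnj (z l)) + v i * cnj (z n)"
        using i by (simp add: border_index)
      then show ?thesis using Hz[of i] i by (simp add: D_sum)
    qed
    have Hlast: "(\<Sum>l<n. v l * cnj (z l)) + c * cnj (z n) = complex_of_real (sqrt x) * z n"
      using Hz[of n] by (simp add: border_index)
    have zn: "z n \<noteq> 0"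
    proof
      assume 0: "z n = 0"
      have "z i = 0" if i: "i < n" for i
      proof (rule ccontr)
        assume nz: "z i \<noteq> 0"
        have "complex_of_real (\<sigma> i) * cnj (z i) = complex_of_real (sqrt x) * z i" using Hrow[OF i] 0 by simp
        then have "cmod (complex_of_real (\<sigma> i) * cnj (z i)) = cmod (complex_of_real (sqrt x) * z i)" by (rule arg_cong)
        then have "\<sigma> i = sqrt x" using nz \<sigma>_pos[OF i] x0 by (simp add: norm_mult)
        then have "x = (\<sigma> i)\<^sup>2" using x0 by simp
        then show False using reg i by (auto simp: regular_def)
      qed
      then show False using i0 0 by (metis less_Suc_eq)
    qed
    have cn: "cnj (z n) \<noteq> 0" using zn by simp
    \<comment> \<open>Dividing z by z n divides the conjugated argument by conj(z n), and the
      mismatch of the two turns sqrt x into this phased value of the same modulus.\<close>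
    define \<kappa> where "\<kappa> = complex_of_real (sqrt x) * z n / cnj (z n)"
    have kx: "(cmod \<kappa>)\<^sup>2 = x" using zn x0 by (simp add: \<kappa>_def norm_divide norm_mult)
    have reg': "regular ((cmod \<kappa>)\<^sup>2)" using reg kx by simp
    have yz: "yy v \<kappa> i = z i / z n" if i: "i < n" for i
    proof (rule yy_unique[OF i reg'])
      have "v i = (complex_of_real (sqrt x) * z i - complex_of_real (\<sigma> i) * cnj (z i)) / cnj (z n)"
        using Hrow[OF i] cn by (simp add: field_simps)
      also have "\<dots> = \<kappa> * (z i / z n) - complex_of_real (\<sigma> i) * cnj (z i / z n)"
        using zn by (simp add: \<kappa>_def diff_divide_distrib)
      finally show "\<kappa> * (z i / z n) - complex_of_real (\<sigma> i) * cnj (z i / z n) = v i" by simp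
    qed
    have hc: "h v \<kappa> = c"
    proof -
      have "(\<Sum>k<n. v k * cnj (yy v \<kappa> k)) = (\<Sum>k<n. v k * cnj (z k)) / cnj (z n)"
        unfolding sum_divide_distrib by (intro sum.cong refl) (simp add: yz)
      moreover have "(\<Sum>k<n. v k * cnj (z k)) = complex_of_real (sqrt x) * z n - c * cnj (z n)"
        using Hlast by (simp add: algebra_simps)
      ultimately show ?thesis unfolding h_eq \<kappa>_def using cn by (simp add: diff_divide_distrib)
    qed
    have "a v x \<noteq> 0"
    proof
      assume "a v x = 0"
      then have "c = - b v x" using hc unfolding h_def kx by simp
      then show False using c reg \<open>a v x = 0\<close> unfolding N_def by blast
    qed
    then have "\<kappa> \<in> slice v" unfolding slice_def using reg kx bs hc by simp
    then show ?thesis using hc by blast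
  qed
  ultimately show ?thesis by blast
qed

end

text \<open>The Jacobian of the passage from (y, \<kappa>) to the last column, cut off where
  |\<kappa>|^2 is not the least squared singular value, so that almost every matrix is counted
  once.\<close>

definition con_weight :: "nat \<Rightarrow> complex mat \<Rightarrow> complex \<Rightarrow> (nat \<Rightarrow> complex) \<Rightarrow> ennreal" where
  "con_weight n K \<kappa> y = (if below_spectrum (con_mat n K \<kappa> y) ((cmod \<kappa>)\<^sup>2)
     then ennreal ((1 + (\<Sum>i<n. (cmod (y i))\<^sup>2)) * cmod (corner_minor n (con_mat n K \<kappa> y) ((cmod \<kappa>)\<^sup>2))) else 0)"

lemma con_image_cong: "(\<And>i. i < n \<Longrightarrow> y i = y' i) \<Longrightarrow> i < n \<Longrightarrow> con_image n K \<kappa> y i = con_image n K \<kappa> y' i"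
  unfolding con_image_def by (auto intro!: sum.cong)

lemma con_mat_cong:
  assumes "\<And>i. i < n \<Longrightarrow> y i = y' i"
  shows "con_mat n K \<kappa> y = con_mat n K \<kappa> y'"
proof -
  have "(\<Sum>i<n. con_image n K \<kappa> y i * cnj (y i)) = (\<Sum>i<n. con_image n K \<kappa> y' i * cnj (y' i))"
    using assms con_image_cong[of n y y', OF assms] by (intro sum.cong) auto
  then show ?thesis
    unfolding con_mat_def using con_image_cong[of n y y', OF assms]
    by (intro eq_mat_SucI[of _ n]) (simp_all add: border_index)
qed

lemma borel_measurable_con_weight:
  assumes K: "mat_measurable N n K" and sym: "\<And>z. z \<in> space N \<Longrightarrow> symmetric_mat n (K z)"
    and \<kappa>: "\<kappa> \<in> borel_measurable N" and y: "\<And>i. i < n \<Longrightarrow> (\<lambda>z. y z i) \<in> borel_measurable N"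
  shows "(\<lambda>z. con_weight n (K z) (\<kappa> z) (y z)) \<in> borel_measurable N"
  unfolding con_weight_def
proof (rule measurable_If)
  note H = mat_measurable_con_mat[OF K \<kappa> y]
  have k2[measurable]: "(\<lambda>z. (cmod (\<kappa> z))\<^sup>2) \<in> borel_measurable N" using \<kappa> by measurable
  note [measurable] = borel_measurable_corner_minor[OF H k2]
  have [measurable]: "(\<lambda>z. \<Sum>i<n. (cmod (y z i))\<^sup>2) \<in> borel_measurable N"
    using y by (intro borel_measurable_sum borel_measurable_power borel_measurable_norm) auto
  show "(\<lambda>z. ennreal ((1 + (\<Sum>i<n. (cmod (y z i))\<^sup>2)) * cmod (corner_minor n (con_mat n (K z) (\<kappa> z) (y z)) ((cmod (\<kappa> z))\<^sup>2)))) \<in> borel_measurable N"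
    by measurable
  show "{z \<in> space N. below_spectrum (con_mat n (K z) (\<kappa> z) (y z)) ((cmod (\<kappa> z))\<^sup>2)} \<in> sets N"
    using sym by (intro measurable_below_spectrum[OF H _ k2]) (auto simp: con_mat_def intro!: symmetric_border)
qed simp

section \<open>Jacobians over a diagonal block\<close>

context diagonal_slice
begin

text \<open>The derivative of \<open>h\<close> in the variable |\<kappa>|^2 with the explicit factor
  \<kappa> held fixed. By the chain rule the Wirtinger coefficients of \<open>h\<close> are
  \<open>a\<close> plus \<open>cc\<close> times conj(\<kappa>), and \<open>cc\<close> times
  \<kappa>.\<close>

definition cc :: "(nat \<Rightarrow> complex) \<Rightarrow> complex \<Rightarrow> complex" where
  "cc v \<kappa> = (\<Sum>k<n. (\<kappa> * complex_of_real ((cmod (v k))\<^sup>2) + complex_of_real (\<sigma> k) * (v k)\<^sup>2) / (complex_of_real ((cmod \<kappa>)\<^sup>2 - (\<sigma> k)\<^sup>2))\<^sup>2)"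

lemma h_has_derivative:
  assumes reg: "regular ((cmod \<kappa>)\<^sup>2)"
  shows "(h v has_derivative (\<lambda>\<zeta>. (complex_of_real (a v ((cmod \<kappa>)\<^sup>2)) + cc v \<kappa> * cnj \<kappa>) * \<zeta> + (cc v \<kappa> * \<kappa>) * cnj \<zeta>)) (at \<kappa>)"
proof -
  define p where "p k = complex_of_real ((cmod (v k))\<^sup>2)" for k
  define q where "q k = complex_of_real (\<sigma> k) * (v k)\<^sup>2" for k
  define s where "s k = complex_of_real ((\<sigma> k)\<^sup>2)" for k
  define X where "X k = \<kappa> * cnj \<kappa> - s k" for k
  have X_eq: "complex_of_real ((cmod z)\<^sup>2 - (\<sigma> k)\<^sup>2) = z * cnj z - s k" for z k
    unfolding of_real_diff complex_norm_square s_def ..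
  have Xnz: "X k \<noteq> 0" if "k < n" for k
    unfolding X_def X_eq[symmetric] of_real_eq_0_iff using reg that by (auto simp: regular_def)
  have h_form: "h v = (\<lambda>z. z - (\<Sum>k<n. (z * p k + q k) * inverse (z * cnj z - s k)))"
  proof
    fix z
    have e1: "complex_of_real (a v ((cmod z)\<^sup>2)) = 1 - (\<Sum>k<n. p k * inverse (z * cnj z - s k))"
      unfolding a_def of_real_diff of_real_sum of_real_divide X_eq[symmetric] p_def by (simp add: divide_inverse)
    have e2: "b v ((cmod z)\<^sup>2) = (\<Sum>k<n. q k * inverse (z * cnj z - s k))"
      unfolding b_def X_eq q_def by (simp add: divide_inverse)
    show "h v z = z - (\<Sum>k<n. (z * p k + q k) * inverse (z * cnj z - s k))"
      unfolding h_def e1 e2 by (simp add: algebra_simps sum.distrib sum_distrib_left)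
  qed
  have dcnj: "(cnj has_derivative cnj) (at \<kappa>)"
    by (rule bounded_linear_imp_has_derivative[OF bounded_linear_cnj])
  have dX: "((\<lambda>z. z * cnj z - s k) has_derivative (\<lambda>\<zeta>. \<kappa> * cnj \<zeta> + \<zeta> * cnj \<kappa>)) (at \<kappa>)" for k
    using has_derivative_diff[OF has_derivative_mult[OF has_derivative_ident dcnj] has_derivative_const] by simp
  have dlin: "((\<lambda>z. z * p k + q k) has_derivative (\<lambda>\<zeta>. \<zeta> * p k)) (at \<kappa>)" for k
    using has_derivative_add[OF has_derivative_mult_left[OF has_derivative_ident] has_derivative_const] by simp
  have dterm: "((\<lambda>z. (z * p k + q k) * inverse (z * cnj z - s k)) has_derivative
      (\<lambda>\<zeta>. (\<kappa> * p k + q k) * - (inverse (X k) * (\<kappa> * cnj \<zeta> + \<zeta> * cnj \<kappa>) * inverse (X k)) + \<zeta> * p k * inverse (X k))) (at \<kappa>)"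
    if "k < n" for k
    using has_derivative_mult[OF dlin[of k] Deriv.has_derivative_inverse[OF _ dX[of k]]] Xnz[OF that] unfolding X_def by simp
  have "(h v has_derivative (\<lambda>\<zeta>. \<zeta> - (\<Sum>k<n. (\<kappa> * p k + q k) * - (inverse (X k) * (\<kappa> * cnj \<zeta> + \<zeta> * cnj \<kappa>) * inverse (X k)) + \<zeta> * p k * inverse (X k)))) (at \<kappa>)"
    unfolding h_form using dterm by (intro has_derivative_diff has_derivative_ident has_derivative_sum) auto
  moreover have "(\<lambda>\<zeta>. \<zeta> - (\<Sum>k<n. (\<kappa> * p k + q k) * - (inverse (X k) * (\<kappa> * cnj \<zeta> + \<zeta> * cnj \<kappa>) * inverse (X k)) + \<zeta> * p k * inverse (X k)))
    = (\<lambda>\<zeta>. (complex_of_real (a v ((cmod \<kappa>)\<^sup>2)) + cc v \<kappa> * cnj \<kappa>) * \<zeta> + (cc v \<kappa> * \<kappa>) * cnj \<zeta>)"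
  proof
    fix \<zeta>
    have 1: "complex_of_real (a v ((cmod \<kappa>)\<^sup>2)) = 1 - (\<Sum>k<n. p k * inverse (X k))"
      unfolding a_def of_real_diff of_real_sum of_real_divide X_def X_eq[symmetric] p_def by (simp add: divide_inverse)
    have 2: "cc v \<kappa> = (\<Sum>k<n. (\<kappa> * p k + q k) * (inverse (X k) * inverse (X k)))"
      unfolding cc_def X_eq X_def p_def q_def by (simp add: divide_inverse power2_eq_square)
    have "(complex_of_real (a v ((cmod \<kappa>)\<^sup>2)) + cc v \<kappa> * cnj \<kappa>) * \<zeta> + (cc v \<kappa> * \<kappa>) * cnj \<zeta>
      = \<zeta> - (\<Sum>k<n. p k * inverse (X k)) * \<zeta> + cc v \<kappa> * (cnj \<kappa> * \<zeta> + \<kappa> * cnj \<zeta>)"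
      unfolding 1 by (simp add: algebra_simps)
    also have "\<dots> = \<zeta> - ((\<Sum>k<n. p k * inverse (X k) * \<zeta>) - (\<Sum>k<n. (\<kappa> * p k + q k) * (inverse (X k) * inverse (X k)) * (cnj \<kappa> * \<zeta> + \<kappa> * cnj \<zeta>)))"
      unfolding 2 sum_distrib_right by simp
    also have "(\<Sum>k<n. p k * inverse (X k) * \<zeta>) - (\<Sum>k<n. (\<kappa> * p k + q k) * (inverse (X k) * inverse (X k)) * (cnj \<kappa> * \<zeta> + \<kappa> * cnj \<zeta>))
      = (\<Sum>k<n. (\<kappa> * p k + q k) * - (inverse (X k) * (\<kappa> * cnj \<zeta> + \<zeta> * cnj \<kappa>) * inverse (X k)) + \<zeta> * p k * inverse (X k))"
      unfolding sum_subtractf[symmetric] by (intro sum.cong refl) (simp add: mult.commute mult.left_commute add.commute)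
    finally show "\<zeta> - (\<Sum>k<n. (\<kappa> * p k + q k) * - (inverse (X k) * (\<kappa> * cnj \<zeta> + \<zeta> * cnj \<kappa>) * inverse (X k)) + \<zeta> * p k * inverse (X k))
      = (complex_of_real (a v ((cmod \<kappa>)\<^sup>2)) + cc v \<kappa> * cnj \<kappa>) * \<zeta> + (cc v \<kappa> * \<kappa>) * cnj \<zeta>" by simp
  qed
  ultimately show ?thesis by simp
qed

text \<open>The terms |cc|^2 |\<kappa>|^2 cancel, leaving a times a + 2 Re (cc conj(\<kappa>)).
  Summing the squared moduli of \<open>yy\<close>, written over the squared denominators, identifies
  this second factor as 1 + |y|^2.\<close>

lemma h_jacobian:
  assumes reg: "regular ((cmod \<kappa>)\<^sup>2)"
  shows "(cmod (complex_of_real (a v ((cmod \<kappa>)\<^sup>2)) + cc v \<kappa> * cnj \<kappa>))\<^sup>2 - (cmod (cc v \<kappa> * \<kappa>))\<^sup>2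
    = a v ((cmod \<kappa>)\<^sup>2) * (1 + (\<Sum>k<n. (cmod (yy v \<kappa> k))\<^sup>2))"
proof -
  define x where "x = (cmod \<kappa>)\<^sup>2"
  have sq: "(cmod (complex_of_real t + w))\<^sup>2 = t * t + 2 * t * Re w + (cmod w)\<^sup>2" for t w
    unfolding cmod_power2 by (simp add: power2_eq_square algebra_simps)
  have yterm: "(cmod (yy v \<kappa> k))\<^sup>2 = 2 * Re ((\<kappa> * complex_of_real ((cmod (v k))\<^sup>2) + complex_of_real (\<sigma> k) * (v k)\<^sup>2) / (complex_of_real (x - (\<sigma> k)\<^sup>2))\<^sup>2 * cnj \<kappa>)
      - (cmod (v k))\<^sup>2 / (x - (\<sigma> k)\<^sup>2)" if k: "k < n" for k
  proof -
    define d where "d = x - (\<sigma> k)\<^sup>2"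
    have d: "d \<noteq> 0" using reg k by (auto simp: d_def x_def regular_def)
    have num: "(cmod (cnj \<kappa> * v k + complex_of_real (\<sigma> k) * cnj (v k)))\<^sup>2
       = 2 * Re ((\<kappa> * complex_of_real ((cmod (v k))\<^sup>2) + complex_of_real (\<sigma> k) * (v k)\<^sup>2) * cnj \<kappa>) - (cmod (v k))\<^sup>2 * d"
      unfolding d_def x_def cmod_power2 by (simp add: power2_eq_square algebra_simps)
    have "(cmod (yy v \<kappa> k))\<^sup>2 = (cmod (cnj \<kappa> * v k + complex_of_real (\<sigma> k) * cnj (v k)))\<^sup>2 / d\<^sup>2"
      unfolding yy_def d_def x_def norm_divide power_divide norm_of_real by simp
    also have "\<dots> = 2 * (Re ((\<kappa> * complex_of_real ((cmod (v k))\<^sup>2) + complex_of_real (\<sigma> k) * (v k)\<^sup>2) * cnj \<kappa>) / d\<^sup>2) - (cmod (v k))\<^sup>2 / d"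
      unfolding num using d by (simp add: diff_divide_distrib power2_eq_square)
    also have "Re ((\<kappa> * complex_of_real ((cmod (v k))\<^sup>2) + complex_of_real (\<sigma> k) * (v k)\<^sup>2) * cnj \<kappa>) / d\<^sup>2
      = Re ((\<kappa> * complex_of_real ((cmod (v k))\<^sup>2) + complex_of_real (\<sigma> k) * (v k)\<^sup>2) / (complex_of_real d)\<^sup>2 * cnj \<kappa>)"
      by (metis Re_divide_of_real of_real_power times_divide_eq_left)
    finally show ?thesis unfolding d_def by simp
  qed
  have "1 + (\<Sum>k<n. (cmod (yy v \<kappa> k))\<^sup>2) = a v x + 2 * Re (cc v \<kappa> * cnj \<kappa>)"
  proof -
    have "(\<Sum>k<n. (cmod (yy v \<kappa> k))\<^sup>2) = (\<Sum>k<n. 2 * Re ((\<kappa> * complex_of_real ((cmod (v k))\<^sup>2) + complex_of_real (\<sigma> k) * (v k)\<^sup>2) / (complex_of_real (x - (\<sigma> k)\<^sup>2))\<^sup>2 * cnj \<kappa>)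
      - (cmod (v k))\<^sup>2 / (x - (\<sigma> k)\<^sup>2))"
      by (intro sum.cong refl) (simp only: yterm lessThan_iff)
    also have "\<dots> = 2 * Re (cc v \<kappa> * cnj \<kappa>) - (\<Sum>k<n. (cmod (v k))\<^sup>2 / (x - (\<sigma> k)\<^sup>2))"
      unfolding sum_subtractf sum_distrib_left[symmetric] Re_sum[symmetric] sum_distrib_right[symmetric] cc_def x_def ..
    finally show ?thesis by (simp add: a_def)
  qed
  then show ?thesis unfolding sq x_def[symmetric]
    by (simp add: norm_mult power_mult_distrib algebra_simps)
qed

text \<open>The leading block of the matrix times its adjoint is D squared plus the rank one matrix
  formed from the last column, so the rank one determinant formula applies.\<close>

lemma corner_minor_con_mat:
  assumes reg: "regular ((cmod \<kappa>)\<^sup>2)"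
  shows "corner_minor n (con_mat n D \<kappa> y) ((cmod \<kappa>)\<^sup>2)
    = complex_of_real ((\<Prod>k<n. (cmod \<kappa>)\<^sup>2 - (\<sigma> k)\<^sup>2) * a (con_image n D \<kappa> y) ((cmod \<kappa>)\<^sup>2))"
proof -
  define x where "x = (cmod \<kappa>)\<^sup>2"
  define v where "v = con_image n D \<kappa> y"
  let ?H = "con_mat n D \<kappa> y"
  define d where "d i = complex_of_real (x - (\<sigma> i)\<^sup>2)" for i
  have HH: "(?H * mat_adjoint ?H) $$ (i, j) = (if i = j then complex_of_real ((\<sigma> i)\<^sup>2) else 0) + v i * cnj (v j)"
    if "i < n" "j < n" for i j
  proof -
    have "(?H * mat_adjoint ?H) $$ (i, j) = (\<Sum>k<Suc n. ?H $$ (i, k) * cnj (?H $$ (j, k)))"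
      using that by (subst index_mult_mat_sum[of _ "Suc n" "Suc n" _ "Suc n"])
        (auto simp: mat_adjoint_index[of _ "Suc n" "Suc n"] con_mat_def)
    also have "\<dots> = (\<Sum>k<n. D $$ (i, k) * cnj (D $$ (j, k))) + v i * cnj (v j)"
      using that by (simp add: con_mat_def border_index v_def)
    also have "(\<Sum>k<n. D $$ (i, k) * cnj (D $$ (j, k))) = complex_of_real (\<sigma> i) * cnj (D $$ (j, i))"
      using that by (simp only: D_sum)
    also have "\<dots> = (if i = j then complex_of_real ((\<sigma> i)\<^sup>2) else 0)"
      using that by (simp add: mat_diag_def power2_eq_square)
    finally show ?thesis .
  qed
  have "corner_minor n ?H x = det (mat n n (\<lambda>(i, j). (if i = j then d i else 0) - v i * cnj (v j)))"
    unfolding corner_minor_def by (intro arg_cong[where f=det] eq_matI) (auto simp: HH d_def simp del: index_mult_mat(1))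
  also have "\<dots> = (\<Prod>i<n. d i) * (1 - (\<Sum>i<n. v i * cnj (v i) / d i))"
  proof (rule det_diag_minus_rank_one)
    show "d i \<noteq> 0" if "i < n" for i
      unfolding d_def of_real_eq_0_iff using reg that by (auto simp: regular_def x_def)
  qed
  also have "1 - (\<Sum>i<n. v i * cnj (v i) / d i) = complex_of_real (a v x)"
    unfolding a_def d_def of_real_diff[of 1] of_real_sum of_real_divide complex_norm_square by simp
  also have "(\<Prod>i<n. d i) = complex_of_real (\<Prod>k<n. x - (\<sigma> k)\<^sup>2)" unfolding d_def of_real_prod ..
  finally show ?thesis unfolding x_def v_def of_real_mult .
qed

lemma AE_regular: "AE \<kappa> in lborel. regular ((cmod \<kappa>)\<^sup>2)"
proof -
  have "(\<Union>k\<in>{..<n}. sphere 0 (\<sigma> k)) \<in> null_sets (lborel :: complex measure)"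
  proof (intro null_sets_UN' countable_finite)
    fix k
    have "negligible (sphere (0::complex) (\<sigma> k))" by (rule negligible_sphere)
    then show "sphere (0::complex) (\<sigma> k) \<in> null_sets lborel"
      by (simp add: negligible_iff_null_sets null_sets_completion_iff borel_closed)
  qed simp
  then show ?thesis
  proof (rule AE_I')
    show "{\<kappa> \<in> space lborel. \<not> regular ((cmod \<kappa>)\<^sup>2)} \<subseteq> (\<Union>k\<in>{..<n}. sphere 0 (\<sigma> k))"
    proof
      fix \<kappa> assume "\<kappa> \<in> {\<kappa> \<in> space lborel. \<not> regular ((cmod \<kappa>)\<^sup>2)}"
      then obtain k where k: "k < n" "(cmod \<kappa>)\<^sup>2 = (\<sigma> k)\<^sup>2" unfolding regular_def by blast
      have "cmod \<kappa> = \<sigma> k"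
        by (rule power2_eq_imp_eq[OF k(2) norm_ge_zero less_imp_le[OF \<sigma>_pos[OF k(1)]]])
      then show "\<kappa> \<in> (\<Union>k\<in>{..<n}. sphere 0 (\<sigma> k))" using k by auto
    qed
  qed
qed

text \<open>Two substitutions in turn. For fixed v the corner entry becomes
  \<open>h v \<kappa>\<close>, with Jacobian a (1 + |y|^2). After exchanging the integrals, for
  fixed \<kappa> the column v is expressed through y, with Jacobian the product of the |\<kappa>|^2
  - (\<sigma> i)^2. That product times \<open>a\<close> is the leading minor, so the two Jacobians
  combine to \<open>con_weight\<close>.\<close>

lemma nn_integral_diagonal_slice:
  assumes \<Phi>: "sym_measurable (Suc n) \<Phi>"
  shows "(\<integral>\<^sup>+v. \<integral>\<^sup>+c. \<Phi> (border n D v c) \<partial>lborel \<partial>cleb {..<n})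
    = (\<integral>\<^sup>+\<kappa>. \<integral>\<^sup>+y. con_weight n D \<kappa> y * \<Phi> (con_mat n D \<kappa> y) \<partial>cleb {..<n} \<partial>lborel)"
proof -
  let ?M = "cleb {..<n} \<Otimes>\<^sub>M (lborel :: complex measure)"
  interpret finite_product_sigma_finite "\<lambda>_::nat. lborel :: complex measure" "{..<n}" by standard simp
  interpret pair: pair_sigma_finite "cleb {..<n}" "lborel :: complex measure" by standard
  define J where "J v \<kappa> = a v ((cmod \<kappa>)\<^sup>2) * (1 + (\<Sum>k<n. (cmod (yy v \<kappa> k))\<^sup>2))" for v \<kappa>
  define G where "G v \<kappa> = \<Phi> (border n D v (h v \<kappa>)) * ennreal \<bar>J v \<kappa>\<bar> * indicator (slice v) \<kappa>" for v \<kappa>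
  have comp[measurable]: "(\<lambda>z. fst z k) \<in> borel_measurable ?M" if "k < n" for k
    using that measurable_compose[OF measurable_fst measurable_component_singleton[of k "{..<n}" "\<lambda>_. lborel :: complex measure"], of "lborel :: complex measure"] by simp
  have a_meas: "(\<lambda>z. a (fst z) ((cmod (snd z))\<^sup>2)) \<in> borel_measurable ?M"
    unfolding a_def by measurable
  have h_meas: "(\<lambda>z. h (fst z) (snd z)) \<in> borel_measurable ?M"
    unfolding h_def b_def using a_meas by measurable
  have J_meas: "(\<lambda>z. J (fst z) (snd z)) \<in> borel_measurable ?M"
    unfolding J_def yy_def using a_meas by measurable
  have Dm: "mat_measurable N n (\<lambda>_. D)" for N :: "'z measure" unfolding mat_measurable_def by auto
  have B_meas: "mat_measurable ?M (Suc n) (\<lambda>z. border n D (fst z) (h (fst z) (snd z)))"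
    by (intro mat_measurable_border Dm h_meas comp)
  have B_sym: "symmetric_mat (Suc n) (border n D v c)" for v c by (rule symmetric_border[OF D_symmetric])
  have slice_meas: "{z \<in> space ?M. snd z \<in> slice (fst z)} \<in> sets ?M"
  proof -
    have "{z \<in> space ?M. below_spectrum (border n D (fst z) (h (fst z) (snd z))) ((cmod (snd z))\<^sup>2)} \<in> sets ?M"
      by (rule measurable_below_spectrum[OF B_meas B_sym]) measurable
    moreover have "{z \<in> space ?M. a (fst z) ((cmod (snd z))\<^sup>2) \<noteq> 0} \<in> sets ?M" using a_meas by measurable
    moreover have "{z \<in> space ?M. regular ((cmod (snd z))\<^sup>2)} \<in> sets ?M"
    proof -
      have "{z \<in> space ?M. \<forall>k\<in>{..<n}. (cmod (snd z))\<^sup>2 \<noteq> (\<sigma> k)\<^sup>2} \<in> sets ?M"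
        by (intro sets.sets_Collect_finite_All) measurable
      then show ?thesis unfolding regular_def by (simp only: Ball_def lessThan_iff)
    qed
    moreover have "{z \<in> space ?M. snd z \<in> slice (fst z)} = {z \<in> space ?M. below_spectrum (border n D (fst z) (h (fst z) (snd z))) ((cmod (snd z))\<^sup>2)}
       \<inter> ({z \<in> space ?M. a (fst z) ((cmod (snd z))\<^sup>2) \<noteq> 0} \<inter> {z \<in> space ?M. regular ((cmod (snd z))\<^sup>2)})"
      by (auto simp: slice_def)
    ultimately show ?thesis by (simp only: sets.Int)
  qed
  have G_meas: "(\<lambda>z. G (fst z) (snd z)) \<in> borel_measurable ?M"
  proof -
    have "(\<lambda>z. indicator (slice (fst z)) (snd z) :: ennreal) \<in> borel_measurable ?M"
    proof -
      have "(\<lambda>z. indicator (slice (fst z)) (snd z) :: ennreal) = (\<lambda>z. if snd z \<in> slice (fst z) then 1 else 0)"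
        by (auto simp: indicator_def)
      then show ?thesis using slice_meas by (auto intro!: measurable_If)
    qed
    moreover have "(\<lambda>z. \<Phi> (border n D (fst z) (h (fst z) (snd z)))) \<in> borel_measurable ?M"
      by (rule sym_measurable_compose[OF \<Phi> B_meas B_sym])
    ultimately show ?thesis unfolding G_def using J_meas by measurable
  qed
  have sect: "(\<lambda>\<kappa>. f (v, \<kappa>)) \<in> borel_measurable borel" if "f \<in> borel_measurable ?M" "v \<in> space (cleb {..<n})" for f :: "_ \<Rightarrow> 'q::topological_space" and v
    using measurable_compose[OF measurable_Pair1'[OF that(2)] that(1)] by simp
  have inner: "(\<integral>\<^sup>+c. \<Phi> (border n D v c) \<partial>lborel) = (\<integral>\<^sup>+\<kappa>. G v \<kappa> \<partial>lborel)"
    if vs: "v \<in> space (cleb {..<n})" and v0: "\<forall>k\<in>{..<n}. v k \<noteq> 0" for v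
  proof -
    obtain N where N: "N \<in> null_sets lborel" "- N \<subseteq> h v ` slice v" using slice_image[of v] v0 by blast
    define A where "A \<kappa> = complex_of_real (a v ((cmod \<kappa>)\<^sup>2)) + cc v \<kappa> * cnj \<kappa>" for \<kappa>
    define B where "B \<kappa> = cc v \<kappa> * \<kappa>" for \<kappa>
    have am[measurable]: "(\<lambda>\<kappa>. a v ((cmod \<kappa>)\<^sup>2)) \<in> borel_measurable borel" using sect[OF a_meas vs] by simp
    have ccm[measurable]: "cc v \<in> borel_measurable borel" unfolding cc_def[abs_def] by measurable
    have hm: "h v \<in> borel_measurable borel" using sect[OF h_meas vs] by simp
    have sl: "slice v \<in> sets borel"
      using measurable_sets[OF measurable_Pair1'[OF vs, of "lborel :: complex measure"] slice_meas] vs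
      by (simp add: vimage_def space_pair_measure)
    have "(\<integral>\<^sup>+c. \<Phi> (border n D v c) \<partial>lborel)
      = (\<integral>\<^sup>+\<kappa>. \<Phi> (border n D v (h v \<kappa>)) * ennreal \<bar>(cmod (A \<kappa>))\<^sup>2 - (cmod (B \<kappa>))\<^sup>2\<bar> * indicator (slice v) \<kappa> \<partial>lborel)"
    proof (rule nn_integral_complex_change_of_variables[OF sl hm _ _ _ inj_on_h N])
      show "A \<in> borel_measurable borel" "B \<in> borel_measurable borel"
        unfolding A_def[abs_def] B_def[abs_def] by measurable
      show "(h v has_derivative (\<lambda>\<zeta>. A z * \<zeta> + B z * cnj \<zeta>)) (at z)" if "z \<in> slice v" for z
        unfolding A_def B_def using that by (intro h_has_derivative) (simp add: slice_def)
      show "(\<lambda>c. \<Phi> (border n D v c)) \<in> borel_measurable borel"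
        by (intro sym_measurable_compose[OF \<Phi>] mat_measurable_border Dm B_sym) auto
    qed
    also have "\<dots> = (\<integral>\<^sup>+\<kappa>. G v \<kappa> \<partial>lborel)"
      unfolding G_def A_def B_def J_def
      by (intro nn_integral_cong) (auto simp: slice_def h_jacobian split: split_indicator)
    finally show ?thesis .
  qed
  \<comment> \<open>Columns with a zero entry form a null set, so the covering statement
    \<open>slice_image\<close> is available for almost every v.\<close>
  have "(\<integral>\<^sup>+v. \<integral>\<^sup>+c. \<Phi> (border n D v c) \<partial>lborel \<partial>cleb {..<n}) = (\<integral>\<^sup>+v. \<integral>\<^sup>+\<kappa>. G v \<kappa> \<partial>lborel \<partial>cleb {..<n})"
    by (rule nn_integral_cong_AE, rule AE_mp[OF AE_PiM_nonzero[OF finite_lessThan]], rule AE_I2, rule impI, rule inner)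
  also have "\<dots> = (\<integral>\<^sup>+\<kappa>. \<integral>\<^sup>+v. G v \<kappa> \<partial>cleb {..<n} \<partial>lborel)"
    by (rule pair.Fubini'[symmetric]) (use G_meas in \<open>simp add: case_prod_beta'\<close>)
  also have "\<dots> = (\<integral>\<^sup>+\<kappa>. \<integral>\<^sup>+y. con_weight n D \<kappa> y * \<Phi> (con_mat n D \<kappa> y) \<partial>cleb {..<n} \<partial>lborel)"
  proof (rule nn_integral_cong_AE, rule AE_mp[OF AE_regular], rule AE_I2, rule impI)
    fix \<kappa> :: complex assume reg: "regular ((cmod \<kappa>)\<^sup>2)"
    define x where "x = (cmod \<kappa>)\<^sup>2"
    \<comment> \<open>For fixed \<kappa> the passage from y to v acts on each coordinate separately
      by a real linear map of determinant |\<kappa>|^2 - (\<sigma> i)^2.\<close>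
    let ?v = "\<lambda>y. \<lambda>i\<in>{..<n}. \<kappa> * y i + (- complex_of_real (\<sigma> i)) * cnj (y i)"
    have Gk: "(\<lambda>v. G v \<kappa>) \<in> borel_measurable (cleb {..<n})"
      using measurable_compose[OF measurable_Pair2'[of \<kappa> lborel "cleb {..<n}"] G_meas] by simp
    have "(\<integral>\<^sup>+v. G v \<kappa> \<partial>cleb {..<n}) = (\<integral>\<^sup>+y. G (?v y) \<kappa> \<partial>cleb {..<n}) * (\<Prod>i<n. ennreal \<bar>x - (\<sigma> i)\<^sup>2\<bar>)"
    proof (rule nn_integral_PiM_componentwise[symmetric, OF _ _ _ Gk])
      fix i and g :: "complex \<Rightarrow> ennreal" assume i: "i \<in> {..<n}" and g: "g \<in> borel_measurable borel"
      have "(cmod \<kappa>)\<^sup>2 \<noteq> (cmod (- complex_of_real (\<sigma> i)))\<^sup>2" using reg i by (simp add: regular_def)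
      from nn_integral_complex_real_linear[OF this g]
      show "(\<integral>\<^sup>+z. g (\<kappa> * z + (- complex_of_real (\<sigma> i)) * cnj z) \<partial>lborel) * ennreal \<bar>x - (\<sigma> i)\<^sup>2\<bar> = (\<integral>\<^sup>+z. g z \<partial>lborel)"
        by (simp add: x_def)
    qed auto
    also have "\<dots> = (\<integral>\<^sup>+y. G (?v y) \<kappa> * (\<Prod>i<n. ennreal \<bar>x - (\<sigma> i)\<^sup>2\<bar>) \<partial>cleb {..<n})"
    proof (rule nn_integral_multc[symmetric])
      have "?v \<in> measurable (cleb {..<n}) (cleb {..<n})"
      proof (rule measurable_restrict)
        fix i assume i: "i \<in> {..<n}"
        have [measurable]: "(\<lambda>y. y i) \<in> borel_measurable (cleb {..<n})"
          using measurable_component_singleton[OF i, of "\<lambda>_. lborel :: complex measure"] by simp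
        show "(\<lambda>y. \<kappa> * y i + (- complex_of_real (\<sigma> i)) * cnj (y i)) \<in> measurable (cleb {..<n}) lborel" by simp
      qed
      then show "(\<lambda>y. G (?v y) \<kappa>) \<in> borel_measurable (cleb {..<n})" using Gk by (rule measurable_compose)
    qed
    also have "\<dots> = (\<integral>\<^sup>+y. con_weight n D \<kappa> y * \<Phi> (con_mat n D \<kappa> y) \<partial>cleb {..<n})"
    proof (rule nn_integral_cong)
      fix y :: "nat \<Rightarrow> complex"
      have vi: "?v y i = con_image n D \<kappa> y i" if "i < n" for i using that by (simp add: con_image_D)
      have yi: "yy (?v y) \<kappa> i = y i" if "i < n" for i
        using that reg by (intro yy_unique) auto
      have a_eq: "a (?v y) x = a (con_image n D \<kappa> y) x"
        unfolding a_def using vi by (intro arg_cong2[where f="(-)"] refl sum.cong) auto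
      have H_eq: "border n D (?v y) (h (?v y) \<kappa>) = con_mat n D \<kappa> y"
        unfolding border_eq_con_mat[OF reg] by (rule con_mat_cong) (rule yi)
      have yy_sum: "(\<Sum>k<n. (cmod (yy (?v y) \<kappa> k))\<^sup>2) = (\<Sum>k<n. (cmod (y k))\<^sup>2)" using yi by (intro sum.cong) auto
      define S where "S = 1 + (\<Sum>k<n. (cmod (y k))\<^sup>2)"
      have S: "S \<ge> 0" unfolding S_def by (intro add_nonneg_nonneg sum_nonneg) auto
      have minor: "cmod (corner_minor n (con_mat n D \<kappa> y) ((cmod \<kappa>)\<^sup>2)) = (\<Prod>i<n. \<bar>x - (\<sigma> i)\<^sup>2\<bar>) * \<bar>a (?v y) x\<bar>"
        by (simp only: corner_minor_con_mat[OF reg, folded x_def] norm_of_real abs_mult abs_prod a_eq x_def[symmetric])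
      have prod: "(\<Prod>i<n. ennreal \<bar>x - (\<sigma> i)\<^sup>2\<bar>) = ennreal (\<Prod>i<n. \<bar>x - (\<sigma> i)\<^sup>2\<bar>)" by (rule prod_ennreal) simp
      have sl: "\<kappa> \<in> slice (?v y) \<longleftrightarrow> a (?v y) x \<noteq> 0 \<and> below_spectrum (con_mat n D \<kappa> y) ((cmod \<kappa>)\<^sup>2)"
        unfolding slice_def mem_Collect_eq H_eq x_def using reg by blast
      define v0 where "v0 = ?v y"
      define P where "P = (\<Prod>i<n. \<bar>x - (\<sigma> i)\<^sup>2\<bar>)"
      define \<alpha> where "\<alpha> = a v0 x"
      define mm where "mm = cmod (corner_minor n (con_mat n D \<kappa> y) ((cmod \<kappa>)\<^sup>2))"
      have P: "P \<ge> 0" unfolding P_def by (intro prod_nonneg) auto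
      have mm: "mm = P * \<bar>\<alpha>\<bar>" unfolding mm_def P_def \<alpha>_def v0_def by (rule minor)
      have Jv: "J v0 \<kappa> = \<alpha> * S" unfolding J_def v0_def yy_sum S_def \<alpha>_def x_def ..
      have sl': "\<kappa> \<in> slice v0 \<longleftrightarrow> \<alpha> \<noteq> 0 \<and> below_spectrum (con_mat n D \<kappa> y) ((cmod \<kappa>)\<^sup>2)"
        unfolding v0_def \<alpha>_def by (rule sl)
      have eqn: "ennreal \<bar>J v0 \<kappa>\<bar> * ennreal P = ennreal (S * mm)"
        unfolding Jv mm using S P by (simp add: abs_mult ac_simps flip: ennreal_mult)
      have cw: "con_weight n D \<kappa> y = (if below_spectrum (con_mat n D \<kappa> y) ((cmod \<kappa>)\<^sup>2) then ennreal (S * mm) else 0)"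
        unfolding con_weight_def mm_def S_def ..
      have "G v0 \<kappa> * ennreal P = con_weight n D \<kappa> y * \<Phi> (con_mat n D \<kappa> y)"
      proof (cases "\<kappa> \<in> slice v0")
        case True
        have "G v0 \<kappa> = \<Phi> (con_mat n D \<kappa> y) * ennreal \<bar>J v0 \<kappa>\<bar>"
          unfolding G_def using True H_eq by (simp add: v0_def)
        then show ?thesis using True sl' unfolding cw eqn[symmetric] by (simp only: if_True ac_simps)
      next
        case False
        then have "G v0 \<kappa> = 0" unfolding G_def by simp
        moreover have "con_weight n D \<kappa> y = 0"
        \<comment> \<open>The slice excludes the zeros of \<open>a\<close> while
          \<open>con_weight\<close> does not test for them, but there the leading minor vanishes
          anyway.\<close>
        proof (cases "\<alpha> = 0")
          case True
          then show ?thesis unfolding cw mm by simp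
        next
          case F: False
          then show ?thesis using False sl' unfolding cw by simp
        qed
        ultimately show ?thesis by simp
      qed
      then show "G (?v y) \<kappa> * (\<Prod>i<n. ennreal \<bar>x - (\<sigma> i)\<^sup>2\<bar>) = con_weight n D \<kappa> y * \<Phi> (con_mat n D \<kappa> y)"
        unfolding prod P_def[symmetric] v0_def .
    qed
    finally show "(\<integral>\<^sup>+v. G v \<kappa> \<partial>cleb {..<n}) = (\<integral>\<^sup>+y. con_weight n D \<kappa> y * \<Phi> (con_mat n D \<kappa> y) \<partial>cleb {..<n})" .
  qed
  finally show ?thesis .
qed

end

section \<open>From a diagonal block to a general one\<close>

lemma nn_integral_PiM_unitary:
  assumes U: "unitary_mat n U" and g: "g \<in> borel_measurable (cleb {..<n})"
  shows "(\<integral>\<^sup>+y. g (\<lambda>i\<in>{..<n}. \<Sum>k<n. U $$ (i, k) * y k) \<partial>cleb {..<n}) = (\<integral>\<^sup>+y. g y \<partial>cleb {..<n})"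
proof -
  let ?T = "\<lambda>W y. \<lambda>i\<in>{..<n}. \<Sum>k<n. W $$ (i, k) * y k :: complex"
  note Uc = unitary_matD(1)[OF U]
  show ?thesis
  proof (rule nn_integral_PiM_isometry[where T="?T U" and T'="?T (mat_adjoint U)" and w="\<lambda>_. 1"])
    show "?T U \<in> measurable (cleb {..<n}) (cleb {..<n})"
      by (rule measurable_restrict) simp
    show "?T U (?T (mat_adjoint U) x) = x" if x: "x \<in> space (cleb {..<n})" for x
    proof
      fix i
      show "?T U (?T (mat_adjoint U) x) i = x i"
      proof (cases "i < n")
        case True
        have "?T U (?T (mat_adjoint U) x) i = (\<Sum>k<n. U $$ (i, k) * (\<Sum>l<n. cnj (U $$ (l, k)) * x l))"
          using True Uc by (simp add: mat_adjoint_index[of _ n n])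
        also have "\<dots> = (\<Sum>l<n. (\<Sum>k<n. U $$ (i, k) * cnj (U $$ (l, k))) * x l)"
          unfolding sum_distrib_left sum_distrib_right by (subst sum.swap) (simp only: mult.assoc)
        also have "\<dots> = (\<Sum>l<n. (if i = l then 1 else 0) * x l)"
          using True by (intro sum.cong refl arg_cong2[where f="(*)"]) (simp only: unitary_mat_rows[OF U] lessThan_iff)
        also have "\<dots> = x i" using True by (simp add: if_distrib if_distribR cong: if_cong)
        finally show ?thesis .
      next
        case False
        then show ?thesis using x by (auto simp: space_PiM PiE_iff extensional_def)
      qed
    qed
    show "?T U (\<lambda>i\<in>{..<n}. x i + y i) = (\<lambda>i\<in>{..<n}. ?T U x i + ?T U y i)" for x y
      by (auto simp: fun_eq_iff distrib_left sum.distrib)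
    show "(\<Sum>i<n. 1 * (cmod (?T U x i))\<^sup>2) = (\<Sum>i<n. 1 * (cmod (x i))\<^sup>2)" for x
      using unitary_mat_preserves_norm[OF U, of x] by simp
  qed (use g in \<open>auto simp: space_PiM\<close>)
qed

lemma con_weight_congruence:
  assumes U: "unitary_mat n U" and K: "K \<in> carrier_mat n n"
  shows "con_weight n (U * K * transpose_mat U) \<kappa> (\<lambda>i\<in>{..<n}. \<Sum>k<n. U $$ (i, k) * y k) = con_weight n K \<kappa> y"
    and "unitarily_invariant (Suc n) \<Phi> \<Longrightarrow> symmetric_mat n K \<Longrightarrow>
      \<Phi> (con_mat n (U * K * transpose_mat U) \<kappa> (\<lambda>i\<in>{..<n}. \<Sum>k<n. U $$ (i, k) * y k)) = \<Phi> (con_mat n K \<kappa> y)"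
proof -
  have C: "con_mat n (U * K * transpose_mat U) \<kappa> (\<lambda>i\<in>{..<n}. \<Sum>k<n. U $$ (i, k) * y k)
    = border n U (\<lambda>_. 0) 1 * con_mat n K \<kappa> y * transpose_mat (border n U (\<lambda>_. 0) 1)"
    unfolding con_mat_congruence[OF U K, symmetric] by (rule con_mat_cong) simp
  have cc: "con_mat n K \<kappa> y \<in> carrier_mat (Suc n) (Suc n)" by (simp add: con_mat_def)
  have s: "(\<Sum>i<n. (cmod ((\<lambda>i\<in>{..<n}. \<Sum>k<n. U $$ (i, k) * y k) i))\<^sup>2) = (\<Sum>i<n. (cmod (y i))\<^sup>2)"
    using unitary_mat_preserves_norm[OF U, of y] by simp
  show "con_weight n (U * K * transpose_mat U) \<kappa> (\<lambda>i\<in>{..<n}. \<Sum>k<n. U $$ (i, k) * y k) = con_weight n K \<kappa> y"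
    unfolding con_weight_def C s below_spectrum_congruence[OF unitary_border[OF U] cc] corner_minor_congruence[OF U cc] ..
  show "\<Phi> (con_mat n (U * K * transpose_mat U) \<kappa> (\<lambda>i\<in>{..<n}. \<Sum>k<n. U $$ (i, k) * y k)) = \<Phi> (con_mat n K \<kappa> y)"
    if "unitarily_invariant (Suc n) \<Phi>" "symmetric_mat n K"
    unfolding C using that unitary_border[OF U] symmetric_border[OF that(2)]
    by (simp add: unitarily_invariant_def con_mat_def del: assoc_mult_mat)
qed

text \<open>Rotating the last column on one side and y on the other by the Takagi unitary of K
  preserves the measures, and by equivariance it replaces K by its diagonal form.\<close>

lemma nn_integral_slice:
  assumes \<Phi>: "sym_measurable (Suc n) \<Phi>" and inv: "unitarily_invariant (Suc n) \<Phi>"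
    and U: "unitary_mat n U" and K: "K = U * mat_diag n (\<lambda>i. complex_of_real (\<sigma> i)) * transpose_mat U"
    and pos: "\<And>i. i < n \<Longrightarrow> \<sigma> i > 0" and inj: "inj_on \<sigma> {..<n}"
  shows "(\<integral>\<^sup>+v. \<integral>\<^sup>+c. \<Phi> (border n K v c) \<partial>lborel \<partial>cleb {..<n})
    = (\<integral>\<^sup>+\<kappa>. \<integral>\<^sup>+y. con_weight n K \<kappa> y * \<Phi> (con_mat n K \<kappa> y) \<partial>cleb {..<n} \<partial>lborel)"
proof -
  interpret diagonal_slice n \<sigma> using pos inj by unfold_locales auto
  note Uc = unitary_matD(1)[OF U]
  have Dc: "D \<in> carrier_mat n n" by simp
  have Ks: "symmetric_mat n K" unfolding K by (rule symmetric_congruence[OF D_symmetric Uc])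
  have Km: "mat_measurable N n (\<lambda>_. K)" for N :: "'z measure" using Ks by (auto simp: mat_measurable_def symmetric_mat_def)
  let ?T = "\<lambda>y. \<lambda>i\<in>{..<n}. \<Sum>k<n. U $$ (i, k) * y k"
  have "(\<integral>\<^sup>+v. \<integral>\<^sup>+c. \<Phi> (border n K v c) \<partial>lborel \<partial>cleb {..<n}) = (\<integral>\<^sup>+v. \<integral>\<^sup>+c. \<Phi> (border n K (?T v) c) \<partial>lborel \<partial>cleb {..<n})"
  proof (rule nn_integral_PiM_unitary[OF U, symmetric])
    have "(\<lambda>z. \<Phi> (border n K (fst z) (snd z))) \<in> borel_measurable (cleb {..<n} \<Otimes>\<^sub>M lborel)"
    proof (rule sym_measurable_compose[OF \<Phi>])
      show "mat_measurable (cleb {..<n} \<Otimes>\<^sub>M lborel) (Suc n) (\<lambda>z. border n K (fst z) (snd z))"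
      proof (intro mat_measurable_border Km)
        fix i assume "i < n"
        then show "(\<lambda>z. fst z i) \<in> borel_measurable (cleb {..<n} \<Otimes>\<^sub>M (lborel :: complex measure))"
          using measurable_compose[OF measurable_fst measurable_component_singleton[of i "{..<n}" "\<lambda>_. lborel :: complex measure"], of "lborel :: complex measure"] by simp
      qed simp
    qed (rule symmetric_border[OF Ks])
    then show "(\<lambda>v. \<integral>\<^sup>+c. \<Phi> (border n K v c) \<partial>lborel) \<in> borel_measurable (cleb {..<n})"
      by (intro lborel.borel_measurable_nn_integral) (simp add: case_prod_beta')
  qed
  also have "\<dots> = (\<integral>\<^sup>+v. \<integral>\<^sup>+c. \<Phi> (border n D v c) \<partial>lborel \<partial>cleb {..<n})"
  proof (intro nn_integral_cong)
    fix v :: "nat \<Rightarrow> complex" and c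
    have "border n K (?T v) c = border n K (\<lambda>i. \<Sum>k<n. U $$ (i, k) * v k) c"
      by (rule eq_mat_SucI[of _ n]) (auto simp: border_index)
    also have "\<dots> = border n U (\<lambda>_. 0) 1 * border n D v c * transpose_mat (border n U (\<lambda>_. 0) 1)"
      unfolding K by (rule border_congruence[OF Uc Dc, symmetric])
    finally show "\<Phi> (border n K (?T v) c) = \<Phi> (border n D v c)"
      using inv unitary_border[OF U] symmetric_border[OF D_symmetric]
      by (simp add: unitarily_invariant_def del: assoc_mult_mat)
  qed
  also have "\<dots> = (\<integral>\<^sup>+\<kappa>. \<integral>\<^sup>+y. con_weight n D \<kappa> y * \<Phi> (con_mat n D \<kappa> y) \<partial>cleb {..<n} \<partial>lborel)"
    by (rule nn_integral_diagonal_slice[OF \<Phi>])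
  also have "\<dots> = (\<integral>\<^sup>+\<kappa>. \<integral>\<^sup>+y. con_weight n K \<kappa> (?T y) * \<Phi> (con_mat n K \<kappa> (?T y)) \<partial>cleb {..<n} \<partial>lborel)"
    unfolding K con_weight_congruence(1)[OF U Dc] con_weight_congruence(2)[OF U Dc inv D_symmetric] ..
  also have "\<dots> = (\<integral>\<^sup>+\<kappa>. \<integral>\<^sup>+y. con_weight n K \<kappa> y * \<Phi> (con_mat n K \<kappa> y) \<partial>cleb {..<n} \<partial>lborel)"
  proof (rule nn_integral_cong, rule nn_integral_PiM_unitary[OF U])
    fix \<kappa> :: complex
    have y: "(\<lambda>y. y i) \<in> borel_measurable (cleb {..<n})" if "i < n" for i
      using measurable_component_singleton[of i "{..<n}" "\<lambda>_. lborel :: complex measure"] that by simp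
    show "(\<lambda>y. con_weight n K \<kappa> y * \<Phi> (con_mat n K \<kappa> y)) \<in> borel_measurable (cleb {..<n})"
      by (intro borel_measurable_times_ennreal borel_measurable_con_weight Km Ks y sym_measurable_compose[OF \<Phi>] mat_measurable_con_mat)
         (auto simp: con_mat_def intro!: symmetric_border Ks)
  qed
  finally show ?thesis .
qed

abbreviation rleb :: "nat \<Rightarrow> (nat \<Rightarrow> real) measure" where
  "rleb n \<equiv> PiM {..<n} (\<lambda>_. lborel)"

subsection \<open>Integration in singular values\<close>

definition sqrt_diag :: "nat \<Rightarrow> (nat \<Rightarrow> real) \<Rightarrow> complex mat" where
  "sqrt_diag n s = mat_diag n (\<lambda>i. complex_of_real (sqrt (s i)))"

definition decreasing_pos :: "nat \<Rightarrow> (nat \<Rightarrow> real) \<Rightarrow> bool" where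
  "decreasing_pos n s \<longleftrightarrow> (\<forall>i j. i < j \<longrightarrow> j < n \<longrightarrow> s j < s i) \<and> (\<forall>i<n. 0 < s i)"

text \<open>The factor for j arises when the size grows from j to j + 1: pi^j / j! from the integral
  over y, and a further pi from the phase of \<kappa>.\<close>

definition vol_const :: "nat \<Rightarrow> real" where
  "vol_const n = (\<Prod>j<n. pi ^ Suc j / fact j)"

definition simple_spectrum :: "nat \<Rightarrow> complex mat \<Rightarrow> bool" where
  "simple_spectrum n A \<longleftrightarrow> (\<exists>s. inj_on s {..<n} \<and> (\<forall>j<n. 0 < s j) \<and> sing_poly A = (\<Prod>j<n. [:- complex_of_real (s j), 1:]))"

text \<open>Unique factorization: any two lists of roots agree as multisets, so distinctness and
  positivity may be tested on whichever list is at hand.\<close>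

lemma simple_spectrum_iff:
  fixes n :: nat
  assumes r: "sing_poly A = (\<Prod>j<n. [:- complex_of_real (r j), 1:])"
  shows "simple_spectrum n A \<longleftrightarrow> inj_on r {..<n} \<and> (\<forall>j<n. 0 < r j)"
proof
  assume "simple_spectrum n A"
  then obtain s where s: "inj_on s {..<n}" "\<forall>j<n. 0 < s j" "sing_poly A = (\<Prod>j<n. [:- complex_of_real (s j), 1:])"
    unfolding simple_spectrum_def by blast
  have "image_mset s (mset_set {..<n}) = image_mset r (mset_set {..<n})"
    using r s(3) by (intro image_mset_of_real_eqD) (simp add: prod_linear_eq_iff_mset[symmetric])
  from arg_cong[OF this, of set_mset] have im: "s ` {..<n} = r ` {..<n}" by simp
  have "card (r ` {..<n}) = card {..<n}" unfolding im[symmetric] by (rule card_image[OF s(1)])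
  then have "inj_on r {..<n}" by (intro eq_card_imp_inj_on) auto
  moreover have "0 < r j" if "j < n" for j
  proof -
    have "r j \<in> s ` {..<n}" unfolding im using that by simp
    then show ?thesis using s(2) by auto
  qed
  ultimately show "inj_on r {..<n} \<and> (\<forall>j<n. 0 < r j)" by blast
qed (use r in \<open>auto simp: simple_spectrum_def\<close>)

lemma symmetric_sqrt_diag: "symmetric_mat n (sqrt_diag n s)"
  unfolding symmetric_mat_def sqrt_diag_def by (auto simp: mat_diag_def intro!: eq_matI)

lemma sing_poly_sqrt_diag:
  assumes "\<And>i. i < n \<Longrightarrow> 0 \<le> s i"
  shows "sing_poly (sqrt_diag n s) = (\<Prod>i<n. [:- complex_of_real (s i), 1:])"
  unfolding sqrt_diag_def sing_poly_mat_diag using assms by (intro prod.cong) auto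

lemma measurable_rleb_component: "i < n \<Longrightarrow> (\<lambda>s. s i) \<in> borel_measurable (rleb n)"
  using measurable_component_singleton[of i "{..<n}" "\<lambda>_. lborel :: real measure"] by simp

lemma mat_measurable_sqrt_diag: "mat_measurable (rleb n) n (sqrt_diag n)"
  unfolding mat_measurable_def sqrt_diag_def
proof (intro conjI ballI allI impI)
  fix i j assume ij: "i < n" "j < n"
  note [measurable] = measurable_rleb_component[OF ij(1)]
  have "(\<lambda>s. complex_of_real (sqrt (s i))) \<in> borel_measurable (rleb n)" by measurable
  then show "(\<lambda>s. mat_diag n (\<lambda>i. complex_of_real (sqrt (s i))) $$ (i, j)) \<in> borel_measurable (rleb n)"
    using ij by (cases "i = j") (simp_all add: mat_diag_def)
qed simp

lemma sets_decreasing_pos: "{s \<in> space (rleb n). decreasing_pos n s} \<in> sets (rleb n)"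
proof -
  note [measurable] = measurable_rleb_component
  have "{s \<in> space (rleb n). decreasing_pos n s} =
    {s \<in> space (rleb n). (\<forall>i\<in>{..<n}. \<forall>j\<in>{i<..<n}. s j < s i) \<and> (\<forall>i\<in>{..<n}. 0 < s i)}"
    unfolding decreasing_pos_def by auto
  also have "\<dots> \<in> sets (rleb n)"
    by (intro sets.sets_Collect_conj sets.sets_Collect_finite_All) (auto intro!: borel_measurable_less measurable_rleb_component)
  finally show ?thesis .
qed

lemma finite_strict_pairs: "finite {(i, j). i < j \<and> j < (n::nat)}"
  by (rule finite_subset[of _ "{..<n} \<times> {..<n}"]) auto

lemma borel_measurable_vandermonde: "vandermonde n \<in> borel_measurable (rleb n)"
  unfolding vandermonde_def[abs_def]
  by (intro borel_measurable_prod) (auto intro!: borel_measurable_diff measurable_rleb_component)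

lemma vandermonde_Suc: "vandermonde (Suc n) s = vandermonde n s * (\<Prod>i<n. s i - s n)"
proof -
  have split: "{(i, j). i < j \<and> j < Suc n} = {(i, j). i < j \<and> j < n} \<union> (\<lambda>i. (i, n)) ` {..<n}" by (auto simp: less_Suc_eq)
  have last: "(\<Prod>(i, j)\<in>(\<lambda>i. (i, n)) ` {..<n}. s i - s j) = (\<Prod>i<n. s i - s n)"
    by (subst prod.reindex) (auto simp: inj_on_def)
  show ?thesis unfolding vandermonde_def split last[symmetric]
    using finite_strict_pairs[of n] by (intro prod.union_disjoint) auto
qed

lemma vandermonde_cong: "(\<And>i. i < n \<Longrightarrow> s i = t i) \<Longrightarrow> vandermonde n s = vandermonde n t"
  unfolding vandermonde_def by (intro prod.cong) auto

lemma vandermonde_nonneg: "decreasing_pos n s \<Longrightarrow> 0 \<le> vandermonde n s"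
  unfolding vandermonde_def decreasing_pos_def by (intro prod_nonneg) (auto intro: less_imp_le)

text \<open>Congruence by a diagonal matrix with last entry u multiplies the corner by u^2, so a
  square root of the phase of \<kappa> removes that phase.\<close>

lemma corner_phase:
  assumes inv: "unitarily_invariant (Suc n) \<Phi>" and A: "symmetric_mat n A"
  shows "\<Phi> (border n A (\<lambda>_. 0) \<kappa>) = \<Phi> (border n A (\<lambda>_. 0) (complex_of_real (cmod \<kappa>)))"
proof -
  obtain u where u: "cmod u = 1" "u * complex_of_real (cmod \<kappa>) * u = \<kappa>"
  proof (cases "\<kappa> = 0")
    case True then show ?thesis using that[of 1] by simp
  next
    case False
    define w where "w = csqrt (\<kappa> / complex_of_real (cmod \<kappa>))"
    have w2: "w * w = \<kappa> / complex_of_real (cmod \<kappa>)" unfolding w_def using power2_csqrt by (metis power2_eq_square)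
    then have "cmod w * cmod w = 1" using False by (metis norm_divide norm_mult norm_of_real abs_norm_cancel divide_self norm_eq_zero)
    then have "cmod w = 1" by (metis abs_norm_cancel abs_square_eq_1 power2_eq_square)
    moreover have "w * complex_of_real (cmod \<kappa>) * w = \<kappa>"
    proof -
      have "w * complex_of_real (cmod \<kappa>) * w = (w * w) * complex_of_real (cmod \<kappa>)" by simp
      then show ?thesis unfolding w2 using False by simp
    qed
    ultimately show ?thesis by (rule that)
  qed
  define e where "e i = (if i < n then 1 else u)" for i
  let ?E = "mat_diag (Suc n) e" and ?B = "border n A (\<lambda>_. 0) (complex_of_real (cmod \<kappa>))"
  have uu: "cnj u * u = 1" using u(1) complex_norm_square[of u] by (simp add: mult.commute)
  have E: "unitary_mat (Suc n) ?E"
  proof (rule unitary_matI_columns)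
    fix i j assume ij: "i < Suc n" "j < Suc n"
    have "(\<Sum>k<Suc n. cnj (?E $$ (k, i)) * ?E $$ (k, j)) = (\<Sum>k<Suc n. if k = i then (if i = j then cnj (e i) * e i else 0) else 0)"
      using ij by (intro sum.cong refl) (auto simp: mat_diag_def)
    also have "\<dots> = (if i = j then 1 else 0)" using ij uu by (simp add: e_def)
    finally show "(\<Sum>k<Suc n. cnj (?E $$ (k, i)) * ?E $$ (k, j)) = (if i = j then 1 else 0)" .
  qed simp
  have Et: "transpose_mat ?E = ?E" by (rule eq_matI) (auto simp: mat_diag_def)
  have EB: "?E * ?B \<in> carrier_mat (Suc n) (Suc n)" by (intro mult_carrier_mat[of _ "Suc n" "Suc n"]) auto
  have ent: "(?E * ?B * transpose_mat ?E) $$ (i, j) = e i * ?B $$ (i, j) * e j" if "i < Suc n" "j < Suc n" for i j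
    unfolding Et using that EB
    by (subst mat_diag_mult_right[of _ "Suc n" "Suc n"]) (auto simp: mat_diag_mult_left[of _ "Suc n" "Suc n"])
  have "?E * ?B * transpose_mat ?E = border n A (\<lambda>_. 0) \<kappa>"
  proof (rule eq_mat_SucI[of _ n])
    show "?E * ?B * transpose_mat ?E \<in> carrier_mat (Suc n) (Suc n)" unfolding Et using EB by (intro mult_carrier_mat[of _ "Suc n" "Suc n"]) auto
  qed (simp_all add: ent border_index e_def u(2) del: index_mult_mat assoc_mult_mat)
  then show ?thesis using inv E symmetric_border[OF A] unfolding unitarily_invariant_def by metis
qed

section \<open>Splitting off the smallest singular value\<close>

lemma sing_poly_border_zero:
  assumes A: "symmetric_mat n A"
  shows "sing_poly (border n A (\<lambda>_. 0) \<kappa>) = sing_poly A * [:- complex_of_real ((cmod \<kappa>)\<^sup>2), 1:]"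
proof -
  obtain U \<sigma> where U: "unitary_mat n U" and A_eq: "A = U * mat_diag n (\<lambda>i. complex_of_real (\<sigma> i)) * transpose_mat U"
    using takagi_factorization[OF A] by blast
  note Uc = unitary_matD(1)[OF U]
  have inv: "unitarily_invariant (Suc n) sing_poly"
    unfolding unitarily_invariant_def using sing_poly_congruence by (auto simp: symmetric_mat_def)
  let ?D = "mat_diag n (\<lambda>i. complex_of_real (\<sigma> i))"
  have "border n A (\<lambda>_. 0) (complex_of_real (cmod \<kappa>))
      = border n U (\<lambda>_. 0) 1 * border n ?D (\<lambda>_. 0) (complex_of_real (cmod \<kappa>)) * transpose_mat (border n U (\<lambda>_. 0) 1)"
    unfolding A_eq by (subst border_congruence[OF Uc mat_diag_dim]) simp
  also have "sing_poly \<dots> = sing_poly (border n ?D (\<lambda>_. 0) (complex_of_real (cmod \<kappa>)))"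
    by (rule sing_poly_congruence[OF unitary_border[OF U]]) simp
  also have "border n ?D (\<lambda>_. 0) (complex_of_real (cmod \<kappa>)) = mat_diag (Suc n) (\<lambda>i. complex_of_real ((\<sigma>(n := cmod \<kappa>)) i))"
    by (rule eq_mat_SucI[of _ n]) (auto simp: border_index mat_diag_def)
  also have "sing_poly \<dots> = (\<Prod>i<n. [:- complex_of_real ((\<sigma> i)\<^sup>2), 1:]) * [:- complex_of_real ((cmod \<kappa>)\<^sup>2), 1:]"
    unfolding sing_poly_mat_diag by simp
  also have "(\<Prod>i<n. [:- complex_of_real ((\<sigma> i)\<^sup>2), 1:]) = sing_poly A" unfolding A_eq sing_poly_takagi[OF U] ..
  finally show ?thesis unfolding corner_phase[OF inv A, of \<kappa>] .
qed

text \<open>What remains of the integrand once (K, y, \<kappa>) has been traded for the split matrix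
  with block A and corner \<kappa>. The polynomial value is the product of the differences between
  |\<kappa>|^2 and the squared singular values of A.\<close>

definition split_density :: "nat \<Rightarrow> (complex mat \<Rightarrow> ennreal) \<Rightarrow> complex \<Rightarrow> complex mat \<Rightarrow> ennreal" where
  "split_density n \<Phi> \<kappa> A = (if below_spectrum (border n A (\<lambda>_. 0) \<kappa>) ((cmod \<kappa>)\<^sup>2)
     then ennreal (cmod (poly (sing_poly A) (complex_of_real ((cmod \<kappa>)\<^sup>2)))) else 0) * \<Phi> (border n A (\<lambda>_. 0) \<kappa>)"

text \<open>For fixed y and \<kappa> the block K is replaced by the block H from
  \<open>con_mat_reduction\<close>. The factor 1 + |y|^2 in \<open>con_weight\<close> is used up by
  the minor there, and y survives only in the Jacobian of the substitution.\<close>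

lemma con_mat_to_split_density:
  assumes \<Phi>: "sym_measurable (Suc n) \<Phi>" and inv: "unitarily_invariant (Suc n) \<Phi>"
  shows "(\<integral>\<^sup>+k. con_weight n (sym_mat n k) \<kappa> y * \<Phi> (con_mat n (sym_mat n k) \<kappa> y) \<partial>cleb (sym_idx n))
    = ennreal (1 / (1 + (\<Sum>i<n. (cmod (y i))\<^sup>2)) ^ Suc n) * (\<integral>\<^sup>+k. split_density n \<Phi> \<kappa> (sym_mat n k) \<partial>cleb (sym_idx n))"
proof -
  define N where "N = 1 + (\<Sum>i<n. (cmod (y i))\<^sup>2)"
  define F where "F A = con_weight n A \<kappa> y * \<Phi> (con_mat n A \<kappa> y)" for A
  have F: "sym_measurable n F"
    unfolding sym_measurable_def F_def
    by (intro borel_measurable_times_ennreal borel_measurable_con_weight mat_measurable_sym_mat sym_measurable_compose[OF \<Phi>] mat_measurable_con_mat)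
       (auto simp: con_mat_def intro!: symmetric_border)
  obtain V W where V: "unitary_mat n V" and W: "unitary_mat (Suc n) W"
    and red: "\<And>H. symmetric_mat n H \<Longrightarrow>
      (let Q = V * mat_diag n (\<lambda>i. if i = 0 then complex_of_real (1 / sqrt N) else 1);
           K = mat n n (\<lambda>(i, j). (Q * H * transpose_mat Q) $$ (i, j) + \<kappa> / complex_of_real N * y i * y j)
       in con_mat n K \<kappa> y = W * border n H (\<lambda>_. 0) \<kappa> * transpose_mat W \<and>
          N * cmod (corner_minor n (con_mat n K \<kappa> y) ((cmod \<kappa>)\<^sup>2)) = cmod (poly (sing_poly H) (complex_of_real ((cmod \<kappa>)\<^sup>2))))"
    using con_mat_reduction[of n y \<kappa>] unfolding N_def by blast
  let ?Q = "V * mat_diag n (\<lambda>i. if i = 0 then complex_of_real (1 / sqrt N) else 1)"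
  let ?K = "\<lambda>H. mat n n (\<lambda>(i, j). (?Q * H * transpose_mat ?Q) $$ (i, j) + \<kappa> / complex_of_real N * y i * y j)"
  have "F (?K H) = split_density n \<Phi> \<kappa> H" if H: "symmetric_mat n H" for H
  proof -
    have C: "con_mat n (?K H) \<kappa> y = W * border n H (\<lambda>_. 0) \<kappa> * transpose_mat W"
      and m: "N * cmod (corner_minor n (con_mat n (?K H) \<kappa> y) ((cmod \<kappa>)\<^sup>2)) = cmod (poly (sing_poly H) (complex_of_real ((cmod \<kappa>)\<^sup>2)))"
      using red[OF H] unfolding Let_def by blast+
    have b: "below_spectrum (con_mat n (?K H) \<kappa> y) ((cmod \<kappa>)\<^sup>2) \<longleftrightarrow> below_spectrum (border n H (\<lambda>_. 0) \<kappa>) ((cmod \<kappa>)\<^sup>2)"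
      unfolding C by (rule below_spectrum_congruence[OF W border_carrier])
    have p: "\<Phi> (con_mat n (?K H) \<kappa> y) = \<Phi> (border n H (\<lambda>_. 0) \<kappa>)"
      unfolding C using inv W symmetric_border[OF H] unfolding unitarily_invariant_def by blast
    show ?thesis unfolding F_def con_weight_def split_density_def b p N_def[symmetric] m ..
  qed
  then show ?thesis
    using nn_integral_sym_reduction[OF V F, where y=y and \<tau>="\<kappa> / complex_of_real N"] unfolding F_def[symmetric] N_def[symmetric] by simp
qed

lemma measurable_split_density:
  assumes \<Phi>: "sym_measurable (Suc n) \<Phi>"
    and A: "mat_measurable N n A" and sym: "\<And>z. z \<in> space N \<Longrightarrow> symmetric_mat n (A z)" and \<kappa>[measurable]: "\<kappa> \<in> borel_measurable N"
  shows "(\<lambda>z. split_density n \<Phi> (\<kappa> z) (A z)) \<in> borel_measurable N"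
proof -
  have B: "mat_measurable N (Suc n) (\<lambda>z. border n (A z) (\<lambda>_. 0) (\<kappa> z))" by (intro mat_measurable_border A) auto
  have Bs: "symmetric_mat (Suc n) (border n (A z) (\<lambda>_. 0) (\<kappa> z))" if "z \<in> space N" for z by (rule symmetric_border[OF sym[OF that]])
  have k2: "(\<lambda>z. (cmod (\<kappa> z))\<^sup>2) \<in> borel_measurable N" by measurable
  obtain r where r: "\<And>j. j < n \<Longrightarrow> r j \<in> borel_measurable N"
    and r': "\<And>z. z \<in> space N \<Longrightarrow> sing_poly (A z) = (\<Prod>j<n. [:- complex_of_real (r j z), 1:])"
    using measurable_singular_values[OF A sym] by blast
  have "(\<lambda>z. ennreal (cmod (\<Prod>j<n. complex_of_real ((cmod (\<kappa> z))\<^sup>2) - complex_of_real (r j z)))) \<in> borel_measurable N"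
    using r by measurable
  then have p: "(\<lambda>z. ennreal (cmod (poly (sing_poly (A z)) (complex_of_real ((cmod (\<kappa> z))\<^sup>2))))) \<in> borel_measurable N"
    by (subst measurable_cong) (use r' in \<open>auto simp: poly_prod_linear\<close>)
  show ?thesis unfolding split_density_def
    by (intro borel_measurable_times_ennreal measurable_If p measurable_below_spectrum[OF B Bs k2] sym_measurable_compose[OF \<Phi> B Bs]) auto
qed

lemma unitarily_invariant_split_density:
  assumes inv: "unitarily_invariant (Suc n) \<Phi>"
  shows "unitarily_invariant n (split_density n \<Phi> \<kappa>)"
  unfolding unitarily_invariant_def
proof (intro allI impI)
  fix U A assume U: "unitary_mat n U" and A: "symmetric_mat n A"
  have Ac: "A \<in> carrier_mat n n" using A by (simp add: symmetric_mat_def)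
  have B: "border n (U * A * transpose_mat U) (\<lambda>_. 0) \<kappa> = border n U (\<lambda>_. 0) 1 * border n A (\<lambda>_. 0) \<kappa> * transpose_mat (border n U (\<lambda>_. 0) 1)"
    by (subst border_congruence[OF unitary_matD(1)[OF U] Ac]) simp
  have "\<Phi> (border n (U * A * transpose_mat U) (\<lambda>_. 0) \<kappa>) = \<Phi> (border n A (\<lambda>_. 0) \<kappa>)"
    unfolding B using inv unitary_border[OF U] symmetric_border[OF A] unfolding unitarily_invariant_def by blast
  then show "split_density n \<Phi> \<kappa> (U * A * transpose_mat U) = split_density n \<Phi> \<kappa> A"
    unfolding split_density_def sing_poly_congruence[OF U Ac]
    by (simp only: B below_spectrum_congruence[OF unitary_border[OF U] border_carrier])
qed

text \<open>The integration formula for size n is applied to the indicator of a degenerate spectrum.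
  This function vanishes at every decreasing positive s, so its integral is zero, and no separate
  description of the degenerate set is required.\<close>

lemma AE_simple_spectrum:
  assumes IH: "\<And>\<Phi>. sym_measurable n \<Phi> \<Longrightarrow> unitarily_invariant n \<Phi> \<Longrightarrow>
    (\<integral>\<^sup>+h. \<Phi> (sym_mat n h) \<partial>cleb (sym_idx n)) = ennreal (vol_const n) *
    (\<integral>\<^sup>+s. indicator {s. decreasing_pos n s} s * ennreal (vandermonde n s) * \<Phi> (sqrt_diag n s) \<partial>rleb n)"
  shows "AE k in cleb (sym_idx n). simple_spectrum n (sym_mat n k)"
proof -
    define \<Phi>0 :: "complex mat \<Rightarrow> ennreal" where "\<Phi>0 A = (if simple_spectrum n A then 0 else 1)" for A
    have "\<exists>r. (\<forall>j<n. r j \<in> borel_measurable (cleb (sym_idx n))) \<and> (\<forall>k\<in>space (cleb (sym_idx n)).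
        (\<forall>j<n. 0 \<le> r j k) \<and> sing_poly (sym_mat n k) = (\<Prod>j<n. [:- complex_of_real (r j k), 1:]))"
      by (rule measurable_singular_values[OF mat_measurable_sym_mat symmetric_sym_mat])
    then obtain r where rm: "\<forall>j<n. r j \<in> borel_measurable (cleb (sym_idx n))"
      and rp: "\<forall>k\<in>space (cleb (sym_idx n)). (\<forall>j<n. 0 \<le> r j k) \<and> sing_poly (sym_mat n k) = (\<Prod>j<n. [:- complex_of_real (r j k), 1:])"
      by (elim exE conjE) (rule that; assumption)
    note r = rm[rule_format]
    have r': "sing_poly (sym_mat n k) = (\<Prod>j<n. [:- complex_of_real (r j k), 1:])" if "k \<in> space (cleb (sym_idx n))" for k
      using bspec[OF rp that] by (rule conjunct2)
    have "{k \<in> space (cleb (sym_idx n)). simple_spectrum n (sym_mat n k)}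
      = {k \<in> space (cleb (sym_idx n)). (\<forall>i\<in>{..<n}. \<forall>j\<in>{..<n} - {i}. r i k \<noteq> r j k) \<and> (\<forall>j\<in>{..<n}. 0 < r j k)}"
      using simple_spectrum_iff[OF r'] unfolding inj_on_def by auto
    also have "\<dots> \<in> sets (cleb (sym_idx n))"
      using r by (intro sets.sets_Collect_conj sets.sets_Collect_finite_All borel_measurable_neq borel_measurable_less) auto
    finally have "sym_measurable n \<Phi>0"
      unfolding sym_measurable_def \<Phi>0_def by (intro measurable_If) auto
    moreover have "unitarily_invariant n \<Phi>0"
      unfolding unitarily_invariant_def \<Phi>0_def simple_spectrum_def by (auto simp: symmetric_mat_def sing_poly_congruence simp del: assoc_mult_mat)
    ultimately have "(\<integral>\<^sup>+h. \<Phi>0 (sym_mat n h) \<partial>cleb (sym_idx n)) = ennreal (vol_const n) *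
      (\<integral>\<^sup>+s. indicator {s. decreasing_pos n s} s * ennreal (vandermonde n s) * \<Phi>0 (sqrt_diag n s) \<partial>rleb n)"
      by (rule IH)
    also have "(\<integral>\<^sup>+s. indicator {s. decreasing_pos n s} s * ennreal (vandermonde n s) * \<Phi>0 (sqrt_diag n s) \<partial>rleb n) = (\<integral>\<^sup>+s. 0 \<partial>rleb n)"
    proof (rule nn_integral_cong)
      fix s :: "nat \<Rightarrow> real"
      have "simple_spectrum n (sqrt_diag n s)" if d: "decreasing_pos n s"
        unfolding simple_spectrum_def
      proof (intro exI[of _ s] conjI)
        show "inj_on s {..<n}" using d unfolding decreasing_pos_def inj_on_def by (metis lessThan_iff less_irrefl nat_neq_iff)
        show "\<forall>j<n. 0 < s j" using d unfolding decreasing_pos_def by blast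
        then show "sing_poly (sqrt_diag n s) = (\<Prod>j<n. [:- complex_of_real (s j), 1:])"
          by (intro sing_poly_sqrt_diag) (auto intro: less_imp_le)
      qed
      then show "indicator {s. decreasing_pos n s} s * ennreal (vandermonde n s) * \<Phi>0 (sqrt_diag n s) = 0"
        by (auto simp: \<Phi>0_def indicator_def)
    qed
    finally have "AE k in cleb (sym_idx n). \<Phi>0 (sym_mat n k) = 0"
      using \<open>sym_measurable n \<Phi>0\<close> by (subst nn_integral_0_iff_AE[symmetric]) (auto simp: sym_measurable_def)
    then show ?thesis by (auto simp: \<Phi>0_def split: if_splits)
  qed

lemma measurable_split_integral:
  assumes \<Phi>: "sym_measurable (Suc n) \<Phi>" and \<psi>: "\<psi> \<in> borel_measurable N"
  shows "(\<lambda>z. \<integral>\<^sup>+s. indicator {s. decreasing_pos n s} s * ennreal (vandermonde n s) * split_density n \<Phi> (\<psi> z) (sqrt_diag n s) \<partial>rleb n) \<in> borel_measurable N"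
proof -
  interpret fr: finite_product_sigma_finite "\<lambda>_::nat. lborel :: real measure" "{..<n}" by standard simp
  have 1: "(\<lambda>z. split_density n \<Phi> (\<psi> (fst z)) (sqrt_diag n (snd z))) \<in> borel_measurable (N \<Otimes>\<^sub>M rleb n)"
    by (rule measurable_split_density[OF \<Phi> mat_measurable_compose[OF measurable_snd mat_measurable_sqrt_diag] symmetric_sqrt_diag measurable_compose[OF measurable_fst \<psi>]])
  have "(\<lambda>s. indicator {s. decreasing_pos n s} s :: ennreal) \<in> borel_measurable (rleb n)"
    using sets_decreasing_pos[of n] by (subst borel_measurable_indicator_iff) (simp add: Int_def conj_commute)
  then have "(\<lambda>s. indicator {s. decreasing_pos n s} s * ennreal (vandermonde n s)) \<in> borel_measurable (rleb n)"
    by (intro borel_measurable_times_ennreal measurable_compose[OF borel_measurable_vandermonde measurable_ennreal])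
  from borel_measurable_times_ennreal[OF measurable_compose[OF measurable_snd this] 1]
  show ?thesis by (intro fr.borel_measurable_nn_integral) (simp add: case_prod_beta')
qed

text \<open>With the block integral placed innermost, y and \<kappa> are fixed while K is exchanged
  for the split block. The induction hypothesis then applies to \<open>split_density\<close>, which
  is again unitarily invariant. The step contributes pi^n / n! from y and pi from the phase of
  \<kappa>, the next factor of \<open>vol_const\<close>.\<close>

theorem nn_integral_singular_values:
  assumes "sym_measurable n \<Phi>" "unitarily_invariant n \<Phi>"
  shows "(\<integral>\<^sup>+h. \<Phi> (sym_mat n h) \<partial>cleb (sym_idx n)) = ennreal (vol_const n) *
    (\<integral>\<^sup>+s. indicator {s. decreasing_pos n s} s * ennreal (vandermonde n s) * \<Phi> (sqrt_diag n s) \<partial>rleb n)"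
  using assms
proof (induction n arbitrary: \<Phi>)
  case 0
  have "sym_idx 0 = {}" by (auto simp: sym_idx_def)
  moreover have "sym_mat 0 (\<lambda>_. undefined) = sqrt_diag 0 (\<lambda>_. undefined)" by (rule eq_matI) (auto simp: sym_mat_def sqrt_diag_def mat_diag_def)
  moreover have "decreasing_pos 0 s" "vandermonde 0 s = 1" for s by (auto simp: decreasing_pos_def vandermonde_def)
  ultimately show ?case by (simp add: PiM_empty nn_integral_count_space_finite vol_const_def)
next
  case (Suc n)
  note \<Phi> = Suc.prems(1) and inv = Suc.prems(2)
  let ?I = "sym_idx n"
  interpret fI: finite_product_sigma_finite "\<lambda>_::nat \<times> nat. lborel :: complex measure" ?I by standard simp
  interpret fn: finite_product_sigma_finite "\<lambda>_::nat. lborel :: complex measure" "{..<n}" by standard simp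
  interpret fr: finite_product_sigma_finite "\<lambda>_::nat. lborel :: real measure" "{..<n}" by standard simp
  interpret pk: pair_sigma_finite "cleb ?I" "lborel :: complex measure" by standard
  interpret py: pair_sigma_finite "cleb ?I" "cleb {..<n}" by standard
  let ?f = "\<lambda>k \<kappa> y. con_weight n (sym_mat n k) \<kappa> y * \<Phi> (con_mat n (sym_mat n k) \<kappa> y)"

  have simple_AE: "AE k in cleb ?I. simple_spectrum n (sym_mat n k)"
    by (rule AE_simple_spectrum[OF Suc.IH])

  have slice: "(\<integral>\<^sup>+v. \<integral>\<^sup>+c. \<Phi> (border n (sym_mat n k) v c) \<partial>lborel \<partial>cleb {..<n}) = (\<integral>\<^sup>+\<kappa>. \<integral>\<^sup>+y. ?f k \<kappa> y \<partial>cleb {..<n} \<partial>lborel)"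
    if simple: "simple_spectrum n (sym_mat n k)" for k
  proof -
    obtain U \<sigma> where U: "unitary_mat n U" and \<sigma>: "\<And>i. i < n \<Longrightarrow> \<sigma> i \<ge> 0"
      and K: "sym_mat n k = U * mat_diag n (\<lambda>i. complex_of_real (\<sigma> i)) * transpose_mat U"
      using takagi_factorization[OF symmetric_sym_mat] by blast
    have "sing_poly (sym_mat n k) = (\<Prod>i<n. [:- complex_of_real ((\<sigma> i)\<^sup>2), 1:])" unfolding K by (rule sing_poly_takagi[OF U])
    then have s: "inj_on (\<lambda>i. (\<sigma> i)\<^sup>2) {..<n}" "\<And>j. j < n \<Longrightarrow> 0 < (\<sigma> j)\<^sup>2"
      using simple simple_spectrum_iff[where n=n and A="sym_mat n k" and r="\<lambda>i. (\<sigma> i)\<^sup>2"] by auto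
    have "\<sigma> i > 0" if "i < n" for i using \<sigma>[OF that] s(2)[OF that] by (cases "\<sigma> i = 0") auto
    moreover have "inj_on \<sigma> {..<n}" using s(1) unfolding inj_on_def by metis
    ultimately show ?thesis by (intro nn_integral_slice[OF \<Phi> inv U K])
  qed

  have f_meas: "(\<lambda>z. ?f (g z) (\<kappa> z) (y z)) \<in> borel_measurable N"
    if g: "g \<in> measurable N (cleb ?I)" and k: "\<kappa> \<in> borel_measurable N" and y: "y \<in> measurable N (cleb {..<n})"
    for g \<kappa> y and N :: "'r measure"
  proof -
    have yi: "(\<lambda>z. y z i) \<in> borel_measurable N" if "i < n" for i
      using measurable_compose[OF y measurable_component_singleton[of i "{..<n}"]] that by simp
    have K: "mat_measurable N n (\<lambda>z. sym_mat n (g z))" using mat_measurable_compose[OF g mat_measurable_sym_mat] .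
    show ?thesis
      by (intro borel_measurable_times_ennreal borel_measurable_con_weight K k yi sym_measurable_compose[OF \<Phi>] mat_measurable_con_mat)
         (auto simp: con_mat_def intro!: symmetric_border)
  qed

  have "(\<integral>\<^sup>+h. \<Phi> (sym_mat (Suc n) h) \<partial>cleb (sym_idx (Suc n)))
    = (\<integral>\<^sup>+k. \<integral>\<^sup>+v. \<integral>\<^sup>+c. \<Phi> (border n (sym_mat n k) v c) \<partial>lborel \<partial>cleb {..<n} \<partial>cleb ?I)"
    by (rule nn_integral_sym_Suc[OF \<Phi>])
  also have "\<dots> = (\<integral>\<^sup>+k. \<integral>\<^sup>+\<kappa>. \<integral>\<^sup>+y. ?f k \<kappa> y \<partial>cleb {..<n} \<partial>lborel \<partial>cleb ?I)"
    by (rule nn_integral_cong_AE, rule AE_mp[OF simple_AE], rule AE_I2, rule impI, rule slice)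
  also have "\<dots> = (\<integral>\<^sup>+\<kappa>. \<integral>\<^sup>+k. \<integral>\<^sup>+y. ?f k \<kappa> y \<partial>cleb {..<n} \<partial>cleb ?I \<partial>lborel)"
  proof (rule pk.Fubini'[symmetric])
    have "(\<lambda>z. ?f (fst (fst z)) (snd (fst z)) (snd z)) \<in> borel_measurable ((cleb ?I \<Otimes>\<^sub>M lborel) \<Otimes>\<^sub>M cleb {..<n})"
      by (rule f_meas) simp_all
    then have "(\<lambda>z. \<integral>\<^sup>+y. ?f (fst z) (snd z) y \<partial>cleb {..<n}) \<in> borel_measurable (cleb ?I \<Otimes>\<^sub>M lborel)"
      by (intro fn.borel_measurable_nn_integral) (simp add: case_prod_beta')
    then show "(\<lambda>(k, \<kappa>). \<integral>\<^sup>+y. ?f k \<kappa> y \<partial>cleb {..<n}) \<in> borel_measurable (cleb ?I \<Otimes>\<^sub>M lborel)" by (simp add: case_prod_beta')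
  qed
  also have "\<dots> = (\<integral>\<^sup>+\<kappa>. \<integral>\<^sup>+y. \<integral>\<^sup>+k. ?f k \<kappa> y \<partial>cleb ?I \<partial>cleb {..<n} \<partial>lborel)"
  proof (rule nn_integral_cong, rule py.Fubini'[symmetric])
    fix \<kappa> :: complex
    have "(\<lambda>z. ?f (fst z) \<kappa> (snd z)) \<in> borel_measurable (cleb ?I \<Otimes>\<^sub>M cleb {..<n})" by (rule f_meas) simp_all
    then show "(\<lambda>(k, y). ?f k \<kappa> y) \<in> borel_measurable (cleb ?I \<Otimes>\<^sub>M cleb {..<n})" by (simp add: case_prod_beta')
  qed
  \<comment> \<open>Only the Jacobian (1 + |y|^2)^(-n-1) still depends on y, and its integral is the
    constant displayed.\<close>
  also have "\<dots> = (\<integral>\<^sup>+\<kappa>. ennreal (pi ^ n / fact n) * (\<integral>\<^sup>+k. split_density n \<Phi> \<kappa> (sym_mat n k) \<partial>cleb ?I) \<partial>lborel)"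
  proof (rule nn_integral_cong)
    fix \<kappa> :: complex
    have "(\<integral>\<^sup>+y. ennreal (1 / (1 + (\<Sum>i<n. (cmod (y i))\<^sup>2)) ^ Suc n) * (\<integral>\<^sup>+k. split_density n \<Phi> \<kappa> (sym_mat n k) \<partial>cleb ?I) \<partial>cleb {..<n})
      = (\<integral>\<^sup>+y. ennreal (1 / (1 + (\<Sum>i<n. (cmod (y i))\<^sup>2)) ^ Suc n) \<partial>cleb {..<n}) * (\<integral>\<^sup>+k. split_density n \<Phi> \<kappa> (sym_mat n k) \<partial>cleb ?I)"
      by (rule nn_integral_multc) measurable
    also have "(\<integral>\<^sup>+y. ennreal (1 / (1 + (\<Sum>i<n. (cmod (y i))\<^sup>2)) ^ Suc n) \<partial>cleb {..<n}) = ennreal (pi ^ n / fact n)"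
      using nn_integral_PiM_inverse_power[of "{..<n}" 1 0] by simp
    finally show "(\<integral>\<^sup>+y. \<integral>\<^sup>+k. ?f k \<kappa> y \<partial>cleb ?I \<partial>cleb {..<n}) = ennreal (pi ^ n / fact n) * (\<integral>\<^sup>+k. split_density n \<Phi> \<kappa> (sym_mat n k) \<partial>cleb ?I)"
      unfolding con_mat_to_split_density[OF \<Phi> inv] .
  qed
  also have "\<dots> = (\<integral>\<^sup>+\<kappa>. ennreal (pi ^ n / fact n * vol_const n) *
     (\<integral>\<^sup>+s. indicator {s. decreasing_pos n s} s * ennreal (vandermonde n s) * split_density n \<Phi> \<kappa> (sqrt_diag n s) \<partial>rleb n) \<partial>lborel)"
  proof (rule nn_integral_cong)
    fix \<kappa> :: complex
    have "sym_measurable n (split_density n \<Phi> \<kappa>)"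
      unfolding sym_measurable_def by (rule measurable_split_density[OF \<Phi> mat_measurable_sym_mat]) auto
    note IH = Suc.IH[OF this unitarily_invariant_split_density[OF inv]]
    have e: "ennreal (pi ^ n / fact n * vol_const n) = ennreal (pi ^ n / fact n) * ennreal (vol_const n)"
      by (rule ennreal_mult) (auto simp: vol_const_def intro!: prod_nonneg)
    show "ennreal (pi ^ n / fact n) * (\<integral>\<^sup>+k. split_density n \<Phi> \<kappa> (sym_mat n k) \<partial>cleb ?I) = ennreal (pi ^ n / fact n * vol_const n) *
       (\<integral>\<^sup>+s. indicator {s. decreasing_pos n s} s * ennreal (vandermonde n s) * split_density n \<Phi> \<kappa> (sqrt_diag n s) \<partial>rleb n)"
      unfolding IH e by (simp only: mult.assoc)
  qed
  \<comment> \<open>The integrand does not see the phase of \<kappa>. Making this explicit lets the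
    plane integral become pi times an integral over x = |\<kappa>|^2, the future last coordinate of
    s.\<close>
  also have "\<dots> = ennreal (pi ^ n / fact n * vol_const n) * (\<integral>\<^sup>+\<kappa>. 
     (\<integral>\<^sup>+s. indicator {s. decreasing_pos n s} s * ennreal (vandermonde n s) * split_density n \<Phi> (complex_of_real (cmod \<kappa>)) (sqrt_diag n s) \<partial>rleb n) \<partial>lborel)"
  proof -
    have ph: "split_density n \<Phi> \<kappa> (sqrt_diag n s) = split_density n \<Phi> (complex_of_real (cmod \<kappa>)) (sqrt_diag n s)" for \<kappa> s
    proof -
      have *: "sing_poly (border n (sqrt_diag n s) (\<lambda>_. 0) \<kappa>) = sing_poly (border n (sqrt_diag n s) (\<lambda>_. 0) (complex_of_real (cmod \<kappa>)))"
        unfolding sing_poly_border_zero[OF symmetric_sqrt_diag] by simp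
      have c: "cmod (complex_of_real (cmod \<kappa>)) = cmod \<kappa>" by simp
      show ?thesis unfolding split_density_def below_spectrum_def * c corner_phase[OF inv symmetric_sqrt_diag, of _ \<kappa>] ..
    qed
    have "(\<lambda>\<kappa>. \<integral>\<^sup>+s. indicator {s. decreasing_pos n s} s * ennreal (vandermonde n s) * split_density n \<Phi> (complex_of_real (cmod \<kappa>)) (sqrt_diag n s) \<partial>rleb n) \<in> borel_measurable lborel"
      by (rule measurable_split_integral[OF \<Phi>]) simp
    note cmult = nn_integral_cmult[OF this]
    show ?thesis unfolding cmult[symmetric]
      by (intro nn_integral_cong arg_cong2[where f="(*)"] refl ph)
  qed
  also have "(\<integral>\<^sup>+\<kappa>. (\<integral>\<^sup>+s. indicator {s. decreasing_pos n s} s * ennreal (vandermonde n s) * split_density n \<Phi> (complex_of_real (cmod \<kappa>)) (sqrt_diag n s) \<partial>rleb n) \<partial>lborel)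
    = ennreal pi * (\<integral>\<^sup>+x. (\<integral>\<^sup>+s. indicator {s. decreasing_pos n s} s * ennreal (vandermonde n s) * split_density n \<Phi> (complex_of_real (sqrt x)) (sqrt_diag n s) \<partial>rleb n) * indicator {0..} x \<partial>lborel)"
  proof -
    let ?g = "\<lambda>x. \<integral>\<^sup>+s. indicator {s. decreasing_pos n s} s * ennreal (vandermonde n s) * split_density n \<Phi> (complex_of_real (sqrt x)) (sqrt_diag n s) \<partial>rleb n"
    have "?g \<in> borel_measurable borel"
      by (rule measurable_split_integral[OF \<Phi>]) simp
    from nn_integral_complex_norm_squared[OF this] show ?thesis by simp
  qed
  also have "(\<integral>\<^sup>+x. (\<integral>\<^sup>+s. indicator {s. decreasing_pos n s} s * ennreal (vandermonde n s) * split_density n \<Phi> (complex_of_real (sqrt x)) (sqrt_diag n s) \<partial>rleb n) * indicator {0..} x \<partial>lborel)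
    = (\<integral>\<^sup>+x. \<integral>\<^sup>+s. indicator {s. decreasing_pos (Suc n) s} (s(n := x)) * ennreal (vandermonde (Suc n) (s(n := x))) * \<Phi> (sqrt_diag (Suc n) (s(n := x))) \<partial>rleb n \<partial>lborel)"
  \<comment> \<open>The point x = 0 is set aside because \<open>indicator {0..}\<close> admits it,
    while \<open>decreasing_pos\<close> demands positive entries.\<close>
  proof (rule nn_integral_cong_AE, rule AE_mp[OF AE_lborel_singleton[of 0]], rule AE_I2, rule impI)
    fix x :: real assume x0: "x \<noteq> 0"
    let ?r = "\<lambda>s. indicator {s. decreasing_pos (Suc n) s} (s(n := x)) * ennreal (vandermonde (Suc n) (s(n := x))) * \<Phi> (sqrt_diag (Suc n) (s(n := x)))"
    show "(\<integral>\<^sup>+s. indicator {s. decreasing_pos n s} s * ennreal (vandermonde n s) * split_density n \<Phi> (complex_of_real (sqrt x)) (sqrt_diag n s) \<partial>rleb n) * indicator {0..} x = (\<integral>\<^sup>+s. ?r s \<partial>rleb n)"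
    proof (cases "x < 0")
      case True
      then have "\<not> decreasing_pos (Suc n) (s(n := x))" for s unfolding decreasing_pos_def by (auto intro!: exI[of _ n])
      then show ?thesis using True by simp
    next
      case False
      then have x: "x > 0" using x0 by simp
      have "indicator {s. decreasing_pos n s} s * ennreal (vandermonde n s) * split_density n \<Phi> (complex_of_real (sqrt x)) (sqrt_diag n s) = ?r s" for s
      proof (cases "decreasing_pos n s")
        case False
        then have "\<not> decreasing_pos (Suc n) (s(n := x))"
          unfolding decreasing_pos_def by (auto split: if_splits) (metis less_SucI less_irrefl less_trans)+
        then show ?thesis using False by simp
      next
        case True
        then have s0: "\<And>i. i < n \<Longrightarrow> 0 \<le> s i" unfolding decreasing_pos_def by (auto intro: less_imp_le)
        have k2: "(cmod (complex_of_real (sqrt x)))\<^sup>2 = x" using x by simp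
        have sp: "sing_poly (sqrt_diag n s) = (\<Prod>i<n. [:- complex_of_real (s i), 1:])" by (rule sing_poly_sqrt_diag[OF s0])
        have "sing_poly (border n (sqrt_diag n s) (\<lambda>_. 0) (complex_of_real (sqrt x))) = (\<Prod>i<Suc n. [:- complex_of_real ((s(n := x)) i), 1:])"
          unfolding sing_poly_border_zero[OF symmetric_sqrt_diag] sp k2 by simp
        then have b: "below_spectrum (border n (sqrt_diag n s) (\<lambda>_. 0) (complex_of_real (sqrt x))) x \<longleftrightarrow> (\<forall>i<n. x \<le> s i)"
          using s0 x by (subst below_spectrum_iff[where n="Suc n" and r="s(n := x)"]) (auto simp: less_Suc_eq)
        have D: "border n (sqrt_diag n s) (\<lambda>_. 0) (complex_of_real (sqrt x)) = sqrt_diag (Suc n) (s(n := x))"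
          by (rule eq_mat_SucI[of _ n]) (auto simp: border_index sqrt_diag_def mat_diag_def)
        have pl: "cmod (poly (sing_poly (sqrt_diag n s)) (complex_of_real x)) = (\<Prod>i<n. \<bar>x - s i\<bar>)"
        proof -
          have "poly (sing_poly (sqrt_diag n s)) (complex_of_real x) = complex_of_real (\<Prod>i<n. x - s i)"
            unfolding sp poly_prod_linear by simp
          then show ?thesis by (simp only: norm_of_real abs_prod)
        qed
        have vS: "vandermonde (Suc n) (s(n := x)) = vandermonde n s * (\<Prod>i<n. s i - x)"
          unfolding vandermonde_Suc by (intro arg_cong2[where f="(*)"] vandermonde_cong prod.cong) auto
        have vn: "0 \<le> vandermonde n s" by (rule vandermonde_nonneg[OF True])
        have ds: "decreasing_pos (Suc n) (s(n := x)) \<longleftrightarrow> (\<forall>i<n. x < s i)"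
          using True x unfolding decreasing_pos_def by (auto simp: less_Suc_eq)
        \<comment> \<open>The weak inequalities from \<open>below_spectrum\<close> and the strict
          ones of \<open>decreasing_pos\<close> differ only where x equals some s i, and there the
          factor |x - s i| vanishes.\<close>
        consider "\<forall>i<n. x < s i" | i where "i < n" "x = s i" | "\<not> (\<forall>i<n. x \<le> s i)" by force
        then show ?thesis
        proof cases
          case 1
          then have le: "\<forall>i<n. x \<le> s i" by (auto intro: less_imp_le)
          have "(\<Prod>i<n. \<bar>x - s i\<bar>) = (\<Prod>i<n. s i - x)" using le by (intro prod.cong) auto
          then have sd: "split_density n \<Phi> (complex_of_real (sqrt x)) (sqrt_diag n s) = ennreal (\<Prod>i<n. s i - x) * \<Phi> (sqrt_diag (Suc n) (s(n := x)))"
            unfolding split_density_def k2 b pl using le D by simp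
          have "0 \<le> (\<Prod>i<n. s i - x)" using le by (intro prod_nonneg) auto
          then show ?thesis unfolding sd vS using True ds 1 vn by (simp add: ennreal_mult mult.assoc)
        next
          case (2 i)
          then have p0: "(\<Prod>i<n. \<bar>x - s i\<bar>) = 0" by (auto intro!: prod_zero)
          have nd: "\<not> decreasing_pos (Suc n) (s(n := x))" unfolding ds using 2 by (metis less_irrefl)
          have sd: "split_density n \<Phi> (complex_of_real (sqrt x)) (sqrt_diag n s) = 0"
            unfolding split_density_def k2 b pl p0 by simp
          show ?thesis by (simp add: nd sd)
        next
          case 3
          then have nd: "\<not> decreasing_pos (Suc n) (s(n := x))" unfolding ds by (metis less_imp_le)
          have sd: "split_density n \<Phi> (complex_of_real (sqrt x)) (sqrt_diag n s) = 0"
            unfolding split_density_def k2 b if_not_P[OF 3] by simp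
          show ?thesis by (simp add: nd sd)
        qed
      qed
      then show ?thesis using x by simp
    qed
  qed
  also have "\<dots> = (\<integral>\<^sup>+s. indicator {s. decreasing_pos (Suc n) s} s * ennreal (vandermonde (Suc n) s) * \<Phi> (sqrt_diag (Suc n) s) \<partial>rleb (Suc n))"
  proof -
    have [measurable]: "(\<lambda>s. indicator {s. decreasing_pos (Suc n) s} s :: ennreal) \<in> borel_measurable (rleb (Suc n))"
      using sets_decreasing_pos[of "Suc n"] by (subst borel_measurable_indicator_iff) (simp add: Int_def conj_commute)
    note [measurable] = borel_measurable_vandermonde[of "Suc n"]
      sym_measurable_compose[OF \<Phi> mat_measurable_sqrt_diag symmetric_sqrt_diag]
    have "(\<lambda>s. indicator {s. decreasing_pos (Suc n) s} s * ennreal (vandermonde (Suc n) s) * \<Phi> (sqrt_diag (Suc n) s)) \<in> borel_measurable (rleb (Suc n))"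
      by measurable
    then show ?thesis unfolding lessThan_Suc
      by (subst lborel_product.product_nn_integral_insert_rev) simp_all
  qed
  finally show ?case
    by (simp add: vol_const_def ennreal_mult' mult.assoc[symmetric] ennreal_mult'[symmetric] prod_nonneg) (simp add: ac_simps)
qed

subsection \<open>The density of critical points\<close>

text \<open>Symmetric products and sums see only the multiset of values, so the squares from
  Takagi's factorization may be exchanged for any other list of the same roots.\<close>

lemma prod_cong_image_mset:
  fixes a b :: "nat \<Rightarrow> 'a" and g :: "'a \<Rightarrow> 'b::comm_monoid_mult" and g' :: "'a \<Rightarrow> 'c::comm_monoid_add"
  assumes "image_mset a (mset_set {..<n}) = image_mset b (mset_set {..<n})"
  shows "(\<Prod>j<n. g (a j)) = (\<Prod>j<n. g (b j))"
    and "(\<Sum>j<n. g' (a j)) = (\<Sum>j<n. g' (b j))"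
proof -
  have "(\<Prod>j<n. g (a j)) = prod_mset (image_mset g (image_mset a (mset_set {..<n})))" for a :: "nat \<Rightarrow> 'a"
    by (simp add: prod_unfold_prod_mset image_mset.compositionality comp_def)
  then show "(\<Prod>j<n. g (a j)) = (\<Prod>j<n. g (b j))" using assms by metis
  have "(\<Sum>j<n. g' (a j)) = sum_mset (image_mset g' (image_mset a (mset_set {..<n})))" for a :: "nat \<Rightarrow> 'a"
    by (simp add: sum_unfold_sum_mset image_mset.compositionality comp_def)
  then show "(\<Sum>j<n. g' (a j)) = (\<Sum>j<n. g' (b j))" using assms by metis
qed

text \<open>The multiplicity of a root is the number of indices j with that value. Exchanging the
  sums over roots and over indices then counts the indices with negative value.\<close>

lemma num_neg_eigenvalues_eq_card:
  fixes n :: nat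
  assumes cp: "char_poly A = (\<Prod>j<n. [:- complex_of_real (a j), 1:])"
  shows "num_neg_eigenvalues A = card {j. j < n \<and> a j < 0}"
proof -
  let ?p = "\<Prod>j<n. [:- complex_of_real (a j), 1:]"
  let ?X = "{x. poly ?p x = 0 \<and> Im x = 0 \<and> Re x < 0}"
  have p0: "?p \<noteq> 0" by (simp add: prod_zero_iff)
  have "finite {x. poly ?p x = 0}" by (rule poly_roots_finite[OF p0])
  then have fin: "finite ?X" by (rule finite_subset[rotated]) auto
  have ord: "Polynomial.order x ?p = (\<Sum>j<n. if complex_of_real (a j) = x then 1 else 0)" for x
  proof -
    have "Polynomial.order x ?p = count (proots ?p) x" using p0 by simp
    also have "proots ?p = (\<Sum>j<n. {#complex_of_real (a j)#})" by (subst proots_prod) auto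
    also have "count \<dots> x = (\<Sum>j<n. if complex_of_real (a j) = x then 1 else 0)"
      unfolding count_sum by (intro sum.cong refl) (simp only: count_single eq_commute)
    finally show ?thesis .
  qed
  have mem: "complex_of_real (a j) \<in> ?X \<longleftrightarrow> a j < 0" if "j < n" for j
  proof -
    have "poly ?p (complex_of_real (a j)) = 0"
      unfolding poly_prod_linear using that by (intro prod_zero bexI[of _ j]) auto
    then show ?thesis by simp
  qed
  have "num_neg_eigenvalues A = (\<Sum>x\<in>?X. \<Sum>j<n. if complex_of_real (a j) = x then 1 else 0)"
    unfolding num_neg_eigenvalues_def cp ord ..
  also have "\<dots> = (\<Sum>j<n. \<Sum>x\<in>?X. if complex_of_real (a j) = x then 1 else 0)" by (rule sum.swap)
  also have "\<dots> = (\<Sum>j<n. if a j < 0 then 1 else 0)"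
  proof (rule sum.cong[OF refl])
    fix j assume "j \<in> {..<n}"
    then have "complex_of_real (a j) \<in> ?X \<longleftrightarrow> a j < 0" by (intro mem) simp
    then show "(\<Sum>x\<in>?X. if complex_of_real (a j) = x then 1 else 0) = (if a j < 0 then 1 else (0::nat))"
      using sum.delta'[OF fin, of "complex_of_real (a j)" "\<lambda>_. 1::nat"] by simp
  qed
  also have "\<dots> = card {j. j < n \<and> a j < 0}"
    by (simp add: sum.If_cases Int_def conj_commute)
  finally show ?thesis .
qed

text \<open>\<open>crit_mat\<close> as a function of the matrix and of t = |x|^2 instead of
  coordinates, so that it composes with unitary congruences; \<open>frobenius\<close> does the same
  for \<open>tr_HHstar\<close>.\<close>

definition shifted_square :: "nat \<Rightarrow> real \<Rightarrow> complex mat \<Rightarrow> complex mat" where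
  "shifted_square m t A = 2 \<cdot>\<^sub>m (A * mat_adjoint A) - complex_of_real t \<cdot>\<^sub>m 1\<^sub>m m"

definition frobenius :: "nat \<Rightarrow> complex mat \<Rightarrow> real" where
  "frobenius m A = Re (\<Sum>i<m. (A * mat_adjoint A) $$ (i, i))"

lemma frobenius_eq:
  assumes A: "A \<in> carrier_mat m m"
  shows "frobenius m A = (\<Sum>i<m. \<Sum>j<m. (cmod (A $$ (i, j)))\<^sup>2)"
proof -
  have "(\<Sum>i<m. (A * mat_adjoint A) $$ (i, i)) = (\<Sum>i<m. \<Sum>j<m. A $$ (i, j) * cnj (A $$ (i, j)))"
    using A by (intro sum.cong refl) (subst index_mult_mat_sum[of _ m m _ m], auto simp: mat_adjoint_index[of _ m m])
  also have "\<dots> = complex_of_real (\<Sum>i<m. \<Sum>j<m. (cmod (A $$ (i, j)))\<^sup>2)"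
    by (simp only: of_real_sum complex_norm_square)
  finally show ?thesis unfolding frobenius_def by (simp only: Re_complex_of_real)
qed

text \<open>Takagi's unitary diagonalizes the shifted square with entries 2 (\<sigma> j)^2 - t. All
  three quantities are symmetric in these entries or in the squares, hence insensitive to which list
  r of roots is given.\<close>

lemma shifted_square_spectrum:
  assumes A: "symmetric_mat m A" and r: "sing_poly A = (\<Prod>j<m. [:- complex_of_real (r j), 1:])"
  shows "num_neg_eigenvalues (shifted_square m t A) = card {j. j < m \<and> 2 * r j < t}"
    and "cmod (det (shifted_square m t A)) = \<bar>\<Prod>j<m. 2 * r j - t\<bar>"
    and "frobenius m A = (\<Sum>j<m. r j)"
proof -
  have Ac: "A \<in> carrier_mat m m" using A by (simp add: symmetric_mat_def)
  obtain U \<sigma> where U: "unitary_mat m U" and A_eq: "A = U * mat_diag m (\<lambda>i. complex_of_real (\<sigma> i)) * transpose_mat U"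
    using takagi_factorization[OF A] by blast
  note Ud = unitary_matD[OF U]
  let ?D = "mat_diag m (\<lambda>i. complex_of_real (\<sigma> i))"
  let ?E = "mat_diag m (\<lambda>i. complex_of_real (2 * (\<sigma> i)\<^sup>2 - t))"
  have "image_mset (\<lambda>j. (\<sigma> j)\<^sup>2) (mset_set {..<m}) = image_mset r (mset_set {..<m})"
    using r unfolding A_eq sing_poly_takagi[OF U]
    by (intro image_mset_of_real_eqD) (simp only: prod_linear_eq_iff_mset[symmetric])
  note ms = prod_cong_image_mset[OF this]
  have SQ: "A * mat_adjoint A = U * mat_diag m (\<lambda>i. complex_of_real ((\<sigma> i)\<^sup>2)) * mat_adjoint U"
    unfolding A_eq congruence_mult_adjoint[OF U mat_diag_dim] mat_diag_mult_adjoint ..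
  have "shifted_square m t A = U * ?E * mat_adjoint U"
  proof (rule eq_matI)
    fix i j assume "i < dim_row (U * ?E * mat_adjoint U)" "j < dim_col (U * ?E * mat_adjoint U)"
    then have ij: "i < m" "j < m" using Ud(1) by auto
    have diag: "(U * mat_diag m f * mat_adjoint U) $$ (i, j) = (\<Sum>k<m. f k * (U $$ (i, k) * cnj (U $$ (j, k))))" for f
    proof -
      have "(U * mat_diag m f * mat_adjoint U) $$ (i, j) = (\<Sum>k<m. (\<Sum>l<m. U $$ (i, l) * mat_diag m f $$ (l, k)) * cnj (U $$ (j, k)))"
        using ij Ud(1) by (intro index_adj_congruence_sum) auto
      also have "\<dots> = (\<Sum>k<m. (U $$ (i, k) * f k) * cnj (U $$ (j, k)))"
        by (intro sum.cong refl arg_cong2[where f="(*)"]) (auto simp: mat_diag_def if_distrib cong: if_cong)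
      finally show ?thesis by (simp add: ac_simps)
    qed
    have car: "A * mat_adjoint A \<in> carrier_mat m m" using Ac by (intro mult_carrier_mat[of _ m m]) auto
    have "shifted_square m t A $$ (i, j) = 2 * (A * mat_adjoint A) $$ (i, j) - complex_of_real t * (if i = j then 1 else 0)"
      unfolding shifted_square_def using ij carrier_matD[OF car]
      by (simp only: index_minus_mat(1) index_smult_mat(1) index_smult_mat(2,3) index_one_mat)
    also have "\<dots> = 2 * (\<Sum>k<m. complex_of_real ((\<sigma> k)\<^sup>2) * (U $$ (i, k) * cnj (U $$ (j, k)))) - complex_of_real t * (\<Sum>k<m. U $$ (i, k) * cnj (U $$ (j, k)))"
      unfolding SQ diag using ij by (simp only: unitary_mat_rows[OF U])
    also have "\<dots> = (\<Sum>k<m. complex_of_real (2 * (\<sigma> k)\<^sup>2 - t) * (U $$ (i, k) * cnj (U $$ (j, k))))"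
      unfolding sum_distrib_left sum_subtractf[symmetric] by (intro sum.cong refl) (simp add: algebra_simps)
    finally show "shifted_square m t A $$ (i, j) = (U * ?E * mat_adjoint U) $$ (i, j)" unfolding diag .
  qed (use Ud(1) Ac in \<open>auto simp: shifted_square_def\<close>)
  note S = this
  have "char_poly (shifted_square m t A) = (\<Prod>i<m. [:- complex_of_real (2 * (\<sigma> i)\<^sup>2 - t), 1:])"
    unfolding S char_poly_unitary_conj[OF U mat_diag_dim] by (rule char_poly_mat_diag)
  also have "\<dots> = (\<Prod>i<m. [:- complex_of_real (2 * r i - t), 1:])" by (rule ms(1))
  finally have "num_neg_eigenvalues (shifted_square m t A) = card {j. j < m \<and> 2 * r j - t < 0}"
    by (rule num_neg_eigenvalues_eq_card)
  then show "num_neg_eigenvalues (shifted_square m t A) = card {j. j < m \<and> 2 * r j < t}" by simp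
  have dE: "det ?E = (\<Prod>i<m. complex_of_real (2 * (\<sigma> i)\<^sup>2 - t))"
    by (subst det_upper_triangular[of _ m])
       (auto simp: mat_diag_def upper_triangular_def diag_mat_def prod_list_map_upt[symmetric] intro!: arg_cong[where f=prod_list])
  have "det (shifted_square m t A) = det U * det ?E * cnj (det U)"
    unfolding S using Ud(1) by (simp add: det_mult[of _ m] mult_carrier_mat[of _ m m] det_mat_adjoint del: assoc_mult_mat)
  then have "cmod (det (shifted_square m t A)) = cmod (det ?E)" using cmod_det_unitary[OF U] by (simp add: norm_mult)
  also have "\<dots> = cmod (complex_of_real (\<Prod>i<m. 2 * (\<sigma> i)\<^sup>2 - t))" unfolding dE of_real_prod ..
  also have "\<dots> = \<bar>\<Prod>i<m. 2 * (\<sigma> i)\<^sup>2 - t\<bar>" by (rule norm_of_real)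
  also have "(\<Prod>i<m. 2 * (\<sigma> i)\<^sup>2 - t) = (\<Prod>j<m. 2 * r j - t)" by (rule ms(1))
  finally show "cmod (det (shifted_square m t A)) = \<bar>\<Prod>j<m. 2 * r j - t\<bar>" .
  have "frobenius m A = (\<Sum>i<m. \<Sum>j<m. (cmod (?D $$ (i, j)))\<^sup>2)"
    unfolding frobenius_eq[OF Ac] unfolding A_eq by (rule frobenius_congruence[OF U mat_diag_dim])
  also have "\<dots> = (\<Sum>i<m. \<Sum>j<m. if i = j then (\<sigma> j)\<^sup>2 else 0)"
    by (intro sum.cong refl) (auto simp: mat_diag_def)
  also have "\<dots> = (\<Sum>i<m. (\<sigma> i)\<^sup>2)" by simp
  also have "\<dots> = (\<Sum>j<m. r j)" by (rule ms(2))
  finally show "frobenius m A = (\<Sum>j<m. r j)" .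
qed

text \<open>The integrand of \<open>b0q\<close> with the condition of \<open>S_set\<close> absorbed
  and t in the place of |x|^2.\<close>

definition crit_density :: "nat \<Rightarrow> nat \<Rightarrow> real \<Rightarrow> complex mat \<Rightarrow> ennreal" where
  "crit_density m p t A = (if num_neg_eigenvalues (shifted_square m t A) = p
     then ennreal (cmod (det (shifted_square m t A)) * exp (- frobenius m A - t)) else 0)"

lemma crit_density_eq:
  assumes "symmetric_mat m A" "sing_poly A = (\<Prod>j<m. [:- complex_of_real (r j), 1:])"
  shows "crit_density m p t A = (if card {j. j < m \<and> 2 * r j < t} = p
     then ennreal (\<bar>\<Prod>j<m. 2 * r j - t\<bar> * exp (- (\<Sum>j<m. r j) - t)) else 0)"
  unfolding crit_density_def shifted_square_spectrum[OF assms] ..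

lemma unitarily_invariant_crit_density: "unitarily_invariant m (crit_density m p t)"
  unfolding unitarily_invariant_def
proof (intro allI impI)
  fix U A assume U: "unitary_mat m U" and A: "symmetric_mat m A"
  obtain V \<sigma> where "unitary_mat m V" "A = V * mat_diag m (\<lambda>i. complex_of_real (\<sigma> i)) * transpose_mat V"
    using takagi_factorization[OF A] by blast
  then have r: "sing_poly A = (\<Prod>j<m. [:- complex_of_real ((\<sigma> j)\<^sup>2), 1:])" by (simp only: sing_poly_takagi)
  have Ac: "A \<in> carrier_mat m m" using A by (simp add: symmetric_mat_def)
  show "crit_density m p t (U * A * transpose_mat U) = crit_density m p t A"
    unfolding crit_density_eq[OF A r]
    by (rule crit_density_eq[OF symmetric_congruence[OF A unitary_matD(1)[OF U]]]) (unfold sing_poly_congruence[OF U Ac], rule r)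
qed

lemma measurable_card_less:
  fixes f :: "nat \<Rightarrow> 'z \<Rightarrow> real"
  assumes "\<And>j. j < m \<Longrightarrow> f j \<in> borel_measurable N" "g \<in> borel_measurable N"
  shows "{z \<in> space N. card {j. j < m \<and> f j z < g z} = p} \<in> sets N"
proof -
  have "(\<lambda>z. \<Sum>j<m. if f j z < g z then 1 else 0 :: real) \<in> borel_measurable N"
    using assms by (intro borel_measurable_sum measurable_If) (auto intro!: borel_measurable_less)
  then have "{z \<in> space N. (\<Sum>j<m. if f j z < g z then 1 else 0) = real p} \<in> sets N" by measurable
  moreover have "(\<Sum>j<m. if f j z < g z then 1 else 0) = real (card {j. j < m \<and> f j z < g z})" for z
    by (simp add: sum.If_cases Int_def conj_commute)
  ultimately show ?thesis by (simp only: of_nat_eq_iff)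
qed

lemma measurable_crit_density:
  assumes A: "mat_measurable N m A" and sym: "\<And>z. z \<in> space N \<Longrightarrow> symmetric_mat m (A z)" and t: "t \<in> borel_measurable N"
  shows "(\<lambda>z. crit_density m p (t z) (A z)) \<in> borel_measurable N"
proof -
  obtain r where r: "\<And>j. j < m \<Longrightarrow> r j \<in> borel_measurable N"
    and r': "\<And>z. z \<in> space N \<Longrightarrow> sing_poly (A z) = (\<Prod>j<m. [:- complex_of_real (r j z), 1:])"
    using measurable_singular_values[OF A sym] by blast
  have "(\<lambda>z. if card {j. j < m \<and> 2 * r j z < t z} = p
     then ennreal (\<bar>\<Prod>j<m. 2 * r j z - t z\<bar> * exp (- (\<Sum>j<m. r j z) - t z)) else 0) \<in> borel_measurable N"
  proof (rule measurable_If)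
    show "{z \<in> space N. card {j. j < m \<and> 2 * r j z < t z} = p} \<in> sets N"
      using r t by (intro measurable_card_less) auto
    note [measurable] = r t
    show "(\<lambda>z. ennreal (\<bar>\<Prod>j<m. 2 * r j z - t z\<bar> * exp (- (\<Sum>j<m. r j z) - t z))) \<in> borel_measurable N"
      by measurable
  qed simp
  then show ?thesis
    by (subst measurable_cong) (use crit_density_eq[OF sym r'] in auto)
qed

section \<open>Separating the variable t\<close>

definition strictly_decreasing :: "nat \<Rightarrow> (nat \<Rightarrow> real) \<Rightarrow> bool" where
  "strictly_decreasing m l \<longleftrightarrow> (\<forall>i j. i < j \<longrightarrow> j < m \<longrightarrow> l j < l i)"

text \<open>In a strictly decreasing sequence without zeros the negative entries form a final
  segment, so their number q - m determines where it starts, namely at 2 m - q.\<close>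

lemma Y_set_iff:
  assumes m: "1 \<le> m" "m \<le> q" "q \<le> 2 * m" and l: "l \<in> space (rleb m)" and nz: "\<And>j. j < m \<Longrightarrow> l j \<noteq> 0"
  shows "l \<in> Y_set m (2 * m - q) \<longleftrightarrow> strictly_decreasing m l \<and> card {j. j < m \<and> l j < 0} = q - m"
proof
  let ?p = "2 * m - q"
  assume "l \<in> Y_set m ?p"
  then have dec: "\<And>i. Suc i < m \<Longrightarrow> l (Suc i) < l i" and s: "\<And>i. i < m \<Longrightarrow> (i < ?p \<longrightarrow> 0 < l i) \<and> (?p \<le> i \<longrightarrow> l i < 0)"
    unfolding Y_set_def by auto
  have "l j < l i" if "i < j" "j < m" for i j
    using that
  proof (induction j)
    case (Suc j)
    then show ?case using dec[of j] by (cases "i = j") (auto intro: less_trans)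
  qed simp
  then have "strictly_decreasing m l" unfolding strictly_decreasing_def by blast
  moreover have "{j. j < m \<and> l j < 0} = {?p..<m}"
  proof (intro Set.set_eqI iffI)
    fix j assume "j \<in> {j. j < m \<and> l j < 0}"
    then show "j \<in> {?p..<m}" using s[of j] by (cases "j < ?p") auto
  next
    fix j assume "j \<in> {?p..<m}"
    then show "j \<in> {j. j < m \<and> l j < 0}" using s[of j] by auto
  qed
  then have "card {j. j < m \<and> l j < 0} = q - m" using m by simp
  ultimately show "strictly_decreasing m l \<and> card {j. j < m \<and> l j < 0} = q - m" ..
next
  let ?p = "2 * m - q"
  assume *: "strictly_decreasing m l \<and> card {j. j < m \<and> l j < 0} = q - m"
  then have dec: "\<And>i j. i < j \<Longrightarrow> j < m \<Longrightarrow> l j < l i" unfolding strictly_decreasing_def by blast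
  let ?N = "{j. j < m \<and> l j < 0}"
  have up: "j' \<in> ?N" if "j \<in> ?N" "j \<le> j'" "j' < m" for j j'
    using that dec[of j j'] by (cases "j = j'") auto
  have fin: "finite ?N" by simp
  have "?N = {?p..<m}"
  proof (cases "?N = {}")
    case True
    then have "card ?N = 0" by (simp only: card.empty)
    then have "q = m" using * m by linarith
    then show ?thesis using True by simp
  next
    case False
    define k where "k = Min ?N"
    have k: "k \<in> ?N" unfolding k_def by (rule Min_in[OF fin False])
    have "?N = {k..<m}"
    proof (intro Set.set_eqI iffI)
      fix j assume "j \<in> ?N"
      then show "j \<in> {k..<m}" unfolding k_def using Min_le[OF fin] by auto
    next
      fix j assume "j \<in> {k..<m}"
      then show "j \<in> ?N" using up[OF k] by auto
    qed
    then have "card ?N = m - k" by simp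
    then have "m - k = q - m" using * by linarith
    then have "k = ?p" using k m by auto
    then show ?thesis using \<open>?N = {k..<m}\<close> by simp
  qed
  then have N: "l i < 0 \<longleftrightarrow> ?p \<le> i" if "i < m" for i using that by (auto simp: set_eq_iff)
  have "(i < ?p \<longrightarrow> 0 < l i) \<and> (?p \<le> i \<longrightarrow> l i < 0)" if "i < m" for i
    using N[OF that] nz[OF that] by auto
  then show "l \<in> Y_set m ?p" unfolding Y_set_def using l dec by auto
qed

text \<open>Up to a single point the two constraints describe the half line that starts at max 0 (-
  2 c).\<close>

lemma nn_integral_exp_threshold:
  assumes a: "a > 0"
  shows "(\<integral>\<^sup>+t. ennreal (exp (- (a * t))) * indicator {t. 0 \<le> t \<and> 0 < c + t / 2} t \<partial>lborel) = ennreal (exp (- (a * max 0 (- 2 * c))) / a)"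
proof -
  let ?b = "max 0 (- 2 * c)"
  have "(\<integral>\<^sup>+t. ennreal (exp (- (a * t))) * indicator {t. 0 \<le> t \<and> 0 < c + t / 2} t \<partial>lborel) = (\<integral>\<^sup>+t. ennreal (exp (- (a * t))) * indicator {?b..} t \<partial>lborel)"
  proof (rule nn_integral_cong_AE, rule eventually_mono[OF AE_lborel_singleton[of ?b]])
    fix t assume "t \<noteq> ?b"
    then have "(0 \<le> t \<and> 0 < c + t / 2) \<longleftrightarrow> ?b \<le> t" by auto
    then show "ennreal (exp (- (a * t))) * indicator {t. 0 \<le> t \<and> 0 < c + t / 2} t = ennreal (exp (- (a * t))) * indicator {?b..} t"
      unfolding indicator_def by simp
  qed
  also have "\<dots> = ennreal (0 - (- exp (- (a * ?b)) / a))"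
  proof (rule nn_integral_FTC_atLeast)
    show "((\<lambda>x. - exp (- (a * x)) / a) \<longlongrightarrow> 0) at_top" using a by real_asymp
    show "DERIV (\<lambda>x. - exp (- (a * x)) / a) x :> exp (- (a * x))" for x
      using a by (auto intro!: derivative_eq_intros)
  qed auto
  finally show ?thesis by simp
qed

definition shift_coords :: "nat \<Rightarrow> real \<Rightarrow> (nat \<Rightarrow> real) \<Rightarrow> nat \<Rightarrow> real" where
  "shift_coords m t l = (\<lambda>i\<in>{..<m}. l i + t / 2)"

definition spectral_density :: "nat \<Rightarrow> nat \<Rightarrow> real \<Rightarrow> (nat \<Rightarrow> real) \<Rightarrow> ennreal" where
  "spectral_density m p t s = indicator {s. decreasing_pos m s} s * ennreal (vandermonde m s) * crit_density m p t (sqrt_diag m s)"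

text \<open>The m eigenvalues 2 l j give the factor 2^m. In the exponent the trace contributes m t /
  2 on top of the t already there, which makes (m + 2) t / 2. The number of negative eigenvalues
  becomes a condition on l alone.\<close>

lemma spectral_density_shift:
  "spectral_density m p t (shift_coords m t l) =
    (if strictly_decreasing m l \<and> (\<forall>i<m. 0 < l i + t / 2) \<and> card {j. j < m \<and> l j < 0} = p
     then ennreal (2 ^ m * (\<bar>\<Prod>j<m. l j\<bar> * vandermonde m l * exp (- (\<Sum>j<m. l j)))) * ennreal (exp (- ((real m + 2) / 2 * t)))
     else 0)"
proof -
  let ?s = "shift_coords m t l"
  have s: "?s i = l i + t / 2" if "i < m" for i using that by (simp add: shift_coords_def)
  have dec: "decreasing_pos m ?s \<longleftrightarrow> strictly_decreasing m l \<and> (\<forall>i<m. 0 < l i + t / 2)"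
    unfolding decreasing_pos_def strictly_decreasing_def by (auto simp: s)
  show ?thesis
  proof (cases "decreasing_pos m ?s")
    case False
    then show ?thesis unfolding spectral_density_def using dec by auto
  next
    case True
    have vand: "vandermonde m ?s = vandermonde m l" unfolding vandermonde_def by (intro prod.cong refl) (auto simp: s)
    have "crit_density m p t (sqrt_diag m ?s) = (if card {j. j < m \<and> 2 * ?s j < t} = p
       then ennreal (\<bar>\<Prod>j<m. 2 * ?s j - t\<bar> * exp (- (\<Sum>j<m. ?s j) - t)) else 0)"
      using True unfolding decreasing_pos_def
      by (intro crit_density_eq symmetric_sqrt_diag sing_poly_sqrt_diag) (auto intro: less_imp_le)
    also have "{j. j < m \<and> 2 * ?s j < t} = {j. j < m \<and> l j < 0}" by (auto simp: s)
    also have "(\<Prod>j<m. 2 * ?s j - t) = (\<Prod>j<m. 2 * l j)" by (intro prod.cong refl) (simp add: s)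
    also have "(\<Prod>j<m. 2 * l j) = 2 ^ m * (\<Prod>j<m. l j)" by (simp add: prod.distrib)
    also have "(\<Sum>j<m. ?s j) = (\<Sum>j<m. l j + t / 2)" by (intro sum.cong refl) (simp add: s)
    also have "\<dots> = (\<Sum>j<m. l j) + real m * (t / 2)" by (simp add: sum.distrib)
    also have "exp (- ((\<Sum>j<m. l j) + real m * (t / 2)) - t) = exp (- (\<Sum>j<m. l j)) * exp (- ((real m + 2) / 2 * t))"
      unfolding exp_add[symmetric] by (simp add: field_simps)
    finally have c: "crit_density m p t (sqrt_diag m ?s) = (if card {j. j < m \<and> l j < 0} = p
       then ennreal (\<bar>2 ^ m * (\<Prod>j<m. l j)\<bar> * (exp (- (\<Sum>j<m. l j)) * exp (- ((real m + 2) / 2 * t)))) else 0)" .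
    have v0: "0 \<le> vandermonde m l" using vandermonde_nonneg[OF True] unfolding vand .
    show ?thesis
    proof (cases "card {j. j < m \<and> l j < 0} = p")
      case False
      then show ?thesis unfolding spectral_density_def c by auto
    next
      case card: True
      have "spectral_density m p t ?s = ennreal (vandermonde m l) * ennreal (\<bar>2 ^ m * (\<Prod>j<m. l j)\<bar> * (exp (- (\<Sum>j<m. l j)) * exp (- ((real m + 2) / 2 * t))))"
        unfolding spectral_density_def c vand using card True by simp
      also have "\<dots> = ennreal (vandermonde m l * (\<bar>2 ^ m * (\<Prod>j<m. l j)\<bar> * (exp (- (\<Sum>j<m. l j)) * exp (- ((real m + 2) / 2 * t)))))"
        using v0 by (intro ennreal_mult[symmetric]) simp_all
      also have "vandermonde m l * (\<bar>2 ^ m * (\<Prod>j<m. l j)\<bar> * (exp (- (\<Sum>j<m. l j)) * exp (- ((real m + 2) / 2 * t)))) =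
          2 ^ m * (\<bar>\<Prod>j<m. l j\<bar> * vandermonde m l * exp (- (\<Sum>j<m. l j))) * exp (- ((real m + 2) / 2 * t))"
        unfolding abs_mult by (simp only: power_abs abs_numeral ac_simps)
      also have "ennreal \<dots> = ennreal (2 ^ m * (\<bar>\<Prod>j<m. l j\<bar> * vandermonde m l * exp (- (\<Sum>j<m. l j)))) * ennreal (exp (- ((real m + 2) / 2 * t)))"
        using v0 by (intro ennreal_mult) simp_all
      finally show ?thesis using card True dec by simp
    qed
  qed
qed

text \<open>The factor (m + 2) / 2^(m+1) cancels the 2^m of the determinant and the 2 / (m + 2) of
  the integral over t. At points with a zero coordinate, where the sign conditions of
  \<open>Y_set\<close> and the count of negative entries may disagree, both sides vanish with the
  product.\<close>

lemma nn_integral_spectral_density_shift: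
  assumes m: "1 \<le> m" "m \<le> q" "q \<le> 2 * m" and l: "l \<in> space (rleb m)"
  shows "indicator (Y_set m (2 * m - q)) l * ennreal (\<bar>\<Prod>j<m. l j\<bar> * vandermonde m l * exp (- (\<Sum>j<m. l j)) * F_fun m q l) =
    ennreal ((real m + 2) / 2 ^ (m + 1)) * (\<integral>\<^sup>+t. spectral_density m (q - m) t (shift_coords m t l) * indicator {0..} t \<partial>lborel)"
proof (cases "\<exists>j<m. l j = 0")
  case True
  then have z: "(\<Prod>j<m. l j) = 0" by auto
  have "spectral_density m (q - m) t (shift_coords m t l) = 0" for t
    unfolding spectral_density_shift z by simp
  then show ?thesis unfolding z by simp
next
  case False
  then have nz: "l j \<noteq> 0" if "j < m" for j using that by auto
  let ?good = "strictly_decreasing m l \<and> card {j. j < m \<and> l j < 0} = q - m"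
  have Y: "l \<in> Y_set m (2 * m - q) \<longleftrightarrow> ?good" by (rule Y_set_iff[OF m l nz])
  show ?thesis
  proof (cases ?good)
    case False
    have "spectral_density m (q - m) t (shift_coords m t l) = 0" for t
      unfolding spectral_density_shift using False by (intro if_not_P) blast
    then show ?thesis using False Y by simp
  next
    case True
    let ?c = "l (m - 1)"
    let ?a = "(real m + 2) / 2"
    let ?L = "\<bar>\<Prod>j<m. l j\<bar> * vandermonde m l * exp (- (\<Sum>j<m. l j))"
    have min: "?c \<le> l i" if "i < m" for i
      using True that m(1) unfolding strictly_decreasing_def by (cases "i = m - 1") (auto intro: less_imp_le)
    \<comment> \<open>All m positivity constraints reduce to the one for the last, smallest
      coordinate, so t has a single lower threshold.\<close>
    have pos: "(\<forall>i<m. 0 < l i + t / 2) \<longleftrightarrow> 0 < ?c + t / 2" for t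
    proof
      assume "\<forall>i<m. 0 < l i + t / 2"
      then show "0 < ?c + t / 2" using m(1) by simp
    next
      assume "0 < ?c + t / 2"
      then show "\<forall>i<m. 0 < l i + t / 2" using min by (force intro: less_le_trans)
    qed
    have L0: "0 \<le> ?L" using True unfolding vandermonde_def strictly_decreasing_def
      by (intro mult_nonneg_nonneg prod_nonneg) (auto intro: less_imp_le)
    have "(\<integral>\<^sup>+t. spectral_density m (q - m) t (shift_coords m t l) * indicator {0..} t \<partial>lborel) =
       (\<integral>\<^sup>+t. ennreal (2 ^ m * ?L) * (ennreal (exp (- (?a * t))) * indicator {t. 0 \<le> t \<and> 0 < ?c + t / 2} t) \<partial>lborel)"
      unfolding spectral_density_shift pos using True by (intro nn_integral_cong) (auto simp: indicator_def)
    also have "\<dots> = ennreal (2 ^ m * ?L) * (\<integral>\<^sup>+t. ennreal (exp (- (?a * t))) * indicator {t. 0 \<le> t \<and> 0 < ?c + t / 2} t \<partial>lborel)"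
      by (intro nn_integral_cmult) measurable
    also have "\<dots> = ennreal (2 ^ m * ?L) * ennreal (exp (- (?a * max 0 (- 2 * ?c))) / ?a)"
      by (subst nn_integral_exp_threshold) simp_all
    \<comment> \<open>For q > m some coordinate is negative, hence so is the last one, c. The
      threshold is then - 2 c, which yields the exponent (m + 2) c. For q = m all coordinates are
      positive, the threshold is 0 and the exponential is 1.\<close>
    also have "exp (- (?a * max 0 (- 2 * ?c))) = F_fun m q l"
    proof (cases "q > m")
      case q: True
      have "{j. j < m \<and> l j < 0} \<noteq> {}"
      proof
        assume "{j. j < m \<and> l j < 0} = {}"
        then have "card {j. j < m \<and> l j < 0} = 0" by (simp only: card.empty)
        then show False using True q by linarith
      qed
      then obtain j where "j < m" "l j < 0" by blast
      then have "?c < 0" using min[of j] by simp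
      then show ?thesis using q unfolding F_fun_def by (simp add: max_def field_simps)
    next
      case False
      then have "card {j. j < m \<and> l j < 0} = 0" using True by simp
      then have "{j. j < m \<and> l j < 0} = {}" by (subst (asm) card_0_eq) auto
      then have "\<not> ?c < 0" using m(1) by auto
      then show ?thesis using False unfolding F_fun_def by (simp add: max_def)
    qed
    finally have I: "(\<integral>\<^sup>+t. spectral_density m (q - m) t (shift_coords m t l) * indicator {0..} t \<partial>lborel) = ennreal (2 ^ m * ?L) * ennreal (F_fun m q l / ?a)" .
    have F0: "0 \<le> F_fun m q l" unfolding F_fun_def by simp
    have "ennreal ((real m + 2) / 2 ^ (m + 1)) * (ennreal (2 ^ m * ?L) * ennreal (F_fun m q l / ?a)) =
      ennreal ((real m + 2) / 2 ^ (m + 1) * (2 ^ m * ?L * (F_fun m q l / ?a)))"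
    proof -
      have "ennreal x * (ennreal y * ennreal z) = ennreal (x * (y * z))" if "0 \<le> x" "0 \<le> y" "0 \<le> z" for x y z :: real
        using that by (simp add: ennreal_mult)
      then show ?thesis using L0 F0 by simp
    qed
    also have "(real m + 2) / 2 ^ (m + 1) * (2 ^ m * ?L * (F_fun m q l / ?a)) = ?L * F_fun m q l"
    proof -
      have "(real m + 2) / 2 ^ (m + 1) * (2 ^ m * x * (y / ((real m + 2) / 2))) = x * y" for x y :: real
        by (simp add: divide_simps)
      then show ?thesis .
    qed
    finally show ?thesis unfolding I using True Y by simp
  qed
qed

lemma measurable_spectral_density:
  "(\<lambda>(t, s). spectral_density m p t s) \<in> borel_measurable (lborel \<Otimes>\<^sub>M rleb m)"
proof -
  have 1: "(\<lambda>z. crit_density m p (fst z) (sqrt_diag m (snd z))) \<in> borel_measurable (lborel \<Otimes>\<^sub>M rleb m)"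
    by (intro measurable_crit_density mat_measurable_compose[OF _ mat_measurable_sqrt_diag] symmetric_sqrt_diag) simp_all
  have "(\<lambda>s. if decreasing_pos m s then ennreal (vandermonde m s) else 0) \<in> borel_measurable (rleb m)"
    by (intro measurable_If sets_decreasing_pos) (auto intro!: measurable_compose[OF borel_measurable_vandermonde])
  from measurable_compose[OF measurable_snd this]
  have 2: "(\<lambda>z. if decreasing_pos m (snd z) then ennreal (vandermonde m (snd z)) else 0) \<in> borel_measurable (lborel \<Otimes>\<^sub>M rleb m)" .
  have eq: "(\<lambda>(t, s). spectral_density m p t s) =
    (\<lambda>z. (if decreasing_pos m (snd z) then ennreal (vandermonde m (snd z)) else 0) * crit_density m p (fst z) (sqrt_diag m (snd z)))"
    unfolding spectral_density_def by (auto simp: fun_eq_iff indicator_def)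
  show ?thesis unfolding eq by (rule borel_measurable_times_ennreal[OF 2 1])
qed

lemma measurable_spectral_density_shift:
  "(\<lambda>(t, l). spectral_density m p t (shift_coords m t l) * indicator {0..} t) \<in> borel_measurable (lborel \<Otimes>\<^sub>M rleb m)"
proof -
  have c: "(\<lambda>z. snd z i + fst z / 2) \<in> borel_measurable (lborel \<Otimes>\<^sub>M rleb m)" if "i \<in> {..<m}" for i
    using measurable_compose[OF measurable_snd measurable_rleb_component] that
    by (intro borel_measurable_add borel_measurable_divide) auto
  have "(\<lambda>z. shift_coords m (fst z) (snd z)) \<in> measurable (lborel \<Otimes>\<^sub>M rleb m) (rleb m)"
    unfolding shift_coords_def using c by (intro measurable_restrict) simp
  then have "(\<lambda>z. (fst z, shift_coords m (fst z) (snd z))) \<in> measurable (lborel \<Otimes>\<^sub>M rleb m) (lborel \<Otimes>\<^sub>M rleb m)"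
    by (intro measurable_Pair) simp_all
  from measurable_compose[OF this measurable_spectral_density[of m p]]
  have "(\<lambda>z. spectral_density m p (fst z) (shift_coords m (fst z) (snd z))) \<in> borel_measurable (lborel \<Otimes>\<^sub>M rleb m)" by simp
  then have "(\<lambda>z. spectral_density m p (fst z) (shift_coords m (fst z) (snd z)) * indicator {0..} (fst z)) \<in> borel_measurable (lborel \<Otimes>\<^sub>M rleb m)"
    by (intro borel_measurable_times_ennreal) (auto intro!: measurable_compose[OF measurable_fst])
  then show ?thesis by (simp add: case_prod_beta')
qed

text \<open>For each fixed t, translating all coordinates by t / 2 preserves the measure; exchanging
  the integrals then leaves t innermost, with l held fixed.\<close>

lemma nn_integral_spectral_density:
  "(\<integral>\<^sup>+t. (\<integral>\<^sup>+s. spectral_density m p t s \<partial>rleb m) * indicator {0..} t \<partial>lborel) =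
    (\<integral>\<^sup>+l. (\<integral>\<^sup>+t. spectral_density m p t (shift_coords m t l) * indicator {0..} t \<partial>lborel) \<partial>rleb m)"
proof -
  interpret finite_product_sigma_finite "\<lambda>_::nat. lborel :: real measure" "{..<m}" by standard simp
  interpret P: pair_sigma_finite "lborel :: real measure" "rleb m" by standard
  have meas: "spectral_density m p t \<in> borel_measurable (rleb m)" for t
    using measurable_compose[OF measurable_Pair1'[of t lborel "rleb m"] measurable_spectral_density[of m p]] by simp
  have "(\<integral>\<^sup>+s. spectral_density m p t s \<partial>rleb m) * indicator {0..} t =
    (\<integral>\<^sup>+l. spectral_density m p t (shift_coords m t l) * indicator {0..} t \<partial>rleb m)" for t
  proof (cases "t \<in> {0..}")
    case True
    then show ?thesis
      using nn_integral_PiM_translate[OF _ meas[of t], of "\<lambda>_. t / 2"] unfolding shift_coords_def by simp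
  qed simp
  then have "(\<integral>\<^sup>+t. (\<integral>\<^sup>+s. spectral_density m p t s \<partial>rleb m) * indicator {0..} t \<partial>lborel) =
    (\<integral>\<^sup>+t. (\<integral>\<^sup>+l. spectral_density m p t (shift_coords m t l) * indicator {0..} t \<partial>rleb m) \<partial>lborel)" by simp
  also have "\<dots> = (\<integral>\<^sup>+l. (\<integral>\<^sup>+t. spectral_density m p t (shift_coords m t l) * indicator {0..} t \<partial>lborel) \<partial>rleb m)"
    by (rule P.Fubini'[symmetric]) (rule measurable_spectral_density_shift)
  finally show ?thesis .
qed

section \<open>Assembling the integrals and the constant\<close>

lemma nn_integral_crit_density:
  "(\<integral>\<^sup>+x. (\<integral>\<^sup>+h. crit_density m p ((cmod x)\<^sup>2) (sym_mat m h) \<partial>cleb (sym_idx m)) \<partial>lborel) =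
    ennreal (vol_const m) * (ennreal pi * (\<integral>\<^sup>+t. (\<integral>\<^sup>+s. spectral_density m p t s \<partial>rleb m) * indicator {0..} t \<partial>lborel))"
proof -
  interpret finite_product_sigma_finite "\<lambda>_::nat. lborel :: real measure" "{..<m}" by standard simp
  interpret P: pair_sigma_finite "lborel :: real measure" "rleb m" by standard
  let ?J = "\<lambda>t. \<integral>\<^sup>+s. spectral_density m p t s \<partial>rleb m"
  have J: "?J \<in> borel_measurable borel"
    using borel_measurable_nn_integral[OF measurable_spectral_density[of m p]] by simp
  have "sym_measurable m (crit_density m p t)" for t
    unfolding sym_measurable_def by (intro measurable_crit_density mat_measurable_sym_mat) simp_all
  from nn_integral_singular_values[OF this unitarily_invariant_crit_density]
  have "(\<integral>\<^sup>+h. crit_density m p t (sym_mat m h) \<partial>cleb (sym_idx m)) = ennreal (vol_const m) * ?J t" for t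
    unfolding spectral_density_def .
  then have "(\<integral>\<^sup>+x. (\<integral>\<^sup>+h. crit_density m p ((cmod x)\<^sup>2) (sym_mat m h) \<partial>cleb (sym_idx m)) \<partial>lborel) =
    (\<integral>\<^sup>+x. ennreal (vol_const m) * ?J ((cmod x)\<^sup>2) \<partial>lborel)" by simp
  also have "\<dots> = ennreal (vol_const m) * (\<integral>\<^sup>+x. ?J ((cmod x)\<^sup>2) \<partial>lborel)"
    by (intro nn_integral_cmult measurable_compose[OF _ J]) simp
  also have "(\<integral>\<^sup>+x. ?J ((cmod x)\<^sup>2) \<partial>lborel) = ennreal pi * (\<integral>\<^sup>+t. ?J t * indicator {0..} t \<partial>lborel)"
    by (rule nn_integral_complex_norm_squared[OF J])
  finally show ?thesis .
qed

text \<open>The power of two is the density in \<open>sym_lebesgue\<close>. Integrating over H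
  inside, with x fixed, prepares the passage to singular values.\<close>

lemma b0q_eq_crit_density:
  "b0q m q = ennreal (pi powr (- real ((m + 2) choose 2))) * (ennreal (2 ^ (m * (m - 1) div 2)) *
     (\<integral>\<^sup>+x. (\<integral>\<^sup>+h. crit_density m (q - m) ((cmod x)\<^sup>2) (sym_mat m h) \<partial>cleb (sym_idx m)) \<partial>lborel))"
proof -
  interpret finite_product_sigma_finite "\<lambda>_::nat \<times> nat. lborel :: complex measure" "sym_idx m" by standard simp
  interpret P: pair_sigma_finite "cleb (sym_idx m)" "lborel :: complex measure" by standard
  let ?M = "sym_lebesgue m \<Otimes>\<^sub>M (lborel :: complex measure)"
  let ?f = "\<lambda>z. crit_density m (q - m) ((cmod (snd z))\<^sup>2) (sym_mat m (fst z))"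
  have f: "?f \<in> borel_measurable (cleb (sym_idx m) \<Otimes>\<^sub>M lborel)"
    by (intro measurable_crit_density mat_measurable_compose[OF _ mat_measurable_sym_mat]) simp_all
  have sets: "sets (sym_lebesgue m) = sets (cleb (sym_idx m))" unfolding sym_lebesgue_def by simp
  then have space: "space (sym_lebesgue m) = space (cleb (sym_idx m))" by (rule sets_eq_imp_space_eq)
  have f': "?f \<in> borel_measurable ?M"
    using f measurable_cong_sets[OF sets_pair_measure_cong[OF sets refl] refl] by blast
  have "(\<integral>\<^sup>+ z. indicator (S_set m (q - m)) z * ennreal (norm (det (crit_mat m (fst z) (snd z))) *
                 exp (- tr_HHstar m (fst z) - (cmod (snd z))\<^sup>2)) \<partial>?M) = (\<integral>\<^sup>+z. ?f z \<partial>?M)"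
  proof (rule nn_integral_cong)
    fix z assume "z \<in> space ?M"
    then have "fst z \<in> space (cleb (sym_idx m))" unfolding space_pair_measure space by auto
    moreover have "crit_mat m (fst z) (snd z) = shifted_square m ((cmod (snd z))\<^sup>2) (sym_mat m (fst z))"
      unfolding crit_mat_def shifted_square_def ..
    moreover have "tr_HHstar m (fst z) = frobenius m (sym_mat m (fst z))"
      unfolding tr_HHstar_def frobenius_def ..
    ultimately show "indicator (S_set m (q - m)) z * ennreal (norm (det (crit_mat m (fst z) (snd z))) *
                 exp (- tr_HHstar m (fst z) - (cmod (snd z))\<^sup>2)) = ?f z"
      unfolding S_set_def crit_density_def indicator_def by (simp add: case_prod_beta')
  qed
  also have "\<dots> = (\<integral>\<^sup>+h. (\<integral>\<^sup>+x. ?f (h, x) \<partial>lborel) \<partial>sym_lebesgue m)"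
    by (rule lborel.nn_integral_fst[symmetric, OF f'])
  also have "\<dots> = (\<integral>\<^sup>+h. ennreal (2 ^ (m * (m - 1) div 2)) * (\<integral>\<^sup>+x. ?f (h, x) \<partial>lborel) \<partial>cleb (sym_idx m))"
    unfolding sym_lebesgue_def using lborel.borel_measurable_nn_integral_fst[OF f] by (intro nn_integral_density) simp_all
  also have "\<dots> = ennreal (2 ^ (m * (m - 1) div 2)) * (\<integral>\<^sup>+h. (\<integral>\<^sup>+x. ?f (h, x) \<partial>lborel) \<partial>cleb (sym_idx m))"
    using lborel.borel_measurable_nn_integral_fst[OF f] by (intro nn_integral_cmult) simp
  also have "(\<integral>\<^sup>+h. (\<integral>\<^sup>+x. ?f (h, x) \<partial>lborel) \<partial>cleb (sym_idx m)) = (\<integral>\<^sup>+x. (\<integral>\<^sup>+h. ?f (h, x) \<partial>cleb (sym_idx m)) \<partial>lborel)"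
    by (rule P.Fubini'[symmetric]) (use f in \<open>simp add: case_prod_beta'\<close>)
  finally show ?thesis unfolding b0q_def by simp
qed

text \<open>Let T = m (m - 1) / 2. The binomial coefficient is T + 2 m + 1, while
  \<open>vol_const\<close> supplies pi^(T+m) and the phase of x one more pi, so pi^(-m) remains. The
  exponent (m^2 + m + 2) / 2 is T + m + 1: the power 2^T belongs to the normalization of the
  measure, and 2^(m+1) cancels against the last factor.\<close>

lemma leading_constant:
  fixes m :: nat
  assumes m: "1 \<le> m"
  shows "pi powr (- real ((m + 2) choose 2)) * (2 ^ (m * (m - 1) div 2) * (vol_const m * pi)) =
    2 powr ((real (m\<^sup>2 + m + 2)) / 2) / (pi ^ m * real (m + 2) * (\<Prod>j\<in>{1..m - 1}. fact j)) * ((real m + 2) / 2 ^ (m + 1))"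
proof -
  define T where "T = m * (m - 1) div 2"
  have "even (m * (m - 1))" by (cases "even m") simp_all
  then have "2 * T = m * (m - 1)" unfolding T_def by simp
  then have T: "m * m = 2 * T + m" using m by (cases m) auto
  have "(m + 2) * (m + 1) = 2 * (T + m + (m + 1))" using T by (simp add: algebra_simps)
  then have ch: "(m + 2) choose 2 = T + m + (m + 1)" unfolding choose_two by simp
  have "real (m\<^sup>2 + m + 2) / 2 = real (T + (m + 1))" unfolding power2_eq_square T by simp
  then have two: "2 powr (real (m\<^sup>2 + m + 2) / 2) = 2 ^ T * 2 ^ (m + 1)" by (simp only: powr_realpow power_add zero_less_numeral)
  have "(\<Sum>j<n. Suc j) * 2 = n * n + n" for n by (induction n) auto
  from this[of m] have "(\<Sum>j<m. Suc j) = T + m" using T by simp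
  then have "(\<Prod>j<m. pi ^ Suc j) = pi ^ (T + m)" by (simp only: power_sum[symmetric])
  then have vol: "vol_const m = pi ^ (T + m) / (\<Prod>j<m. fact j)" unfolding vol_const_def prod_dividef by simp
  \<comment> \<open>The index 0 occurs in \<open>vol_const\<close> but not in the stated constant;
    its factorial is 1.\<close>
  have "{..<m} = insert 0 {1..m - 1}" using m by auto
  then have fac: "(\<Prod>j<m. fact j) = (\<Prod>j\<in>{1..m - 1}. fact j :: real)" by simp
  have F: "(\<Prod>j\<in>{1..m - 1}. fact j :: real) \<noteq> 0" by simp
  have "pi powr (- real (T + m + (m + 1))) = inverse (pi ^ (T + m) * pi ^ m * pi)"
    unfolding powr_minus by (simp only: powr_realpow[OF pi_gt_zero] power_add power_one_right mult.assoc)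
  note pw = this
  have gen: "inverse (a * b * p) * (c * (a / F * p)) = c * d / (b * e * F) * (e / d)"
    if "a \<noteq> 0" "b \<noteq> 0" "p \<noteq> 0" "F \<noteq> 0" "d \<noteq> 0" "e \<noteq> 0" for a b c d e p F :: real
    using that by (simp add: field_simps)
  have e: "real (m + 2) = real m + 2" by simp
  show ?thesis unfolding ch two vol fac T_def[symmetric] pw e using F by (intro gen) simp_all
qed

theorem theorem1p5:
  fixes m q :: nat
  assumes "1 \<le> m" and "m \<le> q" and "q \<le> 2 * m"
  shows "b0q m q =
    ennreal (2 powr ((real (m\<^sup>2 + m + 2)) / 2) /
             (pi ^ m * real (m + 2) * (\<Prod>j\<in>{1..m - 1}. fact j))) *
    (\<integral>\<^sup>+ l. indicator (Y_set m (2 * m - q)) l *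
        ennreal (\<bar>\<Prod>j<m. l j\<bar> * vandermonde m l * exp (- (\<Sum>j<m. l j)) * F_fun m q l)
     \<partial>(PiM {..<m} (\<lambda>_. (lborel :: real measure))))"
proof -
  interpret finite_product_sigma_finite "\<lambda>_::nat. lborel :: real measure" "{..<m}" by standard simp
  interpret P: pair_sigma_finite "lborel :: real measure" "rleb m" by standard
  let ?I = "\<lambda>l. \<integral>\<^sup>+t. spectral_density m (q - m) t (shift_coords m t l) * indicator {0..} t \<partial>lborel"
  let ?C = "2 powr ((real (m\<^sup>2 + m + 2)) / 2) / (pi ^ m * real (m + 2) * (\<Prod>j\<in>{1..m - 1}. fact j))"
  have "?I \<in> borel_measurable (rleb m)"
    by (rule lborel.borel_measurable_nn_integral)
       (use measurable_spectral_density_shift[of m "q - m"] in \<open>simp add: measurable_pair_swap_iff[of _ "rleb m"] case_prod_beta'\<close>)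
  then have "(\<integral>\<^sup>+l. indicator (Y_set m (2 * m - q)) l *
        ennreal (\<bar>\<Prod>j<m. l j\<bar> * vandermonde m l * exp (- (\<Sum>j<m. l j)) * F_fun m q l) \<partial>rleb m) =
     ennreal ((real m + 2) / 2 ^ (m + 1)) * (\<integral>\<^sup>+l. ?I l \<partial>rleb m)"
    by (subst nn_integral_cmult[symmetric], assumption) (intro nn_integral_cong nn_integral_spectral_density_shift assms)
  moreover have "b0q m q = ennreal (pi powr (- real ((m + 2) choose 2)) * (2 ^ (m * (m - 1) div 2) * (vol_const m * pi))) * (\<integral>\<^sup>+l. ?I l \<partial>rleb m)"
  proof -
    have "0 \<le> vol_const m" unfolding vol_const_def by (intro prod_nonneg) simp
    then show ?thesis
      unfolding b0q_eq_crit_density nn_integral_crit_density nn_integral_spectral_density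
      by (simp add: ennreal_mult mult.assoc)
  qed
  moreover have "0 \<le> ?C" by (intro divide_nonneg_nonneg mult_nonneg_nonneg prod_nonneg) simp_all
  ultimately show ?thesis
    unfolding leading_constant[OF assms(1)] by (simp only: ennreal_mult' mult.assoc)
qed

end
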